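(* Let $\gamma:\mathbb{R}\to\mathbb{R}^2$ be a monomial curve, let $1<q<p<\infty$ and $1/q=1/r+1/p$, let $\mu\in A^\gamma_p(\mathbb{R}^2)$ and $\lambda\in A^\gamma_q(\mathbb{R}^2)$, and let $\nu$ be the weight defined by $\nu^{1/p+1/q'}=\mu^{1/p}\lambda^{-1/q}$. Then, for all locally integrable $b:\mathbb{R}^2\to\mathbb{C}$, $$\|M^{\gamma,\#}_\nu b\|_{L^r(\mathbb{R}^2(\nu))}\lesssim\|[b,H_\gamma]\|_{L^p(\mathbb{R}^2(\mu))\to L^q(\mathbb{R}^2(\lambda))},\qquad M^{\gamma,\#}_\nu b=\sup_{Q\in\mathcal{R}^\gamma}\frac{1_Q}{\nu(Q)}\int_Q|b-\langle b\rangle_Q|,$$ where the implied constant depends only on $\gamma,p,q,\mu,\lambda$.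
   Context: A monomial curve $\gamma:\mathbb{R}\to\mathbb{R}^2$ is given by parameters $\beta=(\beta_1,\beta_2)$ with $0<\beta_1<\beta_2$ and $\varepsilon,\delta\in\{-1,1\}^2$ with $\varepsilon_i\neq\delta_i$ for at least one $i$, through $\gamma(t)=(\varepsilon_1|t|^{\beta_1},\varepsilon_2|t|^{\beta_2})$ for $t>0$ and $\gamma(t)=(\delta_1|t|^{\beta_1},\delta_2|t|^{\beta_2})$ for $t\le 0$. The Hilbert transform along $\gamma$ is $H_\gamma f(x)=\mathrm{p.v.}\int_{\mathbb{R}}f(x-\gamma(t))\frac{dt}{t}$, and the commutator is $[b,H_\gamma]f=bH_\gamma f-H_\gamma(bf)$. Operator norms are allowed to be $+\infty$. A $\gamma$-cube is a rectangle $Q=I_1\times I_2$ parallel to the coordinate axes with $\ell(Q):=\ell(I_1)^{1/\beta_1}=\ell(I_2)^{1/\beta_2}$, where $\ell(I_j)$ is the length of $I_j$; their collection is $\mathcal{R}^\gamma$. Weights are positive locally integrable functions, here treated as measures: $\|f\|_{L^s(w)}=\|fw^{1/s}\|_{L^s}$, and $w(Q)=\int_Q w$, $\langle f\rangle_Q=\frac1{|Q|}\int_Q f$. The class $A^\gamma_p$ consists of the weights $\sigma$ with $[\sigma]_{A^\gamma_p}=\sup_{Q\in\mathcal{R}^\gamma}\langle\sigma\rangle_Q\langle\sigma^{-p'/p}\rangle_Q^{p/p'}<\infty$; primes denote Hölder conjugates. *)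

theory Defs
  imports "HOL-Analysis.Analysis"
begin

section \<open>Monomial curves and their cubes\<close>

text \<open>Pairs are points of the plane: \<open>\<beta> = (\<beta>\<^sub>1, \<beta>\<^sub>2)\<close>, and likewise \<open>\<epsilon>\<close>, \<open>\<delta>\<close>.\<close>

definition monomial_params ::
  "real \<times> real \<Rightarrow> real \<times> real \<Rightarrow> real \<times> real \<Rightarrow> bool" where
  "monomial_params \<beta> \<epsilon> \<delta> \<longleftrightarrow>
     0 < fst \<beta> \<and> fst \<beta> < snd \<beta> \<and>
     \<epsilon> \<in> {-1, 1} \<times> {-1, 1} \<and> \<delta> \<in> {-1, 1} \<times> {-1, 1} \<and>
     (fst \<epsilon> \<noteq> fst \<delta> \<or> snd \<epsilon> \<noteq> snd \<delta>)"

definition monomial_curve ::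
  "real \<times> real \<Rightarrow> real \<times> real \<Rightarrow> real \<times> real \<Rightarrow> real \<Rightarrow> real \<times> real" where
  "monomial_curve \<beta> \<epsilon> \<delta> t =
     (if t > 0
      then (fst \<epsilon> * \<bar>t\<bar> powr fst \<beta>, snd \<epsilon> * \<bar>t\<bar> powr snd \<beta>)
      else (fst \<delta> * \<bar>t\<bar> powr fst \<beta>, snd \<delta> * \<bar>t\<bar> powr snd \<beta>))"

definition gamma_cubes :: "real \<times> real \<Rightarrow> (real \<times> real) set set" where
  "gamma_cubes \<beta> =
     {{a\<^sub>1..b\<^sub>1} \<times> {a\<^sub>2..b\<^sub>2} | a\<^sub>1 b\<^sub>1 a\<^sub>2 b\<^sub>2. a\<^sub>1 < b\<^sub>1 \<and> a\<^sub>2 < b\<^sub>2 \<and>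
        (b\<^sub>1 - a\<^sub>1) powr (1 / fst \<beta>) = (b\<^sub>2 - a\<^sub>2) powr (1 / snd \<beta>)}"

section \<open>Weights and norms\<close>

definition locally_integrable :: "(real \<times> real \<Rightarrow> 'b::euclidean_space) \<Rightarrow> bool" where
  "locally_integrable f \<longleftrightarrow>
     f \<in> borel_measurable lebesgue \<and> (\<forall>K. compact K \<longrightarrow> f absolutely_integrable_on K)"

definition weight :: "(real \<times> real \<Rightarrow> real) \<Rightarrow> bool" where
  "weight w \<longleftrightarrow> locally_integrable w \<and> (AE x in lebesgue. 0 < w x)"

definition hoelder_conj :: "real \<Rightarrow> real" where
  "hoelder_conj p = p / (p - 1)"

text \<open>Real powers on \<open>[0, \<infinity>]\<close>; only exponents \<open>a > 0\<close> are used, so that \<open>\<infinity>\<^sup>a = \<infinity>\<close>.\<close>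

definition epowr :: "ennreal \<Rightarrow> real \<Rightarrow> ennreal" where
  "epowr x a = (if x = \<infinity> then \<infinity> else ennreal (enn2real x powr a))"

text \<open>\<open>\<parallel>F w\<^bsup>1/s\<^esup>\<parallel>\<close> in \<open>L\<^sup>s\<close>, for the modulus \<open>F\<close> of a function, possibly infinite.\<close>

definition weighted_norm ::
  "real \<Rightarrow> (real \<times> real \<Rightarrow> real) \<Rightarrow> (real \<times> real \<Rightarrow> ennreal) \<Rightarrow> ennreal" where
  "weighted_norm s w F =
     epowr (\<integral>\<^sup>+x. epowr (F x * ennreal (w x powr (1 / s))) s \<partial>lebesgue) (1 / s)"

definition nn_average :: "(real \<times> real) set \<Rightarrow> (real \<times> real \<Rightarrow> real) \<Rightarrow> ennreal" where
  "nn_average Q w = (\<integral>\<^sup>+x\<in>Q. ennreal (w x) \<partial>lebesgue) / emeasure lebesgue Q"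

definition average :: "(real \<times> real) set \<Rightarrow> (real \<times> real \<Rightarrow> complex) \<Rightarrow> complex" where
  "average Q f = (LINT x:Q|lebesgue. f x) / of_real (measure lebesgue Q)"

definition Ap_const :: "real \<times> real \<Rightarrow> real \<Rightarrow> (real \<times> real \<Rightarrow> real) \<Rightarrow> ennreal" where
  "Ap_const \<beta> p \<sigma> =
     (SUP Q\<in>gamma_cubes \<beta>.
        nn_average Q \<sigma> *
        epowr (nn_average Q (\<lambda>x. \<sigma> x powr (- hoelder_conj p / p))) (p / hoelder_conj p))"

definition Ap_class :: "real \<times> real \<Rightarrow> real \<Rightarrow> (real \<times> real \<Rightarrow> real) set" where
  "Ap_class \<beta> p = {\<sigma>. weight \<sigma> \<and> Ap_const \<beta> p \<sigma> < \<infinity>}"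

definition sharp_maximal ::
  "real \<times> real \<Rightarrow> (real \<times> real \<Rightarrow> real) \<Rightarrow> (real \<times> real \<Rightarrow> complex) \<Rightarrow> real \<times> real \<Rightarrow> ennreal" where
  "sharp_maximal \<beta> \<nu> b x =
     (SUP Q\<in>gamma_cubes \<beta>.
        indicator Q x / (\<integral>\<^sup>+y\<in>Q. ennreal (\<nu> y) \<partial>lebesgue) *
        (\<integral>\<^sup>+y\<in>Q. ennreal (cmod (b y - average Q b)) \<partial>lebesgue))"

section \<open>The Hilbert transform along a curve and its commutators\<close>

definition truncated_hilbert ::
  "(real \<Rightarrow> real \<times> real) \<Rightarrow> real \<Rightarrow> (real \<times> real \<Rightarrow> complex) \<Rightarrow> real \<times> real \<Rightarrow> complex" where
  "truncated_hilbert \<gamma> \<eta> f x = (LINT t:{t. \<eta> < \<bar>t\<bar>}|lebesgue. f (x - \<gamma> t) / of_real t)"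

text \<open>The principal value exists at \<open>x\<close>. The Bochner integral is total, hence absolute
  convergence of the truncations is required explicitly.\<close>

definition hilbert_exists ::
  "(real \<Rightarrow> real \<times> real) \<Rightarrow> (real \<times> real \<Rightarrow> complex) \<Rightarrow> real \<times> real \<Rightarrow> bool" where
  "hilbert_exists \<gamma> f x \<longleftrightarrow>
     (\<forall>\<eta>>0. set_integrable lebesgue {t. \<eta> < \<bar>t\<bar>} (\<lambda>t. f (x - \<gamma> t) / of_real t)) \<and>
     (\<exists>l. ((\<lambda>\<eta>. truncated_hilbert \<gamma> \<eta> f x) \<longlongrightarrow> l) (at_right 0))"

definition hilbert ::
  "(real \<Rightarrow> real \<times> real) \<Rightarrow> (real \<times> real \<Rightarrow> complex) \<Rightarrow> real \<times> real \<Rightarrow> complex" where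
  "hilbert \<gamma> f x = Lim (at_right 0) (\<lambda>\<eta>. truncated_hilbert \<gamma> \<eta> f x)"

definition commutator ::
  "(real \<Rightarrow> real \<times> real) \<Rightarrow> (real \<times> real \<Rightarrow> complex) \<Rightarrow> (real \<times> real \<Rightarrow> complex)
     \<Rightarrow> real \<times> real \<Rightarrow> complex" where
  "commutator \<gamma> b f x = b x * hilbert \<gamma> f x - hilbert \<gamma> (\<lambda>y. b y * f y) x"

definition test_functions :: "(real \<times> real \<Rightarrow> complex) set" where
  "test_functions =
     {f. f \<in> borel_measurable lebesgue \<and> bounded (range f) \<and>
         (\<exists>K. compact K \<and> (\<forall>x. x \<notin> K \<longrightarrow> f x = 0))}"

text \<open>The norm of \<open>[b, H\<^sub>\<gamma>]\<close> as an operator from \<open>L\<^sup>p(\<mu>)\<close> to \<open>L\<^sup>q(lam)\<close>, tested on the bounded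
  compactly supported functions, a dense subspace of \<open>L\<^sup>p(\<mu>)\<close>. For \<open>f\<close> in that subspace and
  locally integrable \<open>b\<close> the product \<open>b f\<close> is only integrable, so the principal value of
  \<open>H\<^sub>\<gamma>(b f)\<close> need not exist; if \<open>[b, H\<^sub>\<gamma>]f\<close> fails to be defined almost everywhere for some such
  \<open>f\<close>, then the infimum is over the empty set and the norm is \<open>\<infinity>\<close>.\<close>

definition commutator_norm ::
  "(real \<Rightarrow> real \<times> real) \<Rightarrow> (real \<times> real \<Rightarrow> complex)
     \<Rightarrow> real \<Rightarrow> (real \<times> real \<Rightarrow> real) \<Rightarrow> real \<Rightarrow> (real \<times> real \<Rightarrow> real) \<Rightarrow> ennreal" where
  "commutator_norm \<gamma> b p \<mu> q lam =
     Inf {C. \<forall>f\<in>test_functions.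
            (AE x in lebesgue. hilbert_exists \<gamma> f x \<and> hilbert_exists \<gamma> (\<lambda>y. b y * f y) x) \<and>
            weighted_norm q lam (\<lambda>x. ennreal (cmod (commutator \<gamma> b f x)))
              \<le> C * weighted_norm p \<mu> (\<lambda>x. ennreal (cmod (f x)))}"

end

theory Submission
  imports Defs
begin

text \<open>Near a \<open>\<gamma>\<close>-cube \<open>Q\<close> the kernel of \<open>H\<^sub>\<gamma>\<close> is positive between a set \<open>A \<supseteq> Q\<close>, the union of three
  translates of \<open>Q\<close>, and a set \<open>P\<close> one step back along \<open>\<gamma>\<close>. Going from \<open>A\<close> to \<open>P\<close> and back along the
  curve is a reversible random walk on \<open>A\<close>. The difference of two steps along \<open>\<gamma>\<close> moves in two
  independent directions, so two steps satisfy a Doeblin minorization and contract oscillations. As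
  the change of \<open>\<langle>f, b\<rangle>\<close> under one step of the walk has the form \<open>\<langle>g, [b, H\<^sub>\<gamma>] h\<rangle>\<close>, this gives
  \<open>\<integral>\<^sub>Q |b - \<langle>b\<rangle>\<^sub>Q| \<lesssim> |\<langle>g, [b, H\<^sub>\<gamma>] h\<rangle>|\<close> with \<open>|g|, |h| \<le> 1\<close> supported in a dilate of \<open>Q\<close>.

  The sharp maximal function of finitely many cubes is dominated by a \<open>\<nu>\<close>-sparse subfamily. Random signs
  combine the local bounds of this subfamily into one pairing of \<open>[b, H\<^sub>\<gamma>] F\<close> with \<open>G\<close>, where \<open>F\<close> and \<open>G\<close>
  are sums over sparse cubes, estimated in \<open>L\<^sup>p(\<mu>)\<close> and \<open>L\<^bsup>q'\<^esup>(\<lambda>\<^bsup>1-q'\<^esup>)\<close> by Carleson embedding. With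
  \<open>\<sigma> = \<lambda>\<^bsup>1-q'\<^esup>\<close> the weight \<open>\<nu>\<close> is a geometric mean \<open>\<mu>\<^sup>a \<sigma>\<^sup>b\<close>, so that \<open>\<nu>(E) \<le> \<mu>(E)\<^sup>a \<sigma>(E)\<^sup>b\<close>, while
  \<open>\<mu>(Q)\<^sup>a \<sigma>(Q)\<^sup>b \<lesssim> \<nu>(Q)\<close> on cubes; hence sparseness passes from \<open>\<nu>\<close> to \<open>\<mu>\<close> and \<open>\<sigma>\<close>.\<close>

section \<open>A Doeblin walk between two sets\<close>

text \<open>Three translates are taken because differences of two steps at nearly equal times fill
  only a narrow cone of directions: a translate can be minorized only from a different one. Two
  points of \<open>A\<close> lie in at most two translates, and a remaining one is their common
  target. On the branch \<open>t < 0\<close> the kernel \<open>1 / t\<close> is negative, so that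
  branch must not lead from \<open>A\<close> to \<open>P\<close> at all. This keeps the half height
  of \<open>P\<close> below that of one step, while \<open>P\<close> must receive the steps back
  from all three translates. Both hold once \<open>u\<^sup>k\<close> varies, near each of the three
  times, by less than its value at the first one; hence the large first time. As
  \<open>q < p\<close>, the local bounds must be summed in l^r, and the coefficients of
  \<open>F\<close> and \<open>G\<close> are chosen for this: if \<open>X\<close> is the sum to be
  bounded, both weighted norms are powers of \<open>X\<close> with exponents adding up to
  \<open>1 / p + 1 / q' = 1 - 1 / r\<close>, and a power of \<open>X\<close> can be absorbed. This
  needs \<open>X\<close> finite, which is why only finite families occur before the final monotone
  limit. Selection by the size of the coefficients replaces the nested structure of dyadic
  cubes.\<close>

declare split_paired_All [simp del] split_paired_Ex [simp del]

lemma nn_integral_lborel_translate: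
  fixes f :: "'a::euclidean_space \<Rightarrow> ennreal"
  assumes [measurable]: "f \<in> borel_measurable borel"
  shows "(\<integral>\<^sup>+x. f (x - v) \<partial>lborel) = (\<integral>\<^sup>+x. f x \<partial>lborel)"
proof -
  have "(\<integral>\<^sup>+x. f x \<partial>lborel) = (\<integral>\<^sup>+x. f x \<partial>distr lborel borel ((+) (- v)))"
    by (simp add: lborel_distr_plus)
  also have "\<dots> = (\<integral>\<^sup>+x. f (- v + x) \<partial>lborel)"
    by (rule nn_integral_distr) auto
  finally show ?thesis by (simp add: algebra_simps)
qed

lemma integral_lborel_translate:
  fixes f :: "'a::euclidean_space \<Rightarrow> 'b::{banach,second_countable_topology}"
  assumes [measurable]: "f \<in> borel_measurable borel"
  shows "(\<integral>x. f (x + v) \<partial>lborel) = (\<integral>x. f x \<partial>lborel)"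
proof -
  have "(\<integral>x. f x \<partial>lborel) = (\<integral>x. f x \<partial>distr lborel borel ((+) v))"
    by (simp add: lborel_distr_plus)
  also have "\<dots> = (\<integral>x. f (v + x) \<partial>lborel)"
    by (rule integral_distr) auto
  finally show ?thesis by (simp add: algebra_simps)
qed

section \<open>Convolution with a finite measure and its adjoint\<close>

locale convolution_pair =
  fixes \<kappa> :: "(real \<times> real) measure"
  assumes finite_kappa: "finite_measure \<kappa>" and sets_kappa [measurable_cong]: "sets \<kappa> = sets borel"
begin

sublocale finite_measure \<kappa> by (rule finite_kappa)
sublocale pair_sigma_finite lborel \<kappa> ..

definition spread :: "(real \<times> real \<Rightarrow> 'a::{banach,second_countable_topology}) \<Rightarrow> real \<times> real \<Rightarrow> 'a" where
  "spread h x = (\<integral>v. h (x - v) \<partial>\<kappa>)"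

definition cospread :: "(real \<times> real \<Rightarrow> 'a::{banach,second_countable_topology}) \<Rightarrow> real \<times> real \<Rightarrow> 'a" where
  "cospread g y = (\<integral>v. g (y + v) \<partial>\<kappa>)"

lemma measurable_spread [measurable]:
  fixes h :: "real \<times> real \<Rightarrow> 'a::{banach,second_countable_topology}"
  assumes [measurable]: "h \<in> borel_measurable borel"
  shows "spread h \<in> borel_measurable borel"
  unfolding spread_def by measurable

lemma measurable_cospread [measurable]:
  fixes h :: "real \<times> real \<Rightarrow> 'a::{banach,second_countable_topology}"
  assumes [measurable]: "h \<in> borel_measurable borel"
  shows "cospread h \<in> borel_measurable borel"
  unfolding cospread_def by measurable

lemma integrable_bounded:
  fixes h :: "real \<times> real \<Rightarrow> real"
  assumes [measurable]: "h \<in> borel_measurable borel" and "\<And>x. \<bar>h x\<bar> \<le> K"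
  shows "integrable \<kappa> h"
  by (rule integrable_const_bound[where B = K]) (use assms in auto)

text \<open>Fubini on \<open>lborel \<Otimes>\<^sub>M \<kappa>\<close> and, for each fixed
  \<open>v\<close>, the translation \<open>x = y + v\<close>. Only integrability is asked of
  \<open>B\<close>, which later is the product of a test function with the function whose
  oscillation is estimated; boundedness is on the side of \<open>g\<close>.\<close>

lemma spread_adjoint:
  fixes B :: "real \<times> real \<Rightarrow> 'a::{banach,second_countable_topology}" and g :: "real \<times> real \<Rightarrow> real"
  assumes B: "integrable lborel B" and g [measurable]: "g \<in> borel_measurable borel"
    and bound: "\<And>x. \<bar>g x\<bar> \<le> K"
  shows "integrable lborel (\<lambda>x. g x *\<^sub>R spread B x)" (is ?i1)
    and "integrable lborel (\<lambda>y. cospread g y *\<^sub>R B y)" (is ?i2)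
    and "(\<integral>x. g x *\<^sub>R spread B x \<partial>lborel) = (\<integral>y. cospread g y *\<^sub>R B y \<partial>lborel)" (is ?e)
proof -
  have [measurable]: "B \<in> borel_measurable borel"
    using B by (simp add: borel_measurable_integrable)
  have K: "0 \<le> K" using bound[of 0] by linarith
  have fin: "(\<integral>\<^sup>+v. ennreal K * (\<integral>\<^sup>+x. norm (B x) \<partial>lborel) \<partial>\<kappa>) < \<infinity>"
    using B by (simp add: integrable_iff_bounded ennreal_mult_less_top emeasure_eq_measure less_top)
  have I1: "integrable (lborel \<Otimes>\<^sub>M \<kappa>) (\<lambda>(x, v). g x *\<^sub>R B (x - v))"
  proof (rule integrableI_bounded)
    have "(\<integral>\<^sup>+z. norm ((\<lambda>(x, v). g x *\<^sub>R B (x - v)) z) \<partial>(lborel \<Otimes>\<^sub>M \<kappa>))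
        = (\<integral>\<^sup>+v. \<integral>\<^sup>+x. norm (g x *\<^sub>R B (x - v)) \<partial>lborel \<partial>\<kappa>)"
      by (subst nn_integral_snd[symmetric]) (auto simp: case_prod_beta)
    also have "\<dots> \<le> (\<integral>\<^sup>+v. \<integral>\<^sup>+x. ennreal K * norm (B (x - v)) \<partial>lborel \<partial>\<kappa>)"
      using bound K by (intro nn_integral_mono) (auto simp: ennreal_mult'[symmetric] intro!: ennreal_leI mult_right_mono)
    also have "\<dots> = (\<integral>\<^sup>+v. ennreal K * (\<integral>\<^sup>+x. norm (B x) \<partial>lborel) \<partial>\<kappa>)"
      by (intro nn_integral_cong) (simp add: nn_integral_cmult nn_integral_lborel_translate[of "\<lambda>x. ennreal (norm (B x))"])
    finally show "(\<integral>\<^sup>+z. norm ((\<lambda>(x, v). g x *\<^sub>R B (x - v)) z) \<partial>(lborel \<Otimes>\<^sub>M \<kappa>)) < \<infinity>"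
      using fin by (rule le_less_trans)
  qed measurable
  have I2: "integrable (lborel \<Otimes>\<^sub>M \<kappa>) (\<lambda>(y, v). g (y + v) *\<^sub>R B y)"
  proof (rule integrableI_bounded)
    have "(\<integral>\<^sup>+z. norm ((\<lambda>(y, v). g (y + v) *\<^sub>R B y) z) \<partial>(lborel \<Otimes>\<^sub>M \<kappa>))
        = (\<integral>\<^sup>+v. \<integral>\<^sup>+y. norm (g (y + v) *\<^sub>R B y) \<partial>lborel \<partial>\<kappa>)"
      by (subst nn_integral_snd[symmetric]) (auto simp: case_prod_beta)
    also have "\<dots> \<le> (\<integral>\<^sup>+v. \<integral>\<^sup>+y. ennreal K * norm (B y) \<partial>lborel \<partial>\<kappa>)"
      using bound K by (intro nn_integral_mono) (auto simp: ennreal_mult'[symmetric] intro!: ennreal_leI mult_right_mono)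
    also have "\<dots> = (\<integral>\<^sup>+v. ennreal K * (\<integral>\<^sup>+x. norm (B x) \<partial>lborel) \<partial>\<kappa>)"
      by (intro nn_integral_cong) (simp add: nn_integral_cmult)
    finally show "(\<integral>\<^sup>+z. norm ((\<lambda>(y, v). g (y + v) *\<^sub>R B y) z) \<partial>(lborel \<Otimes>\<^sub>M \<kappa>)) < \<infinity>"
      using fin by (rule le_less_trans)
  qed measurable
  have e2: "(\<integral>v. g (y + v) *\<^sub>R B y \<partial>\<kappa>) = cospread g y *\<^sub>R B y" for y
  proof -
    have "integrable \<kappa> (\<lambda>v. g (y + v))" using bound by (intro integrable_bounded[where K = K]) auto
    then show ?thesis by (simp add: cospread_def)
  qed
  show ?i1 using integrable_fst'[OF I1] by (simp add: spread_def)
  show ?i2 using integrable_fst'[OF I2] by (simp add: e2)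
  have "(\<integral>x. g x *\<^sub>R spread B x \<partial>lborel) = (\<integral>v. \<integral>x. g x *\<^sub>R B (x - v) \<partial>lborel \<partial>\<kappa>)"
    using Fubini_integral[OF I1] by (simp add: spread_def)
  also have "\<dots> = (\<integral>v. \<integral>y. g (y + v) *\<^sub>R B y \<partial>lborel \<partial>\<kappa>)"
  proof (rule Bochner_Integration.integral_cong[OF refl])
    fix v
    show "(\<integral>x. g x *\<^sub>R B (x - v) \<partial>lborel) = (\<integral>y. g (y + v) *\<^sub>R B y \<partial>lborel)"
      using integral_lborel_translate[of "\<lambda>x. g x *\<^sub>R B (x - v)" v] by simp
  qed
  also have "\<dots> = (\<integral>y. cospread g y *\<^sub>R B y \<partial>lborel)"
    using Fubini_integral[OF I2] by (simp add: e2)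
  finally show ?e .
qed

end

lemma integrable_bounded_scaleR:
  fixes b :: "'a \<Rightarrow> 'b::{banach,second_countable_topology}" and g :: "'a \<Rightarrow> real"
  assumes "integrable M b" "g \<in> borel_measurable M" "\<And>x. \<bar>g x\<bar> \<le> K"
  shows "integrable M (\<lambda>x. g x *\<^sub>R b x)"
proof (rule Bochner_Integration.integrable_bound)
  show "integrable M (\<lambda>x. K *\<^sub>R b x)" using assms(1) by simp
  show "AE x in M. norm (g x *\<^sub>R b x) \<le> norm (K *\<^sub>R b x)"
  proof (rule AE_I2)
    fix x
    have "\<bar>g x\<bar> \<le> \<bar>K\<bar>" using assms(3)[of x] by linarith
    then show "norm (g x *\<^sub>R b x) \<le> norm (K *\<^sub>R b x)" by (simp add: mult_right_mono)
  qed
qed (use assms in measurable)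

text \<open>One set \<open>B\<close> has to serve both \<open>x\<close> and \<open>x'\<close>, since
  an oscillation compares the values of the walk at two points. The right-hand side of the
  minorization is the unnormalized law of a step from \<open>z\<close> into \<open>P\<close>
  followed by a step forward, integrated against \<open>F\<close>.\<close>

locale doeblin_pair = convolution_pair +
  fixes A P :: "(real \<times> real) set" and c vol :: real
  assumes A [measurable]: "A \<in> sets borel" and P [measurable]: "P \<in> sets borel"
    and A_fin: "emeasure lborel A < \<infinity>" and P_fin: "emeasure lborel P < \<infinity>"
    and A_pos: "0 < measure lborel A" and M_pos: "0 < measure \<kappa> UNIV"
    and c_pos: "0 < c" and vol_pos: "0 < vol"
    and minorization: "\<And>x x'. x \<in> A \<Longrightarrow> x' \<in> A \<Longrightarrow> \<exists>B\<in>sets borel. B \<subseteq> A \<and> measure lborel B = vol \<and>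
      (\<forall>z\<in>{x, x'}. \<forall>F K. F \<in> borel_measurable borel \<longrightarrow> (\<forall>y. 0 \<le> F y \<and> F y \<le> (K::real)) \<longrightarrow>
        c * (\<integral>y. indicator B y * F y \<partial>lborel) \<le> spread (\<lambda>y. indicator P y * cospread F y) z)"
begin

abbreviation M :: real where "M \<equiv> measure \<kappa> UNIV"

definition hits :: "real \<times> real \<Rightarrow> real" where "hits = cospread (indicator A)"

text \<open>Points of \<open>P\<close> from which no step returns to \<open>A\<close> are left out,
  so that \<open>relay\<close> may normalize by \<open>hits\<close>.\<close>

definition base :: "real \<times> real \<Rightarrow> real" where
  "base y = (if 0 < hits y then indicator P y else 0)"

text \<open>For \<open>f\<close> supported in \<open>A\<close> this is the conditional mean of
  \<open>f\<close> after a step forward from \<open>y\<close>, given that the step ends in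
  \<open>A\<close>.\<close>

definition relay :: "(real \<times> real \<Rightarrow> real) \<Rightarrow> real \<times> real \<Rightarrow> real" where
  "relay f y = base y * cospread f y / hits y"

text \<open>A lazy walk on \<open>A\<close>: a step back is drawn from \<kappa> / M; if it misses
  \<open>base\<close> the walk stays at \<open>x\<close>, otherwise it returns to \<open>A\<close>
  by \<open>relay\<close>. Dividing by the constant \<open>M\<close> rather than by
  \<open>spread base x\<close> makes the walk reversible for Lebesgue measure on
  \<open>A\<close>.\<close>

definition walk :: "(real \<times> real \<Rightarrow> real) \<Rightarrow> real \<times> real \<Rightarrow> real" where
  "walk f x = f x - indicator A x * (f x * spread base x - spread (relay f) x) / M"

text \<open>The pairing of \<open>g\<close> with \<open>[b, T] h\<close> for
  \<open>T = spread\<close>, with \<open>T\<close> moved to \<open>g\<close> by duality in the term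
  \<open>T (b h)\<close>, so that no operator acts on \<open>b\<close>.\<close>

definition form :: "(real \<times> real \<Rightarrow> 'a::{banach,second_countable_topology}) \<Rightarrow> (real \<times> real \<Rightarrow> real)
    \<Rightarrow> (real \<times> real \<Rightarrow> real) \<Rightarrow> 'a" where
  "form b g h = (\<integral>x. (g x * spread h x - h x * cospread g x) *\<^sub>R b x \<partial>lborel)"

lemma space_kappa: "space \<kappa> = UNIV"
  using sets_eq_imp_space_eq[OF sets_kappa] by simp

lemma measurable_hits [measurable]: "hits \<in> borel_measurable borel"
  unfolding hits_def by measurable

lemma measurable_base [measurable]: "base \<in> borel_measurable borel"
  unfolding base_def by measurable

lemma measurable_relay [measurable]:
  assumes [measurable]: "f \<in> borel_measurable borel"
  shows "relay f \<in> borel_measurable borel"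
  unfolding relay_def by measurable

lemma measurable_walk [measurable]:
  assumes [measurable]: "f \<in> borel_measurable borel"
  shows "walk f \<in> borel_measurable borel"
  unfolding walk_def by measurable

lemma cospread_mono:
  assumes "f \<in> borel_measurable borel" "g \<in> borel_measurable borel"
    and "\<And>x. \<bar>f x\<bar> \<le> K" "\<And>x. \<bar>g x\<bar> \<le> K" "\<And>x. f x \<le> (g x :: real)"
  shows "cospread f y \<le> cospread g y"
  unfolding cospread_def using assms by (intro integral_mono integrable_bounded[where K = K]) auto

lemma spread_mono:
  assumes "f \<in> borel_measurable borel" "g \<in> borel_measurable borel"
    and "\<And>x. \<bar>f x\<bar> \<le> K" "\<And>x. \<bar>g x\<bar> \<le> K" "\<And>x. f x \<le> (g x :: real)"
  shows "spread f y \<le> spread g y"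
  unfolding spread_def using assms by (intro integral_mono integrable_bounded[where K = K]) auto

lemma cospread_const: "cospread (\<lambda>_. k) y = M * (k::real)"
  by (simp add: cospread_def space_kappa)

lemma spread_const: "spread (\<lambda>_. k) y = M * (k::real)"
  by (simp add: spread_def space_kappa)

lemma cospread_linear:
  assumes "f \<in> borel_measurable borel" "g \<in> borel_measurable borel"
    and "\<And>x. \<bar>f x\<bar> \<le> K" "\<And>x. \<bar>g x\<bar> \<le> K'"
  shows "cospread (\<lambda>x. a * f x + b * g x) y = a * cospread f y + b * (cospread g y :: real)"
proof -
  have "integrable \<kappa> (\<lambda>v. f (y + v))" "integrable \<kappa> (\<lambda>v. g (y + v))"
    by (intro integrable_bounded[OF _ assms(3)] integrable_bounded[OF _ assms(4)]; use assms in measurable)+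
  then show ?thesis unfolding cospread_def by simp
qed

lemma spread_linear:
  assumes "f \<in> borel_measurable borel" "g \<in> borel_measurable borel"
    and "\<And>x. \<bar>f x\<bar> \<le> K" "\<And>x. \<bar>g x\<bar> \<le> K'"
  shows "spread (\<lambda>x. a * f x + b * g x) y = a * spread f y + b * (spread g y :: real)"
proof -
  have "integrable \<kappa> (\<lambda>v. f (y - v))" "integrable \<kappa> (\<lambda>v. g (y - v))"
    by (intro integrable_bounded[OF _ assms(3)] integrable_bounded[OF _ assms(4)]; use assms in measurable)+
  then show ?thesis unfolding spread_def by simp
qed

lemma cospread_bound:
  assumes [measurable]: "f \<in> borel_measurable borel" and b: "\<And>x. \<bar>f x\<bar> \<le> (K::real)"
  shows "\<bar>cospread f y\<bar> \<le> M * K"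
proof -
  have K: "0 \<le> K" using b[of 0] by linarith
  have "f x \<le> K" "-K \<le> f x" for x using b[of x] by (simp_all add: abs_le_iff)
  then have "cospread f y \<le> cospread (\<lambda>_. K) y" "cospread (\<lambda>_. -K) y \<le> cospread f y"
    using b K by (intro cospread_mono[where K = K]; simp)+
  then show ?thesis by (simp add: cospread_const)
qed

lemma spread_bound:
  assumes [measurable]: "f \<in> borel_measurable borel" and b: "\<And>x. \<bar>f x\<bar> \<le> (K::real)"
  shows "\<bar>spread f y\<bar> \<le> M * K"
proof -
  have K: "0 \<le> K" using b[of 0] by linarith
  have "f x \<le> K" "-K \<le> f x" for x using b[of x] by (simp_all add: abs_le_iff)
  then have "spread f y \<le> spread (\<lambda>_. K) y" "spread (\<lambda>_. -K) y \<le> spread f y"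
    using b K by (intro spread_mono[where K = K]; simp)+
  then show ?thesis by (simp add: spread_const)
qed

lemma hits_nonneg: "0 \<le> hits y"
  unfolding hits_def cospread_def by simp

lemma hits_le: "hits y \<le> M"
  using cospread_bound[of "indicator A" 1 y] unfolding hits_def by (auto simp: indicator_def)

lemma base_bounds: "0 \<le> base y" "base y \<le> indicator P y" "\<bar>base y\<bar> \<le> 1"
  by (auto simp: base_def indicator_def)

lemma cospread_le_hits:
  assumes [measurable]: "f \<in> borel_measurable borel" and b: "\<And>x. \<bar>f x\<bar> \<le> K * indicator A x"
  shows "\<bar>cospread f y\<bar> \<le> K * hits y"
proof -
  have K: "\<bar>f x\<bar> \<le> \<bar>K\<bar>" "\<bar>K * indicator A x\<bar> \<le> \<bar>K\<bar>" for x
    using b[of x] by (cases "x \<in> A"; simp)+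
  have i: "K * hits y = cospread (\<lambda>x. K * indicator A x) y" for K
    by (simp add: hits_def cospread_def)
  have "cospread f y \<le> cospread (\<lambda>x. K * indicator A x) y"
    using K b by (intro cospread_mono[where K = "\<bar>K\<bar>"]) (auto simp: abs_le_iff)
  moreover have "cospread (\<lambda>x. (-K) * indicator A x) y \<le> cospread f y"
  proof (intro cospread_mono[where K = "\<bar>K\<bar>"])
    show "- K * indicat_real A x \<le> f x" for x using b[of x] by (simp add: abs_le_iff)
  qed (use K in auto)
  ultimately show ?thesis using i[of K] i[of "-K"] by (simp add: abs_le_iff)
qed

lemma relay_bound:
  assumes [measurable]: "f \<in> borel_measurable borel" and b: "\<And>x. \<bar>f x\<bar> \<le> K * indicator A x"
  shows "\<bar>relay f y\<bar> \<le> K * indicator P y"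
proof (cases "0 < hits y")
  case True
  then show ?thesis
    using cospread_le_hits[OF assms, of y] by (auto simp: relay_def base_def indicator_def abs_mult divide_simps)
next
  case False
  moreover have "0 \<le> K * indicator P y"
  proof -
    obtain x where "x \<in> A" using A_pos by (metis equals0I less_irrefl measure_empty)
    then have "0 \<le> K" using b[of x] by simp
    then show ?thesis by simp
  qed
  ultimately show ?thesis by (simp add: relay_def base_def)
qed

lemma relay_hits:
  assumes [measurable]: "f \<in> borel_measurable borel" and b: "\<And>x. \<bar>f x\<bar> \<le> K * indicator A x"
  shows "relay f y * hits y = base y * cospread f y"
  by (auto simp: relay_def base_def)

text \<open>Constants on \<open>A\<close> are fixed because \<open>relay (indicator A)\<close> is
  \<open>base\<close>: whatever leaves for \<open>P\<close> returns.\<close>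

lemma walk_affine:
  assumes [measurable]: "f \<in> borel_measurable borel" and b: "\<And>x. \<bar>f x\<bar> \<le> K * indicator A x"
    and x: "x \<in> A"
  shows "walk (\<lambda>x. m * indicator A x + s * f x) x = m + s * walk f x"
proof -
  have K: "\<bar>f x\<bar> \<le> \<bar>K\<bar>" for x
    using b[of x] by (cases "x \<in> A"; simp)
  have "cospread (\<lambda>x. m * indicator A x + s * f x) y = m * hits y + s * cospread f y" for y
    unfolding hits_def by (rule cospread_linear[where K = 1, OF _ _ _ K]) (auto simp: indicator_def)
  then have "relay (\<lambda>x. m * indicator A x + s * f x) = (\<lambda>y. m * base y + s * relay f y)"
    by (auto simp: relay_def base_def fun_eq_iff field_simps)
  moreover have "spread (\<lambda>y. m * base y + s * relay f y) x = m * spread base x + s * spread (relay f) x"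
  proof (rule spread_linear[where K = 1 and K' = "\<bar>K\<bar>"])
    show "\<bar>relay f y\<bar> \<le> \<bar>K\<bar>" for y
      using relay_bound[OF assms(1,2), of y] by (cases "y \<in> P"; simp)
  qed (use base_bounds in auto)
  ultimately show ?thesis
    using x M_pos by (simp add: walk_def field_simps)
qed

text \<open>The part of the walk that stays in place is nonnegative since \<open>spread base\<close>
  is at most \<open>M\<close>. Of the two factors \<open>1 / M\<close>, one comes from the
  definition of the walk, the other from \<open>hits y \<le> M\<close> in the normalization of the
  return step.\<close>

lemma walk_lower:
  assumes [measurable]: "f \<in> borel_measurable borel" and nonneg: "\<And>x. 0 \<le> f x"
    and b: "\<And>x. f x \<le> K * indicator A x" and x: "x \<in> A"
  shows "spread (\<lambda>y. indicator P y * cospread f y) x / M\<^sup>2 \<le> walk f x"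
proof -
  have b': "\<bar>f x\<bar> \<le> K * indicator A x" for x using b nonneg by simp
  have K: "0 \<le> K" using b[of x] nonneg[of x] x by simp
  have fK: "\<bar>f x\<bar> \<le> K" for x using b'[of x] K by (cases "x \<in> A"; simp)
  have le: "indicator P y * cospread f y / M \<le> relay f y" for y
  proof (cases "0 < hits y")
    case True
    have "0 \<le> cospread f y" unfolding cospread_def using nonneg by simp
    then show ?thesis using True hits_le[of y] M_pos
      by (auto simp: relay_def base_def indicator_def intro!: divide_left_mono)
  next
    case False
    then have "hits y = 0" using hits_nonneg[of y] by simp
    then show ?thesis using cospread_le_hits[OF assms(1) b', of y] by (simp add: relay_def base_def)
  qed
  have "spread (\<lambda>y. indicator P y * cospread f y / M) x \<le> spread (relay f) x"
  proof (rule spread_mono[where K = K])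
    show "\<bar>relay f y\<bar> \<le> K" for y
      using relay_bound[OF assms(1) b', of y] K by (cases "y \<in> P"; simp)
    show "\<bar>indicat_real P y * cospread f y / M\<bar> \<le> K" for y
      using cospread_bound[OF assms(1) fK, of y] M_pos K
      by (auto simp: indicator_def abs_mult divide_simps mult.commute)
  qed (use le in auto)
  then have 1: "spread (\<lambda>y. indicator P y * cospread f y) x / M\<^sup>2 \<le> spread (relay f) x / M"
    using M_pos by (simp add: spread_def power2_eq_square divide_right_mono divide_divide_eq_left[symmetric] del: divide_divide_eq_left)
  have "spread base x \<le> M" using spread_bound[of base 1 x] base_bounds by auto
  then have "0 \<le> f x * (1 - spread base x / M)" using nonneg M_pos by simp
  then have "spread (relay f) x / M \<le> walk f x"
    using x by (simp add: walk_def right_diff_distrib diff_divide_distrib)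
  with 1 show ?thesis by simp
qed

text \<open>At two points of the set \<open>A\<close> the walk has a common part of mass at least \<open>c * vol / M\<^sup>2\<close>.\<close>

lemma walk_contraction:
  assumes [measurable]: "f \<in> borel_measurable borel" and supp: "\<And>x. x \<notin> A \<Longrightarrow> f x = 0"
    and osc: "\<And>x x'. x \<in> A \<Longrightarrow> x' \<in> A \<Longrightarrow> f x - f x' \<le> \<omega>"
    and x: "x \<in> A" "x' \<in> A"
  shows "walk f x - walk f x' \<le> (1 - c * vol / M\<^sup>2) * \<omega>"
proof -
  define m where "m = Inf (f ` A)"
  have bdd: "bdd_below (f ` A)" using osc[OF x(1)] by (intro bdd_belowI[of _ "f x - \<omega>"]) (auto simp: algebra_simps)
  have m1: "m \<le> f z" if "z \<in> A" for z unfolding m_def using that bdd by (auto intro: cINF_lower)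
  have m2: "f z \<le> m + \<omega>" if "z \<in> A" for z
  proof -
    have "f z - \<omega> \<le> m" unfolding m_def using x osc[OF that] by (intro cINF_greatest) (auto simp: algebra_simps)
    then show ?thesis by simp
  qed
  have w: "0 \<le> \<omega>" using osc[OF x(1) x(1)] by simp
  \<comment> \<open>The distances of \<open>f\<close> to its lower and to its upper bound. On
    \<open>A\<close> they add up to \<omega>, so their integrals over the common set
    \<open>B\<close> add up to \<open>\<omega> * vol\<close>, whatever \<open>f\<close> does
    there.\<close>
  define f1 where "f1 z = f z - m * indicator A z" for z
  define f2 where "f2 z = (m + \<omega>) * indicator A z - f z" for z
  have [measurable]: "f1 \<in> borel_measurable borel" "f2 \<in> borel_measurable borel"
    unfolding f1_def f2_def by measurable
  have p: "0 \<le> f1 z" "0 \<le> f2 z" "f1 z \<le> \<omega> * indicator A z" "f2 z \<le> \<omega> * indicator A z" for z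
    using m1[of z] m2[of z] supp[of z] by (auto simp: f1_def f2_def indicator_def)
  have pK: "f1 z \<le> \<omega>" "f2 z \<le> \<omega>" for z
    using p[of z] w by (cases "z \<in> A"; simp)+
  have a1: "walk f z = m + walk f1 z" if "z \<in> A" for z
    using walk_affine[of f1 \<omega> z m 1] p that by (simp add: f1_def)
  have a2: "walk f z = m + \<omega> - walk f2 z" if "z \<in> A" for z
    using walk_affine[of f2 \<omega> z "m + \<omega>" "-1"] p that by (simp add: f2_def)
  obtain B where B [measurable]: "B \<in> sets borel" and BA: "B \<subseteq> A" and vol: "measure lborel B = vol"
    and min: "\<forall>z\<in>{x, x'}. \<forall>F K. F \<in> borel_measurable borel \<longrightarrow> (\<forall>y. 0 \<le> F y \<and> F y \<le> (K::real)) \<longrightarrow>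
        c * (\<integral>y. indicator B y * F y \<partial>lborel) \<le> spread (\<lambda>y. indicator P y * cospread F y) z"
    using minorization[OF x] by auto
  have BK: "emeasure lborel B < \<infinity>" by (rule le_less_trans[OF emeasure_mono[OF BA] A_fin]) simp
  have l1: "c * (\<integral>y. indicator B y * f1 y \<partial>lborel) / M\<^sup>2 \<le> walk f1 x'"
  proof -
    have "c * (\<integral>y. indicator B y * f1 y \<partial>lborel) \<le> spread (\<lambda>y. indicator P y * cospread f1 y) x'"
      using min[rule_format, of x' f1 \<omega>] p pK by simp
    then have "c * (\<integral>y. indicator B y * f1 y \<partial>lborel) / M\<^sup>2 \<le> spread (\<lambda>y. indicator P y * cospread f1 y) x' / M\<^sup>2"
      by (simp add: divide_right_mono)
    also have "\<dots> \<le> walk f1 x'" using p x by (intro walk_lower) auto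
    finally show ?thesis .
  qed
  have l2: "c * (\<integral>y. indicator B y * f2 y \<partial>lborel) / M\<^sup>2 \<le> walk f2 x"
  proof -
    have "c * (\<integral>y. indicator B y * f2 y \<partial>lborel) \<le> spread (\<lambda>y. indicator P y * cospread f2 y) x"
      using min[rule_format, of x f2 \<omega>] p pK by simp
    then have "c * (\<integral>y. indicator B y * f2 y \<partial>lborel) / M\<^sup>2 \<le> spread (\<lambda>y. indicator P y * cospread f2 y) x / M\<^sup>2"
      by (simp add: divide_right_mono)
    also have "\<dots> \<le> walk f2 x" using p x by (intro walk_lower) auto
    finally show ?thesis .
  qed
  have int: "integrable lborel (\<lambda>y. f1 y * indicator B y)" "integrable lborel (\<lambda>y. f2 y * indicator B y)"
    using BK integrable_bounded_scaleR[of lborel "indicator B :: _ \<Rightarrow> real" f1 \<omega>]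
      integrable_bounded_scaleR[of lborel "indicator B :: _ \<Rightarrow> real" f2 \<omega>] p(1,2) pK by (simp_all add: abs_of_nonneg)
  have "(\<integral>y. indicator B y * f1 y \<partial>lborel) + (\<integral>y. indicator B y * f2 y \<partial>lborel)
      = (\<integral>y. f1 y * indicator B y + f2 y * indicator B y \<partial>lborel)"
    using int by (simp add: mult.commute)
  also have "\<dots> = (\<integral>y. \<omega> * indicator B y \<partial>lborel)"
    using BA by (intro Bochner_Integration.integral_cong) (auto simp: f1_def f2_def indicator_def)
  also have "\<dots> = \<omega> * vol" using vol by simp
  finally have s: "(\<integral>y. indicator B y * f1 y \<partial>lborel) + (\<integral>y. indicator B y * f2 y \<partial>lborel) = \<omega> * vol" .
  have "walk f x - walk f x' = \<omega> - (walk f1 x' + walk f2 x)" using a1[of x'] a2[of x] x by simp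
  also have "\<dots> \<le> \<omega> - (c * (\<integral>y. indicator B y * f1 y \<partial>lborel) / M\<^sup>2 + c * (\<integral>y. indicator B y * f2 y \<partial>lborel) / M\<^sup>2)"
    using l1 l2 by simp
  also have "\<dots> = \<omega> - c * (\<omega> * vol) / M\<^sup>2"
    unfolding s[symmetric] by (simp add: algebra_simps add_divide_distrib)
  finally show ?thesis by (simp add: algebra_simps)
qed

lemma integrable_supported:
  assumes "f \<in> borel_measurable borel" "\<And>x. \<bar>f x\<bar> \<le> K * indicator E x" "E \<in> sets borel"
    "emeasure lborel E < \<infinity>"
  shows "integrable lborel (f :: _ \<Rightarrow> real)"
proof (rule Bochner_Integration.integrable_bound)
  show "integrable lborel (\<lambda>x. K * indicator E x)" using assms by simp
  show "AE x in lborel. norm (f x) \<le> norm (K * indicat_real E x)"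
    using assms(2) by (auto intro!: AE_I2 order_trans[OF _ abs_ge_self])
qed (use assms in simp)

lemma form_integrable:
  fixes b :: "_ \<Rightarrow> 'a::{banach,second_countable_topology}"
  assumes b: "integrable lborel b" and [measurable]: "g \<in> borel_measurable borel" "h \<in> borel_measurable borel"
    and g: "\<And>x. \<bar>g x\<bar> \<le> K" and h: "\<And>x. \<bar>h x\<bar> \<le> K'"
  shows "integrable lborel (\<lambda>x. (g x * spread h x - h x * cospread g x) *\<^sub>R b x)"
proof (rule integrable_bounded_scaleR[OF b])
  fix x
  have "\<bar>g x * spread h x\<bar> \<le> K * (M * K')" "\<bar>h x * cospread g x\<bar> \<le> K' * (M * K)"
    unfolding abs_mult using g[of x] h[of x] spread_bound[of h K' x] cospread_bound[of g K x] g h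
    by (intro mult_mono; force)+
  then show "\<bar>g x * spread h x - h x * cospread g x\<bar> \<le> K * (M * K') + K' * (M * K)" by linarith
qed measurable

text \<open>The terms \<open>h * cospread g\<close> of the two forms are
  \<open>base * cospread f\<close> and \<open>relay f * hits\<close>. They agree pointwise and
  cancel in the difference, which leaves the increment of the walk tested against
  \<open>b\<close>.\<close>

lemma walk_form:
  fixes b :: "_ \<Rightarrow> 'a::{banach,second_countable_topology}"
  assumes b: "integrable lborel b" and [measurable]: "f \<in> borel_measurable borel"
    and f: "\<And>x. \<bar>f x\<bar> \<le> K * indicator A x"
  shows "(\<integral>x. f x *\<^sub>R b x \<partial>lborel) - (\<integral>x. walk f x *\<^sub>R b x \<partial>lborel)
      = (1 / M) *\<^sub>R (form b f base - form b (indicator A) (relay f))"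
    and "integrable lborel (\<lambda>x. walk f x *\<^sub>R b x)"
proof -
  have fK: "\<bar>f x\<bar> \<le> \<bar>K\<bar>" for x using f[of x] by (cases "x \<in> A"; simp)
  have rK: "\<bar>relay f x\<bar> \<le> \<bar>K\<bar>" for x using relay_bound[of f K x] f by (cases "x \<in> P"; simp)
  have i1: "integrable lborel (\<lambda>x. (f x * spread base x - base x * cospread f x) *\<^sub>R b x)"
    using fK base_bounds by (intro form_integrable[OF b]) auto
  have i2: "integrable lborel (\<lambda>x. (indicator A x * spread (relay f) x - relay f x * cospread (indicator A) x) *\<^sub>R b x)"
    using rK by (intro form_integrable[OF b, where K = 1]) (auto simp: indicator_def)
  have i3: "integrable lborel (\<lambda>x. f x *\<^sub>R b x)"
    using fK by (intro integrable_bounded_scaleR[OF b]) auto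
  have pt: "walk f x *\<^sub>R b x = f x *\<^sub>R b x - (1 / M) *\<^sub>R ((f x * spread base x - base x * cospread f x) *\<^sub>R b x
      - (indicator A x * spread (relay f) x - relay f x * cospread (indicator A) x) *\<^sub>R b x)" for x
  proof -
    have "f x = 0" if "x \<notin> A" using f[of x] that by simp
    moreover have "relay f x * cospread (indicator A) x = base x * cospread f x"
      using relay_hits[of f K x] f unfolding hits_def by simp
    ultimately have "walk f x = f x - (1 / M) * ((f x * spread base x - base x * cospread f x)
        - (indicator A x * spread (relay f) x - relay f x * cospread (indicator A) x))"
      by (cases "x \<in> A") (auto simp: walk_def)
    then show ?thesis by (simp only: scaleR_left_diff_distrib scaleR_scaleR[symmetric])
  qed
  show "integrable lborel (\<lambda>x. walk f x *\<^sub>R b x)"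
    unfolding pt using i1 i2 i3 by simp
  show "(\<integral>x. f x *\<^sub>R b x \<partial>lborel) - (\<integral>x. walk f x *\<^sub>R b x \<partial>lborel)
      = (1 / M) *\<^sub>R (form b f base - form b (indicator A) (relay f))"
    unfolding pt form_def using i1 i2 i3 by simp
qed

lemma adjoint_supported:
  fixes g h :: "real \<times> real \<Rightarrow> real"
  assumes [measurable]: "g \<in> borel_measurable borel" "h \<in> borel_measurable borel"
    and g: "\<And>x. \<bar>g x\<bar> \<le> K" and h: "\<And>x. \<bar>h x\<bar> \<le> K' * indicator P x"
  shows "(\<integral>x. g x * spread h x \<partial>lborel) = (\<integral>x. h x * cospread g x \<partial>lborel)"
proof -
  have "integrable lborel h" using h P_fin by (intro integrable_supported[where E = P]) auto
  from spread_adjoint(3)[OF this _ g] show ?thesis by (simp add: mult.commute)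
qed

text \<open>Invariance of Lebesgue measure under the reversible walk: by adjunction both terms of
  the increment integrate to the integral of \<open>base * cospread f\<close>.\<close>

lemma walk_mean:
  assumes [measurable]: "f \<in> borel_measurable borel" and f: "\<And>x. \<bar>f x\<bar> \<le> K * indicator A x"
  shows "(\<integral>x. walk f x \<partial>lborel) = (\<integral>x. f x \<partial>lborel)"
proof -
  have fK: "\<bar>f x\<bar> \<le> \<bar>K\<bar>" for x using f[of x] by (cases "x \<in> A"; simp)
  have rK: "\<bar>relay f x\<bar> \<le> \<bar>K\<bar>" for x using relay_bound[of f K x] f by (cases "x \<in> P"; simp)
  have bi: "integrable lborel base" "integrable lborel (relay f)"
    using P_fin base_bounds relay_bound[of f K] f
    by (intro integrable_supported[where E = P and K = 1] integrable_supported[where E = P and K = K]; simp)+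
  have fi: "integrable lborel f" using A_fin f by (intro integrable_supported[where E = A and K = K]) auto
  have ii: "integrable lborel (indicator A :: _ \<Rightarrow> real)" using A_fin by simp
  have j1: "integrable lborel (\<lambda>x. f x * spread base x)" using spread_adjoint(1)[OF bi(1) _ fK] by simp
  have j2: "integrable lborel (\<lambda>x. indicator A x * spread (relay f) x)"
    using spread_adjoint(1)[OF bi(2), of "indicator A" 1] by (auto simp: indicator_def)
  have "walk f x = f x - (1 / M) * (f x * spread base x - indicator A x * spread (relay f) x)" for x
    using f[of x] by (cases "x \<in> A") (auto simp: walk_def)
  then have "(\<integral>x. walk f x \<partial>lborel) = (\<integral>x. f x \<partial>lborel)
      - (1 / M) * ((\<integral>x. f x * spread base x \<partial>lborel) - (\<integral>x. indicator A x * spread (relay f) x \<partial>lborel))"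
    using fi j1 j2 by simp
  also have "(\<integral>x. f x * spread base x \<partial>lborel) = (\<integral>x. base x * cospread f x \<partial>lborel)"
    using base_bounds by (intro adjoint_supported[OF _ _ fK, where K' = 1]) auto
  also have "(\<integral>x. indicator A x * spread (relay f) x \<partial>lborel) = (\<integral>x. relay f x * cospread (indicator A) x \<partial>lborel)"
    using relay_bound[of f K] f by (intro adjoint_supported[where K = 1 and K' = K]) (auto simp: indicator_def)
  also have "(\<integral>x. relay f x * cospread (indicator A) x \<partial>lborel) = (\<integral>x. base x * cospread f x \<partial>lborel)"
    using relay_hits[of f K] f by (simp add: hits_def)
  finally show ?thesis by simp
qed

text \<open>The walk keeps support and mean and contracts the oscillation, so it maps the class for
  \<omega> into the class for a smaller \<omega>. The mean zero condition turns the bound on the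
  oscillation into one on the values.\<close>

definition test_class :: "real \<Rightarrow> (real \<times> real \<Rightarrow> real) set" where
  "test_class \<omega> = {f \<in> borel_measurable borel. (\<forall>x. x \<notin> A \<longrightarrow> f x = 0) \<and> (\<integral>x. f x \<partial>lborel) = 0 \<and>
     (\<forall>x\<in>A. \<forall>x'\<in>A. f x - f x' \<le> \<omega>)}"

lemma test_class_bound:
  assumes f: "f \<in> test_class \<omega>"
  shows "\<bar>f x\<bar> \<le> \<omega> * indicator A x"
proof (cases "x \<in> A")
  case False
  then show ?thesis using f by (simp add: test_class_def)
next
  case True
  have [measurable]: "f \<in> borel_measurable borel" and f0: "\<And>z. z \<notin> A \<Longrightarrow> f z = 0"
    and m: "(\<integral>x. f x \<partial>lborel) = 0" and o: "\<And>z z'. z \<in> A \<Longrightarrow> z' \<in> A \<Longrightarrow> f z - f z' \<le> \<omega>"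
    using f by (auto simp: test_class_def)
  have "\<bar>f z\<bar> \<le> (\<bar>f x\<bar> + \<bar>\<omega>\<bar>) * indicator A z" for z
    using o[of z x] o[of x z] True f0[of z] by (cases "z \<in> A") auto
  then have fi: "integrable lborel f" using A_fin by (intro integrable_supported[where E = A]) auto
  have "f x \<le> \<omega>"
  proof -
    have "(\<integral>z. (f x - \<omega>) * indicator A z \<partial>lborel) \<le> (\<integral>z. f z \<partial>lborel)"
    proof (intro integral_mono fi)
      show "(f x - \<omega>) * indicat_real A z \<le> f z" for z using o[of x z] True f0[of z] by (cases "z \<in> A") auto
    qed (use A_fin in auto)
    then have "(f x - \<omega>) * measure lborel A \<le> 0" using m by simp
    then show ?thesis using A_pos by (simp add: mult_le_0_iff)
  qed
  moreover have "- \<omega> \<le> f x"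
  proof -
    have "(\<integral>z. f z \<partial>lborel) \<le> (\<integral>z. (f x + \<omega>) * indicator A z \<partial>lborel)"
    proof (intro integral_mono fi)
      show "f z \<le> (f x + \<omega>) * indicat_real A z" for z using o[of z x] True f0[of z] by (cases "z \<in> A") auto
    qed (use A_fin in auto)
    then have "0 \<le> (f x + \<omega>) * measure lborel A" using m by simp
    then show ?thesis using A_pos by (simp add: zero_le_mult_iff)
  qed
  ultimately show ?thesis using True by (simp add: abs_le_iff)
qed

lemma test_class_scale:
  assumes "f \<in> test_class \<omega>" "0 < s"
  shows "(\<lambda>x. f x * s) \<in> test_class (\<omega> * s)"
  using assms by (auto simp: test_class_def left_diff_distrib[symmetric])

lemma walk_test_class:
  assumes "f \<in> test_class \<omega>"
  shows "walk f \<in> test_class ((1 - c * vol / M\<^sup>2) * \<omega>)"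
proof -
  have [measurable]: "f \<in> borel_measurable borel" using assms by (simp add: test_class_def)
  show ?thesis
    unfolding test_class_def
  proof (intro CollectI conjI ballI allI impI)
    show "walk f x = 0" if "x \<notin> A" for x using that assms by (simp add: walk_def test_class_def)
    show "(LBINT x. walk f x) = 0"
      using walk_mean[of f \<omega>] test_class_bound[OF assms] assms by (simp add: test_class_def)
    show "walk f x - walk f x' \<le> (1 - c * vol / M\<^sup>2) * \<omega>" if "x \<in> A" "x' \<in> A" for x x'
      using assms that by (intro walk_contraction) (auto simp: test_class_def)
  qed measurable
qed

text \<open>The supremum of the pairings with mean zero functions is absorbed: one step of the walk changes
  the pairing only by values of the form, and contracts the oscillation.\<close>

lemma pairing_bound:
  fixes b :: "_ \<Rightarrow> 'a::{banach,second_countable_topology}"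
  assumes b: "integrable lborel b"
  obtains g h where "g \<in> borel_measurable borel" "h \<in> borel_measurable borel"
    "\<And>x. \<bar>g x\<bar> \<le> indicator A x" "\<And>x. \<bar>h x\<bar> \<le> indicator P x"
    "\<And>f. f \<in> test_class 1 \<Longrightarrow> norm (\<integral>x. f x *\<^sub>R b x \<partial>lborel) \<le> 4 * M / (c * vol) * norm (form b g h)"
proof -
  define k where "k = c * vol / M\<^sup>2"
  have k: "0 < k" using c_pos vol_pos M_pos by (simp add: k_def)
  define O1 where "O1 = (SUP f\<in>test_class 1. norm (\<integral>x. f x *\<^sub>R b x \<partial>lborel))"
  have zero: "(\<lambda>_. 0) \<in> test_class 1" by (auto simp: test_class_def)
  \<comment> \<open>Makes the supremum \<open>O1\<close> a real number; the absorption below would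
    be void otherwise.\<close>
  have le: "norm (\<integral>x. f x *\<^sub>R b x \<partial>lborel) \<le> (\<integral>x. norm (b x) \<partial>lborel)" if f: "f \<in> test_class 1" for f
  proof -
    have [measurable]: "f \<in> borel_measurable borel" using f by (simp add: test_class_def)
    have fK: "\<bar>f x\<bar> \<le> 1" for x using test_class_bound[OF f, of x] by (cases "x \<in> A"; simp)
    have "norm (\<integral>x. f x *\<^sub>R b x \<partial>lborel) \<le> (\<integral>x. norm (f x *\<^sub>R b x) \<partial>lborel)" by (rule integral_norm_bound)
    also have "\<dots> \<le> (\<integral>x. norm (b x) \<partial>lborel)"
    proof (rule integral_mono)
      have "integrable lborel (\<lambda>x. f x *\<^sub>R b x)" by (rule integrable_bounded_scaleR[OF b _ fK]) simp
      then show "integrable lborel (\<lambda>x. norm (f x *\<^sub>R b x))" by (rule integrable_norm)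
    qed (use b fK in \<open>auto intro: mult_left_le_one_le\<close>)
    finally show ?thesis .
  qed
  have bdd: "bdd_above ((\<lambda>f. norm (\<integral>x. f x *\<^sub>R b x \<partial>lborel)) ` test_class 1)"
    using le by (auto simp: bdd_above_def)
  have up: "norm (\<integral>x. f x *\<^sub>R b x \<partial>lborel) \<le> O1" if "f \<in> test_class 1" for f
    unfolding O1_def using that bdd by (rule cSUP_upper)
  have O0: "0 \<le> O1" using up[OF zero] by simp
  have up': "norm (\<integral>x. f x *\<^sub>R b x \<partial>lborel) \<le> \<omega> * O1" if f: "f \<in> test_class \<omega>" for f \<omega>
  proof (cases "\<omega> > 0")
    case True
    have "(\<lambda>x. f x * (1 / \<omega>)) \<in> test_class 1" using test_class_scale[OF f, of "1 / \<omega>"] True by simp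
    from up[OF this] have "norm (\<integral>x. (1 / \<omega>) *\<^sub>R (f x *\<^sub>R b x) \<partial>lborel) \<le> O1" by (simp add: mult.commute)
    then have "norm ((1 / \<omega>) *\<^sub>R (\<integral>x. f x *\<^sub>R b x \<partial>lborel)) \<le> O1"
      by (subst (asm) integral_scaleR_right) auto
    then show ?thesis using True by (simp add: field_simps)
  next
    case False
    obtain x where x: "x \<in> A" using A_pos by (metis equals0I less_irrefl measure_empty)
    have "0 \<le> \<omega>" using test_class_bound[OF f, of x] x by simp
    with False have "\<omega> = 0" by simp
    moreover from this have "f x = 0" for x using test_class_bound[OF f, of x] by simp
    ultimately show ?thesis by simp
  qed
  show ?thesis
  proof (cases "O1 = 0")
    case True
    show ?thesis
      by (rule that[of "\<lambda>_. 0" "\<lambda>_. 0"]) (use up True in \<open>auto simp: form_def\<close>)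
  next
    case False
    then have O: "0 < O1" using O0 by simp
    then have "(1 - k / 2) * O1 < O1" using k by (simp add: algebra_simps)
    \<comment> \<open>An almost extremal \<open>f\<close>. Its pairing exceeds
      \<open>(1 - k / 2) * O1\<close>, while that of \<open>walk f\<close> is at most
      \<open>(1 - k) * O1\<close>. So the two forms of \<open>walk_form\<close> add up to at least
      \<open>k / 2 * O1 * M\<close>, and one of them carries half of it.\<close>
    then obtain f where f: "f \<in> test_class 1" and big: "(1 - k / 2) * O1 < norm (\<integral>x. f x *\<^sub>R b x \<partial>lborel)"
      unfolding O1_def using less_cSUP_iff[OF _ bdd] zero by auto
    have [measurable]: "f \<in> borel_measurable borel" using f by (simp add: test_class_def)
    note fb = test_class_bound[OF f]
    have "norm (\<integral>x. walk f x *\<^sub>R b x \<partial>lborel) \<le> (1 - k) * O1"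
      using up'[OF walk_test_class[OF f]] by (simp add: k_def)
    then have "k / 2 * O1 \<le> norm (\<integral>x. f x *\<^sub>R b x \<partial>lborel) - norm (\<integral>x. walk f x *\<^sub>R b x \<partial>lborel)"
      using big by (simp add: algebra_simps)
    also have "\<dots> \<le> norm ((\<integral>x. f x *\<^sub>R b x \<partial>lborel) - (\<integral>x. walk f x *\<^sub>R b x \<partial>lborel))"
      by (rule norm_triangle_ineq2)
    also have "\<dots> = norm (form b f base - form b (indicator A) (relay f)) / M"
      using walk_form(1)[OF b _ fb] M_pos by simp
    also have "\<dots> \<le> (norm (form b f base) + norm (form b (indicator A) (relay f))) / M"
      using M_pos by (intro divide_right_mono norm_triangle_ineq4) simp
    finally have *: "k / 2 * O1 * M \<le> norm (form b f base) + norm (form b (indicator A) (relay f))"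
      using M_pos by (simp add: field_simps)
    have fin: "norm (\<integral>x. f' x *\<^sub>R b x \<partial>lborel) \<le> 4 * M / (c * vol) * N"
      if "k / 4 * O1 * M \<le> N" "f' \<in> test_class 1" for N f'
    proof -
      have "norm (\<integral>x. f' x *\<^sub>R b x \<partial>lborel) \<le> O1" using up that by simp
      \<comment> \<open>The constant \<open>4 * M / (c * vol)\<close> is
        \<open>4 / (k * M)\<close>.\<close>
      also have "O1 \<le> 4 * M / (c * vol) * N"
        using that(1) M_pos c_pos vol_pos by (simp add: k_def field_simps power2_eq_square)
      finally show ?thesis .
    qed
    show ?thesis
    proof (cases "k / 4 * O1 * M \<le> norm (form b f base)")
      case True
      show ?thesis by (rule that[of f base]) (use fb base_bounds fin True in auto)
    next
      case False
      then have "k / 4 * O1 * M \<le> norm (form b (indicator A) (relay f))" using * by simp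
      then show ?thesis
        by (intro that[of "indicator A" "relay f"]) (use fb relay_bound[of f 1] fin in auto)
    qed
  qed
qed

text \<open>Dualize with the sign \<open>s\<close> of \<open>b - a\<close>. Its mean
  \<open>m\<close> over \<open>Q\<close> can be subtracted because \<open>b - a\<close> has mean
  zero on \<open>Q\<close>. The values of \<open>s - m\<close> lie in [-2, 2], so a quarter of it,
  cut off to \<open>Q\<close>, belongs to \<open>test_class 1\<close>.\<close>

lemma oscillation_bound_real:
  fixes b :: "real \<times> real \<Rightarrow> real"
  assumes b: "integrable lborel b" and Q [measurable]: "Q \<in> sets borel" and QA: "Q \<subseteq> A"
    and Q0: "0 < measure lborel Q"
    and C: "\<And>f. f \<in> test_class 1 \<Longrightarrow> \<bar>\<integral>x. f x * b x \<partial>lborel\<bar> \<le> C"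
  shows "(\<integral>x. indicator Q x * \<bar>b x - (\<integral>y. indicator Q y * b y \<partial>lborel) / measure lborel Q\<bar> \<partial>lborel) \<le> 4 * C"
proof -
  have [measurable]: "b \<in> borel_measurable borel" using b by (simp add: borel_measurable_integrable)
  define a where "a = (\<integral>y. indicator Q y * b y \<partial>lborel) / measure lborel Q"
  define s where "s x = sgn (b x - a)" for x
  have [measurable]: "s \<in> borel_measurable borel" unfolding s_def by measurable
  have QF: "emeasure lborel Q < \<infinity>" by (rule le_less_trans[OF emeasure_mono[OF QA] A_fin]) simp
  have s1: "\<bar>s x\<bar> \<le> 1" for x by (auto simp: s_def sgn_if)
  define m where "m = (\<integral>y. indicator Q y * s y \<partial>lborel) / measure lborel Q"
  have isx: "integrable lborel (\<lambda>y. indicator Q y * s y)"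
    using QF s1 by (intro integrable_supported[where E = Q and K = 1]) (auto simp: indicator_def)
  have ib: "integrable lborel (\<lambda>y. indicator Q y * b y)"
    using integrable_bounded_scaleR[OF b, of "indicator Q" 1] by (simp add: indicator_def)
  have iQ: "integrable lborel (\<lambda>y. indicat_real Q y)" using QF by simp
  have isb: "integrable lborel (\<lambda>y. indicator Q y * s y * b y)"
    using integrable_bounded_scaleR[OF b, of "\<lambda>x. indicator Q x * s x" 1] s1 by (simp add: indicator_def)
  have "(\<integral>x. indicator Q x * \<bar>b x - a\<bar> \<partial>lborel)
      = (\<integral>x. indicator Q x * s x * b x - a * (indicator Q x * s x) \<partial>lborel)"
    by (intro Bochner_Integration.integral_cong) (auto simp: s_def sgn_if indicator_def)
  also have "\<dots> = (\<integral>x. indicator Q x * s x * b x \<partial>lborel) - a * (\<integral>x. indicator Q x * s x \<partial>lborel)"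
    using isb isx by simp
  also have "\<dots> = (\<integral>x. indicator Q x * s x * b x \<partial>lborel) - m * (\<integral>x. indicator Q x * b x \<partial>lborel)"
    by (simp add: a_def m_def)
  also have "\<dots> = (\<integral>x. indicator Q x * s x * b x - m * (indicator Q x * b x) \<partial>lborel)"
    using isb ib by simp
  also have "\<dots> = (\<integral>x. 4 * ((indicator Q x * (s x - m) / 4) * b x) \<partial>lborel)"
    by (intro Bochner_Integration.integral_cong) (auto simp: algebra_simps)
  also have "\<dots> = 4 * (\<integral>x. (indicator Q x * (s x - m) / 4) * b x \<partial>lborel)" by simp
  also have "\<dots> \<le> 4 * C"
  proof -
    have "\<bar>\<integral>y. indicator Q y * s y \<partial>lborel\<bar> \<le> (\<integral>y. \<bar>indicator Q y * s y\<bar> \<partial>lborel)"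
      using integral_norm_bound[of lborel "\<lambda>y. indicator Q y * s y"] by simp
    also have "\<dots> \<le> (\<integral>y. indicator Q y \<partial>lborel)"
      using isx iQ s1 by (intro integral_mono) (auto simp: indicator_def)
    finally have m1: "\<bar>m\<bar> \<le> 1" using Q0 by (simp add: m_def)
    have "(\<lambda>x. indicator Q x * (s x - m) / 4) \<in> test_class 1"
      unfolding test_class_def
    proof (intro CollectI conjI ballI allI impI)
      show "indicat_real Q x * (s x - m) / 4 = 0" if "x \<notin> A" for x using that QA by (auto simp: indicator_def)
      have "(\<integral>x. indicator Q x * (s x - m) / 4 \<partial>lborel) = (\<integral>x. (indicator Q x * s x - m * indicator Q x) / 4 \<partial>lborel)"
        by (simp add: algebra_simps)
      also have "\<dots> = ((\<integral>x. indicator Q x * s x \<partial>lborel) - m * measure lborel Q) / 4"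
        using isx iQ by simp
      also have "\<dots> = 0" using Q0 by (simp add: m_def)
      finally show "(\<integral>x. indicator Q x * (s x - m) / 4 \<partial>lborel) = 0" .
      show "indicat_real Q x * (s x - m) / 4 - indicat_real Q x' * (s x' - m) / 4 \<le> 1" for x x'
        using s1[of x] s1[of x'] m1 by (auto simp: indicator_def abs_le_iff field_simps)
    qed measurable
    from C[OF this] show ?thesis by simp
  qed
  finally show ?thesis by (simp add: a_def)
qed

text \<open>The test functions are real and the pair \<open>g\<close>, \<open>h\<close> of
  \<open>pairing_bound\<close> does not depend on them, so the same pair controls the real and the
  imaginary part of \<open>b\<close>. The constant is 32 = (4 + 4) * 4.\<close>

theorem oscillation_bound:
  fixes b :: "real \<times> real \<Rightarrow> complex"
  assumes b: "integrable lborel b" and Q [measurable]: "Q \<in> sets borel" and QA: "Q \<subseteq> A"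
    and Q0: "0 < measure lborel Q"
  obtains g h where "g \<in> borel_measurable borel" "h \<in> borel_measurable borel"
    "\<And>x. \<bar>g x\<bar> \<le> indicator A x" "\<And>x. \<bar>h x\<bar> \<le> indicator P x"
    "(\<integral>x. indicator Q x * cmod (b x - (\<integral>y. indicator Q y *\<^sub>R b y \<partial>lborel) / of_real (measure lborel Q)) \<partial>lborel)
      \<le> 32 * M / (c * vol) * cmod (form b g h)"
proof -
  have [measurable]: "b \<in> borel_measurable borel" using b by (simp add: borel_measurable_integrable)
  obtain g h where gh: "g \<in> borel_measurable borel" "h \<in> borel_measurable borel"
    "\<And>x. \<bar>g x\<bar> \<le> indicator A x" "\<And>x. \<bar>h x\<bar> \<le> indicator P x"
    and bd: "\<And>f. f \<in> test_class 1 \<Longrightarrow> cmod (\<integral>x. f x *\<^sub>R b x \<partial>lborel) \<le> 4 * M / (c * vol) * cmod (form b g h)"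
    by (rule pairing_bound[OF b], rule that, assumption+)
  let ?C = "4 * M / (c * vol) * cmod (form b g h)"
  define a where "a = (\<integral>y. indicator Q y *\<^sub>R b y \<partial>lborel) / of_real (measure lborel Q)"
  have QF: "emeasure lborel Q < \<infinity>" by (rule le_less_trans[OF emeasure_mono[OF QA] A_fin]) simp
  have ib: "integrable lborel (\<lambda>y. indicator Q y *\<^sub>R b y)"
    using integrable_bounded_scaleR[OF b, of "indicator Q" 1] by (simp add: indicator_def)
  have re: "Re a = (\<integral>y. indicator Q y * Re (b y) \<partial>lborel) / measure lborel Q"
    unfolding a_def Re_divide_of_real using integral_Re[OF ib] by simp
  have im: "Im a = (\<integral>y. indicator Q y * Im (b y) \<partial>lborel) / measure lborel Q"
    unfolding a_def Im_divide_of_real using integral_Im[OF ib] by simp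
  have ci: "integrable lborel (\<lambda>x. f x *\<^sub>R b x)" if "f \<in> test_class 1" for f
  proof (rule integrable_bounded_scaleR[OF b])
    show "\<bar>f x\<bar> \<le> 1" for x using test_class_bound[OF that, of x] by (cases "x \<in> A"; simp)
  qed (use that in \<open>simp add: test_class_def\<close>)
  have cre: "\<bar>\<integral>x. f x * Re (b x) \<partial>lborel\<bar> \<le> ?C" if "f \<in> test_class 1" for f
  proof -
    have "(\<integral>x. f x * Re (b x) \<partial>lborel) = Re (\<integral>x. f x *\<^sub>R b x \<partial>lborel)"
      using integral_Re[OF ci[OF that]] by simp
    then show ?thesis using order_trans[OF abs_Re_le_cmod bd[OF that]] by simp
  qed
  have cim: "\<bar>\<integral>x. f x * Im (b x) \<partial>lborel\<bar> \<le> ?C" if "f \<in> test_class 1" for f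
  proof -
    have "(\<integral>x. f x * Im (b x) \<partial>lborel) = Im (\<integral>x. f x *\<^sub>R b x \<partial>lborel)"
      using integral_Im[OF ci[OF that]] by simp
    then show ?thesis using order_trans[OF abs_Im_le_cmod bd[OF that]] by simp
  qed
  have iQa: "integrable lborel (\<lambda>x. indicator Q x *\<^sub>R (b x - a))"
  proof -
    have "integrable lborel (\<lambda>x. indicator Q x *\<^sub>R b x - indicator Q x *\<^sub>R a)"
      by (intro Bochner_Integration.integrable_diff ib integrable_scaleR_left) (use QF in simp)
    then show ?thesis by (simp add: scaleR_right_diff_distrib)
  qed
  have "(\<integral>x. indicator Q x * cmod (b x - a) \<partial>lborel)
      \<le> (\<integral>x. indicator Q x * \<bar>Re (b x) - Re a\<bar> + indicator Q x * \<bar>Im (b x) - Im a\<bar> \<partial>lborel)"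
  proof (rule integral_mono)
    show "integrable lborel (\<lambda>x. indicator Q x * cmod (b x - a))"
      using integrable_norm[OF iQa] by simp
    have "integrable lborel (\<lambda>x. \<bar>Re (indicator Q x *\<^sub>R (b x - a))\<bar> + \<bar>Im (indicator Q x *\<^sub>R (b x - a))\<bar>)"
      by (rule Bochner_Integration.integrable_add[OF integrable_abs[OF integrable_Re[OF iQa]]
            integrable_abs[OF integrable_Im[OF iQa]]])
    then show "integrable lborel (\<lambda>x. indicator Q x * \<bar>Re (b x) - Re a\<bar> + indicator Q x * \<bar>Im (b x) - Im a\<bar>)"
      by (simp add: abs_mult)
    show "indicator Q x * cmod (b x - a) \<le> indicator Q x * \<bar>Re (b x) - Re a\<bar> + indicator Q x * \<bar>Im (b x) - Im a\<bar>" for x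
      using cmod_le[of "b x - a"] by (cases "x \<in> Q") simp_all
  qed
  also have "\<dots> = (\<integral>x. indicator Q x * \<bar>Re (b x) - Re a\<bar> \<partial>lborel) + (\<integral>x. indicator Q x * \<bar>Im (b x) - Im a\<bar> \<partial>lborel)"
  proof (rule Bochner_Integration.integral_add)
    show "integrable lborel (\<lambda>x. indicator Q x * \<bar>Re (b x) - Re a\<bar>)"
      using integrable_abs[OF integrable_Re[OF iQa]] by (simp add: abs_mult)
    show "integrable lborel (\<lambda>x. indicator Q x * \<bar>Im (b x) - Im a\<bar>)"
      using integrable_abs[OF integrable_Im[OF iQa]] by (simp add: abs_mult)
  qed
  also have "\<dots> \<le> 4 * ?C + 4 * ?C"
    unfolding re im
    by (rule add_mono[OF oscillation_bound_real[OF integrable_Re[OF b] Q QA Q0 cre]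
          oscillation_bound_real[OF integrable_Im[OF b] Q QA Q0 cim]])
  finally have "(\<integral>x. indicator Q x * cmod (b x - a) \<partial>lborel) \<le> 32 * M / (c * vol) * cmod (form b g h)"
    by simp
  from that[OF gh this[unfolded a_def]] show ?thesis .
qed

end

section \<open>Maximal functions and sparse families of cubes\<close>

lemma nn_integral_geometric_mean:
  fixes F G :: "'a \<Rightarrow> real"
  assumes [measurable]: "F \<in> borel_measurable M" "G \<in> borel_measurable M"
    and F0: "AE x in M. 0 \<le> F x" and G0: "AE x in M. 0 \<le> G x"
    and ab: "0 < \<alpha>" "0 < \<beta>" "\<alpha> + \<beta> = 1"
    and FA: "(\<integral>\<^sup>+x. ennreal (F x) \<partial>M) \<le> ennreal A" and GB: "(\<integral>\<^sup>+x. ennreal (G x) \<partial>M) \<le> ennreal B"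
    and AB: "0 \<le> A" "0 \<le> B"
  shows "(\<integral>\<^sup>+x. ennreal (F x powr \<alpha> * G x powr \<beta>) \<partial>M) \<le> ennreal (A powr \<alpha> * B powr \<beta>)"
proof (cases "A = 0 \<or> B = 0")
  case True
  then have "(\<integral>\<^sup>+x. ennreal (F x) \<partial>M) = 0 \<or> (\<integral>\<^sup>+x. ennreal (G x) \<partial>M) = 0" using FA GB by auto
  then have "(AE x in M. F x \<le> 0) \<or> (AE x in M. G x \<le> 0)"
    by (auto simp: nn_integral_0_iff_AE ennreal_eq_0_iff)
  then have "AE x in M. F x powr \<alpha> * G x powr \<beta> = 0"
    using F0 G0 by (auto elim: AE_mp)
  then have "(\<integral>\<^sup>+x. ennreal (F x powr \<alpha> * G x powr \<beta>) \<partial>M) = (\<integral>\<^sup>+x. 0 \<partial>M)"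
    by (intro nn_integral_cong_AE) auto
  then show ?thesis by simp
next
  case False
  then have A: "0 < A" and B: "0 < B" using AB by auto
  let ?k = "A powr \<alpha> * B powr \<beta>"
  have "(\<integral>\<^sup>+x. ennreal (F x powr \<alpha> * G x powr \<beta>) \<partial>M)
      \<le> (\<integral>\<^sup>+x. ennreal (?k * \<alpha> / A) * ennreal (F x) + ennreal (?k * \<beta> / B) * ennreal (G x) \<partial>M)"
    using F0 G0
  proof (intro nn_integral_mono_AE, eventually_elim)
    fix x assume x: "0 \<le> F x" "0 \<le> G x"
    \<comment> \<open>Young's inequality for \<open>F x / A\<close> and \<open>G x / B\<close>,
      multiplied by \<open>?k\<close>. After integration each of the two quotients contributes at
      most 1.\<close>
    have "F x powr \<alpha> * G x powr \<beta> \<le> ?k * (\<alpha> * (F x / A) + \<beta> * (G x / B))"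
    proof (cases "F x = 0 \<or> G x = 0")
      case True
      then show ?thesis using x A B ab by auto
    next
      case False
      then have "(F x / A) powr \<alpha> * (G x / B) powr \<beta> \<le> \<alpha> * (F x / A) + \<beta> * (G x / B)"
        using x A B ab by (intro Youngs_inequality_0) auto
      then have "?k * ((F x / A) powr \<alpha> * (G x / B) powr \<beta>) \<le> ?k * (\<alpha> * (F x / A) + \<beta> * (G x / B))"
        using A B by (intro mult_left_mono) auto
      then show ?thesis using x A B by (simp add: powr_divide)
    qed
    then show "ennreal (F x powr \<alpha> * G x powr \<beta>) \<le> ennreal (?k * \<alpha> / A) * ennreal (F x) + ennreal (?k * \<beta> / B) * ennreal (G x)"
      using x A B ab by (simp add: ennreal_mult'[symmetric] ennreal_plus[symmetric] algebra_simps del: ennreal_plus)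
  qed
  also have "\<dots> = ennreal (?k * \<alpha> / A) * (\<integral>\<^sup>+x. ennreal (F x) \<partial>M) + ennreal (?k * \<beta> / B) * (\<integral>\<^sup>+x. ennreal (G x) \<partial>M)"
    by (simp add: nn_integral_add nn_integral_cmult)
  also have "\<dots> \<le> ennreal (?k * \<alpha> / A) * ennreal A + ennreal (?k * \<beta> / B) * ennreal B"
    using FA GB by (intro add_mono mult_left_mono) auto
  also have "\<dots> = ennreal (?k * \<alpha> + ?k * \<beta>)"
    using A B ab(1,2) by (simp add: ennreal_mult'[symmetric] ennreal_plus[symmetric] del: ennreal_plus)
  also have "?k * \<alpha> + ?k * \<beta> = ?k * (\<alpha> + \<beta>)" by (simp only: distrib_left)
  finally show ?thesis using ab by simp
qed

lemma nn_integral_Hoelder: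
  fixes f g :: "'a \<Rightarrow> real"
  assumes [measurable]: "f \<in> borel_measurable M" "g \<in> borel_measurable M"
    and f0: "\<And>x. 0 \<le> f x" and g0: "\<And>x. 0 \<le> g x"
    and pq: "0 < p" "0 < q" "1 / p + 1 / q = 1"
    and FA: "(\<integral>\<^sup>+x. ennreal (f x powr p) \<partial>M) \<le> ennreal A" and GB: "(\<integral>\<^sup>+x. ennreal (g x powr q) \<partial>M) \<le> ennreal B"
    and AB: "0 \<le> A" "0 \<le> B"
  shows "(\<integral>\<^sup>+x. ennreal (f x * g x) \<partial>M) \<le> ennreal (A powr (1 / p) * B powr (1 / q))"
  using nn_integral_geometric_mean[of "\<lambda>x. f x powr p" M "\<lambda>x. g x powr q" "1 / p" "1 / q" A B] assms
  by (simp add: powr_powr)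

text \<open>Closes every estimate of a quantity by a power of itself. That \<open>X\<close> is a
  real number encodes the finiteness which has to be known beforehand.\<close>

lemma powr_absorb:
  fixes X W \<alpha> :: real
  assumes "0 \<le> X" "0 \<le> W" "0 < \<alpha>" "X \<le> W * X powr (1 - \<alpha>)"
  shows "X \<le> W powr (1 / \<alpha>)"
proof (cases "X = 0")
  case False
  then have X: "0 < X" using assms by simp
  have "X powr \<alpha> * X powr (1 - \<alpha>) = X" using X by (simp add: powr_add[symmetric])
  then have "X powr \<alpha> * X powr (1 - \<alpha>) \<le> W * X powr (1 - \<alpha>)" using assms by simp
  then have "X powr \<alpha> \<le> W" using X by simp
  then have "(X powr \<alpha>) powr (1 / \<alpha>) \<le> W powr (1 / \<alpha>)" using assms by (intro powr_mono2) auto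
  then show ?thesis using X assms by (simp add: powr_powr)
qed simp

lemma nn_integral_powr_layer:
  assumes "0 < s" "0 \<le> y"
  shows "(\<integral>\<^sup>+t. ennreal (s * t powr (s - 1)) * indicator {0<..y} t \<partial>lborel) = ennreal (y powr s)"
proof -
  have "((\<lambda>t. t powr (s - 1)) has_integral (y powr s / s)) {0..y}"
    using has_integral_powr_from_0[of "s - 1" y] assms by simp
  then have "((\<lambda>t. s * t powr (s - 1)) has_integral (s * (y powr s / s))) {0..y}"
    by (rule has_integral_mult_right)
  from nn_integral_has_integral_lebesgue[OF _ this]
  have "(\<integral>\<^sup>+t. ennreal (indicator {0..y} t * (s * t powr (s - 1))) \<partial>lborel) = ennreal (y powr s)"
    using assms by simp
  moreover have "(\<integral>\<^sup>+t. ennreal (indicator {0..y} t * (s * t powr (s - 1))) \<partial>lborel)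
      = (\<integral>\<^sup>+t. ennreal (s * t powr (s - 1)) * indicator {0<..y} t \<partial>lborel)"
    by (intro nn_integral_cong) (auto simp: indicator_def)
  ultimately show ?thesis by simp
qed

text \<open>The weight \<open>g\<close> stays inside the level sets, so the identity serves both
  sides of Doob's inequality: with \<open>g = 1\<close> and exponent \<open>s\<close> on one side,
  with exponent \<open>s - 1\<close> on the other.\<close>

lemma (in sigma_finite_measure) nn_integral_layer_cake:
  fixes f :: "'a \<Rightarrow> real" and g :: "'a \<Rightarrow> ennreal"
  assumes [measurable]: "f \<in> borel_measurable M" "g \<in> borel_measurable M" and f0: "\<And>x. 0 \<le> f x" and s: "0 < s"
  shows "(\<integral>\<^sup>+x. g x * ennreal (f x powr s) \<partial>M)
    = (\<integral>\<^sup>+t. ennreal (s * t powr (s - 1)) * indicator {0<..} t * (\<integral>\<^sup>+x. g x * indicator {x\<in>space M. t \<le> f x} x \<partial>M) \<partial>lborel)"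
proof -
  interpret P: pair_sigma_finite M lborel ..
  have "(\<integral>\<^sup>+x. g x * ennreal (f x powr s) \<partial>M)
      = (\<integral>\<^sup>+x. \<integral>\<^sup>+t. g x * (ennreal (s * t powr (s - 1)) * indicator {0<..f x} t) \<partial>lborel \<partial>M)"
    using f0 s by (simp add: nn_integral_cmult nn_integral_powr_layer)
  also have "\<dots> = (\<integral>\<^sup>+x. \<integral>\<^sup>+t. (ennreal (s * t powr (s - 1)) * indicator {0<..} t) * (g x * indicator {x\<in>space M. t \<le> f x} x) \<partial>lborel \<partial>M)"
    by (intro nn_integral_cong) (auto simp: indicator_def mult.commute)
  also have "\<dots> = (\<integral>\<^sup>+t. \<integral>\<^sup>+x. (ennreal (s * t powr (s - 1)) * indicator {0<..} t) * (g x * indicator {x\<in>space M. t \<le> f x} x) \<partial>M \<partial>lborel)"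
    by (rule P.Fubini'[symmetric]) measurable
  also have "\<dots> = (\<integral>\<^sup>+t. ennreal (s * t powr (s - 1)) * indicator {0<..} t * (\<integral>\<^sup>+x. g x * indicator {x\<in>space M. t \<le> f x} x \<partial>M) \<partial>lborel)"
    by (intro nn_integral_cong nn_integral_cmult) measurable
  finally show ?thesis .
qed

text \<open>Doob's argument: the level set on the right is the same as on the left.\<close>

lemma (in sigma_finite_measure) nn_integral_doob:
  fixes f :: "'a \<Rightarrow> real" and g :: "'a \<Rightarrow> ennreal"
  assumes [measurable]: "f \<in> borel_measurable M" "g \<in> borel_measurable M" and f0: "\<And>x. 0 \<le> f x" and s: "1 < s"
    and D: "0 \<le> D"
    and weak: "\<And>t. 0 < t \<Longrightarrow> ennreal t * emeasure M {x\<in>space M. t \<le> f x} \<le> ennreal D * (\<integral>\<^sup>+x. g x * indicator {x\<in>space M. t \<le> f x} x \<partial>M)"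
  shows "(\<integral>\<^sup>+x. ennreal (f x powr s) \<partial>M) \<le> ennreal (D * s / (s - 1)) * (\<integral>\<^sup>+x. g x * ennreal (f x powr (s - 1)) \<partial>M)"
proof -
  interpret P: pair_sigma_finite M lborel ..
  let ?L = "\<lambda>t. \<integral>\<^sup>+x. g x * indicator {x\<in>space M. t \<le> f x} x \<partial>M"
  have "(\<integral>\<^sup>+x. ennreal (f x powr s) \<partial>M)
      = (\<integral>\<^sup>+t. ennreal (s * t powr (s - 1)) * indicator {0<..} t * emeasure M {x\<in>space M. t \<le> f x} \<partial>lborel)"
    using nn_integral_layer_cake[of f "\<lambda>_. 1" s] f0 s by simp
  also have "\<dots> \<le> (\<integral>\<^sup>+t. ennreal (D * s / (s - 1)) * (ennreal ((s - 1) * t powr (s - 1 - 1)) * indicator {0<..} t * ?L t) \<partial>lborel)"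
  proof (rule nn_integral_mono)
    fix t :: real
    show "ennreal (s * t powr (s - 1)) * indicator {0<..} t * emeasure M {x\<in>space M. t \<le> f x}
        \<le> ennreal (D * s / (s - 1)) * (ennreal ((s - 1) * t powr (s - 1 - 1)) * indicator {0<..} t * ?L t)"
    proof (cases "0 < t")
      case True
      \<comment> \<open>One factor \<open>t\<close> is spent on the weak type bound; what remains is
        the layer cake density for the exponent \<open>s - 1\<close>, which accounts for
        \<open>s / (s - 1)\<close>.\<close>
      have "s * t powr (s - 1) = (s * t powr (s - 1 - 1)) * t"
        using True powr_add[of t "s - 1 - 1" 1] by simp
      then have "ennreal (s * t powr (s - 1)) * emeasure M {x\<in>space M. t \<le> f x}
          = ennreal (s * t powr (s - 1 - 1)) * (ennreal t * emeasure M {x\<in>space M. t \<le> f x})"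
        using True s by (simp add: ennreal_mult mult.assoc)
      also have "\<dots> \<le> ennreal (s * t powr (s - 1 - 1)) * (ennreal D * ?L t)"
        by (intro mult_left_mono weak True) simp
      also have "\<dots> = (ennreal (D * s / (s - 1)) * ennreal ((s - 1) * t powr (s - 1 - 1))) * ?L t"
        using s D by (simp add: ennreal_mult'[symmetric] mult.assoc[symmetric]) (simp add: ac_simps)
      finally show ?thesis using True by (simp add: mult.assoc)
    qed simp
  qed
  also have "\<dots> = ennreal (D * s / (s - 1)) * (\<integral>\<^sup>+t. ennreal ((s - 1) * t powr (s - 1 - 1)) * indicator {0<..} t * ?L t \<partial>lborel)"
    by (intro nn_integral_cmult) measurable
  also have "\<dots> = ennreal (D * s / (s - 1)) * (\<integral>\<^sup>+x. g x * ennreal (f x powr (s - 1)) \<partial>M)"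
    using nn_integral_layer_cake[of f g "s - 1"] f0 s by simp
  finally show ?thesis .
qed

section \<open>Cubes given by centre and size, and the Vitali covering lemma\<close>

definition cube :: "real \<times> real \<Rightarrow> real \<times> real \<Rightarrow> real \<Rightarrow> (real \<times> real) set" where
  "cube \<beta> c s = {fst c - s powr fst \<beta> / 2 .. fst c + s powr fst \<beta> / 2}
     \<times> {snd c - s powr snd \<beta> / 2 .. snd c + s powr snd \<beta> / 2}"

lemma mem_cube: "x \<in> cube \<beta> c s \<longleftrightarrow> \<bar>fst x - fst c\<bar> \<le> s powr fst \<beta> / 2 \<and> \<bar>snd x - snd c\<bar> \<le> s powr snd \<beta> / 2"
  by (cases x) (simp only: cube_def mem_Times_iff atLeastAtMost_iff fst_conv snd_conv; linarith)

lemma cube_borel [measurable]: "cube \<beta> c s \<in> sets borel"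
  by (simp add: cube_def borel_Times)

lemma cube_lebesgue [measurable]: "cube \<beta> c s \<in> sets lebesgue"
  by (rule sets_completionI_sets) simp

lemma cube_subset_dilate:
  assumes "0 \<le> fst \<beta>" "0 \<le> snd \<beta>" "0 < s" "1 \<le> K"
  shows "cube \<beta> c s \<subseteq> cube \<beta> c (K * s)"
proof -
  have "s powr b \<le> (K * s) powr b" if "0 \<le> b" for b
    using assms that by (intro powr_mono2) auto
  from this[of "fst \<beta>"] this[of "snd \<beta>"] show ?thesis using assms by (auto simp: mem_cube)
qed

text \<open>The least dilation that at least triples both sides: exactly for the smaller exponent,
  hence also for the larger one.\<close>

definition vitali_dilation :: "real \<times> real \<Rightarrow> real" where
  "vitali_dilation \<beta> = 3 powr (1 / fst \<beta>)"

lemma vitali_dilation: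
  assumes "0 < fst \<beta>" "fst \<beta> \<le> snd \<beta>"
  shows "1 \<le> vitali_dilation \<beta>" "3 \<le> vitali_dilation \<beta> powr fst \<beta>" "3 \<le> vitali_dilation \<beta> powr snd \<beta>"
proof -
  show 1: "1 \<le> vitali_dilation \<beta>" using assms by (simp add: vitali_dilation_def ge_one_powr_ge_zero)
  show 2: "3 \<le> vitali_dilation \<beta> powr fst \<beta>" using assms by (simp add: vitali_dilation_def powr_powr)
  have "vitali_dilation \<beta> powr fst \<beta> \<le> vitali_dilation \<beta> powr snd \<beta>" using 1 assms by (intro powr_mono) auto
  with 2 show "3 \<le> vitali_dilation \<beta> powr snd \<beta>" by simp
qed

lemma cube_meets_subset:
  assumes b: "0 < fst \<beta>" "fst \<beta> \<le> snd \<beta>" and s: "0 < s'" "s' \<le> s" and meet: "cube \<beta> c' s' \<inter> cube \<beta> c s \<noteq> {}"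
  shows "cube \<beta> c' s' \<subseteq> cube \<beta> c (vitali_dilation \<beta> * s)"
proof
  fix x assume x: "x \<in> cube \<beta> c' s'"
  obtain y where y: "y \<in> cube \<beta> c' s'" "y \<in> cube \<beta> c s" using meet by auto
  have le: "s' powr fst \<beta> \<le> s powr fst \<beta>" "s' powr snd \<beta> \<le> s powr snd \<beta>" using s b by (auto intro!: powr_mono2)
  have "3 * s powr e \<le> vitali_dilation \<beta> powr e * s powr e" if "3 \<le> vitali_dilation \<beta> powr e" for e
    using that by (intro mult_right_mono) auto
  then have "3 * s powr fst \<beta> \<le> (vitali_dilation \<beta> * s) powr fst \<beta>" "3 * s powr snd \<beta> \<le> (vitali_dilation \<beta> * s) powr snd \<beta>"
    using vitali_dilation[OF b] s by (simp_all add: powr_mult)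
  then show "x \<in> cube \<beta> c (vitali_dilation \<beta> * s)"
    using x y le unfolding mem_cube by (elim conjE, intro conjI; linarith)
qed

text \<open>Greedy choice: a largest cube is kept, all cubes meeting it lie in its dilate, and the
  induction continues with those disjoint from it.\<close>

lemma finite_vitali:
  fixes c :: "'i \<Rightarrow> real \<times> real" and s :: "'i \<Rightarrow> real"
  assumes b: "0 < fst \<beta>" "fst \<beta> \<le> snd \<beta>" and I: "finite I" "\<And>i. i \<in> I \<Longrightarrow> 0 < s i"
  shows "\<exists>J\<subseteq>I. disjoint_family_on (\<lambda>i. cube \<beta> (c i) (s i)) J
    \<and> (\<Union>i\<in>I. cube \<beta> (c i) (s i)) \<subseteq> (\<Union>i\<in>J. cube \<beta> (c i) (vitali_dilation \<beta> * s i))"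
  using I
proof (induction "card I" arbitrary: I rule: less_induct)
  case less
  show ?case
  proof (cases "I = {}")
    case False
    obtain k where k: "k \<in> I" "\<And>i. i \<in> I \<Longrightarrow> s i \<le> s k"
    proof -
      have "Max (s ` I) \<in> s ` I" using False less.prems by simp
      then obtain k where "k \<in> I" "Max (s ` I) = s k" by auto
      then show ?thesis using that[of k] less.prems by (metis Max_ge finite_imageI imageI)
    qed
    let ?Q = "\<lambda>i. cube \<beta> (c i) (s i)"
    define I' where "I' = {i \<in> I. ?Q i \<inter> ?Q k = {}}"
    have ne: "?Q k \<noteq> {}" using less.prems(2)[OF k(1)] by (auto simp: cube_def)
    have "I' \<subset> I" using k(1) ne by (auto simp: I'_def)
    then have "card I' < card I" using less.prems by (simp add: psubset_card_mono)
    from less.hyps[OF this] \<open>I' \<subset> I\<close> obtain J where J: "J \<subseteq> I'" "disjoint_family_on ?Q J"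
      "(\<Union>i\<in>I'. ?Q i) \<subseteq> (\<Union>i\<in>J. cube \<beta> (c i) (vitali_dilation \<beta> * s i))"
      using less.prems finite_subset by (metis (no_types, lifting) psubset_imp_subset subsetD)
    have "disjoint_family_on ?Q (insert k J)"
      using J(1,2) unfolding disjoint_family_on_def I'_def by blast
    moreover have "(\<Union>i\<in>I. ?Q i) \<subseteq> (\<Union>i\<in>insert k J. cube \<beta> (c i) (vitali_dilation \<beta> * s i))"
    proof (rule UN_least)
      fix i assume i: "i \<in> I"
      show "?Q i \<subseteq> (\<Union>i\<in>insert k J. cube \<beta> (c i) (vitali_dilation \<beta> * s i))"
      proof (cases "i \<in> I'")
        case True
        then show ?thesis using J(3) by blast
      next
        case False
        then have "?Q i \<subseteq> cube \<beta> (c k) (vitali_dilation \<beta> * s k)"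
          using i k less.prems by (intro cube_meets_subset[OF b]) (auto simp: I'_def)
        then show ?thesis by blast
      qed
    qed
    moreover have "insert k J \<subseteq> I" using k J \<open>I' \<subset> I\<close> by auto
    ultimately show ?thesis by blast
  qed (auto simp: disjoint_family_on_def)
qed

section \<open>Maximal functions of finitely many cubes with coefficients\<close>

definition cmax :: "'i set \<Rightarrow> ('i \<Rightarrow> 'p set) \<Rightarrow> ('i \<Rightarrow> real) \<Rightarrow> 'p \<Rightarrow> real" where
  "cmax I Q a x = Max (insert 0 (a ` {i\<in>I. x \<in> Q i}))"

lemma cmax_nonneg: "finite I \<Longrightarrow> 0 \<le> cmax I Q a x"
  by (simp add: cmax_def)

text \<open>Superlevel sets of positive height are unions of cubes, so weak type bounds become
  covering statements. At height 0 this fails because of the inserted value 0.\<close>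

lemma cmax_ge_iff:
  assumes "finite I" "0 < t"
  shows "t \<le> cmax I Q a x \<longleftrightarrow> x \<in> (\<Union>i\<in>{i\<in>I. t \<le> a i}. Q i)"
  using assms unfolding cmax_def by (subst Max_ge_iff) auto

lemma cmax_ge: "finite I \<Longrightarrow> i \<in> I \<Longrightarrow> x \<in> Q i \<Longrightarrow> a i \<le> cmax I Q a x"
  unfolding cmax_def by (intro Max_ge) auto

lemma measurable_cmax:
  assumes I: "finite I" and Q: "\<And>i. i \<in> I \<Longrightarrow> Q i \<in> sets M"
  shows "cmax I Q a \<in> borel_measurable M"
proof (rule borel_measurableI_ge)
  fix t :: real
  show "{x \<in> space M. t \<le> cmax I Q a x} \<in> sets M"
  proof (cases "0 < t")
    case True
    have "{x \<in> space M. t \<le> cmax I Q a x} = space M \<inter> (\<Union>i\<in>{i\<in>I. t \<le> a i}. Q i)"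
      using cmax_ge_iff[OF I True, of Q a] by blast
    also have "\<dots> \<in> sets M" using I Q by (intro sets.Int sets.top sets.finite_UN) auto
    finally show ?thesis .
  next
    case False
    then have "{x \<in> space M. t \<le> cmax I Q a x} = space M"
      using cmax_nonneg[OF I, of Q a] by (auto intro: order_trans[of t 0])
    then show ?thesis by simp
  qed
qed

lemma cmax_le_sum:
  assumes "finite I" "\<And>i. i \<in> I \<Longrightarrow> 0 \<le> a i"
  shows "cmax I Q a x powr r \<le> (\<Sum>i\<in>I. a i powr r * indicator (Q i) x)"
proof -
  have "cmax I Q a x \<in> insert 0 (a ` {i\<in>I. x \<in> Q i})"
    unfolding cmax_def using assms by (intro Max_in) auto
  then consider "cmax I Q a x = 0" | i where "i \<in> I" "x \<in> Q i" "cmax I Q a x = a i" by auto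
  then show ?thesis
  proof cases
    case 1
    then show ?thesis by (auto intro!: sum_nonneg)
  next
    case 2
    have "a i powr r * indicator (Q i) x \<le> (\<Sum>i\<in>I. a i powr r * indicator (Q i) x)"
      using 2 assms by (intro member_le_sum) auto
    then show ?thesis using 2 by simp
  qed
qed

section \<open>Maximal and Carleson inequalities for doubling measures\<close>

locale cube_measure = sigma_finite_measure m
  for m :: "(real \<times> real) measure" and \<beta> :: "real \<times> real" +
  assumes beta: "0 < fst \<beta>" "fst \<beta> \<le> snd \<beta>"
    and sets_m [measurable_cong, simp]: "sets m = sets lebesgue"
    and cube_finite: "\<And>c s. emeasure m (cube \<beta> c s) < \<infinity>"
    and cube_pos: "\<And>c s. 0 < s \<Longrightarrow> 0 < measure m (cube \<beta> c s)"
    and doubling: "\<And>K. 1 \<le> K \<Longrightarrow> \<exists>D. \<forall>c s. 0 < s \<longrightarrow> measure m (cube \<beta> c (K * s)) \<le> D * measure m (cube \<beta> c s)"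
begin

definition dbl :: real where
  "dbl = (SOME D. 0 < D \<and> (\<forall>c s. 0 < s \<longrightarrow> measure m (cube \<beta> c (vitali_dilation \<beta> * s)) \<le> D * measure m (cube \<beta> c s)))"

lemma dbl: "0 < dbl" "0 < s \<Longrightarrow> measure m (cube \<beta> c (vitali_dilation \<beta> * s)) \<le> dbl * measure m (cube \<beta> c s)"
proof -
  obtain D where D: "\<forall>c s. 0 < s \<longrightarrow> measure m (cube \<beta> c (vitali_dilation \<beta> * s)) \<le> D * measure m (cube \<beta> c s)"
    using doubling[OF vitali_dilation(1)[OF beta]] by blast
  have "measure m (cube \<beta> c (vitali_dilation \<beta> * s)) \<le> max D 1 * measure m (cube \<beta> c s)" if "0 < s" for c s
    using D that by (intro order_trans[OF D[rule_format, OF that]] mult_right_mono) auto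
  then have "\<exists>D>0. \<forall>c s. 0 < s \<longrightarrow> measure m (cube \<beta> c (vitali_dilation \<beta> * s)) \<le> D * measure m (cube \<beta> c s)"
    by (intro exI[of _ "max D 1"]) auto
  from someI_ex[OF this]
  show "0 < dbl" "0 < s \<Longrightarrow> measure m (cube \<beta> c (vitali_dilation \<beta> * s)) \<le> dbl * measure m (cube \<beta> c s)"
    unfolding dbl_def by auto
qed

lemma space_m: "space m = UNIV"
  using sets_eq_imp_space_eq[OF sets_m] by simp

lemma emeasure_cube: "emeasure m (cube \<beta> c s) = ennreal (measure m (cube \<beta> c s))"
  using cube_finite[of c s] by (intro emeasure_eq_ennreal_measure) (simp add: less_top)

text \<open>Only the measure of the union is enlarged by passing to dilates. The integral stays on
  the given cubes, because the selected ones are disjoint members of the family; so both sides refer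
  to the same set, as Doob's inequality requires.\<close>

lemma weak_type:
  fixes c :: "'i \<Rightarrow> real \<times> real" and s :: "'i \<Rightarrow> real"
  assumes I: "finite I" "\<And>i. i \<in> I \<Longrightarrow> 0 < s i" and [measurable]: "\<phi> \<in> borel_measurable m"
    and t: "\<And>i. i \<in> I \<Longrightarrow> t * emeasure m (cube \<beta> (c i) (s i)) \<le> (\<integral>\<^sup>+x\<in>cube \<beta> (c i) (s i). \<phi> x \<partial>m)"
  shows "t * emeasure m (\<Union>i\<in>I. cube \<beta> (c i) (s i)) \<le> ennreal dbl * (\<integral>\<^sup>+x\<in>(\<Union>i\<in>I. cube \<beta> (c i) (s i)). \<phi> x \<partial>m)"
proof -
  let ?Q = "\<lambda>i. cube \<beta> (c i) (s i)"
  obtain J where J: "J \<subseteq> I" "disjoint_family_on ?Q J"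
    "(\<Union>i\<in>I. ?Q i) \<subseteq> (\<Union>i\<in>J. cube \<beta> (c i) (vitali_dilation \<beta> * s i))"
    using finite_vitali[where \<beta> = \<beta> and I = I and s = s and c = c, OF beta I] by auto
  have fJ: "finite J" using J(1) I(1) by (rule finite_subset)
  have "emeasure m (\<Union>i\<in>I. ?Q i) \<le> emeasure m (\<Union>i\<in>J. cube \<beta> (c i) (vitali_dilation \<beta> * s i))"
    using J fJ by (intro emeasure_mono) auto
  also have "\<dots> \<le> (\<Sum>i\<in>J. emeasure m (cube \<beta> (c i) (vitali_dilation \<beta> * s i)))"
    using fJ by (intro emeasure_subadditive_finite) auto
  also have "\<dots> \<le> (\<Sum>i\<in>J. ennreal dbl * emeasure m (?Q i))"
  proof (rule sum_mono)
    fix i assume "i \<in> J"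
    then have "0 < s i" using J(1) I(2) by blast
    from dbl(2)[OF this, of "c i"] dbl(1)
    show "emeasure m (cube \<beta> (c i) (vitali_dilation \<beta> * s i)) \<le> ennreal dbl * emeasure m (?Q i)"
      by (simp add: emeasure_cube ennreal_mult[symmetric])
  qed
  also have "\<dots> = ennreal dbl * (\<Sum>i\<in>J. emeasure m (?Q i))" by (simp add: sum_distrib_left)
  finally have "t * emeasure m (\<Union>i\<in>I. ?Q i) \<le> t * (ennreal dbl * (\<Sum>i\<in>J. emeasure m (?Q i)))"
    by (rule mult_left_mono) simp
  also have "\<dots> = ennreal dbl * (\<Sum>i\<in>J. t * emeasure m (?Q i))"
    by (simp add: sum_distrib_left mult_ac)
  also have "\<dots> \<le> ennreal dbl * (\<Sum>i\<in>J. \<integral>\<^sup>+x\<in>?Q i. \<phi> x \<partial>m)"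
    using J t by (intro mult_left_mono sum_mono) auto
  also have "(\<Sum>i\<in>J. \<integral>\<^sup>+x\<in>?Q i. \<phi> x \<partial>m) = (\<integral>\<^sup>+x. (\<Sum>i\<in>J. \<phi> x * indicator (?Q i) x) \<partial>m)"
    by (intro nn_integral_sum[symmetric]) auto
  also have "\<dots> = (\<integral>\<^sup>+x\<in>(\<Union>i\<in>J. ?Q i). \<phi> x \<partial>m)"
    using J fJ by (intro nn_integral_cong) (simp add: sum_distrib_left[symmetric] indicator_UN_disjoint)
  also have "\<dots> \<le> (\<integral>\<^sup>+x\<in>(\<Union>i\<in>I. ?Q i). \<phi> x \<partial>m)"
    using J by (intro nn_integral_mono) (auto simp: indicator_def)
  finally show ?thesis by (simp add: mult_left_mono)
qed

text \<open>Doob's inequality followed by Hoelder bounds the integral \<open>X\<close> by a multiple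
  of \<open>X powr (1 - 1 / r)\<close>. The crude bound by a finite sum comes first, since the
  absorption needs \<open>X\<close> finite.\<close>

lemma maximal_bound:
  fixes c :: "'i \<Rightarrow> real \<times> real" and s :: "'i \<Rightarrow> real" and \<phi> :: "real \<times> real \<Rightarrow> real"
  assumes I: "finite I" "\<And>i. i \<in> I \<Longrightarrow> 0 < s i" and [measurable]: "\<phi> \<in> borel_measurable m"
    and phi: "\<And>x. 0 \<le> \<phi> x" and r: "1 < r" and A: "(\<integral>\<^sup>+x. ennreal (\<phi> x powr r) \<partial>m) \<le> ennreal A" "0 \<le> A"
    and a0: "\<And>i. i \<in> I \<Longrightarrow> 0 \<le> a i"
    and a: "\<And>i. i \<in> I \<Longrightarrow> ennreal (a i) * emeasure m (cube \<beta> (c i) (s i)) \<le> (\<integral>\<^sup>+x\<in>cube \<beta> (c i) (s i). ennreal (\<phi> x) \<partial>m)"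
  shows "(\<integral>\<^sup>+x. ennreal (cmax I (\<lambda>i. cube \<beta> (c i) (s i)) a x powr r) \<partial>m) \<le> ennreal ((dbl * r / (r - 1)) powr r * A)"
proof -
  let ?Q = "\<lambda>i. cube \<beta> (c i) (s i)"
  let ?N = "cmax I ?Q a"
  have [measurable]: "?N \<in> borel_measurable m" using I by (intro measurable_cmax) auto
  have N0: "0 \<le> ?N x" for x using I by (intro cmax_nonneg)
  have "(\<integral>\<^sup>+x. ennreal (?N x powr r) \<partial>m) \<le> (\<integral>\<^sup>+x. (\<Sum>i\<in>I. ennreal (a i powr r) * indicator (?Q i) x) \<partial>m)"
  proof (intro nn_integral_mono)
    fix x
    have "ennreal (?N x powr r) \<le> ennreal (\<Sum>i\<in>I. a i powr r * indicator (?Q i) x)"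
      using cmax_le_sum[OF I(1) a0, where Q = ?Q and x = x and r = r] by (intro ennreal_leI)
    also have "\<dots> = (\<Sum>i\<in>I. ennreal (a i powr r) * indicator (?Q i) x)"
      by (subst sum_ennreal[symmetric]) (auto simp: ennreal_mult' ennreal_indicator)
    finally show "ennreal (?N x powr r) \<le> (\<Sum>i\<in>I. ennreal (a i powr r) * indicator (?Q i) x)" .
  qed
  also have "\<dots> = (\<Sum>i\<in>I. ennreal (a i powr r) * emeasure m (?Q i))"
    by (subst nn_integral_sum) (auto simp: nn_integral_cmult_indicator)
  also have "\<dots> < \<infinity>" using I by (simp add: emeasure_cube ennreal_mult[symmetric] sum_ennreal)
  finally have fin: "(\<integral>\<^sup>+x. ennreal (?N x powr r) \<partial>m) < \<infinity>" .
  then obtain X where X: "(\<integral>\<^sup>+x. ennreal (?N x powr r) \<partial>m) = ennreal X" "0 \<le> X"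
    by (cases "\<integral>\<^sup>+x. ennreal (?N x powr r) \<partial>m") auto
  have "(\<integral>\<^sup>+x. ennreal (?N x powr r) \<partial>m) \<le> ennreal (dbl * r / (r - 1)) * (\<integral>\<^sup>+x. ennreal (\<phi> x) * ennreal (?N x powr (r - 1)) \<partial>m)"
  proof (rule nn_integral_doob[OF _ _ N0 r])
    show "0 \<le> dbl" using dbl by simp
    fix t :: real assume t: "0 < t"
    let ?I = "{i\<in>I. t \<le> a i}"
    have eq: "{x \<in> space m. t \<le> ?N x} = (\<Union>i\<in>?I. ?Q i)"
      using cmax_ge_iff[OF I(1) t, of ?Q a] by (simp add: space_m set_eq_iff)
    show "ennreal t * emeasure m {x \<in> space m. t \<le> ?N x} \<le> ennreal dbl * (\<integral>\<^sup>+x\<in>{x \<in> space m. t \<le> ?N x}. ennreal (\<phi> x) \<partial>m)"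
      unfolding eq
    proof (rule weak_type)
      show "ennreal t * emeasure m (?Q i) \<le> (\<integral>\<^sup>+x\<in>?Q i. ennreal (\<phi> x) \<partial>m)" if "i \<in> ?I" for i
        using that by (intro order_trans[OF _ a] mult_right_mono ennreal_leI) auto
    qed (use I in auto)
  qed measurable
  also have "(\<integral>\<^sup>+x. ennreal (\<phi> x) * ennreal (?N x powr (r - 1)) \<partial>m) = (\<integral>\<^sup>+x. ennreal (\<phi> x * ?N x powr (r - 1)) \<partial>m)"
    using phi by (simp add: ennreal_mult)
  also have "\<dots> \<le> ennreal (A powr (1 / r) * X powr (1 / (r / (r - 1))))"
  proof (rule nn_integral_Hoelder)
    show "(\<integral>\<^sup>+x. ennreal ((?N x powr (r - 1)) powr (r / (r - 1))) \<partial>m) \<le> ennreal X"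
      using r X by (simp add: powr_powr)
  qed (use r A X phi in \<open>auto simp: field_simps\<close>)
  finally have "ennreal X \<le> ennreal (dbl * r / (r - 1)) * ennreal (A powr (1 / r) * X powr (1 / (r / (r - 1))))"
    unfolding X by (simp add: mult_left_mono)
  then have "X \<le> (dbl * r / (r - 1) * A powr (1 / r)) * X powr (1 - 1 / r)"
    using r dbl by (simp add: ennreal_mult[symmetric] mult.assoc diff_divide_distrib)
  then have "X \<le> (dbl * r / (r - 1) * A powr (1 / r)) powr (1 / (1 / r))"
    using r dbl X by (intro powr_absorb) auto
  also have "\<dots> = (dbl * r / (r - 1)) powr r * (A powr (1 / r)) powr r"
    by (simp only: powr_mult) simp
  also have "\<dots> = (dbl * r / (r - 1)) powr r * A"
    using r A by (simp add: powr_powr)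
  finally show ?thesis unfolding X by (rule ennreal_leI)
qed

text \<open>Cubes are examined in the order of decreasing coefficients; a cube is kept if the cubes kept before
  it cover at most half of its measure. A discarded cube is then half covered by a level set of the
  maximal function of the kept cubes, and the weak type bound applies.\<close>

lemma sparse_selection:
  fixes Q :: "'i \<Rightarrow> (real \<times> real) set" and a :: "'i \<Rightarrow> real"
  assumes "finite I" and Q: "\<And>i. Q i \<in> sets lebesgue" "\<And>i. emeasure m (Q i) < \<infinity>"
  shows "\<exists>G\<subseteq>I. \<exists>E. disjoint_family_on E G \<and>
    (\<forall>i\<in>G. E i \<in> sets lebesgue \<and> E i \<subseteq> Q i \<and> measure m (Q i) \<le> 2 * measure m (E i)) \<and>
    (\<forall>i\<in>I. measure m (Q i) \<le> 2 * measure m (Q i \<inter> (\<Union>j\<in>{j\<in>G. a i \<le> a j}. Q j)))"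
  using assms(1)
proof (induction "card I" arbitrary: I rule: less_induct)
  case less
  let ?R = "\<lambda>I G E. disjoint_family_on E G \<and>
    (\<forall>i\<in>G. E i \<in> sets lebesgue \<and> E i \<subseteq> Q i \<and> measure m (Q i) \<le> 2 * measure m (E i)) \<and>
    (\<forall>i\<in>I. measure m (Q i) \<le> 2 * measure m (Q i \<inter> (\<Union>j\<in>{j\<in>G. a i \<le> a j}. Q j)))"
  show ?case
  proof (cases "I = {}")
    case False
    \<comment> \<open>The induction removes a cube of least coefficient, that is, the one examined
      last. Every cube kept before it has a coefficient at least \<open>a k\<close>, so the covering
      condition for \<open>k\<close> involves all of \<open>G\<close>.\<close>
    obtain k where k: "k \<in> I" "\<And>i. i \<in> I \<Longrightarrow> a k \<le> a i"
    proof -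
      have "Min (a ` I) \<in> a ` I" using False less.prems by simp
      then obtain k where "k \<in> I" "Min (a ` I) = a k" by auto
      then show ?thesis using that[of k] less.prems by (metis Min_le finite_imageI imageI)
    qed
    have "card (I - {k}) < card I" by (rule card_Diff1_less[OF less.prems k(1)])
    then have IH: "\<exists>G\<subseteq>I - {k}. \<exists>E. ?R (I - {k}) G E"
      by (rule less.hyps) (use less.prems in simp)
    then obtain G where "G \<subseteq> I - {k} \<and> (\<exists>E. ?R (I - {k}) G E)" by (rule exE)
    then obtain E where GE: "G \<subseteq> I - {k} \<and> ?R (I - {k}) G E" by (elim conjE exE) (rule that, intro conjI)
    from GE have G: "G \<subseteq> I - {k}" by (rule conjunct1)
    from GE have dis: "disjoint_family_on E G" by simp
    from GE have E: "\<forall>i\<in>G. E i \<in> sets lebesgue \<and> E i \<subseteq> Q i \<and> measure m (Q i) \<le> 2 * measure m (E i)" by simp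
    from GE have cov: "\<forall>i\<in>I - {k}. measure m (Q i) \<le> 2 * measure m (Q i \<inter> (\<Union>j\<in>{j\<in>G. a i \<le> a j}. Q j))" by simp
    have fG: "finite G" using G less.prems finite_subset by blast
    have Gk: "{j\<in>G. a k \<le> a j} = G" using G k by auto
    show ?thesis
    proof (cases "measure m (Q k) \<le> 2 * measure m (Q k \<inter> (\<Union>j\<in>G. Q j))")
      case True
      have cov': "\<forall>i\<in>I. measure m (Q i) \<le> 2 * measure m (Q i \<inter> (\<Union>j\<in>{j\<in>G. a i \<le> a j}. Q j))"
      proof
        fix i assume "i \<in> I"
        then show "measure m (Q i) \<le> 2 * measure m (Q i \<inter> (\<Union>j\<in>{j\<in>G. a i \<le> a j}. Q j))"
          using cov[rule_format, of i] True by (cases "i = k") (simp_all add: Gk)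
      qed
      have sub: "G \<subseteq> I" using G by auto
      have ex: "\<exists>E. ?R I G E" by (rule exI[of _ E], rule conjI[OF dis conjI[OF E cov']])
      show ?thesis by (rule exI[where x = G], rule conjI[OF sub ex])
    next
      case False
      define E' where "E' = E(k := Q k - (\<Union>j\<in>G. Q j))"
      have kG: "k \<notin> G" using G by auto
      have UG: "(\<Union>j\<in>G. Q j) \<in> sets lebesgue" using fG Q by auto
      have "measure m (Q k - (\<Union>j\<in>G. Q j)) = measure m (Q k) - measure m (Q k \<inter> (\<Union>j\<in>G. Q j))"
      proof -
        have "Q k - (\<Union>j\<in>G. Q j) = Q k - (Q k \<inter> (\<Union>j\<in>G. Q j))" by auto
        moreover have "measure m (Q k - (Q k \<inter> (\<Union>j\<in>G. Q j))) = measure m (Q k) - measure m (Q k \<inter> (\<Union>j\<in>G. Q j))"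
          using Q UG by (intro measure_Diff) (auto simp: less_top[symmetric])
        ultimately show ?thesis by simp
      qed
      with False have k2: "measure m (Q k) \<le> 2 * measure m (E' k)" by (simp add: E'_def)
      have 1: "disjoint_family_on E' (insert k G)"
        unfolding disjoint_family_on_def
      proof (intro ballI impI)
        fix i j assume ij: "i \<in> insert k G" "j \<in> insert k G" "i \<noteq> j"
        have sub: "E l \<subseteq> (\<Union>j\<in>G. Q j)" if "l \<in> G" for l using E that by blast
        show "E' i \<inter> E' j = {}"
        proof (cases "i = k \<or> j = k")
          case True
          then show ?thesis using ij kG sub by (auto simp: E'_def)
        next
          case False
          then show ?thesis using ij dis by (auto simp: E'_def disjoint_family_on_def)
        qed
      qed
      have 2: "\<forall>i\<in>insert k G. E' i \<in> sets lebesgue \<and> E' i \<subseteq> Q i \<and> measure m (Q i) \<le> 2 * measure m (E' i)"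
        using E k2 kG UG Q by (auto simp: E'_def)
      have 3: "\<forall>i\<in>I. measure m (Q i) \<le> 2 * measure m (Q i \<inter> (\<Union>j\<in>{j\<in>insert k G. a i \<le> a j}. Q j))"
      proof
        fix i assume i: "i \<in> I"
        show "measure m (Q i) \<le> 2 * measure m (Q i \<inter> (\<Union>j\<in>{j\<in>insert k G. a i \<le> a j}. Q j))"
        proof (cases "i = k")
          case True
          then have "Q i \<inter> (\<Union>j\<in>{j\<in>insert k G. a i \<le> a j}. Q j) = Q i" by auto
          then show ?thesis by simp
        next
          case False
          have fin: "finite {j\<in>insert k G. a i \<le> a j}" using fG by simp
          have "measure m (Q i \<inter> (\<Union>j\<in>{j\<in>G. a i \<le> a j}. Q j)) \<le> measure m (Q i \<inter> (\<Union>j\<in>{j\<in>insert k G. a i \<le> a j}. Q j))"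
          proof (rule measure_mono_fmeasurable)
            have "Q i \<inter> (\<Union>j\<in>{j\<in>insert k G. a i \<le> a j}. Q j) \<in> sets m" using fin Q by auto
            moreover have "emeasure m (Q i \<inter> (\<Union>j\<in>{j\<in>insert k G. a i \<le> a j}. Q j)) < \<infinity>"
              by (rule le_less_trans[OF emeasure_mono[OF Int_lower1] Q(2)[of i]]) (simp add: Q)
            ultimately show "Q i \<inter> (\<Union>j\<in>{j\<in>insert k G. a i \<le> a j}. Q j) \<in> fmeasurable m"
              by (rule fmeasurableI)
            show "Q i \<inter> (\<Union>j\<in>{j\<in>G. a i \<le> a j}. Q j) \<in> sets m" using fG Q by auto
          qed auto
          then show ?thesis using cov[rule_format, of i] False i by simp
        qed
      qed
      have sub: "insert k G \<subseteq> I" using G k by auto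
      have ex: "\<exists>E. ?R I (insert k G) E" by (rule exI[of _ E'], rule conjI[OF 1 conjI[OF 2 3]])
      show ?thesis by (rule exI[where x = "insert k G"], rule conjI[OF sub ex])
    qed
  qed (auto simp: disjoint_family_on_def)
qed

text \<open>Replaces the maximum over all cubes, which cannot be dualized directly, by a sum over
  disjointly supported portions of the kept cubes.\<close>

theorem sparse_domination:
  fixes c :: "'i \<Rightarrow> real \<times> real" and s :: "'i \<Rightarrow> real" and a :: "'i \<Rightarrow> real"
  assumes I: "finite I" "\<And>i. i \<in> I \<Longrightarrow> 0 < s i" and a0: "\<And>i. i \<in> I \<Longrightarrow> 0 \<le> a i" and r: "0 < r"
  obtains G E where "G \<subseteq> I" "disjoint_family_on E G"
    "\<And>i. i \<in> G \<Longrightarrow> E i \<in> sets lebesgue" "\<And>i. i \<in> G \<Longrightarrow> E i \<subseteq> cube \<beta> (c i) (s i)"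
    "\<And>i. i \<in> G \<Longrightarrow> measure m (cube \<beta> (c i) (s i)) \<le> 2 * measure m (E i)"
    "(\<integral>\<^sup>+x. ennreal (cmax I (\<lambda>i. cube \<beta> (c i) (s i)) a x powr r) \<partial>m)
      \<le> ennreal (2 * dbl * (\<Sum>i\<in>G. a i powr r * measure m (cube \<beta> (c i) (s i))))"
proof -
  let ?Q = "\<lambda>i. cube \<beta> (c i) (s i)"
  obtain G E where G: "G \<subseteq> I" "disjoint_family_on E G"
    and E: "\<forall>i\<in>G. E i \<in> sets lebesgue \<and> E i \<subseteq> ?Q i \<and> measure m (?Q i) \<le> 2 * measure m (E i)"
    and cov: "\<forall>i\<in>I. measure m (?Q i) \<le> 2 * measure m (?Q i \<inter> (\<Union>j\<in>{j\<in>G. a i \<le> a j}. ?Q j))"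
  proof -
    have "\<And>i. ?Q i \<in> sets lebesgue" "\<And>i. emeasure m (?Q i) < \<infinity>"
      by (rule cube_lebesgue, rule cube_finite)
    note sparse_selection[where Q = ?Q and a = a, OF I(1) this]
    then obtain G where "G \<subseteq> I \<and> (\<exists>E. disjoint_family_on E G \<and>
      (\<forall>i\<in>G. E i \<in> sets lebesgue \<and> E i \<subseteq> ?Q i \<and> measure m (?Q i) \<le> 2 * measure m (E i)) \<and>
      (\<forall>i\<in>I. measure m (?Q i) \<le> 2 * measure m (?Q i \<inter> (\<Union>j\<in>{j\<in>G. a i \<le> a j}. ?Q j))))" by (rule exE)
    then show ?thesis by (elim conjE exE) (rule that)
  qed
  have fG: "finite G" using G(1) I(1) by (rule finite_subset)
  let ?N = "cmax I ?Q a" and ?N' = "cmax G ?Q a"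
  have half_nonneg: "0 \<le> (1 / 2 :: real)" by simp
  have [measurable]: "?N \<in> borel_measurable m" by (rule measurable_cmax[OF I(1)]) simp
  have [measurable]: "?N' \<in> borel_measurable m" by (rule measurable_cmax[OF fG]) simp
  have ms: "{x\<in>space m. t \<le> ?N x} \<in> sets m" "{x\<in>space m. t \<le> ?N' x} \<in> sets m" for t
    by measurable
  have level: "emeasure m {x\<in>space m. t \<le> ?N x} \<le> ennreal (2 * dbl) * emeasure m {x\<in>space m. t \<le> ?N' x}"
    if t: "0 < t" for t
  proof -
    let ?I = "{i\<in>I. t \<le> a i}" and ?U = "\<Union>i\<in>{i\<in>G. t \<le> a i}. ?Q i"
    have e1: "{x\<in>space m. t \<le> ?N x} = (\<Union>i\<in>?I. ?Q i)"
      using cmax_ge_iff[OF I(1) t, of ?Q a] by (simp add: space_m set_eq_iff)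
    have e2: "{x\<in>space m. t \<le> ?N' x} = ?U"
      using cmax_ge_iff[OF fG t, of ?Q a] by (simp add: space_m set_eq_iff)
    have U: "?U \<in> sets m" using fG by auto
    \<comment> \<open>The weak type bound for the indicator of \<open>?U\<close> at height 1/2: a
      cube with coefficient at least \<open>t\<close> is half covered by kept cubes of coefficient
      at least its own, and these lie in \<open>?U\<close>.\<close>
    have "ennreal (1 / 2) * emeasure m (\<Union>i\<in>?I. ?Q i) \<le> ennreal dbl * (\<integral>\<^sup>+x\<in>(\<Union>i\<in>?I. ?Q i). indicator ?U x \<partial>m)"
    proof (rule weak_type[where I = ?I and c = c and s = s and \<phi> = "indicator ?U" and t = "ennreal (1 / 2)"])
      fix i assume i: "i \<in> ?I"
      have fin: "emeasure m (?Q i \<inter> ?U) < \<infinity>"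
        using emeasure_mono[of "?Q i \<inter> ?U" "?Q i" m] cube_finite[of "c i" "s i"] by auto
      have "measure m (?Q i \<inter> (\<Union>j\<in>{j\<in>G. a i \<le> a j}. ?Q j)) \<le> measure m (?Q i \<inter> ?U)"
      proof (rule measure_mono_fmeasurable)
        show "?Q i \<inter> ?U \<in> fmeasurable m" using fin U by (intro fmeasurableI) auto
        show "?Q i \<inter> (\<Union>j\<in>{j\<in>G. a i \<le> a j}. ?Q j) \<in> sets m" using fG by auto
        show "?Q i \<inter> (\<Union>j\<in>{j\<in>G. a i \<le> a j}. ?Q j) \<subseteq> ?Q i \<inter> ?U" using i by fastforce
      qed
      then have "measure m (?Q i) \<le> 2 * measure m (?Q i \<inter> ?U)" using cov[rule_format, of i] i by simp
      then have "ennreal (1 / 2 * measure m (?Q i)) \<le> ennreal (measure m (?Q i \<inter> ?U))"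
        by (intro ennreal_leI) simp
      also have "\<dots> = emeasure m (?Q i \<inter> ?U)"
        using fin by (intro emeasure_eq_ennreal_measure[symmetric]) (simp add: less_top[symmetric])
      also have "\<dots> = (\<integral>\<^sup>+x. indicator (?Q i \<inter> ?U) x \<partial>m)" using U by simp
      also have "\<dots> = (\<integral>\<^sup>+x\<in>?Q i. indicator ?U x \<partial>m)"
        by (intro nn_integral_cong) (auto simp: indicator_def)
      finally show "ennreal (1 / 2) * emeasure m (?Q i) \<le> (\<integral>\<^sup>+x\<in>?Q i. indicator ?U x \<partial>m)"
        unfolding emeasure_cube ennreal_mult'[OF half_nonneg, symmetric] .
    qed (use I U in auto)
    also have "\<dots> \<le> ennreal dbl * (\<integral>\<^sup>+x. indicator ?U x \<partial>m)"
      by (intro mult_left_mono nn_integral_mono) (auto simp: indicator_def)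
    also have "\<dots> = ennreal dbl * emeasure m ?U" using U by simp
    finally have half: "ennreal (1 / 2) * emeasure m (\<Union>i\<in>?I. ?Q i) \<le> ennreal dbl * emeasure m ?U" .
    have h2: "ennreal 2 * ennreal (1 / 2) = 1"
    proof -
      have "ennreal (2 * (1 / 2)) = ennreal 2 * ennreal (1 / 2)" by (rule ennreal_mult) simp_all
      moreover have "2 * (1 / 2) = (1 :: real)" by simp
      ultimately show ?thesis by (simp only: ennreal_1)
    qed
    have h3: "ennreal 2 * ennreal dbl = ennreal (2 * dbl)"
      by (rule ennreal_mult[symmetric]) (simp_all add: dbl(1) less_imp_le)
    have "emeasure m (\<Union>i\<in>?I. ?Q i) = ennreal 2 * (ennreal (1 / 2) * emeasure m (\<Union>i\<in>?I. ?Q i))"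
      by (simp only: mult.assoc[symmetric] h2 mult_1_left)
    also have "\<dots> \<le> ennreal 2 * (ennreal dbl * emeasure m ?U)" by (rule mult_left_mono[OF half]) simp
    also have "\<dots> = ennreal (2 * dbl) * emeasure m ?U" by (simp only: mult.assoc[symmetric] h3)
    finally show ?thesis unfolding e1 e2 .
  qed
  have "(\<integral>\<^sup>+x. ennreal (?N x powr r) \<partial>m)
      = (\<integral>\<^sup>+t. ennreal (r * t powr (r - 1)) * indicator {0<..} t * emeasure m {x\<in>space m. t \<le> ?N x} \<partial>lborel)"
    using nn_integral_layer_cake[of ?N "\<lambda>_. 1" r] r cmax_nonneg[OF I(1), of ?Q a] ms by (simp del: sets_m)
  also have "\<dots> \<le> (\<integral>\<^sup>+t. ennreal (2 * dbl) * (ennreal (r * t powr (r - 1)) * indicator {0<..} t * emeasure m {x\<in>space m. t \<le> ?N' x}) \<partial>lborel)"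
  proof (rule nn_integral_mono)
    fix t :: real
    show "ennreal (r * t powr (r - 1)) * indicator {0<..} t * emeasure m {x\<in>space m. t \<le> ?N x}
      \<le> ennreal (2 * dbl) * (ennreal (r * t powr (r - 1)) * indicator {0<..} t * emeasure m {x\<in>space m. t \<le> ?N' x})"
      using mult_left_mono[OF level[of t], of "ennreal (r * t powr (r - 1))"]
      by (cases "0 < t") (simp_all add: mult_ac)
  qed
  also have "\<dots> = ennreal (2 * dbl) * (\<integral>\<^sup>+t. ennreal (r * t powr (r - 1)) * indicator {0<..} t * emeasure m {x\<in>space m. t \<le> ?N' x} \<partial>lborel)"
    by (intro nn_integral_cmult) measurable
  also have "\<dots> = ennreal (2 * dbl) * (\<integral>\<^sup>+x. ennreal (?N' x powr r) \<partial>m)"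
    using nn_integral_layer_cake[of ?N' "\<lambda>_. 1" r] r cmax_nonneg[OF fG, of ?Q a] ms by (simp del: sets_m)
  also have "\<dots> \<le> ennreal (2 * dbl) * (\<integral>\<^sup>+x. (\<Sum>i\<in>G. ennreal (a i powr r) * indicator (?Q i) x) \<partial>m)"
  proof (intro mult_left_mono nn_integral_mono)
    fix x
    have "ennreal (?N' x powr r) \<le> ennreal (\<Sum>i\<in>G. a i powr r * indicator (?Q i) x)"
      using cmax_le_sum[OF fG, of a ?Q x r] a0 G by (intro ennreal_leI) auto
    also have "\<dots> = (\<Sum>i\<in>G. ennreal (a i powr r) * indicator (?Q i) x)"
      by (subst sum_ennreal[symmetric]) (auto simp: ennreal_mult' ennreal_indicator)
    finally show "ennreal (?N' x powr r) \<le> (\<Sum>i\<in>G. ennreal (a i powr r) * indicator (?Q i) x)" .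
  qed simp
  also have "(\<integral>\<^sup>+x. (\<Sum>i\<in>G. ennreal (a i powr r) * indicator (?Q i) x) \<partial>m) = (\<Sum>i\<in>G. ennreal (a i powr r) * emeasure m (?Q i))"
    by (subst nn_integral_sum) (auto simp: nn_integral_cmult_indicator)
  also have "\<dots> = ennreal (\<Sum>i\<in>G. a i powr r * measure m (?Q i))"
    by (simp add: emeasure_cube ennreal_mult[symmetric] sum_ennreal)
  also have "ennreal (2 * dbl) * \<dots> = ennreal (2 * dbl * (\<Sum>i\<in>G. a i powr r * measure m (?Q i)))"
    using dbl by (simp add: ennreal_mult'[symmetric])
  finally show ?thesis using G E by (intro that[of G E]) auto
qed

text \<open>Carleson embedding, by duality with the maximal function.\<close>

theorem sparse_sum_bound:
  fixes c :: "'i \<Rightarrow> real \<times> real" and s :: "'i \<Rightarrow> real" and v :: "'i \<Rightarrow> real"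
  assumes G: "finite G" "\<And>i. i \<in> G \<Longrightarrow> 0 < s i" and v: "\<And>i. i \<in> G \<Longrightarrow> 0 \<le> v i" and p: "1 < p"
    and dis: "disjoint_family_on E G" and E: "\<And>i. i \<in> G \<Longrightarrow> E i \<in> sets lebesgue"
    and EQ: "\<And>i. i \<in> G \<Longrightarrow> E i \<subseteq> cube \<beta> (c i) (s i)"
    and \<theta>: "\<And>i. i \<in> G \<Longrightarrow> measure m (cube \<beta> (c i) (s i)) \<le> \<theta> * measure m (E i)" "0 \<le> \<theta>"
  shows "(\<integral>\<^sup>+x. ennreal ((\<Sum>i\<in>G. v i * indicator (cube \<beta> (c i) (s i)) x) powr p) \<partial>m)
    \<le> ennreal ((\<theta> * (dbl * p)) powr p * (\<Sum>i\<in>G. v i powr p * measure m (cube \<beta> (c i) (s i))))"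
proof -
  let ?Q = "\<lambda>i. cube \<beta> (c i) (s i)"
  define F where "F x = (\<Sum>i\<in>G. v i * indicator (?Q i) x)" for x
  \<comment> \<open>The extremal function in the duality of \<open>L\<^sup>p\<close>:
    \<open>F * \<phi>\<close> and \<open>\<phi> powr p'\<close> both equal
    \<open>F powr p\<close>.\<close>
  define \<phi> where "\<phi> x = F x powr (p - 1)" for x
  have [measurable]: "F \<in> borel_measurable m" unfolding F_def by measurable
  have [measurable]: "\<phi> \<in> borel_measurable m" unfolding \<phi>_def by measurable
  have F0: "0 \<le> F x" for x unfolding F_def using v by (intro sum_nonneg) auto
  define V where "V = (\<Sum>i\<in>G. v i)"
  have V: "0 \<le> V" unfolding V_def using v by (intro sum_nonneg) auto
  have FV: "F x \<le> V" for x
    unfolding F_def V_def using v by (intro sum_mono) (auto simp: indicator_def)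
  have F_supp: "F x = 0" if "x \<notin> (\<Union>i\<in>G. ?Q i)" for x
    unfolding F_def using that by (intro sum.neutral) auto
  \<comment> \<open>\<open>F\<close> is bounded and lives on a set of finite measure. This crude
    fact gives the finite \<open>X\<close> that is absorbed at the end.\<close>
  have fU: "emeasure m (\<Union>i\<in>G. ?Q i) < \<infinity>"
  proof -
    have "emeasure m (\<Union>i\<in>G. ?Q i) \<le> (\<Sum>i\<in>G. emeasure m (?Q i))" using G by (intro emeasure_subadditive_finite) auto
    also have "\<dots> < \<infinity>" using G cube_finite by simp
    finally show ?thesis .
  qed
  have "(\<integral>\<^sup>+x. ennreal (F x powr p) \<partial>m) \<le> (\<integral>\<^sup>+x. ennreal (V powr p) * indicator (\<Union>i\<in>G. ?Q i) x \<partial>m)"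
  proof (rule nn_integral_mono)
    fix x show "ennreal (F x powr p) \<le> ennreal (V powr p) * indicator (\<Union>i\<in>G. ?Q i) x"
      using FV[of x] F0[of x] F_supp[of x] p by (cases "x \<in> (\<Union>i\<in>G. ?Q i)") (auto intro!: ennreal_leI powr_mono2)
  qed
  also have "\<dots> < \<infinity>" using fU G by (subst nn_integral_cmult_indicator) (auto simp: ennreal_mult_less_top)
  finally obtain X where X: "(\<integral>\<^sup>+x. ennreal (F x powr p) \<partial>m) = ennreal X" "0 \<le> X"
    by (cases "\<integral>\<^sup>+x. ennreal (F x powr p) \<partial>m") auto
  define p' where "p' = p / (p - 1)"
  have p': "1 < p'" "1 / p + 1 / p' = 1" "1 / p' = 1 - 1 / p" "(p - 1) * p' = p" "p' / (p' - 1) = p"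
    using p by (auto simp: p'_def field_simps)
  have phiX: "(\<integral>\<^sup>+x. ennreal (\<phi> x powr p') \<partial>m) \<le> ennreal X"
    unfolding \<phi>_def X(1)[symmetric] using p' by (simp add: powr_powr)
  have pf: "(\<integral>\<^sup>+x\<in>?Q i. ennreal (\<phi> x) \<partial>m) < \<infinity>" for i
  proof -
    have "(\<integral>\<^sup>+x\<in>?Q i. ennreal (\<phi> x) \<partial>m) \<le> (\<integral>\<^sup>+x. ennreal (V powr (p - 1)) * indicator (?Q i) x \<partial>m)"
      unfolding \<phi>_def using FV F0 p by (intro nn_integral_mono mult_right_mono ennreal_leI powr_mono2) auto
    also have "\<dots> < \<infinity>" using cube_finite by (subst nn_integral_cmult_indicator) (auto simp: ennreal_mult_less_top)
    finally show ?thesis .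
  qed
  define a where "a i = enn2real (\<integral>\<^sup>+x\<in>?Q i. ennreal (\<phi> x) \<partial>m) / measure m (?Q i)" for i
  have a0: "0 \<le> a i" for i by (simp add: a_def)
  have aQ: "ennreal (a i) * emeasure m (?Q i) = (\<integral>\<^sup>+x\<in>?Q i. ennreal (\<phi> x) \<partial>m)" if "i \<in> G" for i
    using cube_pos[OF G(2)[OF that], of "c i"] pf[of i]
    by (simp add: a_def emeasure_cube ennreal_mult[symmetric] ennreal_enn2real less_top)
  let ?N = "cmax G ?Q a"
  have [measurable]: "?N \<in> borel_measurable m" using G by (intro measurable_cmax) auto
  have NX: "(\<integral>\<^sup>+x. ennreal (?N x powr p') \<partial>m) \<le> ennreal ((dbl * p' / (p' - 1)) powr p' * X)"
    using G p' phiX X aQ a0 by (intro maximal_bound[where \<phi> = \<phi>]) (auto simp: \<phi>_def)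
  \<comment> \<open>The mean \<open>a i\<close> of \<open>\<phi>\<close> over a cube is at most
    \<open>?N\<close> on \<open>E i\<close>, so the sum over overlapping cubes turns into the
    integral of \<open>H * ?N\<close>. Disjointness of the \<open>E i\<close> makes
    \<open>H powr p\<close> a sum without mixed terms.\<close>
  define H where "H x = (\<Sum>i\<in>G. v i * indicator (E i) x)" for x
  have [measurable]: "H \<in> borel_measurable m" unfolding H_def
    by (intro borel_measurable_sum borel_measurable_times borel_measurable_const borel_measurable_indicator) (simp add: E)
  have H0: "0 \<le> H x" for x unfolding H_def using v by (intro sum_nonneg) auto
  define W where "W = (\<Sum>i\<in>G. v i powr p * measure m (?Q i))"
  have W0: "0 \<le> W" unfolding W_def by (intro sum_nonneg) auto
  have fE: "emeasure m (E i) = ennreal (measure m (E i))" "measure m (E i) \<le> measure m (?Q i)" if "i \<in> G" for i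
  proof -
    have "emeasure m (E i) \<le> emeasure m (?Q i)" using EQ[OF that] by (intro emeasure_mono) auto
    then have fi: "emeasure m (E i) < \<infinity>" using cube_finite[of "c i" "s i"] by auto
    then show e: "emeasure m (E i) = ennreal (measure m (E i))"
      by (intro emeasure_eq_ennreal_measure) (simp add: less_top)
    show "measure m (E i) \<le> measure m (?Q i)"
      using \<open>emeasure m (E i) \<le> emeasure m (?Q i)\<close> unfolding e emeasure_cube by simp
  qed
  have Hp: "H x powr p = (\<Sum>i\<in>G. v i powr p * indicator (E i) x)" for x
  proof (cases "\<exists>i\<in>G. x \<in> E i")
    case True
    then obtain i where i: "i \<in> G" "x \<in> E i" by auto
    have z: "indicator (E j) x = (0::real)" if "j \<in> G - {i}" for j
      using dis that i by (auto simp: disjoint_family_on_def indicator_def)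
    show ?thesis
      using i G p by (simp add: H_def sum.remove[OF G(1) i(1)] z)
  next
    case False
    then have "indicator (E i) x = (0::real)" if "i \<in> G" for i using that by auto
    then show ?thesis by (simp add: H_def)
  qed
  have HW: "(\<integral>\<^sup>+x. ennreal (H x powr p) \<partial>m) \<le> ennreal W"
  proof -
    have "(\<integral>\<^sup>+x. ennreal (H x powr p) \<partial>m) = (\<integral>\<^sup>+x. (\<Sum>i\<in>G. ennreal (v i powr p) * indicator (E i) x) \<partial>m)"
      unfolding Hp by (intro nn_integral_cong, subst sum_ennreal[symmetric]) (auto simp: ennreal_mult' ennreal_indicator)
    also have "\<dots> = (\<Sum>i\<in>G. ennreal (v i powr p) * emeasure m (E i))"
      using E by (subst nn_integral_sum) (auto simp: nn_integral_cmult_indicator)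
    also have "\<dots> = ennreal (\<Sum>i\<in>G. v i powr p * measure m (E i))"
      by (simp add: fE ennreal_mult[symmetric] sum_ennreal)
    also have "\<dots> \<le> ennreal W"
      unfolding W_def using fE by (intro ennreal_leI sum_mono mult_left_mono) auto
    finally show ?thesis .
  qed
  have FF: "ennreal (F x powr p) = (\<Sum>i\<in>G. ennreal (v i) * (ennreal (\<phi> x) * indicator (?Q i) x))" for x
  proof -
    have "F x powr p = F x * \<phi> x"
      using F0[of x] p powr_add[of "F x" 1 "p - 1"] by (cases "F x = 0") (auto simp: \<phi>_def)
    also have "\<dots> = (\<Sum>i\<in>G. v i * (\<phi> x * indicator (?Q i) x))"
      unfolding F_def sum_distrib_right by (simp add: mult_ac)
    finally have "ennreal (F x powr p) = ennreal (\<Sum>i\<in>G. v i * (\<phi> x * indicator (?Q i) x))" by simp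
    also have "\<dots> = (\<Sum>i\<in>G. ennreal (v i * (\<phi> x * indicator (?Q i) x)))"
      using v by (intro sum_ennreal[symmetric]) (auto simp: \<phi>_def)
    also have "\<dots> = (\<Sum>i\<in>G. ennreal (v i) * (ennreal (\<phi> x) * indicator (?Q i) x))"
      using v by (intro sum.cong) (auto simp: ennreal_mult' ennreal_indicator \<phi>_def)
    finally show ?thesis .
  qed
  have "ennreal X = (\<Sum>i\<in>G. ennreal (v i) * (\<integral>\<^sup>+x\<in>?Q i. ennreal (\<phi> x) \<partial>m))"
    unfolding X(1)[symmetric] FF
    by (subst nn_integral_sum) (auto simp: nn_integral_cmult)
  also have "\<dots> = (\<Sum>i\<in>G. ennreal (v i) * (ennreal (a i) * emeasure m (?Q i)))"
    by (simp add: aQ)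
  also have "\<dots> \<le> (\<Sum>i\<in>G. ennreal \<theta> * (ennreal (v i * a i) * emeasure m (E i)))"
  proof (rule sum_mono)
    fix i assume i: "i \<in> G"
    have "v i * (a i * measure m (?Q i)) \<le> v i * (a i * (\<theta> * measure m (E i)))"
      using \<theta> i v a0 by (intro mult_left_mono) auto
    then show "ennreal (v i) * (ennreal (a i) * emeasure m (?Q i)) \<le> ennreal \<theta> * (ennreal (v i * a i) * emeasure m (E i))"
      using i v a0 \<theta>(2) by (simp add: fE emeasure_cube ennreal_mult[symmetric] mult_ac)
  qed
  also have "\<dots> = ennreal \<theta> * (\<integral>\<^sup>+x. (\<Sum>i\<in>G. ennreal (v i * a i) * indicator (E i) x) \<partial>m)"
    using E by (subst nn_integral_sum) (auto simp: nn_integral_cmult_indicator sum_distrib_left)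
  also have "\<dots> \<le> ennreal \<theta> * (\<integral>\<^sup>+x. ennreal (H x * ?N x) \<partial>m)"
  proof (intro mult_left_mono nn_integral_mono)
    fix x
    have "(\<Sum>i\<in>G. v i * a i * indicator (E i) x) \<le> (\<Sum>i\<in>G. (v i * indicator (E i) x) * ?N x)"
    proof (rule sum_mono)
      fix i assume i: "i \<in> G"
      show "v i * a i * indicator (E i) x \<le> (v i * indicator (E i) x) * ?N x"
        using cmax_ge[OF G(1) i, of x ?Q a] EQ[OF i] v[OF i] by (auto simp: indicator_def intro!: mult_left_mono)
    qed
    then have "ennreal (\<Sum>i\<in>G. v i * a i * indicator (E i) x) \<le> ennreal (H x * ?N x)"
      unfolding H_def sum_distrib_right by (rule ennreal_leI)
    moreover have "ennreal (\<Sum>i\<in>G. v i * a i * indicator (E i) x) = (\<Sum>i\<in>G. ennreal (v i * a i) * indicator (E i) x)"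
      using v a0 by (subst sum_ennreal[symmetric]) (auto simp: ennreal_mult' ennreal_indicator)
    ultimately show "(\<Sum>i\<in>G. ennreal (v i * a i) * indicator (E i) x) \<le> ennreal (H x * ?N x)" by simp
  qed simp
  also have "\<dots> \<le> ennreal \<theta> * ennreal (W powr (1 / p) * ((dbl * p' / (p' - 1)) powr p' * X) powr (1 / p'))"
    using p p' HW NX W0 X H0 cmax_nonneg[OF G(1)] by (intro mult_left_mono nn_integral_Hoelder) auto
  also have "((dbl * p' / (p' - 1)) powr p' * X) powr (1 / p') = ((dbl * p' / (p' - 1)) powr p') powr (1 / p') * X powr (1 / p')"
    by (simp only: powr_mult)
  also have "((dbl * p' / (p' - 1)) powr p') powr (1 / p') = dbl * p"
  proof -
    have "dbl * p' / (p' - 1) = dbl * p" using p'(5) by (metis times_divide_eq_right)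
    then show ?thesis using p'(1) p dbl(1) by (simp add: powr_powr)
  qed
  finally have "X \<le> \<theta> * (W powr (1 / p) * (dbl * p * X powr (1 / p')))"
    using \<theta>(2) p dbl by (subst (asm) ennreal_mult[symmetric]) (auto simp: mult_nonneg_nonneg)
  then have "X \<le> (\<theta> * (dbl * p) * W powr (1 / p)) * X powr (1 - 1 / p)"
    unfolding p'(3) by (simp add: mult_ac)
  then have "X \<le> (\<theta> * (dbl * p) * W powr (1 / p)) powr (1 / (1 / p))"
    using p dbl X \<theta>(2) by (intro powr_absorb) auto
  also have "\<dots> = (\<theta> * (dbl * p)) powr p * (W powr (1 / p)) powr p"
    by (simp only: powr_mult) simp
  also have "\<dots> = (\<theta> * (dbl * p)) powr p * W" using p W0 by (simp add: powr_powr)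
  finally have "ennreal X \<le> ennreal ((\<theta> * (dbl * p)) powr p * W)" by (rule ennreal_leI)
  then show ?thesis unfolding X(1)[symmetric] F_def W_def .
qed

end

section \<open>The oscillation over a cube is bounded by a pairing with the commutator\<close>

lemma powr_diff_bounds:
  fixes x y k :: real
  assumes "0 < x" "x \<le> y" "1 \<le> k"
  shows "k * x powr (k - 1) * (y - x) \<le> y powr k - x powr k" "y powr k - x powr k \<le> k * y powr (k - 1) * (y - x)"
proof -
  have "k * x powr (k - 1) * (y - x) \<le> y powr k - x powr k \<and> y powr k - x powr k \<le> k * y powr (k - 1) * (y - x)"
  proof (cases "x = y")
    case False
    then have xy: "x < y" using assms by simp
    have "\<exists>z. x < z \<and> z < y \<and> y powr k - x powr k = (y - x) * (k * z powr (k - 1))"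
      using xy assms by (intro MVT2) (auto intro!: derivative_eq_intros)
    then obtain z where z: "x < z" "z < y" "y powr k - x powr k = (y - x) * (k * z powr (k - 1))" by blast
    have "x powr (k - 1) \<le> z powr (k - 1)" "z powr (k - 1) \<le> y powr (k - 1)"
      using z assms by (auto intro!: powr_mono2)
    then have "(y - x) * (k * x powr (k - 1)) \<le> (y - x) * (k * z powr (k - 1))"
      "(y - x) * (k * z powr (k - 1)) \<le> (y - x) * (k * y powr (k - 1))"
      using xy assms by (intro mult_left_mono; simp)+
    then show ?thesis using z(3) by (simp add: mult_ac)
  qed simp
  then show "k * x powr (k - 1) * (y - x) \<le> y powr k - x powr k" "y powr k - x powr k \<le> k * y powr (k - 1) * (y - x)"
    by auto
qed

text \<open>Steps at times near \<open>S\<close> and near \<open>T\<close> along \<open>u \<mapsto> (u, u\<^sup>k)\<close>: the slopes differ so much that the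
  differences of such steps cover a full translated unit square.\<close>

definition spaced :: "real \<Rightarrow> real \<Rightarrow> real \<Rightarrow> bool" where
  "spaced k S T \<longleftrightarrow> 9 \<le> S \<and> S + 2 \<le> T \<and> (S + 2) powr k - S powr k + 1 \<le> (T + 1) powr k - T powr k \<and>
     S powr k - (S - 2) powr k + 1 \<le> T powr k - (T - 1) powr k"

text \<open>The factor \<open>3 powr (1 / (k - 1))\<close> makes the slope of
  \<open>u powr k\<close> from \<open>T - 1\<close> on at least three times its slope up to
  \<open>S + 2\<close>. Two of the three parts pay for an interval of length 2 against one of length
  1; the third, being at least 1, pays for the summand 1.\<close>

lemma spacedI:
  assumes k: "1 < k" and S: "9 \<le> S" and T: "3 powr (1 / (k - 1)) * (S + 2) \<le> T - 1"
  shows "spaced k S T"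
proof -
  let ?\<rho> = "3 powr (1 / (k - 1))"
  have r1: "1 \<le> ?\<rho>" using k by (intro ge_one_powr_ge_zero) auto
  have "1 * (S + 2) \<le> ?\<rho> * (S + 2)" using r1 S by (intro mult_right_mono) auto
  then have ST: "S + 2 \<le> T - 1" using T by simp
  have "(?\<rho> * (S + 2)) powr (k - 1) \<le> (T - 1) powr (k - 1)" using T S k by (intro powr_mono2) auto
  moreover have "(?\<rho> * (S + 2)) powr (k - 1) = ?\<rho> powr (k - 1) * (S + 2) powr (k - 1)" by (simp only: powr_mult)
  moreover have "?\<rho> powr (k - 1) = 3" using k by (simp add: powr_powr)
  ultimately have t1: "3 * (S + 2) powr (k - 1) \<le> (T - 1) powr (k - 1)" by simp
  have t2: "(T - 1) powr (k - 1) \<le> T powr (k - 1)" using ST S k by (intro powr_mono2) auto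
  have s1: "1 \<le> (S + 2) powr (k - 1)" using S k by (intro ge_one_powr_ge_zero) auto
  have s2: "S powr (k - 1) \<le> (S + 2) powr (k - 1)" using S k by (intro powr_mono2) auto
  have ks: "1 \<le> k * (S + 2) powr (k - 1)" using mult_mono[of 1 k 1 "(S + 2) powr (k - 1)"] s1 k by simp
  have kt: "3 * (k * (S + 2) powr (k - 1)) \<le> k * (T - 1) powr (k - 1)" "k * (T - 1) powr (k - 1) \<le> k * T powr (k - 1)"
    "k * S powr (k - 1) \<le> k * (S + 2) powr (k - 1)"
    using mult_left_mono[OF t1, of k] mult_left_mono[OF t2, of k] mult_left_mono[OF s2, of k] k by simp_all
  have u1: "(S + 2) powr k - S powr k \<le> k * (S + 2) powr (k - 1) * 2"
    using powr_diff_bounds(2)[of S "S + 2" k] S k by simp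
  have u2: "S powr k - (S - 2) powr k \<le> k * S powr (k - 1) * 2"
    using powr_diff_bounds(2)[of "S - 2" S k] S k by simp
  have l1: "k * T powr (k - 1) \<le> (T + 1) powr k - T powr k"
    using powr_diff_bounds(1)[of T "T + 1" k] S ST k by simp
  have l2: "k * (T - 1) powr (k - 1) \<le> T powr k - (T - 1) powr k"
    using powr_diff_bounds(1)[of "T - 1" T k] S ST k by simp
  show ?thesis unfolding spaced_def using S ST ks kt u1 u2 l1 l2 by (intro conjI; linarith)
qed

text \<open>The second property compares increments of order \<open>X powr (k - 1)\<close> with the
  value \<open>X powr k\<close> at the first time \<open>X\<close>. As all three times are at most a
  fixed multiple of \<open>X\<close>, it holds for large \<open>X\<close>.\<close>

lemma spaced_triple:
  assumes k: "1 < (k::real)"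
  obtains T :: "nat \<Rightarrow> real" where "\<And>i j. i < j \<Longrightarrow> j \<le> 2 \<Longrightarrow> spaced k (T i) (T j)"
    "\<And>i u. i \<le> 2 \<Longrightarrow> \<bar>u - T i\<bar> \<le> 3 \<Longrightarrow> \<bar>u powr k - T i powr k\<bar> + 1 / 2 \<le> T 0 powr k - 1"
    "9 \<le> T 0" "T 0 \<le> T 1" "T 1 \<le> T 2"
proof -
  define \<rho> where "\<rho> = 3 powr (1 / (k - 1))"
  have r1: "1 \<le> \<rho>" unfolding \<rho>_def using k by (intro ge_one_powr_ge_zero) auto
  define \<theta> where "\<theta> = \<rho> * (3 * \<rho> + 3) + 4"
  have th: "1 \<le> \<theta>" using r1 by (simp add: \<theta>_def add_nonneg_nonneg)
  \<comment> \<open>With this choice \<open>3 * k * (\<theta> * X) powr (k - 1)\<close> equals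
    \<open>(X - 11) * X powr (k - 1)\<close>, and the missing \<open>11 * X powr (k - 1)\<close>
    covers the required 3/2. The summand 11 also gives \<open>T 0\<close> its lower bound 9.\<close>
  define X where "X = 3 * k * \<theta> powr (k - 1) + 11"
  have X: "11 \<le> X" using k by (simp add: X_def)
  define T1 where "T1 = \<rho> * (X + 2) + 1"
  define T2 where "T2 = \<rho> * (T1 + 2) + 1"
  define T :: "nat \<Rightarrow> real" where "T i = (if i = 0 then X else if i = 1 then T1 else T2)" for i
  have "1 * (X + 2) \<le> \<rho> * (X + 2)" using r1 X by (intro mult_right_mono) auto
  then have "X + 2 \<le> T1" unfolding T1_def mult_1_left by (rule add_increasing2[OF zero_le_one])
  then have "X \<le> T1" by simp
  with X have T1X: "X \<le> T1" "9 \<le> T1" by simp_all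
  have "1 * (T1 + 2) \<le> \<rho> * (T1 + 2)" using r1 T1X by (intro mult_right_mono) auto
  then have T21: "T1 \<le> T2" by (simp add: T2_def)
  have "\<rho> * (X + 2) \<le> \<rho> * (T1 + 2)" using T1X r1 by (intro mult_left_mono) auto
  then have sp: "spaced k X T1" "spaced k T1 T2" "spaced k X T2"
    using X T1X by (auto intro!: spacedI[OF k] simp: T1_def T2_def \<rho>_def[symmetric])
  have T2X: "T2 + 3 \<le> \<theta> * X"
  proof -
    have "\<rho> * (X + 2) + 1 + 2 \<le> (3 * \<rho> + 3) * X"
    proof -
      have "\<rho> * (X + 2) \<le> \<rho> * (3 * X)" using r1 X by (intro mult_left_mono) auto
      then show ?thesis using X by (simp add: algebra_simps)
    qed
    then have "\<rho> * (T1 + 2) \<le> \<rho> * ((3 * \<rho> + 3) * X)" unfolding T1_def using r1 by (intro mult_left_mono) auto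
    then show ?thesis unfolding T2_def \<theta>_def using X by (simp add: algebra_simps)
  qed
  have sep: "\<bar>u powr k - t powr k\<bar> + 1 / 2 \<le> X powr k - 1" if t: "X \<le> t" "t \<le> T2" and u: "\<bar>u - t\<bar> \<le> 3" for t u
  proof -
    have b: "\<bar>u powr k - t powr k\<bar> \<le> 3 * k * (T2 + 3) powr (k - 1)"
    proof (cases "u \<le> t")
      case True
      have "u powr k \<le> t powr k" using True u t X k by (intro powr_mono2) auto
      then have "\<bar>u powr k - t powr k\<bar> = t powr k - u powr k" by simp
      also have "\<dots> \<le> k * t powr (k - 1) * (t - u)" using True u t X k by (intro powr_diff_bounds) auto
      also have "\<dots> \<le> k * (T2 + 3) powr (k - 1) * 3"
        using True u t X k by (intro mult_mono powr_mono2) auto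
      finally show ?thesis by simp
    next
      case False
      have "t powr k \<le> u powr k" using False u t X k by (intro powr_mono2) auto
      then have "\<bar>u powr k - t powr k\<bar> = u powr k - t powr k" by simp
      also have "\<dots> \<le> k * u powr (k - 1) * (u - t)" using False u t X k by (intro powr_diff_bounds) auto
      also have "\<dots> \<le> k * (T2 + 3) powr (k - 1) * 3"
        using False u t X k by (intro mult_mono powr_mono2) auto
      finally show ?thesis by simp
    qed
    have "(T2 + 3) powr (k - 1) \<le> (\<theta> * X) powr (k - 1)" using T2X T21 T1X X k by (intro powr_mono2) auto
    also have "\<dots> = \<theta> powr (k - 1) * X powr (k - 1)" by (simp only: powr_mult)
    finally have "3 * k * (T2 + 3) powr (k - 1) \<le> 3 * k * (\<theta> powr (k - 1) * X powr (k - 1))"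
      using k by (intro mult_left_mono) auto
    also have "\<dots> = (X - 11) * X powr (k - 1)" by (simp add: X_def)
    also have "\<dots> = X powr k - 11 * X powr (k - 1)"
      using powr_add[of X 1 "k - 1"] X by (simp add: algebra_simps)
    finally have "3 * k * (T2 + 3) powr (k - 1) \<le> X powr k - 11 * X powr (k - 1)" .
    moreover have "1 \<le> X powr (k - 1)" using X k by (intro ge_one_powr_ge_zero) auto
    ultimately show ?thesis using b by linarith
  qed
  show ?thesis
  proof (rule that[of T])
    show "spaced k (T i) (T j)" if "i < j" "j \<le> 2" for i j
    proof -
      have "(i = 0 \<and> j = 1) \<or> (i = 0 \<and> j = 2) \<or> (i = 1 \<and> j = 2)" using that by linarith
      then show ?thesis using sp by (auto simp: T_def)
    qed
    show "\<bar>u powr k - T i powr k\<bar> + 1 / 2 \<le> T 0 powr k - 1" if "i \<le> 2" "\<bar>u - T i\<bar> \<le> 3" for i u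
      using that sep[of "T i" u] T1X T21 by (auto simp: T_def split: if_splits)
  qed (use X T1X T21 in \<open>auto simp: T_def\<close>)
qed

text \<open>The conclusion of \<open>spaced_triple\<close> as a predicate, so that one triple can be
  fixed by \<open>SOME\<close> and all later constants depend on the curve only.\<close>

definition ladder :: "real \<Rightarrow> (nat \<Rightarrow> real) \<Rightarrow> bool" where
  "ladder k T \<longleftrightarrow> (\<forall>i j. i < j \<longrightarrow> j \<le> 2 \<longrightarrow> spaced k (T i) (T j)) \<and>
     (\<forall>i u. i \<le> 2 \<longrightarrow> \<bar>u - T i\<bar> \<le> 3 \<longrightarrow> \<bar>u powr k - T i powr k\<bar> + 1 / 2 \<le> T 0 powr k - 1) \<and>
     9 \<le> T 0 \<and> T 0 \<le> T 1 \<and> T 1 \<le> T 2"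

lemma ladder_exists:
  assumes "1 < k" shows "\<exists>T. ladder k T"
proof (rule spaced_triple[OF assms])
  fix T :: "nat \<Rightarrow> real"
  assume "\<And>i j. i < j \<Longrightarrow> j \<le> 2 \<Longrightarrow> spaced k (T i) (T j)"
    "\<And>i u. i \<le> 2 \<Longrightarrow> \<bar>u - T i\<bar> \<le> 3 \<Longrightarrow> \<bar>u powr k - T i powr k\<bar> + 1 / 2 \<le> T 0 powr k - 1"
    "9 \<le> T 0" "T 0 \<le> T 1" "T 1 \<le> T 2"
  then have "ladder k T" unfolding ladder_def by simp
  then show "\<exists>T. ladder k T" by (rule exI[where x = T])
qed

text \<open>The change of variables from \<open>(u, w)\<close> to
  \<open>(w - u, w powr k - u powr k)\<close>, one coordinate at a time: for a fixed first
  difference \<open>a\<close> the second one is nondecreasing in \<open>u\<close> with derivative at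
  most \<open>k * (T + 3) powr (k - 1)\<close>; afterwards \<open>w = u + a\<close> restores the two
  times.\<close>

lemma nn_integral_chord:
  fixes G :: "real \<Rightarrow> real \<Rightarrow> ennreal"
  assumes [measurable]: "(\<lambda>(x, y). G x y) \<in> borel_measurable borel" and k: "1 < k" and ST: "spaced k S T"
    and supp: "\<And>d e. G d e \<noteq> 0 \<Longrightarrow> \<bar>d - (T - S)\<bar> \<le> 1 \<and> \<bar>e - (T powr k - S powr k)\<bar> \<le> 1"
  shows "(\<integral>\<^sup>+d. \<integral>\<^sup>+e. G d e \<partial>lborel \<partial>lborel) \<le> ennreal (k * (T + 3) powr (k - 1)) *
     (\<integral>\<^sup>+u. \<integral>\<^sup>+w. indicator {S - 2..S + 2} u * indicator {T - 3..T + 3} w * G (w - u) (w powr k - u powr k) \<partial>lborel \<partial>lborel)"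
proof -
  let ?C = "k * (T + 3) powr (k - 1)"
  have GB [measurable]: "(\<lambda>x. G (fst x) (snd x)) \<in> borel_measurable (borel \<Otimes>\<^sub>M borel)"
  proof -
    have "(\<lambda>(x, y). G x y) = (\<lambda>x. G (fst x) (snd x))" by (simp add: fun_eq_iff split: prod.split)
    then show ?thesis using assms(1) by (simp only: borel_prod)
  qed
  have Gm [measurable]: "(\<lambda>x. G (f x) (g x)) \<in> borel_measurable N" if "f \<in> borel_measurable N" "g \<in> borel_measurable N" for f g and N :: "'b measure"
    using measurable_compose[OF measurable_Pair[OF that] GB] by simp
  have S: "9 \<le> S" and T: "S + 2 \<le> T"
    and c1: "(S + 2) powr k - S powr k + 1 \<le> (T + 1) powr k - T powr k"
    and c2: "S powr k - (S - 2) powr k + 1 \<le> T powr k - (T - 1) powr k"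
    using ST by (auto simp: spaced_def)
  have inner: "(\<integral>\<^sup>+e. G a e \<partial>lborel) \<le> ennreal ?C * (\<integral>\<^sup>+u. indicator {S - 2..S + 2} u * G a ((u + a) powr k - u powr k) \<partial>lborel)" for a
  proof (cases "\<bar>a - (T - S)\<bar> \<le> 1")
    case False
    then have "G a e = 0" for e using supp by blast
    then show ?thesis by simp
  next
    case True
    define \<phi> where "\<phi> u = (u + a) powr k - u powr k" for u
    define \<phi>' where "\<phi>' u = k * (u + a) powr (k - 1) - k * u powr (k - 1)" for u
    have a: "1 \<le> a" using True T by linarith
    have der: "(\<phi> has_real_derivative \<phi>' u) (at u)" if "u \<in> {S - 2..S + 2}" for u
      unfolding \<phi>_def \<phi>'_def using that S a by (auto intro!: derivative_eq_intros)
    have cont: "continuous_on {S - 2..S + 2} \<phi>'"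
      unfolding \<phi>'_def using S a by (intro continuous_intros) auto
    have pos: "0 \<le> \<phi>' u" "\<phi>' u \<le> ?C" if "u \<in> {S - 2..S + 2}" for u
    proof -
      have "u powr (k - 1) \<le> (u + a) powr (k - 1)" using that S a k by (intro powr_mono2) auto
      then show "0 \<le> \<phi>' u" using k by (simp add: \<phi>'_def)
      have "(u + a) powr (k - 1) \<le> (T + 3) powr (k - 1)" using that S a k True by (intro powr_mono2) (auto simp: abs_le_iff)
      then have "k * (u + a) powr (k - 1) \<le> ?C" using k by simp
      moreover have "0 \<le> k * u powr (k - 1)" using k by simp
      ultimately show "\<phi>' u \<le> ?C" by (simp add: \<phi>'_def)
    qed
    \<comment> \<open>Here \<open>spaced\<close> enters: the image of \<open>[S - 2, S + 2]\<close>
      under \<open>\<phi>\<close> contains every second coordinate at which \<open>G a\<close> can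
      differ from 0.\<close>
    have cover: "G a e = G a e * indicator {\<phi> (S - 2)..\<phi> (S + 2)} e" for e
    proof (cases "G a e = 0")
      case False
      then have e: "\<bar>e - (T powr k - S powr k)\<bar> \<le> 1" using supp by blast
      have "(S - 2 + a) powr k \<le> (T - 1) powr k" using True S a k by (intro powr_mono2) (auto simp: abs_le_iff)
      then have "\<phi> (S - 2) \<le> e" using e c2 by (simp add: \<phi>_def abs_le_iff)
      moreover have "(T + 1) powr k \<le> (S + 2 + a) powr k" using True S T k by (intro powr_mono2) (auto simp: abs_le_iff)
      then have "e \<le> \<phi> (S + 2)" using e c1 by (simp add: \<phi>_def abs_le_iff)
      ultimately show ?thesis by simp
    qed simp
    have "(\<integral>\<^sup>+e. G a e \<partial>lborel) = (\<integral>\<^sup>+e. G a e * indicator {\<phi> (S - 2)..\<phi> (S + 2)} e \<partial>lborel)"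
      using cover by (intro nn_integral_cong) simp
    also have "\<dots> = (\<integral>\<^sup>+u. G a (\<phi> u) * ennreal (\<phi>' u) * indicator {S - 2..S + 2} u \<partial>lborel)"
      by (rule nn_integral_substitution_aux[OF _ _ der cont pos(1)]) auto
    also have "\<dots> \<le> (\<integral>\<^sup>+u. ennreal ?C * (indicator {S - 2..S + 2} u * G a (\<phi> u)) \<partial>lborel)"
    proof (rule nn_integral_mono)
      fix u
      show "G a (\<phi> u) * ennreal (\<phi>' u) * indicator {S - 2..S + 2} u \<le> ennreal ?C * (indicator {S - 2..S + 2} u * G a (\<phi> u))"
        using mult_right_mono[OF ennreal_leI[OF pos(2)[of u]], of "G a (\<phi> u)"]
        by (cases "u \<in> {S - 2..S + 2}") (simp_all add: mult.commute)
    qed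
    also have "\<dots> = ennreal ?C * (\<integral>\<^sup>+u. indicator {S - 2..S + 2} u * G a (\<phi> u) \<partial>lborel)"
      unfolding \<phi>_def by (rule nn_integral_cmult) measurable
    finally show ?thesis by (simp add: \<phi>_def)
  qed
  have "(\<integral>\<^sup>+d. \<integral>\<^sup>+e. G d e \<partial>lborel \<partial>lborel)
      \<le> (\<integral>\<^sup>+a. ennreal ?C * (\<integral>\<^sup>+u. indicator {S - 2..S + 2} u * G a ((u + a) powr k - u powr k) \<partial>lborel) \<partial>lborel)"
    by (intro nn_integral_mono inner)
  also have "\<dots> = ennreal ?C * (\<integral>\<^sup>+a. \<integral>\<^sup>+u. indicator {S - 2..S + 2} u * G a ((u + a) powr k - u powr k) \<partial>lborel \<partial>lborel)"
    by (rule nn_integral_cmult) measurable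
  also have "(\<integral>\<^sup>+a. \<integral>\<^sup>+u. indicator {S - 2..S + 2} u * G a ((u + a) powr k - u powr k) \<partial>lborel \<partial>lborel)
     = (\<integral>\<^sup>+u. \<integral>\<^sup>+a. indicator {S - 2..S + 2} u * G a ((u + a) powr k - u powr k) \<partial>lborel \<partial>lborel)"
    by (rule lborel_pair.Fubini') measurable
  also have "\<dots> = (\<integral>\<^sup>+u. \<integral>\<^sup>+w. indicator {S - 2..S + 2} u * indicator {T - 3..T + 3} w * G (w - u) (w powr k - u powr k) \<partial>lborel \<partial>lborel)"
  proof (rule nn_integral_cong)
    fix u :: real
    have "(\<integral>\<^sup>+a. indicator {S - 2..S + 2} u * G a ((u + a) powr k - u powr k) \<partial>lborel)
        = (\<integral>\<^sup>+w. indicator {S - 2..S + 2} u * G (w - u) ((u + (w - u)) powr k - u powr k) \<partial>lborel)"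
      by (rule nn_integral_lborel_translate[symmetric]) measurable
    also have "\<dots> = (\<integral>\<^sup>+w. indicator {S - 2..S + 2} u * indicator {T - 3..T + 3} w * G (w - u) (w powr k - u powr k) \<partial>lborel)"
    proof (rule nn_integral_cong)
      fix w :: real
      show "indicator {S - 2..S + 2} u * G (w - u) ((u + (w - u)) powr k - u powr k)
          = indicator {S - 2..S + 2} u * indicator {T - 3..T + 3} w * G (w - u) (w powr k - u powr k)"
      proof (cases "u \<in> {S - 2..S + 2} \<and> G (w - u) (w powr k - u powr k) \<noteq> 0")
        case True
        then have "\<bar>(w - u) - (T - S)\<bar> \<le> 1" using supp by blast
        then have "w \<in> {T - 3..T + 3}" using True by (auto simp: abs_le_iff)
        then show ?thesis by simp
      qed auto
    qed
    finally show "(\<integral>\<^sup>+a. indicator {S - 2..S + 2} u * G a ((u + a) powr k - u powr k) \<partial>lborel)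
      = (\<integral>\<^sup>+w. indicator {S - 2..S + 2} u * indicator {T - 3..T + 3} w * G (w - u) (w powr k - u powr k) \<partial>lborel)" .
  qed
  finally show ?thesis .
qed

lemma measurable_plane_affine:
  fixes H :: "real \<times> real \<Rightarrow> 'b::topological_space"
  assumes "H \<in> borel_measurable borel"
  shows "(\<lambda>(d, e). H (x + a * d, y + b * e)) \<in> borel_measurable borel"
proof -
  have "(\<lambda>z::real \<times> real. (x + a * fst z, y + b * snd z)) \<in> borel_measurable borel"
    by (intro borel_measurable_continuous_onI continuous_intros)
  from measurable_compose[OF this assms] show ?thesis by (simp only: case_prod_unfold)
qed

lemma nn_integral_lborel_plane_affine:
  fixes H :: "real \<times> real \<Rightarrow> ennreal"
  assumes [measurable]: "H \<in> borel_measurable borel" and ab: "a \<noteq> 0" "b \<noteq> 0"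
  shows "(\<integral>\<^sup>+z. H z \<partial>lborel) = ennreal (\<bar>a\<bar> * \<bar>b\<bar>) * (\<integral>\<^sup>+d. \<integral>\<^sup>+e. H (x + a * d, y + b * e) \<partial>lborel \<partial>lborel)"
proof -
  have [measurable]: "H \<in> borel_measurable (borel \<Otimes>\<^sub>M borel)" by (simp add: borel_prod)
  have "(\<integral>\<^sup>+z. H z \<partial>lborel) = (\<integral>\<^sup>+d. \<integral>\<^sup>+e. H (d, e) \<partial>lborel \<partial>lborel)"
    unfolding lborel_prod[symmetric] by (rule lborel.nn_integral_fst[symmetric]) (simp add: borel_prod)
  also have "\<dots> = ennreal \<bar>a\<bar> * (\<integral>\<^sup>+d. \<integral>\<^sup>+e. H (x + a * d, e) \<partial>lborel \<partial>lborel)"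
    using ab(1) by (intro nn_integral_real_affine) auto
  also have "(\<integral>\<^sup>+d. \<integral>\<^sup>+e. H (x + a * d, e) \<partial>lborel \<partial>lborel) = (\<integral>\<^sup>+d. ennreal \<bar>b\<bar> * (\<integral>\<^sup>+e. H (x + a * d, y + b * e) \<partial>lborel) \<partial>lborel)"
    using ab(2) by (intro nn_integral_cong nn_integral_real_affine) auto
  also have "\<dots> = ennreal \<bar>b\<bar> * (\<integral>\<^sup>+d. \<integral>\<^sup>+e. H (x + a * d, y + b * e) \<partial>lborel \<partial>lborel)"
    by (rule nn_integral_cmult) measurable
  finally show ?thesis by (simp add: ennreal_mult' mult.assoc)
qed

section \<open>The measure of steps along the curve and the sets around a cube\<close>

locale monomial =
  fixes \<beta> \<epsilon> \<delta> :: "real \<times> real"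
  assumes params: "monomial_params \<beta> \<epsilon> \<delta>"
begin

abbreviation "b1 \<equiv> fst \<beta>"
abbreviation "b2 \<equiv> snd \<beta>"
abbreviation "e1 \<equiv> fst \<epsilon>"
abbreviation "e2 \<equiv> snd \<epsilon>"
abbreviation "\<gamma> \<equiv> monomial_curve \<beta> \<epsilon> \<delta>"

definition "k = b2 / b1"

lemma b: "0 < b1" "b1 < b2" "0 < b2" and k: "1 < k" and bk: "b1 * k = b2"
  and e: "\<bar>e1\<bar> = 1" "\<bar>e2\<bar> = 1" "e1 * e1 = 1" "e2 * e2 = 1" "e1 \<noteq> 0" "e2 \<noteq> 0"
  using params by (auto simp: monomial_params_def k_def mem_Times_iff)

definition T :: "nat \<Rightarrow> real" where "T = (SOME T. ladder k T)"

lemma ladder_T: "ladder k T"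
  unfolding T_def by (rule someI_ex[OF ladder_exists[OF k]])

lemma T_spaced: "i < j \<Longrightarrow> j \<le> 2 \<Longrightarrow> spaced k (T i) (T j)"
  and T_sep: "i \<le> 2 \<Longrightarrow> \<bar>u - T i\<bar> \<le> 3 \<Longrightarrow> \<bar>u powr k - T i powr k\<bar> + 1 / 2 \<le> T 0 powr k - 1"
  and T0: "9 \<le> T 0"
  using ladder_T unfolding ladder_def by auto

lemma T_le: "i \<le> 2 \<Longrightarrow> T 0 \<le> T i" "i \<le> 2 \<Longrightarrow> T i \<le> T 2"
  using ladder_T unfolding ladder_def by (auto simp: le_less numeral_2_eq_2 less_Suc_eq)

text \<open>The margin 5 exceeds 4 + 1/2, the half width of \<open>Pset\<close> plus that of a cube
  in units of \<open>s powr b1\<close>. Hence every passage from \<open>Pset\<close> to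
  \<open>Aset\<close> along the curve has its parameter in \<open>[ua, ub]\<close>.\<close>

definition "ua = T 0 - 5"
definition "ub = T 2 + 5"

lemma uab: "4 \<le> ua" "ua \<le> ub" "0 < ub"
  using T0 T_le(1)[of 2] by (auto simp: ua_def ub_def)

definition arc_density :: "real \<Rightarrow> ennreal" where
  "arc_density u = ennreal (indicator {ua..ub} u / (b1 * u))"

text \<open>The branch \<open>t > 0\<close> of the curve, reparametrized by \<open>t = s * u powr (1 / b1)\<close>: the measure \<open>dt / t\<close> becomes
  \<open>du / (b1 * u)\<close>.\<close>

definition arc :: "real \<Rightarrow> real \<Rightarrow> real \<times> real" where
  "arc s u = (e1 * s powr b1 * u, e2 * s powr b2 * u powr k)"

definition \<kappa> :: "real \<Rightarrow> (real \<times> real) measure" where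
  "\<kappa> s = distr (density lborel arc_density) borel (arc s)"

lemma measurable_arc [measurable]: "arc s \<in> borel_measurable borel"
  unfolding arc_def by measurable

lemma measurable_arc_density [measurable]: "arc_density \<in> borel_measurable borel"
  unfolding arc_density_def by measurable

lemma nn_integral_kappa:
  assumes [measurable]: "F \<in> borel_measurable borel"
  shows "(\<integral>\<^sup>+v. F v \<partial>\<kappa> s) = (\<integral>\<^sup>+u. arc_density u * F (arc s u) \<partial>lborel)"
  unfolding \<kappa>_def by (simp add: nn_integral_distr nn_integral_density)

text \<open>The total mass of \<open>\<kappa> s\<close>. It does not depend on \<open>s\<close>, as
  \<open>dt / t\<close> is invariant under scaling.\<close>

definition "mass = enn2real (\<integral>\<^sup>+u. arc_density u \<partial>lborel)"

lemma arc_density_bounds: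
  "arc_density u \<le> ennreal (1 / (b1 * ua)) * indicator {ua..ub} u"
  "ennreal (1 / (b1 * ub)) * indicator {ua..ub} u \<le> arc_density u"
proof -
  have "1 / (b1 * u) \<le> 1 / (b1 * ua)" "1 / (b1 * ub) \<le> 1 / (b1 * u)" if "u \<in> {ua..ub}"
    using that b uab by (auto intro!: divide_left_mono mult_left_mono mult_pos_pos)
  then show "arc_density u \<le> ennreal (1 / (b1 * ua)) * indicator {ua..ub} u"
    "ennreal (1 / (b1 * ub)) * indicator {ua..ub} u \<le> arc_density u"
    by (cases "u \<in> {ua..ub}"; simp add: arc_density_def ennreal_leI)+
qed

lemma mass: "(\<integral>\<^sup>+u. arc_density u \<partial>lborel) = ennreal mass" "0 < mass"
proof -
  have "(\<integral>\<^sup>+u. arc_density u \<partial>lborel) \<le> (\<integral>\<^sup>+u. ennreal (1 / (b1 * ua)) * indicator {ua..ub} u \<partial>lborel)"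
    by (intro nn_integral_mono arc_density_bounds)
  also have "\<dots> = ennreal (1 / (b1 * ua)) * ennreal (ub - ua)"
    using uab by (simp add: nn_integral_cmult_indicator)
  also have "\<dots> < \<infinity>" by (simp add: ennreal_mult_less_top)
  finally show e: "(\<integral>\<^sup>+u. arc_density u \<partial>lborel) = ennreal mass" unfolding mass_def by (simp add: ennreal_enn2real)
  have "T 0 \<le> T 2" by (rule T_le) simp
  then have "0 < ennreal (1 / (b1 * ub) * (ub - ua))"
    using uab b by (auto simp: ua_def ub_def)
  also have "\<dots> = (\<integral>\<^sup>+u. ennreal (1 / (b1 * ub)) * indicator {ua..ub} u \<partial>lborel)"
    using uab b by (subst nn_integral_cmult_indicator) (simp_all add: ennreal_mult[symmetric])
  also have "\<dots> \<le> (\<integral>\<^sup>+u. arc_density u \<partial>lborel)"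
    by (intro nn_integral_mono arc_density_bounds)
  finally show "0 < mass" unfolding e by simp
qed

lemma emeasure_kappa: "emeasure (\<kappa> s) UNIV = ennreal mass"
  using nn_integral_kappa[of "\<lambda>_. 1" s] mass by (simp add: \<kappa>_def)

lemma convolution_pair_kappa: "convolution_pair (\<kappa> s)"
proof (rule convolution_pair.intro)
  show "finite_measure (\<kappa> s)"
    by (rule finite_measureI) (use emeasure_kappa[of s] in \<open>simp add: \<kappa>_def\<close>)
qed (simp add: \<kappa>_def)

lemma measure_kappa: "measure (\<kappa> s) UNIV = mass"
  using emeasure_kappa[of s] mass(2) by (simp add: measure_def)

text \<open>Index 0 gives the cube itself. Index \<open>i\<close> gives the cube reached by going
  back at time \<open>T 0\<close> and forward at time \<open>T i\<close>.\<close>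

definition tcube :: "real \<times> real \<Rightarrow> real \<Rightarrow> nat \<Rightarrow> (real \<times> real) set" where
  "tcube c s i = cube \<beta> (c - arc s (T 0) + arc s (T i)) s"

definition Aset :: "real \<times> real \<Rightarrow> real \<Rightarrow> (real \<times> real) set" where
  "Aset c s = (\<Union>i\<in>{..2}. tcube c s i)"

text \<open>Centred one step of time \<open>T 0\<close> behind \<open>c\<close>. The half width 4
  leaves room for times within 3 of \<open>T i\<close> and for half a cube. The half height stays 1
  below that of the step at \<open>T 0\<close>, more than half a cube, so every displacement from
  this set to \<open>Aset\<close> has the signs of \<epsilon>.\<close>

definition Pset :: "real \<times> real \<Rightarrow> real \<Rightarrow> (real \<times> real) set" where
  "Pset c s = (let p = c - arc s (T 0) in
     {fst p - 4 * s powr b1 .. fst p + 4 * s powr b1} \<times>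
     {snd p - (T 0 powr k - 1) * s powr b2 .. snd p + (T 0 powr k - 1) * s powr b2})"

lemma mem_Pset: "y \<in> Pset c s \<longleftrightarrow> \<bar>fst y - (fst c - e1 * s powr b1 * T 0)\<bar> \<le> 4 * s powr b1 \<and>
    \<bar>snd y - (snd c - e2 * s powr b2 * T 0 powr k)\<bar> \<le> (T 0 powr k - 1) * s powr b2"
  by (cases y) (auto simp: Pset_def Let_def arc_def abs_le_iff)

lemma mem_tcube: "x \<in> tcube c s i \<longleftrightarrow>
    \<bar>fst x - (fst c - e1 * s powr b1 * T 0 + e1 * s powr b1 * T i)\<bar> \<le> s powr b1 / 2 \<and>
    \<bar>snd x - (snd c - e2 * s powr b2 * T 0 powr k + e2 * s powr b2 * T i powr k)\<bar> \<le> s powr b2 / 2"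
  by (simp add: tcube_def mem_cube arc_def)

lemma borel_sets [measurable]: "tcube c s i \<in> sets borel" "Aset c s \<in> sets borel" "Pset c s \<in> sets borel"
  by (simp_all add: tcube_def Aset_def Pset_def Let_def borel_Times)

lemma scaled_coord:
  assumes "\<bar>\<eta>\<bar> = (1::real)" "0 < l"
  shows "\<bar>x\<bar> \<le> l * r \<longleftrightarrow> \<bar>x / (\<eta> * l)\<bar> \<le> r"
proof -
  have "\<bar>\<eta> * l\<bar> = l" using assms by (simp add: abs_mult)
  then have "\<bar>x / (\<eta> * l)\<bar> = \<bar>x\<bar> / l" by (simp only: abs_divide)
  then show ?thesis by (simp only: pos_divide_le_eq[OF assms(2)] mult.commute[of r l])
qed

text \<open>Coordinates in which the cube has sides 1 and the signs of \<epsilon> have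
  disappeared.\<close>

lemma tcube_coords:
  assumes s: "0 < s"
  obtains \<eta> where "x \<in> tcube c s i \<longleftrightarrow> \<bar>fst \<eta>\<bar> \<le> 1 / 2 \<and> \<bar>snd \<eta>\<bar> \<le> 1 / 2"
    "x = (fst c - e1 * s powr b1 * T 0 + e1 * s powr b1 * (T i + fst \<eta>),
          snd c - e2 * s powr b2 * T 0 powr k + e2 * s powr b2 * (T i powr k + snd \<eta>))"
proof (rule that)
  define \<eta> where "\<eta> = ((fst x - (fst c - e1 * s powr b1 * T 0 + e1 * s powr b1 * T i)) / (e1 * s powr b1),
     (snd x - (snd c - e2 * s powr b2 * T 0 powr k + e2 * s powr b2 * T i powr k)) / (e2 * s powr b2))"
  show "x \<in> tcube c s i \<longleftrightarrow> \<bar>fst \<eta>\<bar> \<le> 1 / 2 \<and> \<bar>snd \<eta>\<bar> \<le> 1 / 2"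
    unfolding mem_tcube \<eta>_def fst_conv snd_conv
    using s scaled_coord[OF e(1), of "s powr b1" _ "1 / 2"] scaled_coord[OF e(2), of "s powr b2" _ "1 / 2"] by simp
  have "e1 * s powr b1 * fst \<eta> = fst x - (fst c - e1 * s powr b1 * T 0 + e1 * s powr b1 * T i)"
    "e2 * s powr b2 * snd \<eta> = snd x - (snd c - e2 * s powr b2 * T 0 powr k + e2 * s powr b2 * T i powr k)"
    using s e by (simp_all add: \<eta>_def)
  then show "x = (fst c - e1 * s powr b1 * T 0 + e1 * s powr b1 * (T i + fst \<eta>),
          snd c - e2 * s powr b2 * T 0 powr k + e2 * s powr b2 * (T i powr k + snd \<eta>))"
    by (simp add: prod_eq_iff distrib_left)
qed

text \<open>In the first coordinate 3 + 1/2 is at most 4; the second is the case for which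
  \<open>T_sep\<close> was arranged.\<close>

lemma step_in_Pset:
  assumes s: "0 < s" and i: "i \<le> 2" and x: "x \<in> tcube c s i" and u: "\<bar>u - T i\<bar> \<le> 3"
  shows "x - arc s u \<in> Pset c s"
proof -
  obtain \<eta> where \<eta>: "\<bar>fst \<eta>\<bar> \<le> 1 / 2" "\<bar>snd \<eta>\<bar> \<le> 1 / 2"
    "x = (fst c - e1 * s powr b1 * T 0 + e1 * s powr b1 * (T i + fst \<eta>),
          snd c - e2 * s powr b2 * T 0 powr k + e2 * s powr b2 * (T i powr k + snd \<eta>))"
    using tcube_coords[OF s, of x c i] x by metis
  have p: "fst (x - arc s u) - (fst c - e1 * s powr b1 * T 0) = e1 * s powr b1 * (T i + fst \<eta> - u)"
    "snd (x - arc s u) - (snd c - e2 * s powr b2 * T 0 powr k) = e2 * s powr b2 * (T i powr k + snd \<eta> - u powr k)"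
    by (simp_all add: \<eta>(3) arc_def algebra_simps)
  have "\<bar>T i + fst \<eta> - u\<bar> \<le> 4" using \<eta> u by linarith
  then have "s powr b1 * \<bar>T i + fst \<eta> - u\<bar> \<le> s powr b1 * 4" by (rule mult_left_mono) simp
  moreover have "\<bar>T i powr k + snd \<eta> - u powr k\<bar> \<le> T 0 powr k - 1" using \<eta> T_sep[OF i u] by linarith
  then have "s powr b2 * \<bar>T i powr k + snd \<eta> - u powr k\<bar> \<le> s powr b2 * (T 0 powr k - 1)" by (rule mult_left_mono) simp
  ultimately show ?thesis
    unfolding mem_Pset p by (simp add: abs_mult e mult.commute)
qed

text \<open>Two factors \<open>b1 * ub\<close> undo the densities of the two steps; the last factor
  is the Jacobian bound of \<open>nn_integral_chord\<close> at the largest time.\<close>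

definition "cost = (b1 * ub)\<^sup>2 * (k * (T 2 + 3) powr (k - 1))"

lemma cost: "0 < cost"
  using b uab k T0 T_le(1)[of 2] by (auto simp: cost_def)

lemma window_density:
  assumes i: "i \<le> 2" and u: "\<bar>u - T i\<bar> \<le> 3"
  shows "1 \<le> ennreal (b1 * ub) * arc_density u"
proof -
  have "u \<in> {ua..ub}" using T_le[OF i] u by (auto simp: ua_def ub_def abs_le_iff)
  then have "ennreal (1 / (b1 * ub)) \<le> arc_density u" using arc_density_bounds(2)[of u] by simp
  then have "ennreal (b1 * ub) * ennreal (1 / (b1 * ub)) \<le> ennreal (b1 * ub) * arc_density u" by (rule mult_left_mono) simp
  moreover have "ennreal (b1 * ub) * ennreal (1 / (b1 * ub)) = 1"
    using b uab by (subst ennreal_mult[symmetric]) auto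
  ultimately show ?thesis by simp
qed

text \<open>Measured in units of the sides, a point of translate \<open>j\<close> is displaced from
  \<open>x\<close> in translate \<open>i\<close> by
  \<open>(T j - T i, T j powr k - T i powr k)\<close> up to 1 in each coordinate. This is the range
  in which \<open>nn_integral_chord\<close> represents a displacement by a step back near
  \<open>T i\<close> and a step forward near \<open>T j\<close>.\<close>

lemma chord_minorization:
  fixes F :: "real \<times> real \<Rightarrow> ennreal"
  assumes s: "0 < s" and ij: "i \<le> 2" "j \<le> 2" "i \<noteq> j" and x: "x \<in> tcube c s i"
    and [measurable]: "F \<in> borel_measurable borel"
  shows "(\<integral>\<^sup>+y. indicator (tcube c s j) y * F y \<partial>lborel) \<le> ennreal (cost * (s powr b1 * s powr b2)) *
     (\<integral>\<^sup>+v. indicator (Pset c s) (x - v) * (\<integral>\<^sup>+w. F (x - v + w) \<partial>\<kappa> s) \<partial>\<kappa> s)"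
proof -
  let ?l1 = "s powr b1" and ?l2 = "s powr b2"
  have l: "0 < ?l1" "0 < ?l2" using s by auto
  define R where "R = (\<integral>\<^sup>+u. \<integral>\<^sup>+w. indicator (Pset c s) (x - arc s u) * arc_density u * (arc_density w * F (x - arc s u + arc s w)) \<partial>lborel \<partial>lborel)"
  have Rk: "(\<integral>\<^sup>+v. indicator (Pset c s) (x - v) * (\<integral>\<^sup>+w. F (x - v + w) \<partial>\<kappa> s) \<partial>\<kappa> s) = R"
  proof -
    interpret convolution_pair "\<kappa> s" by (rule convolution_pair_kappa)
    have [measurable]: "(\<lambda>v. \<integral>\<^sup>+w. F (x - v + w) \<partial>\<kappa> s) \<in> borel_measurable borel" by measurable
    have "(\<integral>\<^sup>+v. indicator (Pset c s) (x - v) * (\<integral>\<^sup>+w. F (x - v + w) \<partial>\<kappa> s) \<partial>\<kappa> s)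
        = (\<integral>\<^sup>+u. arc_density u * (indicator (Pset c s) (x - arc s u) * (\<integral>\<^sup>+w. F (x - arc s u + w) \<partial>\<kappa> s)) \<partial>lborel)"
      by (rule nn_integral_kappa) measurable
    also have "\<dots> = R"
      unfolding R_def
    proof (rule nn_integral_cong)
      fix u
      have A: "(\<integral>\<^sup>+w. F (x - arc s u + w) \<partial>\<kappa> s) = (\<integral>\<^sup>+w. arc_density w * F (x - arc s u + arc s w) \<partial>lborel)"
        by (rule nn_integral_kappa) measurable
      have B: "(\<integral>\<^sup>+w. indicator (Pset c s) (x - arc s u) * arc_density u * (arc_density w * F (x - arc s u + arc s w)) \<partial>lborel)
          = indicator (Pset c s) (x - arc s u) * arc_density u * (\<integral>\<^sup>+w. arc_density w * F (x - arc s u + arc s w) \<partial>lborel)"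
        by (rule nn_integral_cmult) measurable
      show "arc_density u * (indicator (Pset c s) (x - arc s u) * (\<integral>\<^sup>+w. F (x - arc s u + w) \<partial>\<kappa> s))
          = (\<integral>\<^sup>+w. indicator (Pset c s) (x - arc s u) * arc_density u * (arc_density w * F (x - arc s u + arc s w)) \<partial>lborel)"
        unfolding A B by (simp only: mult_ac)
    qed
    finally show ?thesis .
  qed
  have win: "g \<le> ennreal ((b1 * ub)\<^sup>2) * (indicator (Pset c s) (x - arc s u) * arc_density u * (arc_density w * g))"
    if u: "\<bar>u - T i\<bar> \<le> 3" and w: "\<bar>w - T j\<bar> \<le> 3" for u w and g :: ennreal
  proof -
    have "1 * (1 * g) \<le> (ennreal (b1 * ub) * arc_density u) * ((ennreal (b1 * ub) * arc_density w) * g)"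
      by (intro mult_mono window_density[OF ij(1) u] window_density[OF ij(2) w]) auto
    also have "\<dots> = (ennreal (b1 * ub) * ennreal (b1 * ub)) * (arc_density u * (arc_density w * g))" by (simp add: mult_ac)
    also have "ennreal (b1 * ub) * ennreal (b1 * ub) = ennreal ((b1 * ub)\<^sup>2)"
      using b uab by (simp add: ennreal_mult[symmetric] power2_eq_square)
    finally show ?thesis using step_in_Pset[OF s ij(1) x u] by simp
  qed
  define H where "H y = indicator (tcube c s j) y * F y" for y
  have Hm [measurable]: "H \<in> borel_measurable borel" unfolding H_def by measurable
  have HF: "H y \<le> F y" for y by (auto simp: H_def indicator_def)
  obtain \<eta> where \<eta>: "\<bar>fst \<eta>\<bar> \<le> 1 / 2" "\<bar>snd \<eta>\<bar> \<le> 1 / 2"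
    "x = (fst c - e1 * ?l1 * T 0 + e1 * ?l1 * (T i + fst \<eta>), snd c - e2 * ?l2 * T 0 powr k + e2 * ?l2 * (T i powr k + snd \<eta>))"
    using tcube_coords[OF s, of x c i] x by metis
  have Hsupp: "\<bar>d - (T j - T i)\<bar> \<le> 1 \<and> \<bar>d' - (T j powr k - T i powr k)\<bar> \<le> 1"
    if "H (fst x + e1 * ?l1 * d, snd x + e2 * ?l2 * d') \<noteq> 0" for d d'
  proof -
    have m: "(fst x + e1 * ?l1 * d, snd x + e2 * ?l2 * d') \<in> tcube c s j"
      using that by (auto simp: H_def indicator_def split: if_splits)
    have p: "fst x + e1 * ?l1 * d - (fst c - e1 * ?l1 * T 0 + e1 * ?l1 * T j) = e1 * ?l1 * (T i + fst \<eta> + d - T j)"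
      "snd x + e2 * ?l2 * d' - (snd c - e2 * ?l2 * T 0 powr k + e2 * ?l2 * T j powr k) = e2 * ?l2 * (T i powr k + snd \<eta> + d' - T j powr k)"
      by (simp_all add: \<eta>(3) algebra_simps)
    have "?l1 * \<bar>T i + fst \<eta> + d - T j\<bar> \<le> ?l1 * (1 / 2)" "?l2 * \<bar>T i powr k + snd \<eta> + d' - T j powr k\<bar> \<le> ?l2 * (1 / 2)"
      using m unfolding mem_tcube fst_conv snd_conv p by (simp_all add: abs_mult e)
    then have "\<bar>T i + fst \<eta> + d - T j\<bar> \<le> 1 / 2" "\<bar>T i powr k + snd \<eta> + d' - T j powr k\<bar> \<le> 1 / 2"
      using l by (simp_all add: mult_le_cancel_left_pos del: mult_1_right)
    then show ?thesis using \<eta> by linarith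
  qed
  have arcs: "x - arc s u + arc s w = (fst x + e1 * ?l1 * (w - u), snd x + e2 * ?l2 * (w powr k - u powr k))" for u w
    by (simp add: arc_def prod_eq_iff algebra_simps)
  have Cm: "ennreal (k * (T l + 3) powr (k - 1)) \<le> ennreal (k * (T 2 + 3) powr (k - 1))" if "l \<le> 2" for l
    using T_le[OF that] T0 k by (intro ennreal_leI mult_left_mono powr_mono2) auto
  define G where "G d d' = H (fst x + e1 * ?l1 * d, snd x + e2 * ?l2 * d')" for d d'
  have "\<exists>\<sigma>. \<bar>\<sigma>\<bar> = 1 \<and> (\<integral>\<^sup>+d. \<integral>\<^sup>+d'. H (fst x + \<sigma> * (e1 * ?l1) * d, snd x + \<sigma> * (e2 * ?l2) * d') \<partial>lborel \<partial>lborel) \<le> ennreal cost * R"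
  proof (cases "i < j")
    case True
    have sp: "spaced k (T i) (T j)" using True ij by (intro T_spaced) auto
    have "(\<integral>\<^sup>+d. \<integral>\<^sup>+d'. H (fst x + e1 * ?l1 * d, snd x + e2 * ?l2 * d') \<partial>lborel \<partial>lborel) \<le>
       ennreal (k * (T j + 3) powr (k - 1)) * (\<integral>\<^sup>+u. \<integral>\<^sup>+w. indicator {T i - 2..T i + 2} u * indicator {T j - 3..T j + 3} w *
           H (fst x + e1 * ?l1 * (w - u), snd x + e2 * ?l2 * (w powr k - u powr k)) \<partial>lborel \<partial>lborel)"
      unfolding G_def[symmetric]
    proof (rule nn_integral_chord[where G = G, OF _ k sp])
      show "(\<lambda>(x, y). G x y) \<in> borel_measurable borel" unfolding G_def by (rule measurable_plane_affine[OF Hm])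
      show "\<bar>d - (T j - T i)\<bar> \<le> 1 \<and> \<bar>d' - (T j powr k - T i powr k)\<bar> \<le> 1" if "G d d' \<noteq> 0" for d d'
        using Hsupp[of d d'] that unfolding G_def .
    qed
    also have "\<dots> \<le> ennreal (k * (T 2 + 3) powr (k - 1)) * (\<integral>\<^sup>+u. \<integral>\<^sup>+w. ennreal ((b1 * ub)\<^sup>2) *
        (indicator (Pset c s) (x - arc s u) * arc_density u * (arc_density w * F (x - arc s u + arc s w))) \<partial>lborel \<partial>lborel)"
    proof (rule mult_mono[OF Cm nn_integral_mono[OF nn_integral_mono]])
      fix u w :: real
      show "indicator {T i - 2..T i + 2} u * indicator {T j - 3..T j + 3} w * H (fst x + e1 * ?l1 * (w - u), snd x + e2 * ?l2 * (w powr k - u powr k))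
        \<le> ennreal ((b1 * ub)\<^sup>2) * (indicator (Pset c s) (x - arc s u) * arc_density u * (arc_density w * F (x - arc s u + arc s w)))"
      proof (cases "u \<in> {T i - 2..T i + 2} \<and> w \<in> {T j - 3..T j + 3}")
        case True
        then have "\<bar>u - T i\<bar> \<le> 3" "\<bar>w - T j\<bar> \<le> 3" by (auto simp: abs_le_iff)
        from order_trans[OF HF win[OF this]] True show ?thesis by (simp add: arcs)
      qed auto
    qed (use ij in simp_all)
    also have "\<dots> = ennreal (k * (T 2 + 3) powr (k - 1)) * (ennreal ((b1 * ub)\<^sup>2) * R)"
      unfolding R_def by (simp add: nn_integral_cmult)
    also have "\<dots> = ennreal cost * R" using k by (simp add: cost_def ennreal_mult mult_ac)
    finally show ?thesis by (intro exI[of _ 1]) simp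
  next
    case False
    then have ji: "j < i" using ij by simp
    have sp: "spaced k (T j) (T i)" using ji ij by (intro T_spaced) auto
    \<comment> \<open>\<open>nn_integral_chord\<close> wants the smaller time first. For
      \<open>j < i\<close> it is applied to the reflected function, and Fubini then restores the
      order of the two steps.\<close>
    define H' where "H' d d' = H (fst x + (- (e1 * ?l1)) * d, snd x + (- (e2 * ?l2)) * d')" for d d'
    have H'_eq: "H' d d' = H (fst x + e1 * ?l1 * (- d), snd x + e2 * ?l2 * (- d'))" for d d'
      unfolding H'_def by (simp only: mult_minus_left mult_minus_right)
    have "(\<integral>\<^sup>+d. \<integral>\<^sup>+d'. H' d d' \<partial>lborel \<partial>lborel) \<le> ennreal (k * (T i + 3) powr (k - 1)) * (\<integral>\<^sup>+w. \<integral>\<^sup>+u. indicator {T j - 2..T j + 2} w * indicator {T i - 3..T i + 3} u *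
           H' (u - w) (u powr k - w powr k) \<partial>lborel \<partial>lborel)"
    proof (rule nn_integral_chord[where G = H', OF _ k sp])
      show "(\<lambda>(x, y). H' x y) \<in> borel_measurable borel"
        unfolding H'_def by (rule measurable_plane_affine[OF Hm])
      show "\<bar>d - (T i - T j)\<bar> \<le> 1 \<and> \<bar>d' - (T i powr k - T j powr k)\<bar> \<le> 1" if "H' d d' \<noteq> 0" for d d'
        using Hsupp[of "- d" "- d'"] that unfolding H'_eq by (auto simp: abs_le_iff)
    qed
    also have "\<dots> \<le> ennreal (k * (T 2 + 3) powr (k - 1)) * (\<integral>\<^sup>+w. \<integral>\<^sup>+u. ennreal ((b1 * ub)\<^sup>2) *
        (indicator (Pset c s) (x - arc s u) * arc_density u * (arc_density w * F (x - arc s u + arc s w))) \<partial>lborel \<partial>lborel)"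
    proof (rule mult_mono[OF Cm nn_integral_mono[OF nn_integral_mono]])
      fix w u :: real
      show "indicator {T j - 2..T j + 2} w * indicator {T i - 3..T i + 3} u * H' (u - w) (u powr k - w powr k)
        \<le> ennreal ((b1 * ub)\<^sup>2) * (indicator (Pset c s) (x - arc s u) * arc_density u * (arc_density w * F (x - arc s u + arc s w)))"
      proof (cases "u \<in> {T i - 3..T i + 3} \<and> w \<in> {T j - 2..T j + 2}")
        case True
        then have "\<bar>u - T i\<bar> \<le> 3" "\<bar>w - T j\<bar> \<le> 3" by (auto simp: abs_le_iff)
        from order_trans[OF HF win[OF this]] True show ?thesis by (simp add: arcs H'_eq)
      qed auto
    qed (use ij in simp_all)
    also have "(\<integral>\<^sup>+w. \<integral>\<^sup>+u. ennreal ((b1 * ub)\<^sup>2) *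
        (indicator (Pset c s) (x - arc s u) * arc_density u * (arc_density w * F (x - arc s u + arc s w))) \<partial>lborel \<partial>lborel)
      = (\<integral>\<^sup>+u. \<integral>\<^sup>+w. ennreal ((b1 * ub)\<^sup>2) *
        (indicator (Pset c s) (x - arc s u) * arc_density u * (arc_density w * F (x - arc s u + arc s w))) \<partial>lborel \<partial>lborel)"
      by (rule lborel_pair.Fubini') measurable
    also have "ennreal (k * (T 2 + 3) powr (k - 1)) * \<dots> = ennreal (k * (T 2 + 3) powr (k - 1)) * (ennreal ((b1 * ub)\<^sup>2) * R)"
      unfolding R_def by (simp add: nn_integral_cmult)
    also have "\<dots> = ennreal cost * R" using k by (simp add: cost_def ennreal_mult mult_ac)
    finally show ?thesis by (intro exI[of _ "-1"]) (simp add: H'_eq)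
  qed
  then obtain \<sigma> where sg: "\<bar>\<sigma>\<bar> = 1"
    and main: "(\<integral>\<^sup>+d. \<integral>\<^sup>+d'. H (fst x + \<sigma> * (e1 * ?l1) * d, snd x + \<sigma> * (e2 * ?l2) * d') \<partial>lborel \<partial>lborel) \<le> ennreal cost * R"
    by blast
  have nz: "\<sigma> * (e1 * ?l1) \<noteq> 0" "\<sigma> * (e2 * ?l2) \<noteq> 0" using sg e l by auto
  have ab: "\<bar>\<sigma> * (e1 * ?l1)\<bar> = ?l1" "\<bar>\<sigma> * (e2 * ?l2)\<bar> = ?l2" using sg e by (simp_all add: abs_mult)
  have "(\<integral>\<^sup>+y. H y \<partial>lborel) = ennreal (?l1 * ?l2) * (\<integral>\<^sup>+d. \<integral>\<^sup>+d'. H (fst x + \<sigma> * (e1 * ?l1) * d, snd x + \<sigma> * (e2 * ?l2) * d') \<partial>lborel \<partial>lborel)"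
    using nn_integral_lborel_plane_affine[of H, OF _ nz, of "fst x" "snd x"] unfolding ab by simp
  also have "\<dots> \<le> ennreal (?l1 * ?l2) * (ennreal cost * R)" by (rule mult_left_mono[OF main]) simp
  also have "\<dots> = ennreal (cost * (?l1 * ?l2)) * R" using cost l by (simp add: ennreal_mult mult_ac)
  finally show ?thesis unfolding Rk H_def .
qed

end

section \<open>The Doeblin condition for steps along the curve\<close>

lemma emeasure_cube_lborel:
  assumes "0 < s" shows "emeasure lborel (cube \<beta> c s) = ennreal (s powr fst \<beta> * s powr snd \<beta>)"
    "measure lborel (cube \<beta> c s) = s powr fst \<beta> * s powr snd \<beta>"
proof -
  have e: "cube \<beta> c s = cbox (fst c - s powr fst \<beta> / 2, snd c - s powr snd \<beta> / 2) (fst c + s powr fst \<beta> / 2, snd c + s powr snd \<beta> / 2)"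
    by (simp add: cube_def cbox_Pair_eq)
  show m: "measure lborel (cube \<beta> c s) = s powr fst \<beta> * s powr snd \<beta>"
    unfolding e content_Pair by simp
  show "emeasure lborel (cube \<beta> c s) = ennreal (s powr fst \<beta> * s powr snd \<beta>)"
    unfolding m[symmetric] e
    by (rule emeasure_eq_ennreal_measure, rule less_imp_neq[OF emeasure_lborel_cbox_finite[unfolded infinity_ennreal_def]])
qed

lemma le_indicator_mono: "A \<subseteq> B \<Longrightarrow> indicator A x \<le> (indicator B x :: real)"
  by (auto simp: indicator_def)

context monomial begin

lemma tcube_measure:
  assumes "0 < s"
  shows "emeasure lborel (tcube c s i) = ennreal (s powr b1 * s powr b2)" "measure lborel (tcube c s i) = s powr b1 * s powr b2"
  unfolding tcube_def by (rule emeasure_cube_lborel[OF assms])+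

lemma doeblin_pair_kappa:
  assumes s: "0 < s"
  shows "doeblin_pair (\<kappa> s) (Aset c s) (Pset c s) (1 / (cost * (s powr b1 * s powr b2))) (s powr b1 * s powr b2)"
proof -
  interpret convolution_pair "\<kappa> s" by (rule convolution_pair_kappa)
  let ?V = "s powr b1 * s powr b2"
  have V: "0 < ?V" using s by simp
  have Afin: "emeasure lborel (Aset c s) < \<infinity>"
  proof -
    have "emeasure lborel (Aset c s) \<le> (\<Sum>i\<in>{..2}. emeasure lborel (tcube c s i))"
      unfolding Aset_def by (rule emeasure_subadditive_finite) auto
    also have "\<dots> < \<infinity>" by (simp add: tcube_measure[OF s] ennreal_mult_less_top)
    finally show ?thesis .
  qed
  have Pfin: "emeasure lborel (Pset c s) < \<infinity>"
  proof -
    define p where "p = c - arc s (T 0)"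
    have "Pset c s = cbox (fst p - 4 * s powr b1, snd p - (T 0 powr k - 1) * s powr b2) (fst p + 4 * s powr b1, snd p + (T 0 powr k - 1) * s powr b2)"
      by (simp add: Pset_def Let_def p_def[symmetric] cbox_Pair_eq)
    then show ?thesis by (simp only: emeasure_lborel_cbox_finite)
  qed
  have Apos: "0 < measure lborel (Aset c s)"
  proof -
    have "measure lborel (tcube c s 0) \<le> measure lborel (Aset c s)"
    proof (rule measure_mono_fmeasurable)
      show "Aset c s \<in> fmeasurable lborel" using Afin by (intro fmeasurableI) auto
    qed (auto simp: Aset_def)
    then show ?thesis using V by (simp add: tcube_measure[OF s])
  qed
  have min: "1 / (cost * ?V) * (\<integral>y. indicator (tcube c s j) y * F y \<partial>lborel) \<le> spread (\<lambda>y. indicator (Pset c s) y * cospread F y) z"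
    if ij: "i \<le> 2" "j \<le> 2" "i \<noteq> j" and z: "z \<in> tcube c s i" and F [measurable]: "F \<in> borel_measurable borel"
      and FK: "\<And>y. 0 \<le> F y \<and> F y \<le> (K::real)" for i j z F K
  proof -
    have F1: "\<bar>F y\<bar> \<le> K" for y using FK[of y] by simp
    have K0: "0 \<le> K" using FK[of 0] by linarith
    have iF: "integrable lborel (\<lambda>y. indicator (tcube c s j) y * F y)"
    proof (rule Bochner_Integration.integrable_bound)
      show "integrable lborel (\<lambda>y. K * indicator (tcube c s j) y)" by (simp add: tcube_measure[OF s])
      show "AE y in lborel. norm (indicat_real (tcube c s j) y * F y) \<le> norm (K * indicat_real (tcube c s j) y)"
        using F1 by (auto simp: indicator_def intro!: AE_I2 order_trans[OF F1])
    qed measurable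
    have 1: "(\<integral>\<^sup>+y. indicator (tcube c s j) y * ennreal (F y) \<partial>lborel) = ennreal (\<integral>y. indicator (tcube c s j) y * F y \<partial>lborel)"
    proof -
      have "(\<integral>\<^sup>+y. indicator (tcube c s j) y * ennreal (F y) \<partial>lborel) = (\<integral>\<^sup>+y. ennreal (indicator (tcube c s j) y * F y) \<partial>lborel)"
        by (intro nn_integral_cong) (simp add: indicator_def)
      also have "\<dots> = ennreal (\<integral>y. indicator (tcube c s j) y * F y \<partial>lborel)"
        using FK by (intro nn_integral_eq_integral iF) auto
      finally show ?thesis .
    qed
    have co: "(\<integral>\<^sup>+w. ennreal (F (y + w)) \<partial>\<kappa> s) = ennreal (cospread F y)" for y
      unfolding cospread_def using F1 FK by (intro nn_integral_eq_integral integrable_bounded[where K = K]) auto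
    have cb: "0 \<le> cospread F y" "cospread F y \<le> measure (\<kappa> s) UNIV * K" for y
    proof -
      show "0 \<le> cospread F y" unfolding cospread_def using FK by (intro Bochner_Integration.integral_nonneg) auto
      have "cospread F y \<le> (\<integral>w. K \<partial>\<kappa> s)" unfolding cospread_def
        using F1 FK K0 by (intro integral_mono integrable_bounded[where K = K]) auto
      then show "cospread F y \<le> measure (\<kappa> s) UNIV * K" by (simp add: \<kappa>_def)
    qed
    have 2: "(\<integral>\<^sup>+v. indicator (Pset c s) (z - v) * (\<integral>\<^sup>+w. ennreal (F (z - v + w)) \<partial>\<kappa> s) \<partial>\<kappa> s)
        = ennreal (spread (\<lambda>y. indicator (Pset c s) y * cospread F y) z)"
    proof -
      have "(\<integral>\<^sup>+v. indicator (Pset c s) (z - v) * (\<integral>\<^sup>+w. ennreal (F (z - v + w)) \<partial>\<kappa> s) \<partial>\<kappa> s)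
          = (\<integral>\<^sup>+v. ennreal (indicator (Pset c s) (z - v) * cospread F (z - v)) \<partial>\<kappa> s)"
        unfolding co by (intro nn_integral_cong) (simp add: indicator_def)
      also have "\<dots> = ennreal (spread (\<lambda>y. indicator (Pset c s) y * cospread F y) z)"
        unfolding spread_def
      proof (intro nn_integral_eq_integral integrable_bounded)
        show "\<bar>indicat_real (Pset c s) (z - v) * cospread F (z - v)\<bar> \<le> measure (\<kappa> s) UNIV * K" for v
          using cb[of "z - v"] by (auto simp: indicator_def)
      qed (use cb in auto)
      finally show ?thesis .
    qed
    have "ennreal (\<integral>y. indicator (tcube c s j) y * F y \<partial>lborel)
        \<le> ennreal (cost * ?V) * ennreal (spread (\<lambda>y. indicator (Pset c s) y * cospread F y) z)"
      using chord_minorization[OF s ij z, of "\<lambda>y. ennreal (F y)"] unfolding 1 2 by simp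
    moreover have "0 \<le> spread (\<lambda>y. indicator (Pset c s) y * cospread F y) z"
      unfolding spread_def using cb by (intro Bochner_Integration.integral_nonneg) auto
    ultimately have "(\<integral>y. indicator (tcube c s j) y * F y \<partial>lborel) \<le> cost * ?V * spread (\<lambda>y. indicator (Pset c s) y * cospread F y) z"
      using cost V by (subst (asm) ennreal_mult[symmetric]) auto
    then have "(\<integral>y. indicator (tcube c s j) y * F y \<partial>lborel) / (cost * ?V) \<le> spread (\<lambda>y. indicator (Pset c s) y * cospread F y) z"
      using mult_pos_pos[OF cost V] by (subst pos_divide_le_eq) (simp_all add: mult.commute)
    then show ?thesis by simp
  qed
  show ?thesis
  proof (rule doeblin_pair.intro[OF convolution_pair_kappa], rule doeblin_pair_axioms.intro)
    show "0 < measure (\<kappa> s) UNIV" by (simp add: measure_kappa mass)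
    show "0 < 1 / (cost * ?V)" using mult_pos_pos[OF cost V] by simp
    fix x x' assume "x \<in> Aset c s" "x' \<in> Aset c s"
    then obtain i i' where i: "i \<le> 2" "x \<in> tcube c s i" and i': "i' \<le> 2" "x' \<in> tcube c s i'" by (auto simp: Aset_def)
    \<comment> \<open>The common target: three indices always leave one different from both
      \<open>i\<close> and \<open>i'\<close>.\<close>
    have "\<exists>j\<le>2. j \<noteq> i \<and> j \<noteq> i'" by presburger
    then obtain j where j: "j \<le> 2" "i \<noteq> j" "i' \<noteq> j" by blast
    show "\<exists>B\<in>sets borel. B \<subseteq> Aset c s \<and> measure lborel B = ?V \<and>
      (\<forall>z\<in>{x, x'}. \<forall>F K. F \<in> borel_measurable borel \<longrightarrow> (\<forall>y. 0 \<le> F y \<and> F y \<le> (K::real)) \<longrightarrow>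
        1 / (cost * ?V) * (\<integral>y. indicator B y * F y \<partial>lborel) \<le> spread (\<lambda>y. indicator (Pset c s) y * cospread F y) z)"
    proof (intro bexI[of _ "tcube c s j"] conjI ballI allI impI)
      fix z :: "real \<times> real" and F :: "real \<times> real \<Rightarrow> real" and K :: real
      assume z: "z \<in> {x, x'}" and F: "F \<in> borel_measurable borel" "\<forall>y. 0 \<le> F y \<and> F y \<le> (K::real)"
      show "1 / (cost * ?V) * (\<integral>y. indicator (tcube c s j) y * F y \<partial>lborel) \<le> spread (\<lambda>y. indicator (Pset c s) y * cospread F y) z"
        using z
      proof (elim insertE emptyE)
        assume "z = x"
        then show ?thesis using min[OF i(1) j(1,2) _ F(1), of z K] i F(2) by blast
      next
        assume "z = x'"
        then show ?thesis using min[OF i'(1) j(1,3) _ F(1), of z K] i' F(2) by blast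
      qed
    qed (use j in \<open>auto simp: Aset_def tcube_measure[OF s]\<close>)
  qed (use Afin Pfin Apos V in auto)
qed

section \<open>Comparison of the step measure with the Hilbert transform\<close>

lemma measurable_curve [measurable]: "\<gamma> \<in> borel_measurable borel"
  unfolding monomial_curve_def by measurable

definition "t_min s = s * ua powr (1 / b1)"
definition "t_max s = s * ub powr (1 / b1)"

text \<open>This is where \<open>\<epsilon> \<noteq> \<delta>\<close> enters: the other branch of the curve does not lead from \<open>Aset\<close> to \<open>Pset\<close>.\<close>

lemma curve_hits:
  assumes s: "0 < s" and x: "x \<in> Aset c s" and y: "x - \<gamma> t \<in> Pset c s"
  shows "t \<in> {t_min s..t_max s}"
proof -
  let ?l1 = "s powr b1" and ?l2 = "s powr b2"
  have l: "0 < ?l1" "0 < ?l2" using s by auto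
  obtain i where i: "i \<le> 2" "x \<in> tcube c s i" using x by (auto simp: Aset_def)
  obtain \<eta> where \<eta>: "\<bar>fst \<eta>\<bar> \<le> 1 / 2" "\<bar>snd \<eta>\<bar> \<le> 1 / 2"
    "x = (fst c - e1 * ?l1 * T 0 + e1 * ?l1 * (T i + fst \<eta>), snd c - e2 * ?l2 * T 0 powr k + e2 * ?l2 * (T i powr k + snd \<eta>))"
    using tcube_coords[OF s, of x c i] i(2) by metis
  define g1 where "g1 = e1 * fst (\<gamma> t) / ?l1"
  define g2 where "g2 = e2 * snd (\<gamma> t) / ?l2"
  have g: "fst (\<gamma> t) = e1 * ?l1 * g1" "snd (\<gamma> t) = e2 * ?l2 * g2"
    using l e by (simp_all add: g1_def g2_def)
  have p: "fst (x - \<gamma> t) - (fst c - e1 * ?l1 * T 0) = e1 * ?l1 * (T i + fst \<eta> - g1)"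
    "snd (x - \<gamma> t) - (snd c - e2 * ?l2 * T 0 powr k) = e2 * ?l2 * (T i powr k + snd \<eta> - g2)"
    unfolding fst_diff snd_diff g by (simp_all add: \<eta>(3) algebra_simps)
  have "?l1 * \<bar>T i + fst \<eta> - g1\<bar> \<le> ?l1 * 4" "?l2 * \<bar>T i powr k + snd \<eta> - g2\<bar> \<le> ?l2 * (T 0 powr k - 1)"
    using y unfolding mem_Pset p by (simp_all add: abs_mult e mult.commute)
  then have q: "\<bar>T i + fst \<eta> - g1\<bar> \<le> 4" "\<bar>T i powr k + snd \<eta> - g2\<bar> \<le> T 0 powr k - 1"
    using l by (simp_all only: mult_le_cancel_left_pos)
  have Tk: "T 0 powr k \<le> T i powr k" using T_le(1)[OF i(1)] T0 k by (intro powr_mono2) auto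
  have g1: "ua \<le> g1" "g1 \<le> ub" using q(1) \<eta>(1) T_le[OF i(1)] unfolding ua_def ub_def by linarith+
  have g2: "0 < g2" using q(2) \<eta>(2) Tk by linarith
  have "0 < e1 * fst (\<gamma> t)" "0 < e2 * snd (\<gamma> t)"
  proof -
    have "0 < ?l1 * g1" "0 < ?l2 * g2" using l g1 g2 uab by auto
    moreover have "e1 * fst (\<gamma> t) = (e1 * e1) * (?l1 * g1)" "e2 * snd (\<gamma> t) = (e2 * e2) * (?l2 * g2)"
      unfolding g by (simp_all only: mult_ac)
    ultimately show "0 < e1 * fst (\<gamma> t)" "0 < e2 * snd (\<gamma> t)" using e by simp_all
  qed note pos = this
  \<comment> \<open>On the other branch, positivity of both products would force \<delta> =
    \<epsilon>.\<close>
  have t: "0 < t"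
  proof (rule ccontr)
    assume "\<not> 0 < t"
    then have "\<gamma> t = (fst \<delta> * \<bar>t\<bar> powr b1, snd \<delta> * \<bar>t\<bar> powr b2)" by (simp add: monomial_curve_def)
    then have "0 < (e1 * fst \<delta>) * \<bar>t\<bar> powr b1" "0 < (e2 * snd \<delta>) * \<bar>t\<bar> powr b2" using pos by (simp_all add: mult.assoc)
    then have "0 < e1 * fst \<delta>" "0 < e2 * snd \<delta>" by (simp_all add: zero_less_mult_iff)
    then show False using params by (auto simp: monomial_params_def mem_Times_iff)
  qed
  have "e1 * fst (\<gamma> t) = e1 * e1 * t powr b1" using t by (simp add: monomial_curve_def)
  moreover have "e1 * fst (\<gamma> t) = e1 * e1 * (?l1 * g1)" unfolding g by (simp only: mult_ac)
  ultimately have tg: "t powr b1 = ?l1 * g1" using e by simp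
  have tt: "t = (t powr b1) powr (1 / b1)" using t b by (simp add: powr_powr)
  have ss: "s = ?l1 powr (1 / b1)" using s b by (simp add: powr_powr)
  have "t = (?l1 * g1) powr (1 / b1)" unfolding tg[symmetric] by (rule tt)
  also have "\<dots> = ?l1 powr (1 / b1) * g1 powr (1 / b1)" by (simp only: powr_mult)
  finally have "t = s * g1 powr (1 / b1)" unfolding ss[symmetric] .
  moreover have "ua powr (1 / b1) \<le> g1 powr (1 / b1)" "g1 powr (1 / b1) \<le> ub powr (1 / b1)"
    using g1 uab b by (auto intro!: powr_mono2)
  ultimately show ?thesis using s by (simp add: t_min_def t_max_def)
qed

lemma t_min: "0 < s \<Longrightarrow> 0 < t_min s" "0 < s \<Longrightarrow> t_min s \<le> t_max s"
  using uab b by (auto simp: t_min_def t_max_def intro!: powr_mono2)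

lemma kappa_eq:
  assumes s: "0 < s"
  shows "\<kappa> s = distr (density lborel (\<lambda>t. ennreal (indicator {t_min s..t_max s} t / t))) borel \<gamma>"
proof (rule measure_eqI)
  show "sets (\<kappa> s) = sets (distr (density lborel (\<lambda>t. ennreal (indicator {t_min s..t_max s} t / t))) borel \<gamma>)"
    by (simp add: \<kappa>_def)
  fix X assume "X \<in> sets (\<kappa> s)"
  then have [measurable]: "X \<in> sets borel" by (simp add: \<kappa>_def)
  define g where "g u = s * u powr (1 / b1)" for u
  define g' where "g' u = s / b1 * u powr (1 / b1 - 1)" for u
  have gab: "g ua = t_min s" "g ub = t_max s" by (simp_all add: g_def t_min_def t_max_def)
  have lt: "ua < ub" using T0 T_le(1)[of 2] by (simp add: ua_def ub_def)
  have "emeasure (distr (density lborel (\<lambda>t. ennreal (indicator {t_min s..t_max s} t / t))) borel \<gamma>) X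
     = (\<integral>\<^sup>+t. ennreal (indicator {t_min s..t_max s} t / t) * indicator X (\<gamma> t) \<partial>lborel)"
  proof -
    let ?D = "density lborel (\<lambda>t. ennreal (indicator {t_min s..t_max s} t / t))"
    have "emeasure (distr ?D borel \<gamma>) X = (\<integral>\<^sup>+v. indicator X v \<partial>distr ?D borel \<gamma>)" by simp
    also have "\<dots> = (\<integral>\<^sup>+t. indicator X (\<gamma> t) \<partial>?D)" by (rule nn_integral_distr) measurable
    also have "\<dots> = (\<integral>\<^sup>+t. ennreal (indicator {t_min s..t_max s} t / t) * indicator X (\<gamma> t) \<partial>lborel)"
      by (rule nn_integral_density) measurable
    finally show ?thesis .
  qed
  also have "\<dots> = (\<integral>\<^sup>+t. (ennreal (1 / t) * indicator X (\<gamma> t)) * indicator {g ua..g ub} t \<partial>lborel)"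
    unfolding gab by (intro nn_integral_cong) (simp add: indicator_def)
  also have "\<dots> = (\<integral>\<^sup>+u. (ennreal (1 / g u) * indicator X (\<gamma> (g u))) * ennreal (g' u) * indicator {ua..ub} u \<partial>lborel)"
  proof (rule nn_integral_substitution_aux)
    show "(g has_real_derivative g' u) (at u)" if "u \<in> {ua..ub}" for u
      unfolding g_def g'_def using that uab by (auto intro!: derivative_eq_intros)
    show "continuous_on {ua..ub} g'"
      unfolding g'_def using uab by (intro continuous_intros) auto
    show "0 \<le> g' u" for u using s b by (simp add: g'_def)
  qed (use lt in auto)
  also have "\<dots> = (\<integral>\<^sup>+u. arc_density u * indicator X (arc s u) \<partial>lborel)"
  proof (rule nn_integral_cong)
    fix u :: real
    show "(ennreal (1 / g u) * indicator X (\<gamma> (g u))) * ennreal (g' u) * indicator {ua..ub} u = arc_density u * indicator X (arc s u)"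
    proof (cases "u \<in> {ua..ub}")
      case True
      then have u: "0 < u" using uab by simp
      have gp: "0 < g u" using s u by (simp add: g_def)
      have "g u powr b1 = s powr b1 * u" "g u powr b2 = s powr b2 * u powr k"
        using s u b by (simp_all add: g_def powr_mult powr_powr k_def)
      then have a: "\<gamma> (g u) = arc s u" using gp by (simp add: monomial_curve_def arc_def)
      have "u powr (1 / b1 - 1) = u powr (1 / b1) / u" using u by (simp add: powr_diff)
      then have "1 / g u * g' u = 1 / (b1 * u)" using s u b by (simp add: g_def g'_def)
      then have "ennreal (1 / g u) * ennreal (g' u) = ennreal (1 / (b1 * u))"
        using gp s b by (subst ennreal_mult[symmetric]) (auto simp: g'_def)
      then have d: "ennreal (1 / g u) * ennreal (g' u) = arc_density u" using True by (simp add: arc_density_def)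
      show ?thesis using True unfolding a d[symmetric] by (simp add: mult_ac)
    qed (simp add: arc_density_def)
  qed
  also have "\<dots> = emeasure (\<kappa> s) X"
    using nn_integral_kappa[of "indicator X" s] by (simp add: \<kappa>_def)
  finally show "emeasure (\<kappa> s) X = emeasure (distr (density lborel (\<lambda>t. ennreal (indicator {t_min s..t_max s} t / t))) borel \<gamma>) X"
    by simp
qed

text \<open>Only times in \<open>[t_min s, t_max s]\<close> lead from \<open>Aset\<close> to
  \<open>Pset\<close>. All truncations below \<open>t_min s\<close> therefore agree, and no
  cancellation at \<open>t = 0\<close> is involved in the principal value.\<close>

lemma hilbert_eq_spread:
  fixes B :: "real \<times> real \<Rightarrow> complex"
  assumes s: "0 < s" and x: "x \<in> Aset c s" and [measurable]: "B \<in> borel_measurable borel"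
    and B0: "\<And>y. y \<notin> Pset c s \<Longrightarrow> B y = 0"
  shows "hilbert \<gamma> B x = convolution_pair.spread (\<kappa> s) B x"
proof -
  interpret convolution_pair "\<kappa> s" by (rule convolution_pair_kappa)
  let ?I = "{t_min s..t_max s}"
  have z: "B (x - \<gamma> t) = 0" if "t \<notin> ?I" for t
    using curve_hits[OF s x, of t] B0 that by blast
  have tr: "truncated_hilbert \<gamma> \<eta> B x = spread B x" if \<eta>: "0 < \<eta>" "\<eta> < t_min s" for \<eta>
  proof -
    have "truncated_hilbert \<gamma> \<eta> B x = (LINT t|lebesgue. (indicator ?I t / t) *\<^sub>R B (x - \<gamma> t))"
      unfolding truncated_hilbert_def set_lebesgue_integral_def
    proof (rule Bochner_Integration.integral_cong[OF refl])
      fix t :: real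
      show "indicat_real {t. \<eta> < \<bar>t\<bar>} t *\<^sub>R (B (x - \<gamma> t) / complex_of_real t) = (indicator ?I t / t) *\<^sub>R B (x - \<gamma> t)"
      proof (cases "t \<in> ?I")
        case True
        then have "0 < t" "\<eta> < \<bar>t\<bar>" using t_min[OF s] \<eta> by auto
        then show ?thesis using True by (simp add: scaleR_conv_of_real)
      next
        case False
        then show ?thesis using z by simp
      qed
    qed
    also have "\<dots> = (LINT t|lborel. (indicator ?I t / t) *\<^sub>R B (x - \<gamma> t))"
      by (rule integral_completion) measurable
    also have "\<dots> = (LINT t|density lborel (\<lambda>t. ennreal (indicator ?I t / t)). B (x - \<gamma> t))"
      using t_min[OF s] by (intro integral_density[symmetric]) (auto simp: indicator_def)
    also have "\<dots> = (LINT v|\<kappa> s. B (x - v))"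
      unfolding kappa_eq[OF s] by (rule integral_distr[symmetric]) measurable
    finally show ?thesis by (simp add: spread_def)
  qed
  have "eventually (\<lambda>\<eta>. truncated_hilbert \<gamma> \<eta> B x = spread B x) (at_right 0)"
    using eventually_at_right_less[of "0::real"] eventually_at_right_field[of "\<lambda>\<eta>. \<eta> < t_min s" 0] t_min(1)[OF s] tr
    unfolding eventually_at_right_field by (intro exI[of _ "t_min s"]) auto
  then have "((\<lambda>\<eta>. truncated_hilbert \<gamma> \<eta> B x) \<longlongrightarrow> spread B x) (at_right 0)"
    by (rule tendsto_eventually)
  then show ?thesis unfolding hilbert_def by (intro tendsto_Lim) auto
qed

text \<open>The root of the smaller exponent serves both coordinates: as the base is at least 1,
  \<open>reach powr b2\<close> is no less than \<open>reach powr b1\<close>.\<close>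

definition "reach = (2 * ub + 4 * ub powr k + 1) powr (1 / b1)"

lemma reach: "1 \<le> reach"
  unfolding reach_def using uab b by (intro ge_one_powr_ge_zero) auto

lemma sets_subset_reach:
  assumes s: "0 < s"
  shows "Aset c s \<subseteq> cube \<beta> c (reach * s)" "Pset c s \<subseteq> cube \<beta> c (reach * s)"
proof -
  let ?Y = "2 * ub + 4 * ub powr k + 1"
  let ?l1 = "s powr b1" and ?l2 = "s powr b2"
  have Y: "1 \<le> ?Y" using uab by simp
  have r1: "reach powr b1 = ?Y" using Y b by (simp add: reach_def powr_powr)
  have "reach powr b1 \<le> reach powr b2" using reach b by (intro powr_mono) auto
  then have r2: "?Y \<le> reach powr b2" using r1 by simp
  have m1: "(reach * s) powr b1 = ?Y * ?l1" by (simp add: powr_mult r1)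
  have m2: "?Y * ?l2 \<le> (reach * s) powr b2" using r2 by (simp add: powr_mult mult_right_mono)
  have i1: "\<bar>e1 * ?l1 * d\<bar> \<le> (reach * s) powr b1 / 2" if "\<bar>d\<bar> \<le> ub" for d
  proof -
    have "?Y / 2 = ub + 2 * ub powr k + 1 / 2" by simp
    then have "\<bar>d\<bar> \<le> ?Y / 2" using that uab powr_ge_zero[of ub k] by linarith
    then have "?l1 * \<bar>d\<bar> \<le> ?l1 * (?Y / 2)" by (rule mult_left_mono) simp
    then show ?thesis unfolding m1 by (simp add: abs_mult e mult.commute)
  qed
  have i2: "\<bar>e2 * ?l2 * d\<bar> \<le> (reach * s) powr b2 / 2" if "\<bar>d\<bar> \<le> 2 * ub powr k" for d
  proof -
    have "?Y / 2 = ub + 2 * ub powr k + 1 / 2" by simp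
    then have "\<bar>d\<bar> \<le> ?Y / 2" using that uab by linarith
    then have "?l2 * \<bar>d\<bar> \<le> ?l2 * (?Y / 2)" by (rule mult_left_mono) simp
    then have "2 * \<bar>e2 * ?l2 * d\<bar> \<le> ?Y * ?l2" by (simp add: abs_mult e mult.commute)
    then show ?thesis using m2 by linarith
  qed
  have ubk: "1 \<le> ub powr k" using uab k by (intro ge_one_powr_ge_zero) auto
  have Tk: "T i powr k \<le> ub powr k" "0 \<le> T i powr k" "T 0 powr k \<le> ub powr k" if "i \<le> 2" for i
    using T_le[OF that] T_le(2)[of 0] T0 k by (auto intro!: powr_mono2 simp: ub_def)
  show "Aset c s \<subseteq> cube \<beta> c (reach * s)"
  proof
    fix x assume "x \<in> Aset c s"
    then obtain i where i: "i \<le> 2" "x \<in> tcube c s i" by (auto simp: Aset_def)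
    obtain \<eta> where \<eta>: "\<bar>fst \<eta>\<bar> \<le> 1 / 2" "\<bar>snd \<eta>\<bar> \<le> 1 / 2"
      "x = (fst c - e1 * ?l1 * T 0 + e1 * ?l1 * (T i + fst \<eta>), snd c - e2 * ?l2 * T 0 powr k + e2 * ?l2 * (T i powr k + snd \<eta>))"
      using tcube_coords[OF s, of x c i] i(2) by metis
    have x: "fst x - fst c = e1 * ?l1 * (T i + fst \<eta> - T 0)" "snd x - snd c = e2 * ?l2 * (T i powr k + snd \<eta> - T 0 powr k)"
      by (simp_all add: \<eta>(3) algebra_simps)
    have "\<bar>T i + fst \<eta> - T 0\<bar> \<le> ub" using \<eta> T_le[OF i(1)] T0 uab unfolding ub_def by linarith
    moreover have "\<bar>T i powr k + snd \<eta> - T 0 powr k\<bar> \<le> 2 * ub powr k"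
      using \<eta> Tk[OF i(1)] powr_ge_zero[of "T 0" k] ubk by linarith
    ultimately show "x \<in> cube \<beta> c (reach * s)" unfolding mem_cube x using i1 i2 by blast
  qed
  show "Pset c s \<subseteq> cube \<beta> c (reach * s)"
  proof
    fix y assume y: "y \<in> Pset c s"
    have f: "\<bar>fst y - fst c\<bar> \<le> \<bar>fst y - (fst c - e1 * ?l1 * T 0)\<bar> + \<bar>e1 * ?l1 * T 0\<bar>"
      "\<bar>snd y - snd c\<bar> \<le> \<bar>snd y - (snd c - e2 * ?l2 * T 0 powr k)\<bar> + \<bar>e2 * ?l2 * T 0 powr k\<bar>" by linarith+
    have "\<bar>e1 * ?l1 * T 0\<bar> = T 0 * ?l1" "\<bar>e2 * ?l2 * T 0 powr k\<bar> = T 0 powr k * ?l2"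
      using T0 by (simp_all add: abs_mult e)
    with f y have "\<bar>fst y - fst c\<bar> \<le> 4 * ?l1 + T 0 * ?l1" "\<bar>snd y - snd c\<bar> \<le> (T 0 powr k - 1) * ?l2 + T 0 powr k * ?l2"
      unfolding mem_Pset by linarith+
    then have g: "\<bar>fst y - fst c\<bar> \<le> ?l1 * (4 + T 0)" "\<bar>snd y - snd c\<bar> \<le> ?l2 * (2 * T 0 powr k - 1)"
      by (simp_all add: algebra_simps)
    have "?l1 * (4 + T 0) \<le> (reach * s) powr b1 / 2"
    proof -
      have "4 + T 0 \<le> ub" using T_le(2)[of 0] by (simp add: ub_def)
      then have "\<bar>4 + T 0\<bar> \<le> ub" using T0 by simp
      from i1[OF this] show ?thesis using T0 by (simp add: abs_mult e)
    qed
    moreover have "?l2 * (2 * T 0 powr k - 1) \<le> (reach * s) powr b2 / 2"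
    proof -
      have "1 \<le> T 0 powr k" using T0 k by (intro ge_one_powr_ge_zero) auto
      then have ge: "0 \<le> 2 * T 0 powr k - 1" by simp
      then have "\<bar>2 * T 0 powr k - 1\<bar> \<le> 2 * ub powr k" using Tk(3)[of 0] by simp
      from i2[OF this] show ?thesis using ge by (simp add: abs_mult e)
    qed
    ultimately show "y \<in> cube \<beta> c (reach * s)" unfolding mem_cube using g by linarith
  qed
qed

text \<open>On \<open>Aset\<close> the Hilbert transforms of \<open>h\<close> and \<open>b h\<close>
  are given by \<open>spread\<close>, and elsewhere \<open>g\<close> vanishes, so the form of the
  walk is the pairing with the commutator. By scaling, \<open>M / (c * vol)\<close> becomes
  \<open>mass * cost\<close>, independent of the cube.\<close>

theorem local_bound:
  fixes b :: "real \<times> real \<Rightarrow> complex"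
  assumes s: "0 < s" and b [measurable]: "b \<in> borel_measurable borel"
    and int: "integrable lborel (\<lambda>x. indicator (cube \<beta> c (reach * s)) x *\<^sub>R b x)"
  obtains g h where "g \<in> borel_measurable borel" "h \<in> borel_measurable borel"
    "\<And>x. \<bar>g x\<bar> \<le> indicator (cube \<beta> c (reach * s)) x" "\<And>x. \<bar>h x\<bar> \<le> indicator (cube \<beta> c (reach * s)) x"
    "integrable lborel (\<lambda>x. g x *\<^sub>R commutator \<gamma> b (\<lambda>x. of_real (h x)) x)"
    "(\<integral>x. indicator (cube \<beta> c s) x * cmod (b x - (\<integral>y. indicator (cube \<beta> c s) y *\<^sub>R b y \<partial>lborel) / of_real (measure lborel (cube \<beta> c s))) \<partial>lborel)
      \<le> 32 * mass * cost * cmod (\<integral>x. g x *\<^sub>R commutator \<gamma> b (\<lambda>x. of_real (h x)) x \<partial>lborel)"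
proof -
  interpret doeblin_pair "\<kappa> s" "Aset c s" "Pset c s" "1 / (cost * (s powr b1 * s powr b2))" "s powr b1 * s powr b2"
    by (rule doeblin_pair_kappa[OF s])
  let ?V = "s powr b1 * s powr b2"
  have V: "0 < ?V" using s by simp
  let ?R = "cube \<beta> c (reach * s)"
  \<comment> \<open>The cut-off makes \<open>b\<close> globally integrable and changes nothing on
    \<open>Aset\<close> and \<open>Pset\<close>, both contained in \<open>?R\<close>.\<close>
  define b0 where "b0 x = indicator ?R x *\<^sub>R b x" for x
  have b0 [measurable]: "b0 \<in> borel_measurable borel" unfolding b0_def by measurable
  have ib0: "integrable lborel b0" using int unfolding b0_def .
  have eq: "cube \<beta> c s = tcube c s 0" by (simp add: tcube_def)
  have QA: "cube \<beta> c s \<subseteq> Aset c s" unfolding eq by (auto simp: Aset_def)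
  have b0Q: "indicator (cube \<beta> c s) x *\<^sub>R b0 x = indicator (cube \<beta> c s) x *\<^sub>R b x" for x
    using QA sets_subset_reach(1)[OF s, of c] by (auto simp: b0_def indicator_def)
  have Qpos: "0 < measure lborel (cube \<beta> c s)" using V by (simp add: emeasure_cube_lborel[OF s])
  obtain g h where g [measurable]: "g \<in> borel_measurable borel" and h [measurable]: "h \<in> borel_measurable borel"
    and gA: "\<And>x. \<bar>g x\<bar> \<le> indicator (Aset c s) x" and hP: "\<And>x. \<bar>h x\<bar> \<le> indicator (Pset c s) x"
    and bound: "(\<integral>x. indicator (cube \<beta> c s) x * cmod (b0 x - (\<integral>y. indicator (cube \<beta> c s) y *\<^sub>R b0 y \<partial>lborel) / of_real (measure lborel (cube \<beta> c s))) \<partial>lborel)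
      \<le> 32 * M / (1 / (cost * ?V) * ?V) * cmod (form b0 g h)"
    by (rule oscillation_bound[OF ib0 cube_borel QA Qpos], rule that, assumption+)
  have g1: "\<bar>g x\<bar> \<le> 1" for x using gA[of x] by (cases "x \<in> Aset c s"; simp)
  have h1: "\<bar>h x\<bar> \<le> 1" for x using hP[of x] by (cases "x \<in> Pset c s"; simp)
  have hR: "integrable lborel (\<lambda>x. h x *\<^sub>R b0 x)" by (rule integrable_bounded_scaleR[OF ib0 _ h1]) simp
  have comm: "g x *\<^sub>R commutator \<gamma> b (\<lambda>x. of_real (h x)) x = (g x * spread h x) *\<^sub>R b0 x - g x *\<^sub>R spread (\<lambda>x. h x *\<^sub>R b0 x) x" for x
  proof (cases "x \<in> Aset c s")
    case True
    have h0: "h y = 0" if "y \<notin> Pset c s" for y using hP[of y] that by simp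
    have "hilbert \<gamma> (\<lambda>x. of_real (h x)) x = spread (\<lambda>x. complex_of_real (h x)) x"
      using h0 by (intro hilbert_eq_spread[OF s True]) auto
    also have "\<dots> = of_real (spread h x)" by (simp add: spread_def)
    finally have 1: "hilbert \<gamma> (\<lambda>x. of_real (h x)) x = of_real (spread h x)" .
    have e: "(\<lambda>y. b y * complex_of_real (h y)) = (\<lambda>y. h y *\<^sub>R b0 y)"
    proof
      fix y show "b y * complex_of_real (h y) = h y *\<^sub>R b0 y"
        using h0[of y] sets_subset_reach(2)[OF s, of c]
        by (cases "y \<in> Pset c s") (auto simp: b0_def scaleR_conv_of_real mult.commute)
    qed
    have 2: "hilbert \<gamma> (\<lambda>y. b y * complex_of_real (h y)) x = spread (\<lambda>y. h y *\<^sub>R b0 y) x"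
      unfolding e using h0 by (intro hilbert_eq_spread[OF s True]) auto
    have "b x = b0 x" using True sets_subset_reach(1)[OF s, of c] by (auto simp: b0_def)
    then show ?thesis unfolding commutator_def 1 2 by (simp add: scaleR_conv_of_real algebra_simps)
  next
    case False
    then have "g x = 0" using gA[of x] by simp
    then show ?thesis by simp
  qed
  have i1: "integrable lborel (\<lambda>x. (g x * spread h x) *\<^sub>R b0 x)"
  proof (rule integrable_bounded_scaleR[OF ib0])
    fix x
    have "\<bar>g x\<bar> * \<bar>spread h x\<bar> \<le> 1 * (M * 1)" using g1 spread_bound[OF h h1] by (intro mult_mono) auto
    then show "\<bar>g x * spread h x\<bar> \<le> M" by (simp add: abs_mult)
  qed measurable
  note adj = spread_adjoint[OF hR g g1]
  have i3: "integrable lborel (\<lambda>x. (h x * cospread g x) *\<^sub>R b0 x)" using adj(2) by (simp add: mult.commute)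
  have icomm: "integrable lborel (\<lambda>x. g x *\<^sub>R commutator \<gamma> b (\<lambda>x. of_real (h x)) x)"
    unfolding comm using i1 adj(1) by (rule Bochner_Integration.integrable_diff)
  have "(\<integral>x. g x *\<^sub>R commutator \<gamma> b (\<lambda>x. of_real (h x)) x \<partial>lborel)
      = (\<integral>x. (g x * spread h x) *\<^sub>R b0 x \<partial>lborel) - (\<integral>x. g x *\<^sub>R spread (\<lambda>x. h x *\<^sub>R b0 x) x \<partial>lborel)"
    unfolding comm using i1 adj(1) by (rule Bochner_Integration.integral_diff)
  also have "(\<integral>x. g x *\<^sub>R spread (\<lambda>x. h x *\<^sub>R b0 x) x \<partial>lborel) = (\<integral>x. (h x * cospread g x) *\<^sub>R b0 x \<partial>lborel)"
    unfolding adj(3) by (simp add: mult.commute)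
  also have "(\<integral>x. (g x * spread h x) *\<^sub>R b0 x \<partial>lborel) - (\<integral>x. (h x * cospread g x) *\<^sub>R b0 x \<partial>lborel) = form b0 g h"
    unfolding form_def scaleR_left_diff_distrib using i1 i3 by (rule Bochner_Integration.integral_diff[symmetric])
  finally have fm: "(\<integral>x. g x *\<^sub>R commutator \<gamma> b (\<lambda>x. of_real (h x)) x \<partial>lborel) = form b0 g h" .
  have const: "32 * M / (1 / (cost * ?V) * ?V) = 32 * mass * cost"
    using V cost s by (simp add: measure_kappa)
  define a where "a = (\<integral>y. indicator (cube \<beta> c s) y *\<^sub>R b y \<partial>lborel) / of_real (measure lborel (cube \<beta> c s))"
  have e0: "indicator (cube \<beta> c s) x * cmod (b0 x - a) = indicator (cube \<beta> c s) x * cmod (b x - a)" for x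
    using QA sets_subset_reach(1)[OF s, of c] by (auto simp: b0_def indicator_def)
  have final: "(\<integral>x. indicator (cube \<beta> c s) x * cmod (b x - a) \<partial>lborel) \<le> 32 * mass * cost * cmod (form b0 g h)"
    using bound unfolding const b0Q a_def[symmetric] e0 .
  show ?thesis
  proof (rule that[OF g h _ _ icomm])
    show "\<bar>g x\<bar> \<le> indicator ?R x" for x
      by (rule order_trans[OF gA le_indicator_mono]) (use sets_subset_reach(1)[OF s, of c] in auto)
    show "\<bar>h x\<bar> \<le> indicator ?R x" for x
      by (rule order_trans[OF hP le_indicator_mono]) (use sets_subset_reach(2)[OF s, of c] in auto)
  qed (use final in \<open>simp only: fm a_def\<close>)
qed

end

section \<open>Bloom weights\<close>

definition wm :: "(real \<times> real \<Rightarrow> real) \<Rightarrow> (real \<times> real) measure" where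
  "wm w = density lebesgue (\<lambda>x. ennreal (w x))"

lemma sets_wm [simp, measurable_cong]: "sets (wm w) = sets lebesgue"
  by (simp add: wm_def)

lemma emeasure_wm:
  assumes "w \<in> borel_measurable lebesgue" "E \<in> sets lebesgue"
  shows "emeasure (wm w) E = (\<integral>\<^sup>+x\<in>E. ennreal (w x) \<partial>lebesgue)"
  unfolding wm_def using assms by (intro emeasure_density) auto

lemma emeasure_cube_lebesgue:
  assumes "0 < s" shows "emeasure lebesgue (cube \<beta> c s) = ennreal (s powr fst \<beta> * s powr snd \<beta>)"
    "measure lebesgue (cube \<beta> c s) = s powr fst \<beta> * s powr snd \<beta>"
  using emeasure_cube_lborel[OF assms, of \<beta> c] by (simp_all add: measure_def)

lemma cube_gamma_cubes:
  assumes "0 < fst \<beta>" "0 < snd \<beta>" "0 < s"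
  shows "cube \<beta> c s \<in> gamma_cubes \<beta>"
proof -
  have "(s powr fst \<beta>) powr (1 / fst \<beta>) = s" "(s powr snd \<beta>) powr (1 / snd \<beta>) = s"
    using assms by (simp_all add: powr_powr)
  then show ?thesis unfolding gamma_cubes_def cube_def mem_Collect_eq using assms
    by (intro exI[of _ "fst c - s powr fst \<beta> / 2"] exI[of _ "fst c + s powr fst \<beta> / 2"]
        exI[of _ "snd c - s powr snd \<beta> / 2"] exI[of _ "snd c + s powr snd \<beta> / 2"]) simp
qed

text \<open>\<open>cube_finite\<close> is demanded for every real \<open>s\<close>. Whatever value
  \<open>powr\<close> takes at a nonpositive \<open>s\<close>, some cube of positive size is at
  least as large.\<close>

lemma cube_enlarge:
  assumes "0 < fst \<beta>" "0 < snd \<beta>"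
  obtains S where "0 < S" "cube \<beta> c s \<subseteq> cube \<beta> c S"
proof -
  define S where "S = 1 + (s powr fst \<beta>) powr (1 / fst \<beta>) + (s powr snd \<beta>) powr (1 / snd \<beta>)"
  have S: "0 < S" by (simp add: S_def add_pos_nonneg)
  have "((s powr e) powr (1 / e)) powr e \<le> S powr e" if "e \<in> {fst \<beta>, snd \<beta>}" for e
    using that assms by (intro powr_mono2) (auto simp: S_def)
  moreover have "((s powr e) powr (1 / e)) powr e = s powr e" if "e \<in> {fst \<beta>, snd \<beta>}" for e
    using that assms by (auto simp: powr_powr)
  ultimately have "s powr fst \<beta> \<le> S powr fst \<beta>" "s powr snd \<beta> \<le> S powr snd \<beta>" by force+
  then have "cube \<beta> c s \<subseteq> cube \<beta> c S" by (auto simp: mem_cube)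
  with S show ?thesis by (rule that)
qed

lemma cubes_exhaust:
  assumes "0 < fst \<beta>" "0 < snd \<beta>"
  shows "(\<Union>n::nat. cube \<beta> c (real n + 1)) = UNIV"
proof -
  have "\<exists>n::nat. x \<in> cube \<beta> c (real n + 1)" for x
  proof -
    define R where "R = (2 * \<bar>fst x - fst c\<bar>) powr (1 / fst \<beta>) + (2 * \<bar>snd x - snd c\<bar>) powr (1 / snd \<beta>)"
    obtain n :: nat where n: "R \<le> real n" using real_arch_simple by blast
    have "((2 * \<bar>fst x - fst c\<bar>) powr (1 / fst \<beta>)) powr fst \<beta> \<le> (real n + 1) powr fst \<beta>"
    proof (rule powr_mono2)
      have "0 \<le> (2 * \<bar>snd x - snd c\<bar>) powr (1 / snd \<beta>)" by simp
      then show "(2 * \<bar>fst x - fst c\<bar>) powr (1 / fst \<beta>) \<le> real n + 1" using n unfolding R_def by linarith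
    qed (use assms in auto)
    moreover have "((2 * \<bar>snd x - snd c\<bar>) powr (1 / snd \<beta>)) powr snd \<beta> \<le> (real n + 1) powr snd \<beta>"
    proof (rule powr_mono2)
      have "0 \<le> (2 * \<bar>fst x - fst c\<bar>) powr (1 / fst \<beta>)" by simp
      then show "(2 * \<bar>snd x - snd c\<bar>) powr (1 / snd \<beta>) \<le> real n + 1" using n unfolding R_def by linarith
    qed (use assms in auto)
    ultimately have "x \<in> cube \<beta> c (real n + 1)" using assms by (simp add: mem_cube powr_powr)
    then show ?thesis ..
  qed
  then show ?thesis by blast
qed

lemma wm_sigma_finite:
  assumes "0 < fst \<beta>" "0 < snd \<beta>" and fin: "\<And>c s. 0 < s \<Longrightarrow> emeasure (wm w) (cube \<beta> c s) < \<infinity>"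
  shows "sigma_finite_measure (wm w)"
proof
  have sp: "space (wm w) = UNIV" by (simp add: wm_def)
  show "\<exists>A. countable A \<and> A \<subseteq> sets (wm w) \<and> \<Union>A = space (wm w) \<and> (\<forall>a\<in>A. emeasure (wm w) a \<noteq> \<infinity>)"
  proof (intro exI[of _ "range (\<lambda>n::nat. cube \<beta> 0 (real n + 1))"] conjI ballI)
    show "\<Union>(range (\<lambda>n::nat. cube \<beta> 0 (real n + 1))) = space (wm w)" unfolding sp by (rule cubes_exhaust[OF assms(1,2)])
    fix a assume "a \<in> range (\<lambda>n::nat. cube \<beta> 0 (real n + 1))"
    then obtain n :: nat where a: "a = cube \<beta> 0 (real n + 1)" by blast
    have "emeasure (wm w) a < \<infinity>" unfolding a by (rule fin) simp
    then show "emeasure (wm w) a \<noteq> \<infinity>" by simp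
  qed auto
qed

lemma cube_measure_wm:
  assumes b: "0 < fst \<beta>" "fst \<beta> \<le> snd \<beta>" and w: "w \<in> borel_measurable lebesgue" "AE x in lebesgue. 0 < w x"
    and fin: "\<And>c s. 0 < s \<Longrightarrow> emeasure (wm w) (cube \<beta> c s) < \<infinity>"
    and dbl: "\<And>K. 1 \<le> K \<Longrightarrow> \<exists>D. \<forall>c s. 0 < s \<longrightarrow> measure (wm w) (cube \<beta> c (K * s)) \<le> D * measure (wm w) (cube \<beta> c s)"
  shows "cube_measure (wm w) \<beta>"
proof (rule cube_measure.intro)
  have b2: "0 < snd \<beta>" using b by simp
  show "sigma_finite_measure (wm w)" by (rule wm_sigma_finite[OF b(1) b2 fin])
  show "cube_measure_axioms (wm w) \<beta>"
  proof (rule cube_measure_axioms.intro[OF b])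
    show "emeasure (wm w) (cube \<beta> c s) < \<infinity>" for c s
    proof -
      obtain S where S: "0 < S" "cube \<beta> c s \<subseteq> cube \<beta> c S" by (rule cube_enlarge[OF b(1) b2])
      have "emeasure (wm w) (cube \<beta> c s) \<le> emeasure (wm w) (cube \<beta> c S)" by (rule emeasure_mono[OF S(2)]) simp
      then show ?thesis using fin[OF S(1), of c] by (rule le_less_trans)
    qed
    show "0 < measure (wm w) (cube \<beta> c s)" if s: "0 < s" for c s
    proof -
      have "emeasure (wm w) (cube \<beta> c s) \<noteq> 0"
      proof
        assume "emeasure (wm w) (cube \<beta> c s) = 0"
        then have "(\<integral>\<^sup>+x. ennreal (w x) * indicator (cube \<beta> c s) x \<partial>lebesgue) = 0" using w by (simp add: emeasure_wm)
        then have "AE x in lebesgue. ennreal (w x) * indicator (cube \<beta> c s) x = 0"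
          using w by (subst (asm) nn_integral_0_iff_AE) auto
        then have "AE x in lebesgue. x \<notin> cube \<beta> c s" using w(2)
          by eventually_elim (auto simp: indicator_def ennreal_eq_0_iff split: if_splits)
        then have "cube \<beta> c s \<in> null_sets lebesgue" by (subst AE_iff_null_sets) auto
        then have "emeasure lebesgue (cube \<beta> c s) = 0" by (rule null_setsD1)
        then show False using s unfolding emeasure_cube_lebesgue(1)[OF s] by simp
      qed
      then show ?thesis using fin[OF s, of c] unfolding measure_def
        by (simp add: enn2real_positive_iff less_top[symmetric] zero_less_iff_neq_zero)
    qed
  qed (use dbl in auto)
qed

text \<open>The pair \<open>w\<close>, \<open>w' = w powr (1 - p')\<close>, with the \<open>A\<^sub>p\<close> condition raised to a form that is symmetric
  under \<open>(p, w, w') \<mapsto> (p', w', w)\<close>.\<close>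

definition muck :: "real \<times> real \<Rightarrow> real \<Rightarrow> (real \<times> real \<Rightarrow> real) \<Rightarrow> (real \<times> real \<Rightarrow> real) \<Rightarrow> bool" where
  "muck \<beta> p w w' \<longleftrightarrow> w \<in> borel_measurable lebesgue \<and> w' \<in> borel_measurable lebesgue \<and>
     (AE x in lebesgue. 0 < w x) \<and> (AE x in lebesgue. 0 < w' x) \<and> (AE x in lebesgue. w' x = w x powr (- 1 / (p - 1))) \<and>
     (\<forall>c s. 0 < s \<longrightarrow> emeasure (wm w) (cube \<beta> c s) < \<infinity> \<and> emeasure (wm w') (cube \<beta> c s) < \<infinity>) \<and>
     (\<exists>C. 0 < C \<and> (\<forall>c s. 0 < s \<longrightarrow> measure (wm w) (cube \<beta> c s) * measure (wm w') (cube \<beta> c s) powr (p - 1)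
        \<le> C * measure lebesgue (cube \<beta> c s) powr p))"

text \<open>Multiplying by the \<open>p\<close>-th power of the volume clears the averages. Local
  integrability of \<open>w\<close> is part of being a weight, whereas finiteness of the dual weight
  on cubes is drawn from the \<open>A\<^sub>p\<close> bound itself.\<close>

lemma Ap_class_muck:
  assumes b: "0 < fst \<beta>" "0 < snd \<beta>" and p: "1 < p" and w: "w \<in> Ap_class \<beta> p"
  shows "muck \<beta> p w (\<lambda>x. w x powr (- 1 / (p - 1)))"
proof -
  let ?w' = "\<lambda>x. w x powr (- 1 / (p - 1))"
  have [measurable]: "w \<in> borel_measurable lebesgue" and pos: "AE x in lebesgue. 0 < w x"
    and li: "\<And>K. compact K \<Longrightarrow> w absolutely_integrable_on K" and Ap: "Ap_const \<beta> p w < \<infinity>"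
    using w by (auto simp: Ap_class_def weight_def locally_integrable_def)
  have pos': "AE x in lebesgue. 0 < ?w' x" using pos by eventually_elim simp
  have ex: "- hoelder_conj p / p = - 1 / (p - 1)" "p / hoelder_conj p = p - 1"
    using p by (simp_all add: hoelder_conj_def)
  obtain C0 where C0: "Ap_const \<beta> p w = ennreal C0" "0 \<le> C0" using Ap by (cases "Ap_const \<beta> p w") auto
  have fin1: "emeasure (wm w) (cube \<beta> c s) < \<infinity>" for c s
  proof -
    have "compact (cube \<beta> c s)" unfolding cube_def by (intro compact_Times compact_Icc)
    then have "set_integrable lebesgue (cube \<beta> c s) w" by (rule li)
    then have "(\<integral>\<^sup>+x. ennreal (norm (indicator (cube \<beta> c s) x *\<^sub>R w x)) \<partial>lebesgue) < \<infinity>"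
      unfolding set_integrable_def by (simp add: integrable_iff_bounded)
    moreover have "(\<integral>\<^sup>+x. ennreal (w x) * indicator (cube \<beta> c s) x \<partial>lebesgue) \<le> (\<integral>\<^sup>+x. ennreal (norm (indicator (cube \<beta> c s) x *\<^sub>R w x)) \<partial>lebesgue)"
      by (intro nn_integral_mono) (auto simp: indicator_def intro!: ennreal_leI)
    ultimately show ?thesis by (simp add: emeasure_wm)
  qed
  have main: "emeasure (wm ?w') (cube \<beta> c s) < \<infinity> \<and> measure (wm w) (cube \<beta> c s) * measure (wm ?w') (cube \<beta> c s) powr (p - 1)
        \<le> (C0 + 1) * measure lebesgue (cube \<beta> c s) powr p" if s: "0 < s" for c s
  proof -
    let ?Q = "cube \<beta> c s"
    define V where "V = measure lebesgue ?Q"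
    have V: "emeasure lebesgue ?Q = ennreal V" "0 < V" using emeasure_cube_lebesgue[OF s, of \<beta> c] s by (simp_all add: V_def)
    define A where "A = measure (wm w) ?Q"
    have A: "emeasure (wm w) ?Q = ennreal A" unfolding A_def using fin1[of c s] by (intro emeasure_eq_ennreal_measure) (simp add: less_top)
    have A0: "0 < A"
    proof -
      have "emeasure (wm w) ?Q \<noteq> 0"
      proof
        assume "emeasure (wm w) ?Q = 0"
        then have "(\<integral>\<^sup>+x. ennreal (w x) * indicator ?Q x \<partial>lebesgue) = 0" by (simp add: emeasure_wm)
        then have "AE x in lebesgue. ennreal (w x) * indicator ?Q x = 0" by (subst (asm) nn_integral_0_iff_AE) auto
        then have "AE x in lebesgue. x \<notin> ?Q" using pos
          by eventually_elim (auto simp: indicator_def ennreal_eq_0_iff split: if_splits)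
        then have "?Q \<in> null_sets lebesgue" by (subst AE_iff_null_sets) auto
        then have "emeasure lebesgue ?Q = 0" by (rule null_setsD1)
        then show False using V by simp
      qed
      then show ?thesis using A by (simp add: ennreal_eq_0_iff)
    qed
    have "nn_average ?Q w * epowr (nn_average ?Q ?w') (p - 1) \<le> ennreal C0"
    proof -
      have "nn_average ?Q w * epowr (nn_average ?Q (\<lambda>x. w x powr (- hoelder_conj p / p))) (p / hoelder_conj p) \<le> Ap_const \<beta> p w"
        unfolding Ap_const_def by (intro SUP_upper cube_gamma_cubes b s)
      then show ?thesis unfolding ex C0 .
    qed
    moreover have nA: "nn_average ?Q w = ennreal (A / V)"
      unfolding nn_average_def using A V A0 by (simp add: emeasure_wm divide_ennreal)
    moreover have nB: "nn_average ?Q ?w' = emeasure (wm ?w') ?Q / ennreal V"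
      unfolding nn_average_def using V by (simp add: emeasure_wm)
    ultimately have le: "ennreal (A / V) * epowr (emeasure (wm ?w') ?Q / ennreal V) (p - 1) \<le> ennreal C0" by simp
    \<comment> \<open>An infinite dual mass would make the product infinite, since \<open>w\<close>
      has positive mass on the cube.\<close>
    have finB: "emeasure (wm ?w') ?Q < \<infinity>"
    proof (rule ccontr)
      assume "\<not> emeasure (wm ?w') ?Q < \<infinity>"
      then have "emeasure (wm ?w') ?Q = \<infinity>" by (simp add: less_top[symmetric])
      then have "epowr (emeasure (wm ?w') ?Q / ennreal V) (p - 1) = \<infinity>" using V by (simp add: epowr_def ennreal_top_divide)
      then show False using le A0 V by (simp add: ennreal_mult_top top_unique)
    qed
    define B where "B = measure (wm ?w') ?Q"
    have B: "emeasure (wm ?w') ?Q = ennreal B" "0 \<le> B" unfolding B_def using finB by (auto intro: emeasure_eq_ennreal_measure simp: less_top)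
    have "ennreal (A / V * (B / V) powr (p - 1)) \<le> ennreal C0"
    proof -
      have eq: "ennreal (A / V * (B / V) powr (p - 1)) = ennreal (A / V) * ennreal ((B / V) powr (p - 1))"
        by (rule ennreal_mult) (use A0 V in auto)
      show ?thesis using le V B unfolding eq by (simp add: divide_ennreal epowr_def)
    qed
    then have "A / V * (B / V) powr (p - 1) \<le> C0" using C0 by simp
    then have "A / V * (B / V) powr (p - 1) * V powr p \<le> C0 * V powr p" by (rule mult_right_mono) simp
    moreover have "A / V * (B / V) powr (p - 1) * V powr p = A * B powr (p - 1)"
    proof -
      have "V powr p = V * V powr (p - 1)" using V powr_add[of V 1 "p - 1"] by simp
      then show ?thesis using V B by (simp add: powr_divide)
    qed
    ultimately have "A * B powr (p - 1) \<le> C0 * V powr p" by simp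
    also have "\<dots> \<le> (C0 + 1) * V powr p" by (intro mult_right_mono) auto
    finally show ?thesis using finB unfolding A_def B_def V_def by simp
  qed
  have "0 < C0 + 1" using C0 by simp
  then show ?thesis unfolding muck_def using pos pos' fin1 main by (intro conjI exI[of _ "C0 + 1"]) auto
qed

text \<open>The condition raised to the power \<open>1 / (p - 1)\<close>, which is the conjugate
  exponent minus 1.\<close>

lemma muck_dual:
  assumes p: "1 < p" and m: "muck \<beta> p w w'"
  shows "muck \<beta> (p / (p - 1)) w' w"
proof -
  have p': "p / (p - 1) - 1 = 1 / (p - 1)" using p by (simp add: field_simps)
  obtain C where C: "0 < C" "\<And>c s. 0 < s \<Longrightarrow> measure (wm w) (cube \<beta> c s) * measure (wm w') (cube \<beta> c s) powr (p - 1) \<le> C * measure lebesgue (cube \<beta> c s) powr p"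
    using m unfolding muck_def by blast
  have "AE x in lebesgue. 0 < w x" "AE x in lebesgue. w' x = w x powr (- 1 / (p - 1))" using m unfolding muck_def by auto
  then have e: "AE x in lebesgue. w x = w' x powr (- 1 / (p / (p - 1) - 1))"
  proof eventually_elim
    fix x assume x: "0 < w x" "w' x = w x powr (- 1 / (p - 1))"
    have "- 1 / (p - 1) * (- 1 / (1 / (p - 1))) = 1" using p by (simp add: divide_eq_eq)
    then show "w x = w' x powr (- 1 / (p / (p - 1) - 1))" using x(1) unfolding x(2) powr_powr p' by simp
  qed
  have "measure (wm w') (cube \<beta> c s) * measure (wm w) (cube \<beta> c s) powr (p / (p - 1) - 1)
      \<le> C powr (1 / (p - 1)) * measure lebesgue (cube \<beta> c s) powr (p / (p - 1))" if s: "0 < s" for c s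
  proof -
    let ?A = "measure (wm w) (cube \<beta> c s)" and ?B = "measure (wm w') (cube \<beta> c s)" and ?V = "measure lebesgue (cube \<beta> c s)"
    have "(?A * ?B powr (p - 1)) powr (1 / (p - 1)) \<le> (C * ?V powr p) powr (1 / (p - 1))"
      using C(2)[OF s, of c] p by (intro powr_mono2) auto
    then have "?A powr (1 / (p - 1)) * (?B powr (p - 1)) powr (1 / (p - 1)) \<le> C powr (1 / (p - 1)) * (?V powr p) powr (1 / (p - 1))"
      by (simp only: powr_mult)
    then show ?thesis using p by (simp add: powr_powr p' mult.commute)
  qed
  then show ?thesis using m e C(1) unfolding muck_def by (intro conjI exI[of _ "C powr (1 / (p - 1))"]) auto
qed

lemma wm_geometric_mean:
  assumes F: "F \<in> borel_measurable lebesgue" "AE x in lebesgue. 0 < F x" and G: "G \<in> borel_measurable lebesgue" "AE x in lebesgue. 0 < G x"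
    and ab: "0 < a" "0 < b" "a + b = 1" and H: "AE x in lebesgue. H x = F x powr a * G x powr b"
    and E: "E \<in> sets lebesgue" and fin: "emeasure (wm F) E < \<infinity>" "emeasure (wm G) E < \<infinity>" and Hm: "H \<in> borel_measurable lebesgue"
  shows "emeasure (wm H) E \<le> ennreal (measure (wm F) E powr a * measure (wm G) E powr b)"
proof -
  have [measurable]: "F \<in> borel_measurable lebesgue" "G \<in> borel_measurable lebesgue" "E \<in> sets lebesgue" by fact+
  have i: "(\<integral>\<^sup>+x. ennreal (indicator E x * K x) \<partial>lebesgue) = ennreal (measure (wm K) E)"
    if "K \<in> borel_measurable lebesgue" "emeasure (wm K) E < \<infinity>" for K
  proof -
    have "(\<integral>\<^sup>+x. ennreal (indicator E x * K x) \<partial>lebesgue) = emeasure (wm K) E"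
      unfolding emeasure_wm[OF that(1) E] by (intro nn_integral_cong) (simp add: indicator_def)
    then show ?thesis using that(2) emeasure_eq_ennreal_measure[of "wm K" E] by (simp add: less_top)
  qed
  have "emeasure (wm H) E = (\<integral>\<^sup>+x. ennreal ((indicator E x * F x) powr a * (indicator E x * G x) powr b) \<partial>lebesgue)"
    unfolding emeasure_wm[OF Hm E] using H
  proof (intro nn_integral_cong_AE, eventually_elim)
    fix x assume "H x = F x powr a * G x powr b"
    then show "ennreal (H x) * indicator E x = ennreal ((indicator E x * F x) powr a * (indicator E x * G x) powr b)"
      by (cases "x \<in> E") simp_all
  qed
  also have "\<dots> \<le> ennreal (measure (wm F) E powr a * measure (wm G) E powr b)"
  proof (rule nn_integral_geometric_mean[OF _ _ _ _ ab])
    show "AE x in lebesgue. 0 \<le> indicator E x * F x" using F(2) by eventually_elim (simp add: indicator_def)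
    show "AE x in lebesgue. 0 \<le> indicator E x * G x" using G(2) by eventually_elim (simp add: indicator_def)
    show "(\<integral>\<^sup>+x. ennreal (indicator E x * F x) \<partial>lebesgue) \<le> ennreal (measure (wm F) E)" using i[OF F(1) fin(1)] by simp
    show "(\<integral>\<^sup>+x. ennreal (indicator E x * G x) \<partial>lebesgue) \<le> ennreal (measure (wm G) E)" using i[OF G(1) fin(2)] by simp
  qed auto
  finally show ?thesis .
qed

lemma wm_one: "E \<in> sets lebesgue \<Longrightarrow> emeasure (wm (\<lambda>_. 1)) E = emeasure lebesgue E"
  by (simp add: emeasure_wm)

text \<open>Hoelder for \<open>1 = w powr (1 / p) * w' powr (1 - 1 / p)\<close> on
  \<open>?Q\<close>, with \<open>w'\<close> then enlarged to \<open>?R\<close>, bounds the volume of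
  \<open>?Q\<close> from above; the Muckenhoupt condition on \<open>?R\<close> bounds its volume
  from below. Both contain the same power of the \<open>w'\<close>-mass of \<open>?R\<close>, which
  cancels and leaves doubling of \<open>w\<close>.\<close>

lemma muck_cube_measure:
  assumes b: "0 < fst \<beta>" "fst \<beta> \<le> snd \<beta>" and p: "1 < p" and m: "muck \<beta> p w w'"
  shows "cube_measure (wm w) \<beta>"
proof (rule cube_measure_wm[OF b])
  have w: "w \<in> borel_measurable lebesgue" "AE x in lebesgue. 0 < w x" and w': "w' \<in> borel_measurable lebesgue" "AE x in lebesgue. 0 < w' x"
    and e: "AE x in lebesgue. w' x = w x powr (- 1 / (p - 1))"
    and fin: "\<And>c s. 0 < s \<Longrightarrow> emeasure (wm w) (cube \<beta> c s) < \<infinity>" "\<And>c s. 0 < s \<Longrightarrow> emeasure (wm w') (cube \<beta> c s) < \<infinity>"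
    using m unfolding muck_def by auto
  show "w \<in> borel_measurable lebesgue" "AE x in lebesgue. 0 < w x" by fact+
  show "emeasure (wm w) (cube \<beta> c s) < \<infinity>" if "0 < s" for c s by (rule fin(1)[OF that])
  obtain C where C: "0 < C" "\<And>c s. 0 < s \<Longrightarrow> measure (wm w) (cube \<beta> c s) * measure (wm w') (cube \<beta> c s) powr (p - 1) \<le> C * measure lebesgue (cube \<beta> c s) powr p"
    using m unfolding muck_def by blast
  fix K :: real assume K: "1 \<le> K"
  let ?D = "C * (K powr fst \<beta> * K powr snd \<beta>) powr p"
  have "measure (wm w) (cube \<beta> c (K * s)) \<le> ?D * measure (wm w) (cube \<beta> c s)" if s: "0 < s" for c s
  proof -
    let ?Q = "cube \<beta> c s" and ?R = "cube \<beta> c (K * s)"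
    have Ks: "0 < K * s" using K s by simp
    have sub: "?Q \<subseteq> ?R" using cube_subset_dilate[of \<beta> s K c] b K s by simp
    have V: "measure lebesgue ?R = (K powr fst \<beta> * K powr snd \<beta>) * measure lebesgue ?Q"
      unfolding emeasure_cube_lebesgue(2)[OF s] emeasure_cube_lebesgue(2)[OF Ks] by (simp add: powr_mult)
    have V0: "0 < measure lebesgue ?Q" unfolding emeasure_cube_lebesgue(2)[OF s] using s by simp
    have one: "AE x in lebesgue. 1 = w x powr (1 / p) * w' x powr (1 - 1 / p)"
      using w(2) e
    proof eventually_elim
      fix x assume x: "0 < w x" "w' x = w x powr (- 1 / (p - 1))"
      have "- 1 / (p - 1) * (1 - 1 / p) = - (1 / p)" using p by (simp add: field_simps)
      then have "w' x powr (1 - 1 / p) = w x powr (- (1 / p))" unfolding x(2) powr_powr by simp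
      then show "1 = w x powr (1 / p) * w' x powr (1 - 1 / p)" using x(1) by (simp add: powr_add[symmetric])
    qed
    have "emeasure (wm (\<lambda>_. 1)) ?Q \<le> ennreal (measure (wm w) ?Q powr (1 / p) * measure (wm w') ?Q powr (1 - 1 / p))"
      using p by (intro wm_geometric_mean[OF w w' _ _ _ one] fin s) auto
    then have "measure lebesgue ?Q \<le> measure (wm w) ?Q powr (1 / p) * measure (wm w') ?Q powr (1 - 1 / p)"
      unfolding wm_one[OF cube_lebesgue] emeasure_cube_lebesgue(1)[OF s] emeasure_cube_lebesgue(2)[OF s] by simp
    also have "\<dots> \<le> measure (wm w) ?Q powr (1 / p) * measure (wm w') ?R powr (1 - 1 / p)"
    proof (intro mult_left_mono powr_mono2)
      show "measure (wm w') ?Q \<le> measure (wm w') ?R"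
        using fin(2)[OF Ks, of c] by (intro measure_mono_fmeasurable[OF sub] fmeasurableI) auto
    qed (use p in auto)
    finally have "measure lebesgue ?Q powr p \<le> (measure (wm w) ?Q powr (1 / p) * measure (wm w') ?R powr (1 - 1 / p)) powr p"
      using p by (intro powr_mono2) auto
    also have "\<dots> = (measure (wm w) ?Q powr (1 / p)) powr p * (measure (wm w') ?R powr (1 - 1 / p)) powr p" by (simp only: powr_mult)
    also have "\<dots> = measure (wm w) ?Q * measure (wm w') ?R powr (p - 1)"
      using p by (simp add: powr_powr left_diff_distrib)
    finally have lo: "measure lebesgue ?Q powr p \<le> measure (wm w) ?Q * measure (wm w') ?R powr (p - 1)" .
    have "measure (wm w) ?R * measure (wm w') ?R powr (p - 1) \<le> C * measure lebesgue ?R powr p" by (rule C(2)[OF Ks])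
    also have "\<dots> = ?D * measure lebesgue ?Q powr p" unfolding V powr_mult by simp
    also have "\<dots> \<le> ?D * (measure (wm w) ?Q * measure (wm w') ?R powr (p - 1))"
      using C(1) by (intro mult_left_mono lo) auto
    finally have "measure (wm w) ?R * measure (wm w') ?R powr (p - 1) \<le> (?D * measure (wm w) ?Q) * measure (wm w') ?R powr (p - 1)" by simp
    moreover have "0 < measure (wm w') ?R powr (p - 1)"
    proof (rule ccontr)
      assume "\<not> 0 < measure (wm w') ?R powr (p - 1)"
      then have "measure (wm w') ?R powr (p - 1) = 0" using powr_ge_zero[of "measure (wm w') ?R" "p - 1"] by linarith
      then have "measure lebesgue ?Q powr p \<le> 0" using lo by simp
      then show False using V0 by simp
    qed
    ultimately show ?thesis by (simp only: mult_le_cancel_right_pos)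
  qed
  then show "\<exists>D. \<forall>c s. 0 < s \<longrightarrow> measure (wm w) (cube \<beta> c (K * s)) \<le> D * measure (wm w) (cube \<beta> c s)" by blast
qed

section \<open>The weight \<nu> as a geometric mean of two Muckenhoupt weights\<close>

locale bloom_weights =
  fixes \<beta> :: "real \<times> real" and p q :: real and \<mu> lam \<nu> :: "real \<times> real \<Rightarrow> real"
  assumes beta: "0 < fst \<beta>" "fst \<beta> < snd \<beta>" and p: "1 < p" and q: "1 < q"
    and mu: "\<mu> \<in> Ap_class \<beta> p" and lam: "lam \<in> Ap_class \<beta> q"
    and nu: "\<nu> \<in> borel_measurable lebesgue" "AE x in lebesgue. 0 < \<nu> x"
    and nu_eq: "AE x in lebesgue. \<nu> x powr (1 / p + 1 / hoelder_conj q) = \<mu> x powr (1 / p) * lam x powr (- 1 / q)"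
begin

definition "q' = q / (q - 1)"
text \<open>The exponent of \<open>\<nu>\<close> in its defining relation. Division by it turns
  \<open>1 / p\<close> and \<open>1 / q'\<close> into the weights \<open>a\<close> and
  \<open>b\<close> of a geometric mean.\<close>

definition "\<tau> = 1 / p + 1 / q'"
definition "a = 1 / p / \<tau>"
definition "b = 1 / q' / \<tau>"
definition \<mu>' where "\<mu>' x = \<mu> x powr (- 1 / (p - 1))"
definition \<sigma> where "\<sigma> x = lam x powr (- 1 / (q - 1))"

lemma q': "1 < q'" "1 / q + 1 / q' = 1" "q' - 1 = 1 / (q - 1)" "q' = hoelder_conj q" "1 / q' = (q - 1) / q"
  using q by (auto simp: q'_def hoelder_conj_def field_simps)

lemma tau: "0 < \<tau>" and ab: "0 < a" "0 < b" "a + b = 1" "a * \<tau> = 1 / p" "b * \<tau> = 1 / q'"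
proof -
  show t: "0 < \<tau>" using p q'(1) by (simp add: \<tau>_def add_pos_pos)
  show "0 < a" "0 < b" using p q'(1) t by (simp_all add: a_def b_def)
  show "a * \<tau> = 1 / p" "b * \<tau> = 1 / q'" using t by (simp_all add: a_def b_def)
  have "a + b = (1 / p + 1 / q') / \<tau>" by (simp add: a_def b_def add_divide_distrib)
  then show "a + b = 1" using t by (simp add: \<tau>_def)
qed

lemma b2: "0 < snd \<beta>" "fst \<beta> \<le> snd \<beta>" using beta by simp_all

lemma muck_mu: "muck \<beta> p \<mu> \<mu>'"
  unfolding \<mu>'_def by (rule Ap_class_muck[OF beta(1) b2(1) p mu])

lemma muck_lam: "muck \<beta> q lam \<sigma>"
  unfolding \<sigma>_def by (rule Ap_class_muck[OF beta(1) b2(1) q lam])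

lemma muck_sigma: "muck \<beta> q' \<sigma> lam"
  unfolding q'_def by (rule muck_dual[OF q muck_lam])

sublocale Mu: cube_measure "wm \<mu>" \<beta>
  by (rule muck_cube_measure[OF beta(1) b2(2) p muck_mu])

sublocale Sig: cube_measure "wm \<sigma>" \<beta>
  by (rule muck_cube_measure[OF beta(1) b2(2) q'(1) muck_sigma])

lemma meas [measurable]: "\<mu> \<in> borel_measurable lebesgue" "\<mu>' \<in> borel_measurable lebesgue" "lam \<in> borel_measurable lebesgue"
    "\<sigma> \<in> borel_measurable lebesgue" "\<nu> \<in> borel_measurable lebesgue"
  and pos: "AE x in lebesgue. 0 < \<mu> x" "AE x in lebesgue. 0 < \<mu>' x" "AE x in lebesgue. 0 < lam x" "AE x in lebesgue. 0 < \<sigma> x"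
  using muck_mu muck_lam nu unfolding muck_def by auto

lemma nu_mean: "AE x in lebesgue. \<nu> x = \<mu> x powr a * \<sigma> x powr b"
  using nu_eq nu(2) pos(1,3)
proof eventually_elim
  fix x assume x: "\<nu> x powr (1 / p + 1 / hoelder_conj q) = \<mu> x powr (1 / p) * lam x powr (- 1 / q)" "0 < \<nu> x" "0 < \<mu> x" "0 < lam x"
  have "\<nu> x = (\<nu> x powr \<tau>) powr (1 / \<tau>)" using x tau by (simp add: powr_powr)
  also have "\<nu> x powr \<tau> = \<mu> x powr (1 / p) * lam x powr (- 1 / q)" using x(1) by (simp add: \<tau>_def q'(4))
  also have "(\<mu> x powr (1 / p) * lam x powr (- 1 / q)) powr (1 / \<tau>) = \<mu> x powr (1 / p * (1 / \<tau>)) * lam x powr (- 1 / q * (1 / \<tau>))"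
    by (simp only: powr_mult powr_powr)
  also have "1 / p * (1 / \<tau>) = a" by (simp add: a_def)
  also have "- 1 / q * (1 / \<tau>) = - 1 / (q - 1) * b" using q by (simp add: b_def q'(5))
  also have "lam x powr (- 1 / (q - 1) * b) = \<sigma> x powr b" unfolding \<sigma>_def powr_powr ..
  finally show "\<nu> x = \<mu> x powr a * \<sigma> x powr b" .
qed

lemma nu_upper:
  assumes "E \<in> sets lebesgue" "emeasure (wm \<mu>) E < \<infinity>" "emeasure (wm \<sigma>) E < \<infinity>"
  shows "emeasure (wm \<nu>) E \<le> ennreal (measure (wm \<mu>) E powr a * measure (wm \<sigma>) E powr b)"
  by (rule wm_geometric_mean[OF meas(1) pos(1) meas(4) pos(4) ab(1,2,3) nu_mean assms meas(5)])

lemma nu_upper_cube: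
  assumes "E \<in> sets lebesgue" "E \<subseteq> cube \<beta> c s"
  shows "emeasure (wm \<nu>) E < \<infinity>" "measure (wm \<nu>) E \<le> measure (wm \<mu>) E powr a * measure (wm \<sigma>) E powr b"
proof -
  have "emeasure (wm \<mu>) E \<le> emeasure (wm \<mu>) (cube \<beta> c s)" by (rule emeasure_mono[OF assms(2)]) simp
  then have f1: "emeasure (wm \<mu>) E < \<infinity>" using Mu.cube_finite[of c s] by (rule le_less_trans)
  have "emeasure (wm \<sigma>) E \<le> emeasure (wm \<sigma>) (cube \<beta> c s)" by (rule emeasure_mono[OF assms(2)]) simp
  then have f2: "emeasure (wm \<sigma>) E < \<infinity>" using Sig.cube_finite[of c s] by (rule le_less_trans)
  note u = nu_upper[OF assms(1) f1 f2]
  then show f: "emeasure (wm \<nu>) E < \<infinity>" by (rule le_less_trans) simp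
  then have "emeasure (wm \<nu>) E = ennreal (measure (wm \<nu>) E)" by (intro emeasure_eq_ennreal_measure) (simp add: less_top)
  then show "measure (wm \<nu>) E \<le> measure (wm \<mu>) E powr a * measure (wm \<sigma>) E powr b" using u by simp
qed

text \<open>The product of \<open>\<nu>\<close> to the power \<open>1 / S\<close>,
  \<open>\<mu>'\<close> to the power \<open>x / S\<close> and \<open>lam\<close> to the power
  \<open>y / S\<close> is 1, so Hoelder bounds the volume to the power \<open>S\<close> by \<nu>(Q)
  \<mu>'(Q)^x lam(Q)^y. The Muckenhoupt conditions for \<open>\<mu>\<close> and
  \<open>\<sigma>\<close>, raised to the powers \<open>a\<close> and \<open>b\<close>, convert the
  last two factors, and \<open>S = a * p + b * q'\<close> makes the volumes cancel.\<close>

lemma nu_lower: "\<exists>C>0. \<forall>c s. 0 < s \<longrightarrow> measure (wm \<mu>) (cube \<beta> c s) powr a * measure (wm \<sigma>) (cube \<beta> c s) powr b \<le> C * measure (wm \<nu>) (cube \<beta> c s)"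
proof -
  obtain C1 where C1: "0 < C1" "\<And>c s. 0 < s \<Longrightarrow> measure (wm \<mu>) (cube \<beta> c s) * measure (wm \<mu>') (cube \<beta> c s) powr (p - 1) \<le> C1 * measure lebesgue (cube \<beta> c s) powr p"
    using muck_mu unfolding muck_def by blast
  obtain C2 where C2: "0 < C2" "\<And>c s. 0 < s \<Longrightarrow> measure (wm \<sigma>) (cube \<beta> c s) * measure (wm lam) (cube \<beta> c s) powr (q' - 1) \<le> C2 * measure lebesgue (cube \<beta> c s) powr q'"
    using muck_sigma unfolding muck_def by blast
  define x where "x = a * (p - 1)"
  define y where "y = b * (q' - 1)"
  have xy: "0 < x" "0 < y" using ab(1,2) p q'(1) by (simp_all add: x_def y_def)
  define \<eta> where "\<eta> = x / (x + y)"
  define S where "S = 1 + x + y"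
  have S: "1 < S" using xy by (simp add: S_def)
  have S2: "S = a * p + b * q'" using ab(3) by (simp add: S_def x_def y_def algebra_simps)
  have eta: "0 < \<eta>" "0 < 1 - \<eta>" "1 - \<eta> = y / (x + y)" using xy by (simp_all add: \<eta>_def field_simps)
  have es: "\<eta> * (1 - 1 / S) = x / S" "(1 - \<eta>) * (1 - 1 / S) = y / S"
  proof -
    have "1 - 1 / S = (S - 1) / S" using S by (simp add: field_simps)
    also have "S - 1 = x + y" by (simp add: S_def)
    finally have e: "1 - 1 / S = (x + y) / S" .
    show "\<eta> * (1 - 1 / S) = x / S" unfolding e \<eta>_def using xy by simp
    show "(1 - \<eta>) * (1 - 1 / S) = y / S" unfolding e eta(3) using xy by simp
  qed
  \<comment> \<open>Two of the three factors merged into one weight: Hoelder with three factors is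
    two applications of \<open>wm_geometric_mean\<close>.\<close>
  define g where "g z = \<mu>' z powr \<eta> * lam z powr (1 - \<eta>)" for z
  have [measurable]: "g \<in> borel_measurable lebesgue" unfolding g_def by measurable
  have gpos: "AE z in lebesgue. 0 < g z" using pos(2,3) by eventually_elim (simp add: g_def)
  have one: "AE z in lebesgue. 1 = \<nu> z powr (1 / S) * g z powr (1 - 1 / S)"
    using nu_mean pos
  proof eventually_elim
    fix z assume z: "\<nu> z = \<mu> z powr a * \<sigma> z powr b" "0 < \<mu> z" "0 < \<mu>' z" "0 < lam z" "0 < \<sigma> z"
    have "- 1 / (p - 1) * (x / S) = - (a / S)" using p by (simp add: x_def)
    then have m: "\<mu>' z powr (x / S) = \<mu> z powr (- (a / S))" unfolding \<mu>'_def powr_powr by simp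
    have "- 1 / (q - 1) * (b / S) = - (y / S)" using q' by (simp add: y_def)
    then have s: "\<sigma> z powr (b / S) = lam z powr (- (y / S))" unfolding \<sigma>_def powr_powr by simp
    have "\<nu> z powr (1 / S) = \<mu> z powr (a / S) * \<sigma> z powr (b / S)" unfolding z(1) powr_mult powr_powr by simp
    moreover have "g z powr (1 - 1 / S) = \<mu>' z powr (x / S) * lam z powr (y / S)" unfolding g_def powr_mult powr_powr es ..
    ultimately have "\<nu> z powr (1 / S) * g z powr (1 - 1 / S) = (\<mu> z powr (a / S) * \<mu> z powr (- (a / S))) * (lam z powr (- (y / S)) * lam z powr (y / S))"
      unfolding m s by simp
    then show "1 = \<nu> z powr (1 / S) * g z powr (1 - 1 / S)" using z by (simp add: powr_add[symmetric])
  qed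
  have "measure (wm \<mu>) (cube \<beta> c s) powr a * measure (wm \<sigma>) (cube \<beta> c s) powr b \<le> (C1 powr a * C2 powr b) * measure (wm \<nu>) (cube \<beta> c s)"
    if s: "0 < s" for c s
  proof -
    let ?Q = "cube \<beta> c s"
    let ?A = "measure (wm \<mu>) ?Q" and ?B = "measure (wm \<sigma>) ?Q" and ?X = "measure (wm \<nu>) ?Q"
      and ?Y = "measure (wm \<mu>') ?Q" and ?Z = "measure (wm lam) ?Q" and ?V = "measure lebesgue ?Q"
    have V0: "0 < ?V" unfolding emeasure_cube_lebesgue(2)[OF s] using s by simp
    have f: "emeasure (wm \<mu>') ?Q < \<infinity>" "emeasure (wm lam) ?Q < \<infinity>"
      using muck_mu muck_lam s unfolding muck_def by auto
    have fn: "emeasure (wm \<nu>) ?Q < \<infinity>" by (rule nu_upper_cube(1)[OF _ subset_refl]) simp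
    have gQ: "emeasure (wm g) ?Q \<le> ennreal (?Y powr \<eta> * ?Z powr (1 - \<eta>))"
      by (rule wm_geometric_mean[OF meas(2) pos(2) meas(3) pos(3) eta(1,2)]) (use f in \<open>auto simp: g_def\<close>)
    then have fg: "emeasure (wm g) ?Q < \<infinity>" by (rule le_less_trans) simp
    then have "emeasure (wm g) ?Q = ennreal (measure (wm g) ?Q)" by (intro emeasure_eq_ennreal_measure) (simp add: less_top)
    then have gQ': "measure (wm g) ?Q \<le> ?Y powr \<eta> * ?Z powr (1 - \<eta>)" using gQ by simp
    have "emeasure (wm (\<lambda>_. 1)) ?Q \<le> ennreal (?X powr (1 / S) * measure (wm g) ?Q powr (1 - 1 / S))"
      by (rule wm_geometric_mean[OF nu _ gpos _ _ _ one _ fn fg]) (use S in auto)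
    then have "?V \<le> ?X powr (1 / S) * measure (wm g) ?Q powr (1 - 1 / S)"
      unfolding wm_one[OF cube_lebesgue] emeasure_cube_lebesgue(1)[OF s] emeasure_cube_lebesgue(2)[OF s] by simp
    also have "\<dots> \<le> ?X powr (1 / S) * (?Y powr \<eta> * ?Z powr (1 - \<eta>)) powr (1 - 1 / S)"
      using S gQ' by (intro mult_left_mono powr_mono2) auto
    also have "\<dots> = ?X powr (1 / S) * (?Y powr (x / S) * ?Z powr (y / S))" unfolding powr_mult powr_powr es ..
    finally have "?V powr S \<le> (?X powr (1 / S) * (?Y powr (x / S) * ?Z powr (y / S))) powr S"
      using S by (intro powr_mono2) auto
    also have "\<dots> = ?X * (?Y powr x * ?Z powr y)" using S by (simp add: powr_mult powr_powr)
    finally have VS: "?V powr S \<le> ?X * (?Y powr x * ?Z powr y)" .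
    have "(?A * ?Y powr (p - 1)) powr a \<le> (C1 * ?V powr p) powr a" using C1(2)[OF s, of c] ab by (intro powr_mono2) auto
    then have AY: "?A powr a * ?Y powr x \<le> C1 powr a * ?V powr (a * p)" unfolding powr_mult powr_powr x_def by (simp only: mult.commute)
    have "(?B * ?Z powr (q' - 1)) powr b \<le> (C2 * ?V powr q') powr b" using C2(2)[OF s, of c] ab by (intro powr_mono2) auto
    then have BZ: "?B powr b * ?Z powr y \<le> C2 powr b * ?V powr (b * q')" unfolding powr_mult powr_powr y_def by (simp only: mult.commute)
    have "(?A powr a * ?B powr b) * ?V powr S \<le> (?A powr a * ?B powr b) * (?X * (?Y powr x * ?Z powr y))"
      using VS by (rule mult_left_mono) simp
    also have "\<dots> = ?X * ((?A powr a * ?Y powr x) * (?B powr b * ?Z powr y))" by simp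
    also have "\<dots> \<le> ?X * ((C1 powr a * ?V powr (a * p)) * (C2 powr b * ?V powr (b * q')))"
      by (rule mult_left_mono[OF mult_mono[OF AY BZ]]) auto
    also have "\<dots> = ((C1 powr a * C2 powr b) * ?X) * ?V powr S" unfolding S2 powr_add by simp
    finally show ?thesis by (rule mult_right_le_imp_le) (use V0 in simp)
  qed
  then show ?thesis using C1(1) C2(1) by (intro exI[of _ "C1 powr a * C2 powr b"]) auto
qed

definition "cnu = (SOME C. 0 < C \<and> (\<forall>c s. 0 < s \<longrightarrow> measure (wm \<mu>) (cube \<beta> c s) powr a * measure (wm \<sigma>) (cube \<beta> c s) powr b \<le> C * measure (wm \<nu>) (cube \<beta> c s)))"

lemma cnu: "0 < cnu" "0 < s \<Longrightarrow> measure (wm \<mu>) (cube \<beta> c s) powr a * measure (wm \<sigma>) (cube \<beta> c s) powr b \<le> cnu * measure (wm \<nu>) (cube \<beta> c s)"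
  using someI_ex[OF nu_lower] unfolding cnu_def by auto

text \<open>Doubling is inherited from \<open>\<mu>\<close> and \<open>\<sigma>\<close>: \<nu> is
  compared with their geometric mean from above on the dilate and from below on the cube.\<close>

sublocale Nu: cube_measure "wm \<nu>" \<beta>
proof (rule cube_measure_wm[OF beta(1) b2(2) nu])
  show "emeasure (wm \<nu>) (cube \<beta> c s) < \<infinity>" for c s by (rule nu_upper_cube(1)[OF _ subset_refl]) simp
  fix K :: real assume K: "1 \<le> K"
  obtain D1 where D1: "\<And>c s. 0 < s \<Longrightarrow> measure (wm \<mu>) (cube \<beta> c (K * s)) \<le> D1 * measure (wm \<mu>) (cube \<beta> c s)"
    using Mu.doubling[OF K] by blast
  obtain D2 where D2: "\<And>c s. 0 < s \<Longrightarrow> measure (wm \<sigma>) (cube \<beta> c (K * s)) \<le> D2 * measure (wm \<sigma>) (cube \<beta> c s)"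
    using Sig.doubling[OF K] by blast
  have "measure (wm \<nu>) (cube \<beta> c (K * s)) \<le> (D1 powr a * D2 powr b * cnu) * measure (wm \<nu>) (cube \<beta> c s)" if s: "0 < s" for c s
  proof -
    let ?Q = "cube \<beta> c s" and ?R = "cube \<beta> c (K * s)"
    have "measure (wm \<nu>) ?R \<le> measure (wm \<mu>) ?R powr a * measure (wm \<sigma>) ?R powr b" by (rule nu_upper_cube(2)[OF _ subset_refl]) simp
    also have "\<dots> \<le> (D1 * measure (wm \<mu>) ?Q) powr a * (D2 * measure (wm \<sigma>) ?Q) powr b"
      using D1[OF s, of c] D2[OF s, of c] ab by (intro mult_mono powr_mono2) auto
    also have "\<dots> = D1 powr a * D2 powr b * (measure (wm \<mu>) ?Q powr a * measure (wm \<sigma>) ?Q powr b)" unfolding powr_mult by simp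
    also have "\<dots> \<le> D1 powr a * D2 powr b * (cnu * measure (wm \<nu>) ?Q)" by (intro mult_left_mono cnu(2)[OF s]) simp
    finally show ?thesis by simp
  qed
  then show "\<exists>D. \<forall>c s. 0 < s \<longrightarrow> measure (wm \<nu>) (cube \<beta> c (K * s)) \<le> D * measure (wm \<nu>) (cube \<beta> c s)" by blast
qed

text \<open>Comparing the geometric means on the cube and on \<open>E\<close>, one of the two
  measures of \<open>E\<close> is enlarged to that of the cube and cancelled. The other one remains
  with its exponent, which the roots \<open>1 / a\<close> and \<open>1 / b\<close> remove.\<close>

lemma sparse_transfer:
  assumes s: "0 < s" and E: "E \<in> sets lebesgue" "E \<subseteq> cube \<beta> c s"
    and h: "measure (wm \<nu>) (cube \<beta> c s) \<le> 2 * measure (wm \<nu>) E"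
  shows "measure (wm \<mu>) (cube \<beta> c s) \<le> (2 * cnu) powr (1 / a) * measure (wm \<mu>) E"
    and "measure (wm \<sigma>) (cube \<beta> c s) \<le> (2 * cnu) powr (1 / b) * measure (wm \<sigma>) E"
proof -
  let ?Q = "cube \<beta> c s"
  let ?A = "measure (wm \<mu>) ?Q" and ?B = "measure (wm \<sigma>) ?Q" and ?E1 = "measure (wm \<mu>) E" and ?E2 = "measure (wm \<sigma>) E"
  have A0: "0 < ?A" "0 < ?B" using Mu.cube_pos[OF s] Sig.cube_pos[OF s] by auto
  have le: "?E1 \<le> ?A" "?E2 \<le> ?B"
    using Mu.cube_finite[of c s] Sig.cube_finite[of c s] E by (auto intro!: measure_mono_fmeasurable fmeasurableI)
  have "?A powr a * ?B powr b \<le> cnu * measure (wm \<nu>) ?Q" by (rule cnu(2)[OF s])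
  also have "\<dots> \<le> cnu * (2 * measure (wm \<nu>) E)" using h cnu(1) by (intro mult_left_mono) auto
  also have "\<dots> \<le> cnu * (2 * (?E1 powr a * ?E2 powr b))" using nu_upper_cube(2)[OF E] cnu(1) by (intro mult_left_mono) auto
  finally have m: "?A powr a * ?B powr b \<le> 2 * cnu * (?E1 powr a * ?E2 powr b)" by simp
  have root: "A \<le> (2 * cnu) powr (1 / e) * E'" if "0 < e" "0 \<le> A" "0 \<le> E'" "A powr e \<le> 2 * cnu * E' powr e" for A E' e :: real
  proof -
    have "(A powr e) powr (1 / e) \<le> (2 * cnu * E' powr e) powr (1 / e)" using that by (intro powr_mono2) auto
    then have "(A powr e) powr (1 / e) \<le> (2 * cnu) powr (1 / e) * (E' powr e) powr (1 / e)" by (simp only: powr_mult)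
    then show ?thesis using that by (simp add: powr_powr)
  qed
  show "?A \<le> (2 * cnu) powr (1 / a) * ?E1"
  proof (rule root)
    have "?A powr a * ?B powr b \<le> 2 * cnu * (?E1 powr a * ?B powr b)"
      using m le(2) ab cnu(1) by (elim order_trans) (intro mult_left_mono powr_mono2, auto)
    then have "?A powr a * ?B powr b \<le> (2 * cnu * ?E1 powr a) * ?B powr b" by simp
    then show "?A powr a \<le> 2 * cnu * ?E1 powr a" by (rule mult_right_le_imp_le) (use A0 in simp)
  qed (use ab in auto)
  show "?B \<le> (2 * cnu) powr (1 / b) * ?E2"
  proof (rule root)
    have "?A powr a * ?B powr b \<le> 2 * cnu * (?A powr a * ?E2 powr b)"
      using m le(1) ab cnu(1) by (elim order_trans) (intro mult_left_mono mult_right_mono powr_mono2, auto)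
    then have "?B powr b * ?A powr a \<le> (2 * cnu * ?E2 powr b) * ?A powr a" by (simp add: mult_ac)
    then show "?B powr b \<le> 2 * cnu * ?E2 powr b" by (rule mult_right_le_imp_le) (use A0 in simp)
  qed (use ab in auto)
qed

end

section \<open>Principal values and the commutator\<close>

text \<open>The average of the right-hand side over all choices of signs is the left-hand side.\<close>

lemma signs_exist:
  fixes c :: "'i \<Rightarrow> 'i \<Rightarrow> real"
  assumes "finite G"
  shows "\<exists>\<eta>. (\<forall>i. \<bar>\<eta> i\<bar> = 1) \<and> (\<Sum>i\<in>G. c i i) \<le> (\<Sum>i\<in>G. \<Sum>j\<in>G. \<eta> i * \<eta> j * c i j)"
  using assms
proof induction
  case empty
  show ?case by (intro exI[of _ "\<lambda>_. 1"]) simp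
next
  case (insert k G)
  then obtain \<eta> where e: "\<forall>i. \<bar>\<eta> i\<bar> = 1" "(\<Sum>i\<in>G. c i i) \<le> (\<Sum>i\<in>G. \<Sum>j\<in>G. \<eta> i * \<eta> j * c i j)" by blast
  \<comment> \<open>The terms in which the new sign occurs once add up to \<open>t * R\<close>.
    Taking \<open>t\<close> with the sign of \<open>R\<close> makes them nonnegative, so no
    averaging is required.\<close>
  define R where "R = (\<Sum>i\<in>G. \<eta> i * (c i k + c k i))"
  define t :: real where "t = (if 0 \<le> R then 1 else -1)"
  define \<eta>' where "\<eta>' = \<eta>(k := t)"
  have t: "\<bar>t\<bar> = 1" "t * t = 1" "0 \<le> t * R" by (auto simp: t_def)
  have same: "\<eta>' i = \<eta> i" if "i \<in> G" for i using that insert(2) by (auto simp: \<eta>'_def)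
  have "(\<Sum>i\<in>insert k G. \<Sum>j\<in>insert k G. \<eta>' i * \<eta>' j * c i j)
      = t * t * c k k + (\<Sum>j\<in>G. t * \<eta> j * c k j) + (\<Sum>i\<in>G. \<eta> i * t * c i k) + (\<Sum>i\<in>G. \<Sum>j\<in>G. \<eta> i * \<eta> j * c i j)"
    using insert(1,2) by (simp add: sum.distrib same) (simp add: \<eta>'_def)
  also have "\<dots> = c k k + t * R + (\<Sum>i\<in>G. \<Sum>j\<in>G. \<eta> i * \<eta> j * c i j)"
    unfolding t(2) R_def by (simp add: sum_distrib_left sum.distrib algebra_simps)
  also have "\<dots> \<ge> c k k + (\<Sum>i\<in>G. c i i)" using t(3) e(2) by linarith
  finally have "(\<Sum>i\<in>insert k G. c i i) \<le> (\<Sum>i\<in>insert k G. \<Sum>j\<in>insert k G. \<eta>' i * \<eta>' j * c i j)"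
    using insert(1,2) by simp
  moreover have "\<forall>i. \<bar>\<eta>' i\<bar> = 1" using e(1) t(1) by (simp add: \<eta>'_def)
  ultimately show ?case by blast
qed

section \<open>Null sets and measurability for principal values\<close>

lemma borel_representative:
  fixes b :: "real \<times> real \<Rightarrow> complex"
  assumes "b \<in> borel_measurable lebesgue"
  obtains b' where "b' \<in> borel_measurable borel" "AE x in lborel. b x = b' x"
proof -
  have "(\<lambda>x. Re (b x)) \<in> borel_measurable lebesgue" "(\<lambda>x. Im (b x)) \<in> borel_measurable lebesgue"
    using assms by measurable
  from completion_ex_borel_measurable_real[OF this(1)] completion_ex_borel_measurable_real[OF this(2)]
  obtain u v where u: "u \<in> borel_measurable lborel" "AE x in lborel. Re (b x) = u x"
    and v: "v \<in> borel_measurable lborel" "AE x in lborel. Im (b x) = v x" by blast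
  show ?thesis
  proof (rule that[of "\<lambda>x. complex_of_real (u x) + \<i> * complex_of_real (v x)"])
    show "(\<lambda>x. complex_of_real (u x) + \<i> * complex_of_real (v x)) \<in> borel_measurable borel" using u(1) v(1) by simp
    show "AE x in lborel. b x = complex_of_real (u x) + \<i> * complex_of_real (v x)"
      using u(2) v(2) by eventually_elim (simp add: complex_eq_iff)
  qed
qed

text \<open>A curve is a null set of the plane, so equality almost everywhere says nothing on a
  single translate of it. For each fixed \<open>t\<close> the translated exceptional set is null,
  and Fubini gives the claim for almost every translate.\<close>

lemma AE_translated_curve:
  fixes g :: "real \<Rightarrow> real \<times> real"
  assumes [measurable]: "g \<in> borel_measurable borel" and P: "AE x in lborel. P x"
  shows "AE x in lborel. AE t in lborel. P (x - g t)"
proof -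
  obtain N where N: "N \<in> null_sets lborel" "{x \<in> space lborel. \<not> P x} \<subseteq> N" using P unfolding eventually_ae_filter by blast
  then have [measurable]: "N \<in> sets borel" by auto
  have "(\<integral>\<^sup>+x. \<integral>\<^sup>+t. indicator N (x - g t) \<partial>lborel \<partial>lborel) = (\<integral>\<^sup>+t. \<integral>\<^sup>+x. indicator N (x - g t) \<partial>lborel \<partial>lborel)"
    by (rule lborel_pair.Fubini'[symmetric]) measurable
  also have "\<dots> = (\<integral>\<^sup>+(t::real). \<integral>\<^sup>+x. indicator N x \<partial>lborel \<partial>lborel)"
    by (rule nn_integral_cong, rule nn_integral_lborel_translate[where f = "indicator N"]) simp
  also have "\<dots> = 0" using N by (simp add: null_sets_def)
  finally have "AE x in lborel. (\<integral>\<^sup>+t. indicator N (x - g t) \<partial>lborel) = 0"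
    by (subst (asm) nn_integral_0_iff_AE) measurable
  then show ?thesis
  proof eventually_elim
    fix x assume "(\<integral>\<^sup>+t. indicator N (x - g t) \<partial>lborel) = (0::ennreal)"
    then have "AE t in lborel. indicator N (x - g t) = (0::ennreal)" by (subst (asm) nn_integral_0_iff_AE) measurable
    then show "AE t in lborel. P (x - g t)"
      by eventually_elim (use N(2) in \<open>auto simp: indicator_def split: if_splits\<close>)
  qed
qed

lemma hilbert_tendsto:
  assumes "hilbert_exists \<gamma> f x"
  shows "((\<lambda>\<eta>. truncated_hilbert \<gamma> \<eta> f x) \<longlongrightarrow> hilbert \<gamma> f x) (at_right 0)"
proof -
  obtain l where l: "((\<lambda>\<eta>. truncated_hilbert \<gamma> \<eta> f x) \<longlongrightarrow> l) (at_right 0)" using assms unfolding hilbert_exists_def by blast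
  then have "hilbert \<gamma> f x = l" unfolding hilbert_def by (intro tendsto_Lim) auto
  with l show ?thesis by simp
qed

lemma hilbert_cong:
  assumes ex: "hilbert_exists \<gamma> f x"
    and tr: "\<And>\<eta>. 0 < \<eta> \<Longrightarrow> truncated_hilbert \<gamma> \<eta> g x = truncated_hilbert \<gamma> \<eta> f x"
  shows "((\<lambda>\<eta>. truncated_hilbert \<gamma> \<eta> g x) \<longlongrightarrow> hilbert \<gamma> f x) (at_right 0)" "hilbert \<gamma> g x = hilbert \<gamma> f x"
proof -
  have "eventually (\<lambda>\<eta>. truncated_hilbert \<gamma> \<eta> f x = truncated_hilbert \<gamma> \<eta> g x) (at_right 0)"
    using eventually_at_right_less[of "0::real"] by eventually_elim (simp add: tr)
  with hilbert_tendsto[OF ex]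
  show t: "((\<lambda>\<eta>. truncated_hilbert \<gamma> \<eta> g x) \<longlongrightarrow> hilbert \<gamma> f x) (at_right 0)" by (rule Lim_transform_eventually)
  show "hilbert \<gamma> g x = hilbert \<gamma> f x"
    unfolding hilbert_def[of \<gamma> g x] using t by (intro tendsto_Lim) auto
qed

lemma truncated_hilbert_cong_AE:
  assumes f: "set_integrable lebesgue {t. \<eta> < \<bar>t\<bar>} (\<lambda>t. f (x - \<gamma> t) / of_real t)"
    and [measurable]: "\<gamma> \<in> borel_measurable borel" "g \<in> borel_measurable borel"
    and ae: "AE t in lborel. f (x - \<gamma> t) = g (x - \<gamma> t)"
  shows "truncated_hilbert \<gamma> \<eta> g x = truncated_hilbert \<gamma> \<eta> f x"
  unfolding truncated_hilbert_def set_lebesgue_integral_def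
proof (rule integral_cong_AE)
  show "(\<lambda>t. indicat_real {t. \<eta> < \<bar>t\<bar>} t *\<^sub>R (g (x - \<gamma> t) / complex_of_real t)) \<in> borel_measurable lebesgue"
    by (rule measurable_completion) measurable
  show "(\<lambda>t. indicat_real {t. \<eta> < \<bar>t\<bar>} t *\<^sub>R (f (x - \<gamma> t) / complex_of_real t)) \<in> borel_measurable lebesgue"
    using f unfolding set_integrable_def by (rule borel_measurable_integrable)
  show "AE t in lebesgue. indicat_real {t. \<eta> < \<bar>t\<bar>} t *\<^sub>R (g (x - \<gamma> t) / complex_of_real t) = indicat_real {t. \<eta> < \<bar>t\<bar>} t *\<^sub>R (f (x - \<gamma> t) / complex_of_real t)"
    using ae unfolding AE_completion_iff by eventually_elim simp
qed

lemma measurable_truncated_hilbert: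
  assumes [measurable]: "\<gamma> \<in> borel_measurable borel" "f \<in> borel_measurable borel"
  shows "truncated_hilbert \<gamma> \<eta> f \<in> borel_measurable borel"
proof -
  have "truncated_hilbert \<gamma> \<eta> f x = (LINT t|lborel. indicat_real {t. \<eta> < \<bar>t\<bar>} t *\<^sub>R (f (x - \<gamma> t) / complex_of_real t))" for x
    unfolding truncated_hilbert_def set_lebesgue_integral_def by (rule integral_completion) measurable
  then have "truncated_hilbert \<gamma> \<eta> f = (\<lambda>x. LINT t|lborel. indicat_real {t. \<eta> < \<bar>t\<bar>} t *\<^sub>R (f (x - \<gamma> t) / complex_of_real t))" by blast
  then show ?thesis by (simp only:) measurable
qed

text \<open>A Borel function that agrees with \<open>hilbert\<close> wherever the principal value exists.\<close>

definition hilbert_seq :: "(real \<Rightarrow> real \<times> real) \<Rightarrow> (real \<times> real \<Rightarrow> complex) \<Rightarrow> real \<times> real \<Rightarrow> complex" where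
  "hilbert_seq \<gamma> f x = lim (\<lambda>n. truncated_hilbert \<gamma> (1 / real (Suc n)) f x)"

lemma measurable_hilbert_seq:
  assumes "\<gamma> \<in> borel_measurable borel" "f \<in> borel_measurable borel"
  shows "hilbert_seq \<gamma> f \<in> borel_measurable borel"
  unfolding hilbert_seq_def using measurable_truncated_hilbert[OF assms] by (rule borel_measurable_lim_metric)

lemma hilbert_seq_eq:
  assumes "((\<lambda>\<eta>. truncated_hilbert \<gamma> \<eta> f x) \<longlongrightarrow> l) (at_right 0)"
  shows "hilbert_seq \<gamma> f x = l"
proof -
  have "filterlim (\<lambda>n. 1 / real (Suc n)) (at_right 0) sequentially"
    by (intro tendsto_imp_filterlim_at_right lim_1_over_n[THEN LIMSEQ_Suc] always_eventually) simp
  from filterlim_compose[OF assms this] show ?thesis unfolding hilbert_seq_def by (rule limI)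
qed

text \<open>Measurability of the principal value is obtained from a limit along a sequence. One
  function \<open>k\<close> stands for two commutators, because the operator norm speaks of
  \<open>b\<close> and the local bounds of its Borel version \<open>b'\<close>.\<close>

lemma commutator_representative:
  fixes b f :: "real \<times> real \<Rightarrow> complex"
  assumes g: "\<gamma> \<in> borel_measurable borel" and b': "b' \<in> borel_measurable borel" "AE x in lborel. b x = b' x"
    and f: "f \<in> borel_measurable borel"
    and ex: "AE x in lborel. hilbert_exists \<gamma> f x \<and> hilbert_exists \<gamma> (\<lambda>y. b y * f y) x"
  obtains k where "k \<in> borel_measurable borel" "AE x in lborel. commutator \<gamma> b f x = k x"
    "AE x in lborel. commutator \<gamma> b' f x = k x"
proof (rule that[of "\<lambda>x. b' x * hilbert_seq \<gamma> f x - hilbert_seq \<gamma> (\<lambda>y. b' y * f y) x"])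
  have b'f: "(\<lambda>y. b' y * f y) \<in> borel_measurable borel" using b'(1) f by measurable
  show "(\<lambda>x. b' x * hilbert_seq \<gamma> f x - hilbert_seq \<gamma> (\<lambda>y. b' y * f y) x) \<in> borel_measurable borel"
    using b'(1) measurable_hilbert_seq[OF g f] measurable_hilbert_seq[OF g b'f] by measurable
  have "AE x in lborel. AE t in lborel. b (x - \<gamma> t) = b' (x - \<gamma> t)" by (rule AE_translated_curve[OF g b'(2)])
  with ex b'(2)
  have main: "AE x in lborel. b x = b' x \<and> hilbert_seq \<gamma> f x = hilbert \<gamma> f x \<and> hilbert \<gamma> (\<lambda>y. b' y * f y) x = hilbert \<gamma> (\<lambda>y. b y * f y) x
     \<and> hilbert_seq \<gamma> (\<lambda>y. b' y * f y) x = hilbert \<gamma> (\<lambda>y. b y * f y) x"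
  proof eventually_elim
    fix x assume ex: "hilbert_exists \<gamma> f x \<and> hilbert_exists \<gamma> (\<lambda>y. b y * f y) x" and bx: "b x = b' x"
      and ae: "AE t in lborel. b (x - \<gamma> t) = b' (x - \<gamma> t)"
    have tr: "truncated_hilbert \<gamma> \<eta> (\<lambda>y. b' y * f y) x = truncated_hilbert \<gamma> \<eta> (\<lambda>y. b y * f y) x" if "0 < \<eta>" for \<eta>
    proof (rule truncated_hilbert_cong_AE[OF _ g b'f])
      show "set_integrable lebesgue {t. \<eta> < \<bar>t\<bar>} (\<lambda>t. b (x - \<gamma> t) * f (x - \<gamma> t) / complex_of_real t)"
        using ex that unfolding hilbert_exists_def by blast
      show "AE t in lborel. b (x - \<gamma> t) * f (x - \<gamma> t) = b' (x - \<gamma> t) * f (x - \<gamma> t)" using ae by eventually_elim simp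
    qed
    have ex2: "hilbert_exists \<gamma> (\<lambda>y. b y * f y) x" using ex by blast
    note c = hilbert_cong[OF ex2 tr]
    show "b x = b' x \<and> hilbert_seq \<gamma> f x = hilbert \<gamma> f x \<and> hilbert \<gamma> (\<lambda>y. b' y * f y) x = hilbert \<gamma> (\<lambda>y. b y * f y) x
       \<and> hilbert_seq \<gamma> (\<lambda>y. b' y * f y) x = hilbert \<gamma> (\<lambda>y. b y * f y) x"
      using bx hilbert_seq_eq[OF hilbert_tendsto] ex c(2) hilbert_seq_eq[OF c(1)] by blast
  qed
  show "AE x in lborel. commutator \<gamma> b f x = b' x * hilbert_seq \<gamma> f x - hilbert_seq \<gamma> (\<lambda>y. b' y * f y) x"
    using main by eventually_elim (simp add: commutator_def)
  show "AE x in lborel. commutator \<gamma> b' f x = b' x * hilbert_seq \<gamma> f x - hilbert_seq \<gamma> (\<lambda>y. b' y * f y) x"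
    using main by eventually_elim (simp add: commutator_def)
qed

text \<open>Existence of the individual principal values is what makes this true at
  \<open>x\<close>: without it integrals and limits may be mere default values, which are not
  additive.\<close>

lemma hilbert_sum:
  fixes f :: "'i \<Rightarrow> real \<times> real \<Rightarrow> complex"
  assumes G: "finite G" and ex: "\<And>i. i \<in> G \<Longrightarrow> hilbert_exists \<gamma> (f i) x"
  shows "hilbert \<gamma> (\<lambda>y. \<Sum>i\<in>G. w i * f i y) x = (\<Sum>i\<in>G. w i * hilbert \<gamma> (f i) x)"
proof -
  have tr: "truncated_hilbert \<gamma> \<eta> (\<lambda>y. \<Sum>i\<in>G. w i * f i y) x = (\<Sum>i\<in>G. w i * truncated_hilbert \<gamma> \<eta> (f i) x)" if "0 < \<eta>" for \<eta>
  proof -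
    have int: "integrable lebesgue (\<lambda>t. indicat_real {t. \<eta> < \<bar>t\<bar>} t *\<^sub>R (f i (x - \<gamma> t) / complex_of_real t))" if "i \<in> G" for i
      using ex[OF that] \<open>0 < \<eta>\<close> unfolding hilbert_exists_def set_integrable_def by blast
    have "truncated_hilbert \<gamma> \<eta> (\<lambda>y. \<Sum>i\<in>G. w i * f i y) x
        = (LINT t|lebesgue. (\<Sum>i\<in>G. w i * (indicat_real {t. \<eta> < \<bar>t\<bar>} t *\<^sub>R (f i (x - \<gamma> t) / complex_of_real t))))"
      unfolding truncated_hilbert_def set_lebesgue_integral_def
      by (intro Bochner_Integration.integral_cong refl) (simp add: sum_divide_distrib scaleR_sum_right)
    also have "\<dots> = (\<Sum>i\<in>G. LINT t|lebesgue. w i * (indicat_real {t. \<eta> < \<bar>t\<bar>} t *\<^sub>R (f i (x - \<gamma> t) / complex_of_real t)))"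
      using int by (intro Bochner_Integration.integral_sum integrable_mult_right) auto
    also have "\<dots> = (\<Sum>i\<in>G. w i * truncated_hilbert \<gamma> \<eta> (f i) x)"
      unfolding truncated_hilbert_def set_lebesgue_integral_def by (intro sum.cong refl integral_mult_right_zero)
    finally show ?thesis .
  qed
  have "((\<lambda>\<eta>. \<Sum>i\<in>G. w i * truncated_hilbert \<gamma> \<eta> (f i) x) \<longlongrightarrow> (\<Sum>i\<in>G. w i * hilbert \<gamma> (f i) x)) (at_right 0)"
    using ex by (intro tendsto_sum tendsto_mult tendsto_const hilbert_tendsto)
  moreover have "eventually (\<lambda>\<eta>. (\<Sum>i\<in>G. w i * truncated_hilbert \<gamma> \<eta> (f i) x) = truncated_hilbert \<gamma> \<eta> (\<lambda>y. \<Sum>i\<in>G. w i * f i y) x) (at_right 0)"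
    using eventually_at_right_less[of "0::real"] by eventually_elim (simp add: tr)
  ultimately have "((\<lambda>\<eta>. truncated_hilbert \<gamma> \<eta> (\<lambda>y. \<Sum>i\<in>G. w i * f i y) x) \<longlongrightarrow> (\<Sum>i\<in>G. w i * hilbert \<gamma> (f i) x)) (at_right 0)"
    by (rule Lim_transform_eventually)
  then show ?thesis unfolding hilbert_def[of \<gamma> "\<lambda>y. \<Sum>i\<in>G. w i * f i y"] by (intro tendsto_Lim) auto
qed

lemma commutator_sum:
  fixes f :: "'i \<Rightarrow> real \<times> real \<Rightarrow> complex"
  assumes G: "finite G" and ex: "\<And>i. i \<in> G \<Longrightarrow> hilbert_exists \<gamma> (f i) x \<and> hilbert_exists \<gamma> (\<lambda>y. b y * f i y) x"
  shows "commutator \<gamma> b (\<lambda>y. \<Sum>i\<in>G. w i * f i y) x = (\<Sum>i\<in>G. w i * commutator \<gamma> b (f i) x)"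
proof -
  have "(\<lambda>y. b y * (\<Sum>i\<in>G. w i * f i y)) = (\<lambda>y. \<Sum>i\<in>G. w i * (b y * f i y))"
    by (simp add: sum_distrib_left mult_ac)
  moreover have "hilbert \<gamma> (\<lambda>y. \<Sum>i\<in>G. w i * (b y * f i y)) x = (\<Sum>i\<in>G. w i * hilbert \<gamma> (\<lambda>y. b y * f i y) x)"
    using ex by (intro hilbert_sum[OF G]) blast
  moreover have "hilbert \<gamma> (\<lambda>y. \<Sum>i\<in>G. w i * f i y) x = (\<Sum>i\<in>G. w i * hilbert \<gamma> (f i) x)"
    using ex by (intro hilbert_sum[OF G]) blast
  ultimately show ?thesis
    by (simp add: commutator_def right_diff_distrib sum_subtractf sum_distrib_left mult_ac)
qed

section \<open>The bound for finite families of cubes\<close>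

lemma epowr_ennreal: "0 \<le> y \<Longrightarrow> epowr (ennreal y) a = ennreal (y powr a)"
  by (simp add: epowr_def)

lemma epowr_mono: "0 < a \<Longrightarrow> x \<le> y \<Longrightarrow> epowr x a \<le> epowr y a"
  by (cases x; cases y) (auto simp: epowr_def top_unique intro!: ennreal_leI powr_mono2)

lemma epowr_epowr: "0 < a \<Longrightarrow> epowr (epowr x a) (1 / a) = x" "0 < a \<Longrightarrow> epowr (epowr x (1 / a)) a = x"
  by (cases x; simp add: epowr_def powr_powr)+

lemma epowr_mult:
  assumes "0 < a" shows "epowr (x * y) a = epowr x a * epowr y a"
proof (cases x)
  case (real u)
  show ?thesis
  proof (cases y)
    case (real v)
    then show ?thesis using \<open>x = ennreal u\<close> \<open>0 \<le> u\<close> assms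
      by (simp add: epowr_ennreal ennreal_mult[symmetric] powr_mult)
  next
    case top
    then show ?thesis using real assms by (cases "u = 0") (auto simp: epowr_def ennreal_mult_top)
  qed
next
  case top
  show ?thesis
  proof (cases y)
    case (real v)
    then show ?thesis using top assms by (cases "v = 0") (auto simp: epowr_def ennreal_top_mult)
  qed (use top in \<open>simp add: epowr_def\<close>)
qed

lemma weighted_norm_eq:
  assumes s: "0 < s" and w: "AE x in lebesgue. 0 < w x"
  shows "weighted_norm s w F = epowr (\<integral>\<^sup>+x. ennreal (w x) * epowr (F x) s \<partial>lebesgue) (1 / s)"
proof -
  have "(\<integral>\<^sup>+x. epowr (F x * ennreal (w x powr (1 / s))) s \<partial>lebesgue) = (\<integral>\<^sup>+x. ennreal (w x) * epowr (F x) s \<partial>lebesgue)"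
    using w
  proof (intro nn_integral_cong_AE, eventually_elim)
    fix x assume "0 < w x"
    then show "epowr (F x * ennreal (w x powr (1 / s))) s = ennreal (w x) * epowr (F x) s"
      using s by (simp add: epowr_mult epowr_ennreal powr_powr mult.commute)
  qed
  then show ?thesis by (simp add: weighted_norm_def)
qed

text \<open>The constant is quantified before the family, so it can be fixed in advance of
  \<open>G\<close>, \<open>E\<close> and \<open>v\<close>. The sum is spread over dilates by
  \<open>R\<close>, where the functions of \<open>local_bound\<close> are supported, while the bound
  refers to the cubes themselves.\<close>

definition (in cube_measure) carleson_const :: "real \<Rightarrow> real \<Rightarrow> real \<Rightarrow> real \<Rightarrow> bool" where
  "carleson_const R p \<theta> K \<longleftrightarrow> 0 < K \<and> (\<forall>(G :: ((real \<times> real) \<times> real) set) E v.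
    finite G \<and> (\<forall>i\<in>G. 0 < snd i \<and> 0 \<le> v i \<and> E i \<in> sets lebesgue \<and> E i \<subseteq> cube \<beta> (fst i) (snd i) \<and>
      measure m (cube \<beta> (fst i) (snd i)) \<le> \<theta> * measure m (E i)) \<and> disjoint_family_on E G \<longrightarrow>
    (\<integral>\<^sup>+x. ennreal ((\<Sum>i\<in>G. v i * indicator (cube \<beta> (fst i) (R * snd i)) x) powr p) \<partial>m)
      \<le> ennreal (K powr p * (\<Sum>i\<in>G. v i powr p * measure m (cube \<beta> (fst i) (snd i)))))"

lemma (in cube_measure) carleson_constD:
  fixes G :: "((real \<times> real) \<times> real) set"
  assumes K: "carleson_const R p \<theta> K" and "finite G" "\<And>i. i \<in> G \<Longrightarrow> 0 < snd i" "\<And>i. i \<in> G \<Longrightarrow> 0 \<le> v i"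
    "disjoint_family_on E G" "\<And>i. i \<in> G \<Longrightarrow> E i \<in> sets lebesgue" "\<And>i. i \<in> G \<Longrightarrow> E i \<subseteq> cube \<beta> (fst i) (snd i)"
    "\<And>i. i \<in> G \<Longrightarrow> measure m (cube \<beta> (fst i) (snd i)) \<le> \<theta> * measure m (E i)"
  shows "(\<integral>\<^sup>+x. ennreal ((\<Sum>i\<in>G. v i * indicator (cube \<beta> (fst i) (R * snd i)) x) powr p) \<partial>m)
      \<le> ennreal (K powr p * (\<Sum>i\<in>G. v i powr p * measure m (cube \<beta> (fst i) (snd i))))"
  by (rule K[unfolded carleson_const_def, THEN conjunct2, rule_format, of G v E]) (use assms(2-) in simp)

text \<open>By doubling, \<open>E i\<close> is still a fixed portion of the dilated cube, which
  costs one factor \<open>D\<close>; another one returns from the measures of the dilates to those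
  of the cubes. The summand 1 keeps \<open>K\<close> positive if \<theta> is 0.\<close>

lemma (in cube_measure) carleson_const_exists:
  assumes R: "1 \<le> R" and p: "1 < p" and \<theta>: "0 \<le> \<theta>"
  shows "\<exists>K. carleson_const R p \<theta> K"
proof -
  obtain D where D: "\<And>c s. 0 < s \<Longrightarrow> measure m (cube \<beta> c (R * s)) \<le> D * measure m (cube \<beta> c s)"
    using doubling[OF R] by blast
  have D0: "0 < D"
  proof -
    have "0 < R * 1" using R by simp
    then have "0 < measure m (cube \<beta> 0 (R * 1))" by (rule cube_pos)
    also have "\<dots> \<le> D * measure m (cube \<beta> 0 1)" by (rule D) simp
    finally show ?thesis using cube_pos[of 1 0] by (simp add: zero_less_mult_iff)
  qed
  define K where "K = D * \<theta> * (dbl * p) * D powr (1 / p) + 1"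
  have K0: "0 < K" using D0 \<theta> dbl p unfolding K_def by (intro add_nonneg_pos mult_nonneg_nonneg) auto
  have "carleson_const R p \<theta> K"
    unfolding carleson_const_def
  proof (intro conjI K0 allI impI)
    fix G :: "((real \<times> real) \<times> real) set" and E :: "(real \<times> real) \<times> real \<Rightarrow> (real \<times> real) set" and v :: "(real \<times> real) \<times> real \<Rightarrow> real"
    assume asm: "finite G \<and> (\<forall>i\<in>G. 0 < snd i \<and> 0 \<le> v i \<and> E i \<in> sets lebesgue \<and> E i \<subseteq> cube \<beta> (fst i) (snd i) \<and>
      measure m (cube \<beta> (fst i) (snd i)) \<le> \<theta> * measure m (E i)) \<and> disjoint_family_on E G"
    have G: "finite G" and s: "\<And>i. i \<in> G \<Longrightarrow> 0 < snd i" and v: "\<And>i. i \<in> G \<Longrightarrow> 0 \<le> v i" and dis: "disjoint_family_on E G"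
      and E: "\<And>i. i \<in> G \<Longrightarrow> E i \<in> sets lebesgue" and EQ: "\<And>i. i \<in> G \<Longrightarrow> E i \<subseteq> cube \<beta> (fst i) (snd i)"
      and sp: "\<And>i. i \<in> G \<Longrightarrow> measure m (cube \<beta> (fst i) (snd i)) \<le> \<theta> * measure m (E i)"
      using asm by simp_all
    have sub: "cube \<beta> (fst i) (snd i) \<subseteq> cube \<beta> (fst i) (R * snd i)" if "i \<in> G" for i
      using beta s[OF that] R by (intro cube_subset_dilate) auto
    have sp': "measure m (cube \<beta> (fst i) (R * snd i)) \<le> (D * \<theta>) * measure m (E i)" if "i \<in> G" for i
    proof -
      have "measure m (cube \<beta> (fst i) (R * snd i)) \<le> D * measure m (cube \<beta> (fst i) (snd i))" by (rule D[OF s[OF that]])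
      also have "\<dots> \<le> D * (\<theta> * measure m (E i))" using sp[OF that] D0 by (intro mult_left_mono) auto
      finally show ?thesis by simp
    qed
    have Rs: "0 < R * snd i" if "i \<in> G" for i using R s[OF that] by simp
    have EQ': "E i \<subseteq> cube \<beta> (fst i) (R * snd i)" if "i \<in> G" for i using EQ[OF that] sub[OF that] by (rule subset_trans)
    have Dt: "0 \<le> D * \<theta>" using D0 \<theta> by simp
    have V0: "0 \<le> (\<Sum>i\<in>G. v i powr p * measure m (cube \<beta> (fst i) (snd i)))" by (intro sum_nonneg) auto
    have "(\<integral>\<^sup>+x. ennreal ((\<Sum>i\<in>G. v i * indicator (cube \<beta> (fst i) (R * snd i)) x) powr p) \<partial>m)
      \<le> ennreal (((D * \<theta>) * (dbl * p)) powr p * (\<Sum>i\<in>G. v i powr p * measure m (cube \<beta> (fst i) (R * snd i))))"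
      by (rule sparse_sum_bound[where c = fst and s = "\<lambda>i. R * snd i" and v = v and E = E, OF G Rs v p dis E EQ' sp' Dt])
    also have "\<dots> \<le> ennreal (K powr p * (\<Sum>i\<in>G. v i powr p * measure m (cube \<beta> (fst i) (snd i))))"
    proof (rule ennreal_leI)
      have "(\<Sum>i\<in>G. v i powr p * measure m (cube \<beta> (fst i) (R * snd i))) \<le> (\<Sum>i\<in>G. D * (v i powr p * measure m (cube \<beta> (fst i) (snd i))))"
      proof (rule sum_mono)
        fix i assume "i \<in> G"
        then show "v i powr p * measure m (cube \<beta> (fst i) (R * snd i)) \<le> D * (v i powr p * measure m (cube \<beta> (fst i) (snd i)))"
          using mult_left_mono[OF D[OF s], of i "v i powr p" "fst i"] by (simp add: mult_ac)
      qed
      also have "\<dots> = (D powr (1 / p)) powr p * (\<Sum>i\<in>G. v i powr p * measure m (cube \<beta> (fst i) (snd i)))"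
        using D0 p by (simp add: sum_distrib_left powr_powr)
      finally have "((D * \<theta>) * (dbl * p)) powr p * (\<Sum>i\<in>G. v i powr p * measure m (cube \<beta> (fst i) (R * snd i)))
         \<le> ((D * \<theta>) * (dbl * p)) powr p * ((D powr (1 / p)) powr p * (\<Sum>i\<in>G. v i powr p * measure m (cube \<beta> (fst i) (snd i))))"
        by (rule mult_left_mono) simp
      also have "\<dots> = ((D * \<theta>) * (dbl * p) * D powr (1 / p)) powr p * (\<Sum>i\<in>G. v i powr p * measure m (cube \<beta> (fst i) (snd i)))"
        by (simp only: powr_mult mult.assoc)
      also have "\<dots> \<le> K powr p * (\<Sum>i\<in>G. v i powr p * measure m (cube \<beta> (fst i) (snd i)))"
        using D0 \<theta> dbl p V0 by (intro mult_right_mono powr_mono2) (auto simp: K_def)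
      finally show "((D * \<theta>) * (dbl * p)) powr p * (\<Sum>i\<in>G. v i powr p * measure m (cube \<beta> (fst i) (R * snd i)))
         \<le> K powr p * (\<Sum>i\<in>G. v i powr p * measure m (cube \<beta> (fst i) (snd i)))" .
    qed
    finally show "(\<integral>\<^sup>+x. ennreal ((\<Sum>i\<in>G. v i * indicator (cube \<beta> (fst i) (R * snd i)) x) powr p) \<partial>m)
      \<le> ennreal (K powr p * (\<Sum>i\<in>G. v i powr p * measure m (cube \<beta> (fst i) (snd i))))" .
  qed
  then show ?thesis by (rule exI[where x = K])
qed

definition osc :: "(real \<times> real \<Rightarrow> complex) \<Rightarrow> (real \<times> real) set \<Rightarrow> real" where
  "osc f Q = (\<integral>x. indicator Q x * cmod (f x - (\<integral>y. indicator Q y *\<^sub>R f y \<partial>lborel) / of_real (measure lborel Q)) \<partial>lborel)"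

lemma osc_nonneg: "0 \<le> osc f Q"
  unfolding osc_def by (intro Bochner_Integration.integral_nonneg) simp

lemma nn_integral_wm:
  assumes "w \<in> borel_measurable lebesgue" "F \<in> borel_measurable lebesgue"
  shows "(\<integral>\<^sup>+x. F x \<partial>wm w) = (\<integral>\<^sup>+x. ennreal (w x) * F x \<partial>lebesgue)"
  unfolding wm_def using assms by (intro nn_integral_density) auto

section \<open>The commutator acting on sparse sums\<close>

locale bloom_commutator = bloom_weights +
  fixes \<epsilon> \<delta> :: "real \<times> real" and r :: real
  assumes mono_params: "monomial_params \<beta> \<epsilon> \<delta>" and qp: "q < p" and r_eq: "1 / q = 1 / r + 1 / p"
begin

sublocale Mo: monomial \<beta> \<epsilon> \<delta> by unfold_locales (rule mono_params)

abbreviation "\<gamma> \<equiv> monomial_curve \<beta> \<epsilon> \<delta>"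

lemma r: "1 < r" "1 / p + 1 / q' = 1 - 1 / r" "\<tau> = 1 - 1 / r"
proof -
  have "1 / p < 1 / q" using qp p q by (simp add: divide_strict_left_mono)
  then have i: "0 < 1 / r" using r_eq by simp
  then have r0: "0 < r" by (simp add: zero_less_divide_iff)
  have "1 / r < 1 / q" using r_eq p by simp
  also have "1 / q < 1" using q by simp
  finally show "1 < r" using r0 by (simp add: divide_less_eq)
  show t: "1 / p + 1 / q' = 1 - 1 / r" using r_eq q'(2) by simp
  show "\<tau> = 1 - 1 / r" using t by (simp add: \<tau>_def)
qed

text \<open>The condition that \<open>commutator_norm\<close> imposes on its finite
  constants.\<close>

definition admissible :: "(real \<times> real \<Rightarrow> complex) \<Rightarrow> real \<Rightarrow> bool" where
  "admissible f N \<longleftrightarrow> (\<forall>F\<in>test_functions.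
     (AE x in lebesgue. hilbert_exists \<gamma> F x \<and> hilbert_exists \<gamma> (\<lambda>y. f y * F y) x) \<and>
     weighted_norm q lam (\<lambda>x. ennreal (cmod (commutator \<gamma> f F x))) \<le> ennreal N * weighted_norm p \<mu> (\<lambda>x. ennreal (cmod (F x))))"

text \<open>Hoelder with the factors \<open>lam powr (1 / q)\<close> and
  \<open>lam powr (- 1 / q)\<close>; the second one to the power \<open>q'\<close> is
  \<open>\<sigma>\<close>. The Borel function \<open>k\<close> replaces the commutator so that the
  integrals can be manipulated.\<close>

lemma pairing:
  assumes adm: "admissible f N" and N: "0 \<le> N" and F: "F \<in> test_functions" "F \<in> borel_measurable borel"
    and k [measurable]: "k \<in> borel_measurable borel" and ae: "AE x in lborel. commutator \<gamma> f F x = k x"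
    and G [measurable]: "G \<in> borel_measurable borel"
    and P: "0 \<le> P" "(\<integral>\<^sup>+x. ennreal (cmod (F x) powr p) \<partial>wm \<mu>) \<le> ennreal (P powr p)"
    and Y: "0 \<le> Y" "(\<integral>\<^sup>+x. ennreal (cmod (G x) powr q') \<partial>wm \<sigma>) \<le> ennreal (Y powr q')"
  shows "(\<integral>\<^sup>+x. ennreal (cmod (G x) * cmod (k x)) \<partial>lborel) \<le> ennreal (N * P * Y)"
proof -
  have [measurable]: "F \<in> borel_measurable lebesgue" "k \<in> borel_measurable lebesgue" "G \<in> borel_measurable lebesgue"
    using F(2) k G by (auto intro: measurable_completion)
  have p0: "0 < p" "0 < q" using p q by auto
  have wp: "weighted_norm p \<mu> (\<lambda>x. ennreal (cmod (F x))) \<le> ennreal P"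
  proof -
    have "(\<integral>\<^sup>+x. ennreal (\<mu> x) * epowr (ennreal (cmod (F x))) p \<partial>lebesgue) = (\<integral>\<^sup>+x. ennreal (cmod (F x) powr p) \<partial>wm \<mu>)"
      by (simp add: nn_integral_wm epowr_ennreal)
    then have "weighted_norm p \<mu> (\<lambda>x. ennreal (cmod (F x))) \<le> epowr (ennreal (P powr p)) (1 / p)"
      unfolding weighted_norm_eq[OF p0(1) pos(1)] using P(2) p0 by (intro epowr_mono) auto
    also have "\<dots> = ennreal P" using P p0 by (simp add: epowr_ennreal powr_powr)
    finally show ?thesis .
  qed
  have "weighted_norm q lam (\<lambda>x. ennreal (cmod (commutator \<gamma> f F x))) \<le> ennreal N * weighted_norm p \<mu> (\<lambda>x. ennreal (cmod (F x)))"
    using adm F(1) unfolding admissible_def by blast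
  also have "\<dots> \<le> ennreal N * ennreal P" by (rule mult_left_mono[OF wp]) simp
  also have "\<dots> = ennreal (N * P)" using N P by (simp add: ennreal_mult)
  finally have "epowr (weighted_norm q lam (\<lambda>x. ennreal (cmod (commutator \<gamma> f F x)))) q \<le> epowr (ennreal (N * P)) q"
    using p0 by (intro epowr_mono) auto
  then have le: "(\<integral>\<^sup>+x. ennreal (lam x) * ennreal (cmod (commutator \<gamma> f F x) powr q) \<partial>lebesgue) \<le> ennreal ((N * P) powr q)"
    unfolding weighted_norm_eq[OF p0(2) pos(3)] epowr_epowr(2)[OF p0(2)] using N P by (simp add: epowr_ennreal)
  have ae': "AE x in lebesgue. commutator \<gamma> f F x = k x" using ae by (simp add: AE_completion_iff)
  define u where "u x = cmod (k x) * lam x powr (1 / q)" for x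
  define v where "v x = cmod (G x) * lam x powr (- 1 / q)" for x
  have uq: "(\<integral>\<^sup>+x. ennreal (u x powr q) \<partial>lebesgue) \<le> ennreal ((N * P) powr q)"
  proof -
    have "(\<integral>\<^sup>+x. ennreal (u x powr q) \<partial>lebesgue) = (\<integral>\<^sup>+x. ennreal (lam x) * ennreal (cmod (commutator \<gamma> f F x) powr q) \<partial>lebesgue)"
      using ae' pos(3)
    proof (intro nn_integral_cong_AE, eventually_elim)
      fix x assume x: "commutator \<gamma> f F x = k x" "0 < lam x"
      have "u x powr q = lam x * cmod (k x) powr q" using x(2) p0 by (simp add: u_def powr_mult powr_powr)
      then show "ennreal (u x powr q) = ennreal (lam x) * ennreal (cmod (commutator \<gamma> f F x) powr q)"
        unfolding x(1) using x(2) by (simp add: ennreal_mult)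
    qed
    then show ?thesis using le by simp
  qed
  have vq: "(\<integral>\<^sup>+x. ennreal (v x powr q') \<partial>lebesgue) \<le> ennreal (Y powr q')"
  proof -
    have ex: "- 1 / q * q' = - 1 / (q - 1)" using q by (simp add: q'_def)
    have "(\<integral>\<^sup>+x. ennreal (v x powr q') \<partial>lebesgue) = (\<integral>\<^sup>+x. ennreal (\<sigma> x) * ennreal (cmod (G x) powr q') \<partial>lebesgue)"
    proof (intro nn_integral_cong)
      fix x
      have "v x powr q' = \<sigma> x * cmod (G x) powr q'" unfolding v_def \<sigma>_def powr_mult powr_powr ex by (simp only: mult.commute)
      moreover have "0 \<le> \<sigma> x" by (simp add: \<sigma>_def)
      ultimately show "ennreal (v x powr q') = ennreal (\<sigma> x) * ennreal (cmod (G x) powr q')" by (simp add: ennreal_mult)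
    qed
    also have "\<dots> = (\<integral>\<^sup>+x. ennreal (cmod (G x) powr q') \<partial>wm \<sigma>)" by (rule nn_integral_wm[symmetric]) measurable
    finally show ?thesis using Y(2) by simp
  qed
  have "(\<integral>\<^sup>+x. ennreal (cmod (G x) * cmod (k x)) \<partial>lborel) = (\<integral>\<^sup>+x. ennreal (cmod (G x) * cmod (k x)) \<partial>lebesgue)"
    by (simp add: nn_integral_completion)
  also have "\<dots> = (\<integral>\<^sup>+x. ennreal (u x * v x) \<partial>lebesgue)"
    using pos(3)
  proof (intro nn_integral_cong_AE, eventually_elim)
    fix x assume "0 < lam x"
    then have "lam x powr (1 / q) * lam x powr (- 1 / q) = 1" by (simp add: powr_add[symmetric])
    then have "u x * v x = cmod (G x) * cmod (k x)" unfolding u_def v_def by (simp add: mult_ac)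
    then show "ennreal (cmod (G x) * cmod (k x)) = ennreal (u x * v x)" by simp
  qed
  also have "\<dots> \<le> ennreal (((N * P) powr q) powr (1 / q) * (Y powr q') powr (1 / q'))"
    by (rule nn_integral_Hoelder[OF _ _ _ _ _ _ _ uq vq]) (use p0 q' in \<open>auto simp: u_def v_def\<close>)
  also have "((N * P) powr q) powr (1 / q) * (Y powr q') powr (1 / q') = N * P * Y"
    using N P Y p0 q'(1) by (simp add: powr_powr)
  finally show ?thesis .
qed

lemma test_functionI:
  assumes [measurable]: "F \<in> borel_measurable borel" and "\<And>x. cmod (F x) \<le> K" "compact C" "\<And>x. x \<notin> C \<Longrightarrow> F x = 0"
  shows "F \<in> test_functions"
  unfolding test_functions_def using assms
  by (auto intro!: measurable_completion boundedI[where B = K])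

lemma compact_cube: "compact (cube \<beta> c s)"
  unfolding cube_def by (intro compact_Times compact_Icc)

text \<open>With \<open>X\<close> the sum of \<open>A i powr r\<close> times the \<nu>-mass over the
  sparse cubes, \<open>X\<close> is the sum of \<open>A i powr (r - 1) * osc\<close>. It is bounded
  through the local estimates by a multiple of the sum of \<open>u i * v i * cmod (d i)\<close>, and
  that by \<open>N * P * Y\<close>, a multiple of \<open>N * X powr (1 - 1 / r)\<close>. The factors
  lost are collected in \<open>K3\<close>.\<close>

lemma finite_family_bound:
  obtains K where "0 < K" "\<And>f f' N (I :: ((real \<times> real) \<times> real) set).
    f' \<in> borel_measurable borel \<Longrightarrow> (\<And>c s. integrable lborel (\<lambda>x. indicator (cube \<beta> c s) x *\<^sub>R f' x)) \<Longrightarrow>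
    AE x in lborel. f x = f' x \<Longrightarrow> 0 \<le> N \<Longrightarrow> admissible f N \<Longrightarrow> finite I \<Longrightarrow> (\<And>i. i \<in> I \<Longrightarrow> 0 < snd i) \<Longrightarrow>
    (\<integral>\<^sup>+x. ennreal (cmax I (\<lambda>i. cube \<beta> (fst i) (snd i))
        (\<lambda>i. osc f' (cube \<beta> (fst i) (snd i)) / measure (wm \<nu>) (cube \<beta> (fst i) (snd i))) x powr r) \<partial>wm \<nu>)
      \<le> ennreal (K * N powr r)"
proof -
  let ?R = "Mo.reach"
  obtain K1 where K1c: "Mu.carleson_const ?R p ((2 * cnu) powr (1 / a)) K1"
    using Mu.carleson_const_exists[OF Mo.reach p powr_ge_zero] by (rule exE)
  obtain K2 where K2c: "Sig.carleson_const ?R q' ((2 * cnu) powr (1 / b)) K2"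
    using Sig.carleson_const_exists[OF Mo.reach q'(1) powr_ge_zero] by (rule exE)
  have K12: "0 < K1" "0 < K2"
    using K1c[unfolded Mu.carleson_const_def, THEN conjunct1] K2c[unfolded Sig.carleson_const_def, THEN conjunct1] .
  define L where "L = 32 * Mo.mass * Mo.cost"
  have L: "0 < L" using Mo.mass Mo.cost by (simp add: L_def)
  define K3 where "K3 = cnu powr \<tau> * L * (K1 * K2)"
  have K3: "0 < K3" using cnu(1) L K12 by (simp add: K3_def)
  show ?thesis
  proof (rule that[of "2 * Nu.dbl * K3 powr r"])
    show "0 < 2 * Nu.dbl * K3 powr r" using Nu.dbl(1) K3 by simp
    fix f f' :: "real \<times> real \<Rightarrow> complex" and N :: real and I :: "((real \<times> real) \<times> real) set"
    assume f' [measurable]: "f' \<in> borel_measurable borel"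
      and fi: "\<And>c s. integrable lborel (\<lambda>x. indicator (cube \<beta> c s) x *\<^sub>R f' x)"
      and ff': "AE x in lborel. f x = f' x" and N: "0 \<le> N" and adm: "admissible f N" and I: "finite I" "\<And>i. i \<in> I \<Longrightarrow> 0 < snd i"
    let ?Q = "\<lambda>i :: (real \<times> real) \<times> real. cube \<beta> (fst i) (snd i)"
    let ?QR = "\<lambda>i :: (real \<times> real) \<times> real. cube \<beta> (fst i) (?R * snd i)"
    define A where "A i = osc f' (?Q i) / measure (wm \<nu>) (?Q i)" for i
    have A0: "0 \<le> A i" for i unfolding A_def by (intro divide_nonneg_nonneg osc_nonneg measure_nonneg)
    have r0: "0 < r" using r(1) by simp
    obtain G E where G: "G \<subseteq> I" and dis: "disjoint_family_on E G"
      and E: "\<And>i. i \<in> G \<Longrightarrow> E i \<in> sets lebesgue" and EQ: "\<And>i. i \<in> G \<Longrightarrow> E i \<subseteq> ?Q i"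
      and sp: "\<And>i. i \<in> G \<Longrightarrow> measure (wm \<nu>) (?Q i) \<le> 2 * measure (wm \<nu>) (E i)"
      and dom: "(\<integral>\<^sup>+x. ennreal (cmax I ?Q A x powr r) \<partial>wm \<nu>)
        \<le> ennreal (2 * Nu.dbl * (\<Sum>i\<in>G. A i powr r * measure (wm \<nu>) (?Q i)))"
      by (rule Nu.sparse_domination[where c = fst and s = snd and a = A, OF I A0 r0], assumption, rule that, assumption+)
    have fG: "finite G" using G I(1) by (rule finite_subset)
    have sG: "0 < snd i" if "i \<in> G" for i using that G I(2) by blast
    let ?n = "\<lambda>i. measure (wm \<nu>) (?Q i)" and ?m = "\<lambda>i. measure (wm \<mu>) (?Q i)" and ?s = "\<lambda>i. measure (wm \<sigma>) (?Q i)"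
    have mp: "0 < ?n i" "0 < ?m i" "0 < ?s i" if "i \<in> G" for i
      using Nu.cube_pos Mu.cube_pos Sig.cube_pos sG[OF that] by auto
    define X where "X = (\<Sum>i\<in>G. A i powr r * ?n i)"
    have X0: "0 \<le> X" unfolding X_def by (intro sum_nonneg) auto
    \<comment> \<open>Chosen so that both Carleson sums equal \<open>X\<close>, while
      \<open>u i * v i\<close> recovers \<open>A i powr (r - 1)\<close> up to the comparison of
      \<nu> with the geometric mean. The exponents fit because
      \<open>r / p + r / q' = r - 1\<close>.\<close>
    define v where "v i = A i powr (r / p) * (?n i / ?m i) powr (1 / p)" for i
    define u where "u i = A i powr (r / q') * (?n i / ?s i) powr (1 / q')" for i
    have uv0: "0 \<le> v i" "0 \<le> u i" for i by (simp_all add: v_def u_def)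
    have vX: "(\<Sum>i\<in>G. v i powr p * ?m i) = X"
      unfolding X_def
    proof (rule sum.cong[OF refl])
      fix i assume i: "i \<in> G"
      show "v i powr p * ?m i = A i powr r * ?n i" using mp[OF i] p by (simp add: v_def powr_mult powr_powr)
    qed
    have uX: "(\<Sum>i\<in>G. u i powr q' * ?s i) = X"
      unfolding X_def
    proof (rule sum.cong[OF refl])
      fix i assume i: "i \<in> G"
      show "u i powr q' * ?s i = A i powr r * ?n i" using mp[OF i] q'(1) by (simp add: u_def powr_mult powr_powr)
    qed
    have uv: "A i powr (r - 1) \<le> cnu powr \<tau> * (u i * v i)" if i: "i \<in> G" for i
    proof -
      have "r / p + r / q' = r * (1 / p + 1 / q')" by (simp add: distrib_left)
      also have "\<dots> = r - 1" unfolding r(2) using r(1) by (simp add: right_diff_distrib)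
      finally have ex: "A i powr (r / q') * A i powr (r / p) = A i powr (r - 1)" by (simp add: powr_add[symmetric] add.commute)
      have "(?m i powr a * ?s i powr b) powr \<tau> \<le> (cnu * ?n i) powr \<tau>"
        using cnu(2)[OF sG[OF i], of "fst i"] tau by (intro powr_mono2) auto
      then have ms: "?m i powr (1 / p) * ?s i powr (1 / q') \<le> cnu powr \<tau> * ?n i powr \<tau>"
        unfolding powr_mult powr_powr ab(4,5) .
      have nt: "?n i powr (1 / q') * ?n i powr (1 / p) = ?n i powr \<tau>" by (simp add: powr_add[symmetric] \<tau>_def add.commute)
      have "u i * v i = (A i powr (r / q') * A i powr (r / p)) * ((?n i powr (1 / q') * ?n i powr (1 / p)) / (?m i powr (1 / p) * ?s i powr (1 / q')))"
        unfolding u_def v_def by (simp only: powr_divide times_divide_times_eq times_divide_eq_left times_divide_eq_right divide_divide_eq_left mult_ac)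
      also have "\<dots> = A i powr (r - 1) * (?n i powr \<tau> / (?m i powr (1 / p) * ?s i powr (1 / q')))" unfolding ex nt ..
      finally have e: "cnu powr \<tau> * (u i * v i) = A i powr (r - 1) * ((cnu powr \<tau> * ?n i powr \<tau>) / (?m i powr (1 / p) * ?s i powr (1 / q')))" by simp
      have "1 \<le> (cnu powr \<tau> * ?n i powr \<tau>) / (?m i powr (1 / p) * ?s i powr (1 / q'))"
        using ms mp[OF i] by (subst le_divide_eq_1_pos) auto
      then have "A i powr (r - 1) * 1 \<le> A i powr (r - 1) * ((cnu powr \<tau> * ?n i powr \<tau>) / (?m i powr (1 / p) * ?s i powr (1 / q')))"
        by (rule mult_left_mono) simp
      then show ?thesis unfolding e by simp
    qed
    have "\<forall>i\<in>G. \<exists>gh. fst gh \<in> borel_measurable borel \<and> snd gh \<in> borel_measurable borel \<and>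
      (\<forall>x. \<bar>fst gh x\<bar> \<le> indicator (?QR i) x) \<and> (\<forall>x. \<bar>snd gh x\<bar> \<le> indicator (?QR i) x) \<and>
      integrable lborel (\<lambda>x. fst gh x *\<^sub>R commutator \<gamma> f' (\<lambda>x. of_real (snd gh x)) x) \<and>
      osc f' (?Q i) \<le> L * cmod (\<integral>x. fst gh x *\<^sub>R commutator \<gamma> f' (\<lambda>x. of_real (snd gh x)) x \<partial>lborel)"
    proof
      fix i assume i: "i \<in> G"
      show "\<exists>gh. fst gh \<in> borel_measurable borel \<and> snd gh \<in> borel_measurable borel \<and>
      (\<forall>x. \<bar>fst gh x\<bar> \<le> indicator (?QR i) x) \<and> (\<forall>x. \<bar>snd gh x\<bar> \<le> indicator (?QR i) x) \<and>
      integrable lborel (\<lambda>x. fst gh x *\<^sub>R commutator \<gamma> f' (\<lambda>x. of_real (snd gh x)) x) \<and>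
      osc f' (?Q i) \<le> L * cmod (\<integral>x. fst gh x *\<^sub>R commutator \<gamma> f' (\<lambda>x. of_real (snd gh x)) x \<partial>lborel)"
      proof (rule Mo.local_bound[OF sG[OF i] f' fi, of "fst i"])
        fix g h :: "real \<times> real \<Rightarrow> real"
        assume gh: "g \<in> borel_measurable borel" "h \<in> borel_measurable borel"
          "\<And>x. \<bar>g x\<bar> \<le> indicator (?QR i) x" "\<And>x. \<bar>h x\<bar> \<le> indicator (?QR i) x"
          "integrable lborel (\<lambda>x. g x *\<^sub>R commutator \<gamma> f' (\<lambda>x. of_real (h x)) x)"
          "(\<integral>x. indicator (?Q i) x * cmod (f' x - (\<integral>y. indicator (?Q i) y *\<^sub>R f' y \<partial>lborel) / of_real (measure lborel (?Q i))) \<partial>lborel)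
            \<le> 32 * Mo.mass * Mo.cost * cmod (\<integral>x. g x *\<^sub>R commutator \<gamma> f' (\<lambda>x. of_real (h x)) x \<partial>lborel)"
        show ?thesis
          by (intro exI[of _ "(g, h)"] conjI allI) (use gh in \<open>simp_all add: osc_def L_def\<close>)
      qed
    qed
    from bchoice[OF this] obtain gh where gh: "\<forall>i\<in>G. fst (gh i) \<in> borel_measurable borel \<and> snd (gh i) \<in> borel_measurable borel \<and>
      (\<forall>x. \<bar>fst (gh i) x\<bar> \<le> indicator (?QR i) x) \<and> (\<forall>x. \<bar>snd (gh i) x\<bar> \<le> indicator (?QR i) x) \<and>
      integrable lborel (\<lambda>x. fst (gh i) x *\<^sub>R commutator \<gamma> f' (\<lambda>x. of_real (snd (gh i) x)) x) \<and>
      osc f' (?Q i) \<le> L * cmod (\<integral>x. fst (gh i) x *\<^sub>R commutator \<gamma> f' (\<lambda>x. of_real (snd (gh i) x)) x \<partial>lborel)" ..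
    define g where "g i = fst (gh i)" for i
    define h where "h i x = complex_of_real (snd (gh i) x)" for i x
    have gm [measurable]: "g i \<in> borel_measurable borel" and hm [measurable]: "h i \<in> borel_measurable borel" if "i \<in> G" for i
      using gh that unfolding g_def h_def by (auto intro!: borel_measurable_of_real)
    have gQ: "\<bar>g i x\<bar> \<le> indicator (?QR i) x" and hQ: "cmod (h i x) \<le> indicator (?QR i) x" if "i \<in> G" for i x
      using gh that unfolding g_def h_def by auto
    define d where "d i = (\<integral>x. g i x *\<^sub>R commutator \<gamma> f' (h i) x \<partial>lborel)" for i
    have dint: "integrable lborel (\<lambda>x. g i x *\<^sub>R commutator \<gamma> f' (h i) x)" and dosc: "osc f' (?Q i) \<le> L * cmod (d i)" if "i \<in> G" for i
    proof -
      have e: "h i = (\<lambda>x. complex_of_real (snd (gh i) x))" by (simp add: h_def fun_eq_iff)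
      show "integrable lborel (\<lambda>x. g i x *\<^sub>R commutator \<gamma> f' (h i) x)" "osc f' (?Q i) \<le> L * cmod (d i)"
        using gh that unfolding d_def e g_def by auto
    qed
    have htest: "h i \<in> test_functions" if i: "i \<in> G" for i
    proof (rule test_functionI[OF hm[OF i] _ compact_cube])
      show "cmod (h i x) \<le> 1" for x by (rule order_trans[OF hQ[OF i]]) (simp add: indicator_def)
      show "h i x = 0" if "x \<notin> ?QR i" for x using hQ[OF i, of x] that by simp
    qed
    have hex: "AE x in lborel. hilbert_exists \<gamma> (h i) x \<and> hilbert_exists \<gamma> (\<lambda>y. f y * h i y) x" if i: "i \<in> G" for i
      using adm htest[OF i] unfolding admissible_def AE_completion_iff by blast
    have "\<forall>i\<in>G. \<exists>k. k \<in> borel_measurable borel \<and> (AE x in lborel. commutator \<gamma> f (h i) x = k x) \<and> (AE x in lborel. commutator \<gamma> f' (h i) x = k x)"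
    proof
      fix i assume i: "i \<in> G"
      show "\<exists>k. k \<in> borel_measurable borel \<and> (AE x in lborel. commutator \<gamma> f (h i) x = k x) \<and> (AE x in lborel. commutator \<gamma> f' (h i) x = k x)"
        by (rule commutator_representative[OF Mo.measurable_curve f' ff' hm[OF i] hex[OF i]]) (intro exI conjI, assumption+)
    qed
    from bchoice[OF this] obtain k where k: "\<forall>i\<in>G. k i \<in> borel_measurable borel \<and> (AE x in lborel. commutator \<gamma> f (h i) x = k i x) \<and> (AE x in lborel. commutator \<gamma> f' (h i) x = k i x)" ..
    have km [measurable]: "k i \<in> borel_measurable borel" if "i \<in> G" for i using k that by blast
    have kf: "AE x in lborel. commutator \<gamma> f (h i) x = k i x" "AE x in lborel. commutator \<gamma> f' (h i) x = k i x" if "i \<in> G" for i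
      using k that by blast+
    \<comment> \<open>The double sum also contains pairings of different cubes, on which
      \<open>local_bound\<close> is silent. Their integrability follows from the weighted estimate,
      as \<open>h j\<close> and \<open>g i\<close> are bounded by indicators of cubes.\<close>
    have gkint: "integrable lborel (\<lambda>x. g i x *\<^sub>R k j x)" if i: "i \<in> G" and j: "j \<in> G" for i j
    proof (rule integrableI_bounded)
      show "(\<lambda>x. g i x *\<^sub>R k j x) \<in> borel_measurable lborel" using gm[OF i] km[OF j] by simp
      have Gm: "(\<lambda>x. complex_of_real (g i x)) \<in> borel_measurable borel" using gm[OF i] by simp
      let ?P = "measure (wm \<mu>) (?QR j) powr (1 / p)" and ?Y = "measure (wm \<sigma>) (?QR i) powr (1 / q')"
      have P: "(\<integral>\<^sup>+x. ennreal (cmod (h j x) powr p) \<partial>wm \<mu>) \<le> ennreal (?P powr p)"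
      proof -
        have "(\<integral>\<^sup>+x. ennreal (cmod (h j x) powr p) \<partial>wm \<mu>) \<le> (\<integral>\<^sup>+x. indicator (?QR j) x \<partial>wm \<mu>)"
        proof (rule nn_integral_mono)
          fix x show "ennreal (cmod (h j x) powr p) \<le> indicator (?QR j) x"
            using hQ[OF j, of x] p powr_mono2[of p "cmod (h j x)" 1] by (cases "x \<in> ?QR j") simp_all
        qed
        also have "\<dots> = ennreal (?P powr p)" using p by (simp add: Mu.emeasure_cube powr_powr)
        finally show ?thesis .
      qed
      have Y: "(\<integral>\<^sup>+x. ennreal (cmod (complex_of_real (g i x)) powr q') \<partial>wm \<sigma>) \<le> ennreal (?Y powr q')"
      proof -
        have "(\<integral>\<^sup>+x. ennreal (cmod (complex_of_real (g i x)) powr q') \<partial>wm \<sigma>) \<le> (\<integral>\<^sup>+x. indicator (?QR i) x \<partial>wm \<sigma>)"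
        proof (rule nn_integral_mono)
          fix x show "ennreal (cmod (complex_of_real (g i x)) powr q') \<le> indicator (?QR i) x"
            using gQ[OF i, of x] q'(1) powr_mono2[of q' "\<bar>g i x\<bar>" 1] by (cases "x \<in> ?QR i") simp_all
        qed
        also have "\<dots> = ennreal (?Y powr q')" using q'(1) by (simp add: Sig.emeasure_cube powr_powr)
        finally show ?thesis .
      qed
      have "(\<integral>\<^sup>+x. ennreal (cmod (complex_of_real (g i x)) * cmod (k j x)) \<partial>lborel) \<le> ennreal (N * ?P * ?Y)"
        by (rule pairing[OF adm N htest[OF j] hm[OF j] km[OF j] kf(1)[OF j] Gm _ P _ Y]) auto
      then show "(\<integral>\<^sup>+x. ennreal (norm (g i x *\<^sub>R k j x)) \<partial>lborel) < \<infinity>"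
        by (simp add: le_less_trans[OF _ ennreal_less_top])
    qed
    have dk: "d i = (\<integral>x. g i x *\<^sub>R k i x \<partial>lborel)" if i: "i \<in> G" for i
      unfolding d_def
    proof (rule integral_cong_AE)
      show "AE x in lborel. g i x *\<^sub>R commutator \<gamma> f' (h i) x = g i x *\<^sub>R k i x" using kf(2)[OF i] by eventually_elim simp
    qed (use dint[OF i] gkint[OF i i] in \<open>auto intro: borel_measurable_integrable\<close>)
    \<comment> \<open>Rotates each diagonal pairing to its modulus.\<close>
    define \<omega> where "\<omega> i = cnj (sgn (d i))" for i
    have w1: "cmod (\<omega> i) \<le> 1" for i by (simp add: \<omega>_def norm_sgn)
    have wd: "\<omega> i * d i = of_real (cmod (d i))" for i
      by (cases "d i = 0") (simp_all add: \<omega>_def sgn_eq complex_norm_square[symmetric] power2_eq_square mult.commute)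
    define cc where "cc i j = Re (of_real (u i * v j) * \<omega> i * (\<integral>x. g i x *\<^sub>R k j x \<partial>lborel))" for i j
    have cii: "cc i i = u i * v i * cmod (d i)" if "i \<in> G" for i
      using wd[of i] unfolding cc_def dk[OF that, symmetric] by (simp add: mult.assoc)
    \<comment> \<open>The same signs enter both sparse sums below: they leave the diagonal terms
      unchanged and appear as \<open>\<eta> i * \<eta> j\<close> in the others. Real parts were
      taken in \<open>cc\<close> because the sign lemma concerns real matrices.\<close>
    obtain \<eta> where \<eta>: "\<forall>i. \<bar>\<eta> i\<bar> = 1" "(\<Sum>i\<in>G. cc i i) \<le> (\<Sum>i\<in>G. \<Sum>j\<in>G. \<eta> i * \<eta> j * cc i j)"
      using signs_exist[OF fG, of cc] by blast
    define F where "F x = (\<Sum>j\<in>G. of_real (\<eta> j * v j) * h j x)" for x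
    define kF where "kF x = (\<Sum>j\<in>G. of_real (\<eta> j * v j) * k j x)" for x
    define GG where "GG x = (\<Sum>i\<in>G. (of_real (\<eta> i * u i) * \<omega> i) * of_real (g i x))" for x
    have Fm: "F \<in> borel_measurable borel" unfolding F_def using hm by (intro borel_measurable_sum borel_measurable_times borel_measurable_const) auto
    have kFm: "kF \<in> borel_measurable borel" unfolding kF_def using km by (intro borel_measurable_sum borel_measurable_times borel_measurable_const) auto
    have GGm: "GG \<in> borel_measurable borel" unfolding GG_def using gm by (intro borel_measurable_sum borel_measurable_times borel_measurable_const borel_measurable_of_real) auto
    have Fle: "cmod (F x) \<le> (\<Sum>j\<in>G. v j * indicator (?QR j) x)" for x
      unfolding F_def
    proof (rule order_trans[OF norm_sum sum_mono])
      fix j assume j: "j \<in> G"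
      have "cmod (of_real (\<eta> j * v j) * h j x) = v j * cmod (h j x)" using \<eta>(1) uv0 by (simp add: norm_mult abs_mult)
      also have "\<dots> \<le> v j * indicator (?QR j) x" by (rule mult_left_mono[OF hQ[OF j] uv0(1)])
      finally show "cmod (of_real (\<eta> j * v j) * h j x) \<le> v j * indicator (?QR j) x" .
    qed
    have GGle: "cmod (GG x) \<le> (\<Sum>i\<in>G. u i * indicator (?QR i) x)" for x
      unfolding GG_def
    proof (rule order_trans[OF norm_sum sum_mono])
      fix i assume i: "i \<in> G"
      have "cmod ((of_real (\<eta> i * u i) * \<omega> i) * of_real (g i x)) = u i * (cmod (\<omega> i) * \<bar>g i x\<bar>)" using \<eta>(1) uv0 by (simp add: norm_mult abs_mult)
      also have "\<dots> \<le> u i * (1 * indicator (?QR i) x)" by (intro mult_left_mono mult_mono w1 gQ[OF i] uv0) auto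
      finally show "cmod ((of_real (\<eta> i * u i) * \<omega> i) * of_real (g i x)) \<le> u i * indicator (?QR i) x" by simp
    qed
    have Ftest: "F \<in> test_functions"
    proof (rule test_functionI[OF Fm])
      show "cmod (F x) \<le> (\<Sum>j\<in>G. v j)" for x
        by (rule order_trans[OF Fle sum_mono]) (use uv0 in \<open>simp add: indicator_def\<close>)
      show "compact (\<Union>j\<in>G. ?QR j)" using fG compact_cube by (intro compact_UN) auto
      show "F x = 0" if "x \<notin> (\<Union>j\<in>G. ?QR j)" for x
      proof -
        have "(\<Sum>j\<in>G. v j * indicator (?QR j) x) = 0" using that by (intro sum.neutral) auto
        then show ?thesis using Fle[of x] by simp
      qed
    qed
    have kFae: "AE x in lborel. commutator \<gamma> f F x = kF x"
    proof -
      have "AE x in lborel. \<forall>i\<in>G. hilbert_exists \<gamma> (h i) x \<and> hilbert_exists \<gamma> (\<lambda>y. f y * h i y) x"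
        using fG hex by (intro AE_finite_allI) auto
      moreover have "AE x in lborel. \<forall>i\<in>G. commutator \<gamma> f (h i) x = k i x"
        using fG kf(1) by (intro AE_finite_allI) auto
      ultimately show ?thesis
      proof eventually_elim
        fix x assume x: "\<forall>i\<in>G. hilbert_exists \<gamma> (h i) x \<and> hilbert_exists \<gamma> (\<lambda>y. f y * h i y) x" "\<forall>i\<in>G. commutator \<gamma> f (h i) x = k i x"
        have "commutator \<gamma> f F x = (\<Sum>j\<in>G. of_real (\<eta> j * v j) * commutator \<gamma> f (h j) x)"
          unfolding F_def using x(1) by (intro commutator_sum[OF fG]) blast
        then show "commutator \<gamma> f F x = kF x" unfolding kF_def using x(2) by simp
      qed
    qed
    define P where "P = K1 * X powr (1 / p)"
    define Y where "Y = K2 * X powr (1 / q')"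
    have PY: "0 \<le> P" "0 \<le> Y" using K12 by (simp_all add: P_def Y_def)
    have FP: "(\<integral>\<^sup>+x. ennreal (cmod (F x) powr p) \<partial>wm \<mu>) \<le> ennreal (P powr p)"
    proof -
      have "(\<integral>\<^sup>+x. ennreal (cmod (F x) powr p) \<partial>wm \<mu>) \<le> (\<integral>\<^sup>+x. ennreal ((\<Sum>i\<in>G. v i * indicator (?QR i) x) powr p) \<partial>wm \<mu>)"
        using Fle p by (intro nn_integral_mono ennreal_leI powr_mono2) auto
      also have "\<dots> \<le> ennreal (K1 powr p * (\<Sum>i\<in>G. v i powr p * ?m i))"
        by (rule Mu.carleson_constD[OF K1c fG sG uv0(1) dis E EQ sparse_transfer(1)[OF sG E EQ sp]])
      also have "K1 powr p * (\<Sum>i\<in>G. v i powr p * ?m i) = P powr p"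
        unfolding vX P_def powr_mult using X0 p by (simp add: powr_powr)
      finally show ?thesis .
    qed
    have GY: "(\<integral>\<^sup>+x. ennreal (cmod (GG x) powr q') \<partial>wm \<sigma>) \<le> ennreal (Y powr q')"
    proof -
      have "(\<integral>\<^sup>+x. ennreal (cmod (GG x) powr q') \<partial>wm \<sigma>) \<le> (\<integral>\<^sup>+x. ennreal ((\<Sum>i\<in>G. u i * indicator (?QR i) x) powr q') \<partial>wm \<sigma>)"
        using GGle q'(1) by (intro nn_integral_mono ennreal_leI powr_mono2) auto
      also have "\<dots> \<le> ennreal (K2 powr q' * (\<Sum>i\<in>G. u i powr q' * ?s i))"
        by (rule Sig.carleson_constD[OF K2c fG sG uv0(2) dis E EQ sparse_transfer(2)[OF sG E EQ sp]])
      also have "K2 powr q' * (\<Sum>i\<in>G. u i powr q' * ?s i) = Y powr q'"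
        unfolding uX Y_def powr_mult using X0 q'(1) by (simp add: powr_powr)
      finally show ?thesis .
    qed
    have pr: "(\<integral>\<^sup>+x. ennreal (cmod (GG x) * cmod (kF x)) \<partial>lborel) \<le> ennreal (N * P * Y)"
      by (rule pairing[OF adm N Ftest Fm kFm kFae GGm PY(1) FP PY(2) GY])
    have expand: "GG x * kF x = (\<Sum>i\<in>G. \<Sum>j\<in>G. (of_real (\<eta> i * \<eta> j * (u i * v j)) * \<omega> i) * (g i x *\<^sub>R k j x))" for x
      unfolding GG_def kF_def sum_product by (intro sum.cong refl) (simp add: scaleR_conv_of_real)
    have iGk: "(\<integral>x. GG x * kF x \<partial>lborel) = (\<Sum>i\<in>G. \<Sum>j\<in>G. (of_real (\<eta> i * \<eta> j * (u i * v j)) * \<omega> i) * (\<integral>x. g i x *\<^sub>R k j x \<partial>lborel))"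
    proof -
      have ij: "integrable lborel (\<lambda>x. (of_real (\<eta> i * \<eta> j * (u i * v j)) * \<omega> i) * (g i x *\<^sub>R k j x))" if "i \<in> G" "j \<in> G" for i j
        by (rule integrable_mult_right) (rule gkint[OF that])
      have "(\<integral>x. GG x * kF x \<partial>lborel) = (\<Sum>i\<in>G. \<integral>x. (\<Sum>j\<in>G. (of_real (\<eta> i * \<eta> j * (u i * v j)) * \<omega> i) * (g i x *\<^sub>R k j x)) \<partial>lborel)"
        unfolding expand by (intro Bochner_Integration.integral_sum Bochner_Integration.integrable_sum ij)
      also have "\<dots> = (\<Sum>i\<in>G. \<Sum>j\<in>G. \<integral>x. (of_real (\<eta> i * \<eta> j * (u i * v j)) * \<omega> i) * (g i x *\<^sub>R k j x) \<partial>lborel)"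
        by (intro sum.cong refl Bochner_Integration.integral_sum ij)
      also have "\<dots> = (\<Sum>i\<in>G. \<Sum>j\<in>G. (of_real (\<eta> i * \<eta> j * (u i * v j)) * \<omega> i) * (\<integral>x. g i x *\<^sub>R k j x \<partial>lborel))"
        by (intro sum.cong refl integral_mult_right_zero)
      finally show ?thesis .
    qed
    have re: "Re ((of_real (\<eta> i * \<eta> j * (u i * v j)) * \<omega> i) * (\<integral>x. g i x *\<^sub>R k j x \<partial>lborel)) = \<eta> i * \<eta> j * cc i j" for i j
    proof -
      have "(of_real (\<eta> i * \<eta> j * (u i * v j)) * \<omega> i) * (\<integral>x. g i x *\<^sub>R k j x \<partial>lborel)
          = of_real (\<eta> i * \<eta> j) * (of_real (u i * v j) * \<omega> i * (\<integral>x. g i x *\<^sub>R k j x \<partial>lborel))"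
        unfolding of_real_mult by (simp only: mult.assoc)
      moreover have "Re (of_real y * z) = y * Re z" for y z by simp
      ultimately show ?thesis unfolding cc_def by (simp only:)
    qed
    have "(\<Sum>i\<in>G. u i * v i * cmod (d i)) = (\<Sum>i\<in>G. cc i i)" using cii by simp
    also have "\<dots> \<le> Re (\<integral>x. GG x * kF x \<partial>lborel)"
      using \<eta>(2) unfolding iGk Re_sum re .
    also have "\<dots> \<le> cmod (\<integral>x. GG x * kF x \<partial>lborel)" by (rule complex_Re_le_cmod)
    also have "\<dots> \<le> N * P * Y"
    proof -
      have "ennreal (cmod (\<integral>x. GG x * kF x \<partial>lborel)) \<le> (\<integral>\<^sup>+x. ennreal (norm (GG x * kF x)) \<partial>lborel)"
      proof (rule integral_norm_bound_ennreal)
        show "integrable lborel (\<lambda>x. GG x * kF x)"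
          unfolding expand by (intro Bochner_Integration.integrable_sum integrable_mult_right gkint)
      qed
      also have "\<dots> \<le> ennreal (N * P * Y)" using pr by (simp add: norm_mult)
      finally show ?thesis using N PY by (subst (asm) ennreal_le_iff) auto
    qed
    finally have diag: "(\<Sum>i\<in>G. u i * v i * cmod (d i)) \<le> N * P * Y" .
    have "X = (\<Sum>i\<in>G. A i powr (r - 1) * osc f' (?Q i))"
      unfolding X_def
    proof (rule sum.cong[OF refl])
      fix i assume i: "i \<in> G"
      have "A i powr r = A i powr (r - 1) * A i"
        using A0[of i] r(1) powr_add[of "A i" "r - 1" 1] by (cases "A i = 0") auto
      moreover have "A i * ?n i = osc f' (?Q i)" using mp[OF i] by (simp add: A_def)
      ultimately show "A i powr r * ?n i = A i powr (r - 1) * osc f' (?Q i)" by (simp add: mult.assoc)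
    qed
    also have "\<dots> \<le> (\<Sum>i\<in>G. cnu powr \<tau> * L * (u i * v i * cmod (d i)))"
    proof (rule sum_mono)
      fix i assume i: "i \<in> G"
      have "A i powr (r - 1) * osc f' (?Q i) \<le> (cnu powr \<tau> * (u i * v i)) * (L * cmod (d i))"
        using uv[OF i] dosc[OF i] uv0 by (intro mult_mono osc_nonneg) auto
      then show "A i powr (r - 1) * osc f' (?Q i) \<le> cnu powr \<tau> * L * (u i * v i * cmod (d i))" by (simp only: mult_ac)
    qed
    also have "\<dots> = cnu powr \<tau> * L * (\<Sum>i\<in>G. u i * v i * cmod (d i))" by (simp only: sum_distrib_left)
    also have "\<dots> \<le> cnu powr \<tau> * L * (N * P * Y)" using diag L by (intro mult_left_mono) auto
    also have "\<dots> = K3 * N * (X powr (1 / p) * X powr (1 / q'))" unfolding P_def Y_def K3_def by (simp only: mult_ac)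
    also have "X powr (1 / p) * X powr (1 / q') = X powr (1 - 1 / r)" unfolding r(2)[symmetric] by (simp only: powr_add)
    finally have "X \<le> (K3 * N) powr (1 / (1 / r))"
      using X0 K3 N r0 by (intro powr_absorb) auto
    then have XN: "X \<le> K3 powr r * N powr r" by (simp add: powr_mult)
    have "2 * Nu.dbl * X \<le> 2 * Nu.dbl * (K3 powr r * N powr r)" using XN Nu.dbl(1) by (intro mult_left_mono) auto
    then have "2 * Nu.dbl * X \<le> 2 * Nu.dbl * K3 powr r * N powr r" by (simp only: mult.assoc)
    from order_trans[OF dom[folded X_def] ennreal_leI[OF this]]
    show "(\<integral>\<^sup>+x. ennreal (cmax I ?Q (\<lambda>i. osc f' (?Q i) / measure (wm \<nu>) (?Q i)) x powr r) \<partial>wm \<nu>) \<le> ennreal (2 * Nu.dbl * K3 powr r * N powr r)"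
      unfolding A_def .
  qed
qed

end

section \<open>Passage to all cubes\<close>

text \<open>Changing the mean over \<open>Q\<close> into that over \<open>Q'\<close> costs at most a
  second copy of the resulting integral. As \<open>osc\<close> is not normalized by the volume, the
  ratio of the two sets does not enter.\<close>

lemma osc_mono:
  assumes [measurable]: "f \<in> borel_measurable borel" and Q [measurable]: "Q \<in> sets borel" and Q' [measurable]: "Q' \<in> sets borel"
    and sub: "Q \<subseteq> Q'" and Qpos: "0 < measure lborel Q" and fin: "emeasure lborel Q' < \<infinity>"
    and int: "integrable lborel (\<lambda>x. indicator Q' x *\<^sub>R f x)"
  shows "osc f Q \<le> 2 * osc f Q'"
proof -
  define A where "A = (\<integral>y. indicator Q y *\<^sub>R f y \<partial>lborel) / of_real (measure lborel Q)"
  define A' where "A' = (\<integral>y. indicator Q' y *\<^sub>R f y \<partial>lborel) / of_real (measure lborel Q')"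
  have finQ: "emeasure lborel Q < \<infinity>" by (rule le_less_trans[OF emeasure_mono[OF sub] fin]) simp
  have iQ: "integrable lborel (\<lambda>x. indicator Q x *\<^sub>R f x)"
  proof (rule Bochner_Integration.integrable_bound[OF int])
    show "AE x in lborel. norm (indicator Q x *\<^sub>R f x) \<le> norm (indicator Q' x *\<^sub>R f x)"
      using sub by (auto simp: indicator_def)
  qed measurable
  have c: "integrable lborel (\<lambda>x. indicator E x *\<^sub>R (f x - z))"
    if "integrable lborel (\<lambda>x. indicator E x *\<^sub>R f x)" "E \<in> sets borel" "emeasure lborel E < \<infinity>" for E z
  proof -
    have "integrable lborel (\<lambda>x. indicator E x *\<^sub>R f x - indicator E x *\<^sub>R z)"
      using that by (intro Bochner_Integration.integrable_diff integrable_scaleR_left) auto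
    then show ?thesis by (simp add: scaleR_right_diff_distrib)
  qed
  have i1: "integrable lborel (\<lambda>x. indicator Q x *\<^sub>R (f x - A'))" by (rule c[OF iQ Q finQ])
  have n: "integrable lborel (\<lambda>x. indicator E x * cmod (f x - z))"
    if "integrable lborel (\<lambda>x. indicator E x *\<^sub>R f x)" "E \<in> sets borel" "emeasure lborel E < \<infinity>" for E z
    using integrable_norm[OF c[OF that, of z]] by simp
  have mQ: "(\<integral>x. indicator Q x *\<^sub>R z \<partial>lborel) = measure lborel Q *\<^sub>R z" for z :: complex
    using finQ by simp
  have "(\<integral>x. indicator Q x *\<^sub>R (f x - A') \<partial>lborel) = (\<integral>x. indicator Q x *\<^sub>R f x - indicator Q x *\<^sub>R A' \<partial>lborel)"
    by (simp only: scaleR_right_diff_distrib)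
  also have "\<dots> = (\<integral>x. indicator Q x *\<^sub>R f x \<partial>lborel) - measure lborel Q *\<^sub>R A'"
    unfolding mQ[symmetric] using finQ by (intro Bochner_Integration.integral_diff iQ integrable_scaleR_left) simp
  also have "(\<integral>x. indicator Q x *\<^sub>R f x \<partial>lborel) = measure lborel Q *\<^sub>R A" using Qpos by (simp add: A_def scaleR_conv_of_real)
  finally have "measure lborel Q *\<^sub>R (A - A') = (\<integral>x. indicator Q x *\<^sub>R (f x - A') \<partial>lborel)" by (simp only: scaleR_right_diff_distrib)
  then have "measure lborel Q * cmod (A - A') = cmod (\<integral>x. indicator Q x *\<^sub>R (f x - A') \<partial>lborel)"
    by (metis abs_of_nonneg measure_nonneg norm_scaleR)
  also have "\<dots> \<le> (\<integral>x. norm (indicator Q x *\<^sub>R (f x - A')) \<partial>lborel)" by (rule integral_norm_bound)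
  finally have aa: "measure lborel Q * cmod (A - A') \<le> (\<integral>x. indicator Q x * cmod (f x - A') \<partial>lborel)" by simp
  have "osc f Q = (\<integral>x. indicator Q x * cmod (f x - A) \<partial>lborel)" by (simp add: osc_def A_def)
  also have "\<dots> \<le> (\<integral>x. indicator Q x * cmod (f x - A') + indicator Q x * cmod (A - A') \<partial>lborel)"
  proof (rule integral_mono)
    show "integrable lborel (\<lambda>x. indicator Q x * cmod (f x - A') + indicator Q x * cmod (A - A'))"
      using finQ by (intro Bochner_Integration.integrable_add n[OF iQ Q finQ] integrable_mult_left) simp
    show "indicator Q x * cmod (f x - A) \<le> indicator Q x * cmod (f x - A') + indicator Q x * cmod (A - A')" for x
      using norm_triangle_ineq[of "f x - A'" "A' - A"] by (cases "x \<in> Q") (simp_all add: norm_minus_commute)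
  qed (rule n[OF iQ Q finQ])
  also have "\<dots> = (\<integral>x. indicator Q x * cmod (f x - A') \<partial>lborel) + (\<integral>x. indicator Q x * cmod (A - A') \<partial>lborel)"
    using finQ by (intro Bochner_Integration.integral_add n[OF iQ Q finQ] integrable_mult_left) simp
  also have "(\<integral>x. indicator Q x * cmod (A - A') \<partial>lborel) = measure lborel Q * cmod (A - A')" by simp
  also have "(\<integral>x. indicator Q x * cmod (f x - A') \<partial>lborel) + measure lborel Q * cmod (A - A') \<le> 2 * (\<integral>x. indicator Q x * cmod (f x - A') \<partial>lborel)"
    using aa by simp
  also have "(\<integral>x. indicator Q x * cmod (f x - A') \<partial>lborel) \<le> (\<integral>x. indicator Q' x * cmod (f x - A') \<partial>lborel)"
    using sub by (intro integral_mono n[OF iQ Q finQ] n[OF int Q' fin]) (auto simp: indicator_def)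
  also have "\<dots> = osc f Q'" by (simp add: osc_def A'_def)
  finally show ?thesis by simp
qed

lemma locally_integrable_cube:
  assumes f: "locally_integrable f" and f' [measurable]: "f' \<in> borel_measurable borel" and ae: "AE x in lborel. f x = f' x"
  shows "integrable lborel (\<lambda>x. indicator (cube \<beta> c s) x *\<^sub>R f' x)" (is ?i)
    and "0 < s \<Longrightarrow> (\<integral>\<^sup>+y\<in>cube \<beta> c s. ennreal (cmod (f y - average (cube \<beta> c s) f)) \<partial>lebesgue) = ennreal (osc f' (cube \<beta> c s))"
proof -
  let ?Q = "cube \<beta> c s"
  have ael: "AE x in lebesgue. f x = f' x" using ae by (simp add: AE_completion_iff)
  have [measurable]: "f' \<in> borel_measurable lebesgue" "f \<in> borel_measurable lebesgue"
    using f' f by (auto intro: measurable_completion simp: locally_integrable_def)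
  have "compact ?Q" unfolding cube_def by (intro compact_Times compact_Icc)
  then have "integrable lebesgue (\<lambda>x. indicator ?Q x *\<^sub>R f x)" using f unfolding locally_integrable_def set_integrable_def by blast
  moreover have aeQ: "AE x in lebesgue. indicator ?Q x *\<^sub>R f x = indicator ?Q x *\<^sub>R f' x" using ael by eventually_elim simp
  ultimately have "integrable lebesgue (\<lambda>x. indicator ?Q x *\<^sub>R f' x)" by (subst integrable_cong_AE[symmetric]) auto
  then show int: ?i by (subst (asm) integrable_completion) auto
  assume s: "0 < s"
  have mm: "measure lebesgue ?Q = measure lborel ?Q" using emeasure_cube_lborel[OF s, of \<beta> c] emeasure_cube_lebesgue[OF s, of \<beta> c] by simp
  have "(LINT x|lebesgue. indicator ?Q x *\<^sub>R f x) = (LINT x|lebesgue. indicator ?Q x *\<^sub>R f' x)" by (rule integral_cong_AE[OF _ _ aeQ]) auto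
  also have "\<dots> = (LINT x|lborel. indicator ?Q x *\<^sub>R f' x)" by (rule integral_completion) measurable
  finally have av: "average ?Q f = (\<integral>y. indicator ?Q y *\<^sub>R f' y \<partial>lborel) / of_real (measure lborel ?Q)"
    unfolding average_def set_lebesgue_integral_def mm by simp
  define z where "z = (\<integral>y. indicator ?Q y *\<^sub>R f' y \<partial>lborel) / of_real (measure lborel ?Q)"
  have "(\<integral>\<^sup>+y\<in>?Q. ennreal (cmod (f y - z)) \<partial>lebesgue) = (\<integral>\<^sup>+y. ennreal (indicator ?Q y * cmod (f' y - z)) \<partial>lebesgue)"
    using ael by (intro nn_integral_cong_AE, eventually_elim) (simp add: indicator_def)
  also have "\<dots> = (\<integral>\<^sup>+y. ennreal (indicator ?Q y * cmod (f' y - z)) \<partial>lborel)" by (simp add: nn_integral_completion)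
  also have "\<dots> = ennreal (\<integral>y. indicator ?Q y * cmod (f' y - z) \<partial>lborel)"
  proof (rule nn_integral_eq_integral)
    have "integrable lborel (\<lambda>x. indicator ?Q x *\<^sub>R f' x - indicator ?Q x *\<^sub>R z)"
      by (intro Bochner_Integration.integrable_diff int integrable_scaleR_left) (simp add: emeasure_cube_lborel[OF s])
    then have "integrable lborel (\<lambda>x. indicator ?Q x *\<^sub>R (f' x - z))" by (simp only: scaleR_right_diff_distrib)
    from integrable_norm[OF this] show "integrable lborel (\<lambda>y. indicator ?Q y * cmod (f' y - z))" by simp
  qed simp
  finally show "(\<integral>\<^sup>+y\<in>?Q. ennreal (cmod (f y - average ?Q f)) \<partial>lebesgue) = ennreal (osc f' ?Q)"
    unfolding av z_def[symmetric] osc_def .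
qed

lemma gamma_cubeE:
  assumes b: "0 < fst \<beta>" "0 < snd \<beta>" and Q: "Q \<in> gamma_cubes \<beta>"
  obtains c s where "0 < s" "Q = cube \<beta> c s"
proof -
  obtain l1 u1 l2 u2 where Q: "Q = {l1..u1} \<times> {l2..u2}" and lt: "l1 < u1" "l2 < u2"
    and eq: "(u1 - l1) powr (1 / fst \<beta>) = (u2 - l2) powr (1 / snd \<beta>)"
    using Q unfolding gamma_cubes_def by blast
  define s where "s = (u1 - l1) powr (1 / fst \<beta>)"
  have s: "0 < s" using lt by (simp add: s_def)
  have p1: "s powr fst \<beta> = u1 - l1" using lt b by (simp add: s_def powr_powr)
  have p2: "s powr snd \<beta> = u2 - l2" using lt b unfolding s_def eq by (simp add: powr_powr)
  have "Q = cube \<beta> ((l1 + u1) / 2, (l2 + u2) / 2) s"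
    unfolding Q cube_def p1 p2 by (simp add: field_simps)
  with s show ?thesis by (rule that)
qed

text \<open>Reduces the uncountable supremum over cubes to a countable one. A size above the Vitali
  dilation of \<open>s\<close> leaves room for moving the centre to a rational point; a further
  Vitali dilation and the factor 2 contain the result again.\<close>

lemma rational_cube:
  assumes b: "0 < fst \<beta>" "fst \<beta> \<le> snd \<beta>" and s: "0 < s"
  obtains c' s' where "fst c' \<in> \<rat>" "snd c' \<in> \<rat>" "s' \<in> \<rat>" "0 < s'" "cube \<beta> c s \<subseteq> cube \<beta> c' s'"
    "cube \<beta> c' s' \<subseteq> cube \<beta> c (2 * vitali_dilation \<beta> * vitali_dilation \<beta> * s)"
proof -
  let ?V = "vitali_dilation \<beta>"
  note V = vitali_dilation[OF b]
  have Vs: "0 < ?V * s" using V(1) s by simp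
  have "?V * s < 2 * ?V * s" using Vs unfolding mult.assoc by linarith
  from Rats_dense_in_real[OF this] obtain s' where s': "s' \<in> \<rat>" "?V * s < s'" "s' < 2 * ?V * s" by blast
  have approx: "\<exists>d\<in>\<rat>. \<bar>d - t\<bar> \<le> l / 2" if "0 < l" for t l :: real
  proof -
    have "t - l / 2 < t + l / 2" using that by simp
    from Rats_dense_in_real[OF this] obtain d where "d \<in> \<rat>" "t - l / 2 < d" "d < t + l / 2" by blast
    then show ?thesis by (intro bexI[of _ d]) (auto simp: abs_if field_simps)
  qed
  have "\<exists>d1\<in>\<rat>. \<bar>d1 - fst c\<bar> \<le> s powr fst \<beta> / 2" "\<exists>d2\<in>\<rat>. \<bar>d2 - snd c\<bar> \<le> s powr snd \<beta> / 2"
    using s by (intro approx; simp)+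
  then obtain d1 d2 where d: "d1 \<in> \<rat>" "\<bar>d1 - fst c\<bar> \<le> s powr fst \<beta> / 2" "d2 \<in> \<rat>" "\<bar>d2 - snd c\<bar> \<le> s powr snd \<beta> / 2" by blast
  have e: "2 * s powr e \<le> s' powr e" "s' powr e + s powr e \<le> (2 * ?V * ?V * s) powr e" if e: "e \<in> {fst \<beta>, snd \<beta>}" for e
  proof -
    have e0: "0 < e" and V3: "3 \<le> ?V powr e" using e b V by auto
    have "3 * s powr e \<le> ?V powr e * s powr e" using V3 by (intro mult_right_mono) auto
    also have "\<dots> = (?V * s) powr e" by (simp only: powr_mult)
    also have "\<dots> \<le> s' powr e" using s' Vs e0 by (intro powr_mono2) auto
    finally have l: "3 * s powr e \<le> s' powr e" .
    then show "2 * s powr e \<le> s' powr e" using powr_ge_zero[of s e] by linarith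
    have "s' powr e + s powr e \<le> 3 * s' powr e" using l powr_ge_zero[of s e] powr_ge_zero[of s' e] by linarith
    also have "\<dots> \<le> ?V powr e * s' powr e" using V3 by (intro mult_right_mono) auto
    also have "\<dots> = (?V * s') powr e" by (simp only: powr_mult)
    also have "\<dots> \<le> (2 * ?V * ?V * s) powr e"
    proof (rule powr_mono2)
      have "?V * s' \<le> ?V * (2 * ?V * s)" using s'(3) V(1) by (intro mult_left_mono) auto
      then show "?V * s' \<le> 2 * ?V * ?V * s" by (simp only: mult_ac)
      show "0 \<le> ?V * s'" using V(1) s' Vs by auto
    qed (use e0 in simp)
    finally show "s' powr e + s powr e \<le> (2 * ?V * ?V * s) powr e" .
  qed
  note e1 = e[of "fst \<beta>", simplified] and e2 = e[of "snd \<beta>", simplified]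
  show ?thesis
  proof (rule that[of "(d1, d2)" s'])
    show "cube \<beta> c s \<subseteq> cube \<beta> (d1, d2) s'"
    proof
      fix x assume "x \<in> cube \<beta> c s"
      then have "\<bar>fst x - fst c\<bar> \<le> s powr fst \<beta> / 2" "\<bar>snd x - snd c\<bar> \<le> s powr snd \<beta> / 2" unfolding mem_cube by auto
      then have "\<bar>fst x - d1\<bar> \<le> s' powr fst \<beta> / 2" "\<bar>snd x - d2\<bar> \<le> s' powr snd \<beta> / 2" using d e1(1) e2(1) by linarith+
      then show "x \<in> cube \<beta> (d1, d2) s'" unfolding mem_cube by simp
    qed
    show "cube \<beta> (d1, d2) s' \<subseteq> cube \<beta> c (2 * ?V * ?V * s)"
    proof
      fix x assume "x \<in> cube \<beta> (d1, d2) s'"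
      then have "\<bar>fst x - d1\<bar> \<le> s' powr fst \<beta> / 2" "\<bar>snd x - d2\<bar> \<le> s' powr snd \<beta> / 2" unfolding mem_cube by auto
      then have "\<bar>fst x - fst c\<bar> \<le> (2 * ?V * ?V * s) powr fst \<beta> / 2" "\<bar>snd x - snd c\<bar> \<le> (2 * ?V * ?V * s) powr snd \<beta> / 2"
        using d e1(2) e2(2) by linarith+
      then show "x \<in> cube \<beta> c (2 * ?V * ?V * s)" unfolding mem_cube by simp
    qed
  qed (use d s' Vs in auto)
qed

text \<open>\<open>epowr\<close> with a positive exponent is an order isomorphism, with the
  reciprocal exponent as its inverse.\<close>

lemma epowr_SUP_le:
  assumes a: "0 < a" shows "epowr (SUP n. y n) a \<le> (SUP n. epowr (y n) a)"
proof -
  let ?W = "SUP n. epowr (y n) a"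
  have a': "0 < 1 / a" using a by simp
  have "y n \<le> epowr ?W (1 / a)" for n
  proof -
    have "y n = epowr (epowr (y n) a) (1 / a)" using epowr_epowr(1)[OF a] by simp
    also have "\<dots> \<le> epowr ?W (1 / a)" by (intro epowr_mono[OF a'] SUP_upper) simp
    finally show ?thesis .
  qed
  then have "(SUP n. y n) \<le> epowr ?W (1 / a)" by (intro SUP_least)
  then have "epowr (SUP n. y n) a \<le> epowr (epowr ?W (1 / a)) a" by (rule epowr_mono[OF a])
  then show ?thesis unfolding epowr_epowr(2)[OF a] .
qed

lemma cmax_mono:
  assumes "finite J" "I \<subseteq> J" shows "cmax I Q A x \<le> cmax J Q A x"
  unfolding cmax_def using assms by (intro Max_mono) (auto intro: finite_subset)

context bloom_commutator begin

text \<open>Maxima over finite sets of rational cubes increase to a function that dominates the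
  sharp maximal function up to the factor \<open>2 * D\<close>. The bound for finite families is
  uniform, so it survives the monotone limit.\<close>

lemma sharp_maximal_bound:
  obtains C where "0 < C" "\<And>f N. locally_integrable f \<Longrightarrow> 0 \<le> N \<Longrightarrow> admissible f N \<Longrightarrow>
    weighted_norm r \<nu> (sharp_maximal \<beta> \<nu> f) \<le> ennreal (C * N)"
proof (rule finite_family_bound)
  fix K :: real
  assume K: "0 < K" and bound: "\<And>f f' N (I :: ((real \<times> real) \<times> real) set).
    f' \<in> borel_measurable borel \<Longrightarrow> (\<And>c s. integrable lborel (\<lambda>x. indicator (cube \<beta> c s) x *\<^sub>R f' x)) \<Longrightarrow>
    AE x in lborel. f x = f' x \<Longrightarrow> 0 \<le> N \<Longrightarrow> admissible f N \<Longrightarrow> finite I \<Longrightarrow> (\<And>i. i \<in> I \<Longrightarrow> 0 < snd i) \<Longrightarrow>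
    (\<integral>\<^sup>+x. ennreal (cmax I (\<lambda>i. cube \<beta> (fst i) (snd i))
        (\<lambda>i. osc f' (cube \<beta> (fst i) (snd i)) / measure (wm \<nu>) (cube \<beta> (fst i) (snd i))) x powr r) \<partial>wm \<nu>)
      \<le> ennreal (K * N powr r)"
  have r0: "0 < r" "0 < 1 / r" using r(1) by auto
  let ?V = "vitali_dilation \<beta>"
  have V1: "1 \<le> ?V" by (rule vitali_dilation(1)[OF beta(1) b2(2)])
  then have W: "1 \<le> 2 * ?V * ?V" using mult_mono[of 1 ?V 1 ?V] by simp
  obtain D where D: "\<And>c s. 0 < s \<Longrightarrow> measure (wm \<nu>) (cube \<beta> c (2 * ?V * ?V * s)) \<le> D * measure (wm \<nu>) (cube \<beta> c s)"
    using Nu.doubling[OF W] by blast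
  have D0: "0 < D"
  proof -
    have "0 < measure (wm \<nu>) (cube \<beta> 0 (2 * ?V * ?V * 1))" using W by (intro Nu.cube_pos) simp
    also have "\<dots> \<le> D * measure (wm \<nu>) (cube \<beta> 0 1)" by (rule D) simp
    finally show ?thesis using Nu.cube_pos[of 1 0] by (simp add: zero_less_mult_iff)
  qed
  define C where "C = 2 * D * K powr (1 / r)"
  have C: "0 < C" using D0 K by (simp add: C_def)
  let ?Q = "\<lambda>i :: (real \<times> real) \<times> real. cube \<beta> (fst i) (snd i)"
  define J where "J = {i :: (real \<times> real) \<times> real. fst (fst i) \<in> \<rat> \<and> snd (fst i) \<in> \<rat> \<and> snd i \<in> \<rat> \<and> 0 < snd i}"
  have "countable ((\<rat> \<times> \<rat>) \<times> (\<rat> :: real set))" by (intro countable_SIGMA countable_rat)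
  moreover have "J \<subseteq> (\<rat> \<times> \<rat>) \<times> \<rat>" by (auto simp: J_def mem_Times_iff)
  ultimately have cJ: "countable J" by (rule countable_subset[rotated])
  have "((0, 0), 1) \<in> J" by (simp add: J_def)
  then have neJ: "J \<noteq> {}" by blast
  define e where "e = from_nat_into J"
  have eJ: "range e = J" unfolding e_def by (rule range_from_nat_into[OF neJ cJ])
  have eJ': "e n \<in> J" for n using eJ by blast
  show ?thesis
  proof (rule that[OF C])
    fix f :: "real \<times> real \<Rightarrow> complex" and N :: real
    assume f: "locally_integrable f" and N: "0 \<le> N" and adm: "admissible f N"
    have "f \<in> borel_measurable lebesgue" using f by (simp add: locally_integrable_def)
    then obtain f' where f' [measurable]: "f' \<in> borel_measurable borel" and ff': "AE x in lborel. f x = f' x"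
      by (rule borel_representative)
    note li = locally_integrable_cube[OF f f' ff']
    define A where "A i = osc f' (?Q i) / measure (wm \<nu>) (?Q i)" for i
    define M where "M n = cmax (e ` {..<n}) ?Q A" for n
    have Mm [measurable]: "M n \<in> borel_measurable lebesgue" for n unfolding M_def by (rule measurable_cmax) auto
    have M0: "0 \<le> M n x" for n x unfolding M_def by (rule cmax_nonneg) simp
    have Mb: "(\<integral>\<^sup>+x. ennreal (M n x powr r) \<partial>wm \<nu>) \<le> ennreal (K * N powr r)" for n
      unfolding M_def A_def
    proof (rule bound[OF f' li(1) ff' N adm])
      show "0 < snd i" if "i \<in> e ` {..<n}" for i using that eJ' by (auto simp: J_def)
    qed simp
    have pt: "sharp_maximal \<beta> \<nu> f x \<le> ennreal (2 * D) * (SUP n. ennreal (M n x))" for x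
      unfolding sharp_maximal_def
    proof (rule SUP_least)
      fix Q assume "Q \<in> gamma_cubes \<beta>"
      then obtain c s where s: "0 < s" and Q: "Q = cube \<beta> c s" by (rule gamma_cubeE[OF beta(1) b2(1)])
      show "indicator Q x / (\<integral>\<^sup>+y\<in>Q. ennreal (\<nu> y) \<partial>lebesgue) * (\<integral>\<^sup>+y\<in>Q. ennreal (cmod (f y - average Q f)) \<partial>lebesgue)
          \<le> ennreal (2 * D) * (SUP n. ennreal (M n x))"
      proof (cases "x \<in> Q")
        case False
        then show ?thesis by simp
      next
        case True
        obtain c' s' where c': "fst c' \<in> \<rat>" "snd c' \<in> \<rat>" "s' \<in> \<rat>" "0 < s'" "cube \<beta> c s \<subseteq> cube \<beta> c' s'"
          "cube \<beta> c' s' \<subseteq> cube \<beta> c (2 * ?V * ?V * s)"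
          by (rule rational_cube[OF beta(1) b2(2) s])
        have "(c', s') \<in> J" using c' by (simp add: J_def)
        then obtain n where n: "e n = (c', s')" using eJ by (metis imageE)
        let ?n = "measure (wm \<nu>) (cube \<beta> c s)" and ?n' = "measure (wm \<nu>) (cube \<beta> c' s')"
        have pos: "0 < ?n" "0 < ?n'" using Nu.cube_pos s c'(4) by auto
        have "?n' \<le> measure (wm \<nu>) (cube \<beta> c (2 * ?V * ?V * s))"
          using Nu.cube_finite by (intro measure_mono_fmeasurable[OF c'(6)] fmeasurableI) auto
        also have "\<dots> \<le> D * ?n" by (rule D[OF s])
        finally have nn: "?n' \<le> D * ?n" .
        have oo: "osc f' (cube \<beta> c s) \<le> 2 * osc f' (cube \<beta> c' s')"
          using s c' by (intro osc_mono[OF f' cube_borel cube_borel c'(5) _ _ li(1)]) (simp_all add: emeasure_cube_lborel)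
        have xM: "A (c', s') \<le> M (Suc n) x"
        proof -
          have "(c', s') \<in> e ` {..<Suc n}" using n by (metis imageI lessI lessThan_iff)
          moreover have "x \<in> ?Q (c', s')" using True c'(5) by (auto simp: Q)
          ultimately show ?thesis unfolding M_def by (intro cmax_ge) auto
        qed
        \<comment> \<open>The numerator loses 2 by \<open>osc_mono\<close>, the denominator loses
          \<open>D\<close> by doubling of \<nu>.\<close>
        have "osc f' (cube \<beta> c s) / ?n \<le> (2 * osc f' (cube \<beta> c' s')) / (?n' / D)"
        proof (rule frac_le)
          show "?n' / D \<le> ?n" using nn D0 by (simp add: pos_divide_le_eq mult.commute)
        qed (use oo osc_nonneg pos D0 in auto)
        also have "\<dots> = 2 * D * A (c', s')" by (simp add: A_def)
        also have "\<dots> \<le> 2 * D * M (Suc n) x" using xM D0 by (intro mult_left_mono) auto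
        finally have le: "osc f' (cube \<beta> c s) / ?n \<le> 2 * D * M (Suc n) x" .
        have nuQ: "(\<integral>\<^sup>+y\<in>cube \<beta> c s. ennreal (\<nu> y) \<partial>lebesgue) = ennreal ?n"
          using Nu.emeasure_cube[of c s] by (simp add: emeasure_wm nu)
        have "indicator Q x / (\<integral>\<^sup>+y\<in>Q. ennreal (\<nu> y) \<partial>lebesgue) * (\<integral>\<^sup>+y\<in>Q. ennreal (cmod (f y - average Q f)) \<partial>lebesgue)
            = ennreal 1 / ennreal ?n * ennreal (osc f' (cube \<beta> c s))"
          using True unfolding Q nuQ li(2)[OF s] by simp
        also have "\<dots> = ennreal (1 / ?n * osc f' (cube \<beta> c s))"
          using pos(1) osc_nonneg by (simp only: divide_ennreal[OF zero_le_one] ennreal_mult[symmetric] zero_le_divide_1_iff less_imp_le)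
        also have "\<dots> \<le> ennreal (2 * D * M (Suc n) x)" using le by (intro ennreal_leI) simp
        also have "\<dots> = ennreal (2 * D) * ennreal (M (Suc n) x)" using D0 M0 by (simp add: ennreal_mult)
        also have "\<dots> \<le> ennreal (2 * D) * (SUP n. ennreal (M n x))" by (intro mult_left_mono SUP_upper) auto
        finally show ?thesis .
      qed
    qed
    have ep: "epowr (sharp_maximal \<beta> \<nu> f x) r \<le> ennreal ((2 * D) powr r) * (SUP n. ennreal (M n x powr r))" for x
    proof -
      have "epowr (sharp_maximal \<beta> \<nu> f x) r \<le> epowr (ennreal (2 * D) * (SUP n. ennreal (M n x))) r"
        by (rule epowr_mono[OF r0(1) pt])
      also have "\<dots> = ennreal ((2 * D) powr r) * epowr (SUP n. ennreal (M n x)) r"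
        using D0 by (simp add: epowr_mult[OF r0(1)] epowr_ennreal)
      also have "\<dots> \<le> ennreal ((2 * D) powr r) * (SUP n. epowr (ennreal (M n x)) r)"
        by (intro mult_left_mono epowr_SUP_le[OF r0(1)]) simp
      finally show ?thesis by (simp add: epowr_ennreal M0)
    qed
    have inc: "incseq (\<lambda>n x. ennreal (M n x powr r))"
    proof (intro incseq_SucI le_funI ennreal_leI powr_mono2 M0)
      show "M n x \<le> M (Suc n) x" for n x unfolding M_def by (rule cmax_mono) auto
    qed (use r0 in simp)
    have "(\<integral>\<^sup>+x. ennreal (\<nu> x) * epowr (sharp_maximal \<beta> \<nu> f x) r \<partial>lebesgue)
        \<le> (\<integral>\<^sup>+x. ennreal (\<nu> x) * (ennreal ((2 * D) powr r) * (SUP n. ennreal (M n x powr r))) \<partial>lebesgue)"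
      by (intro nn_integral_mono mult_left_mono ep) simp
    also have "\<dots> = (\<integral>\<^sup>+x. ennreal ((2 * D) powr r) * (SUP n. ennreal (M n x powr r)) \<partial>wm \<nu>)"
      by (rule nn_integral_wm[symmetric, OF nu(1)]) measurable
    also have "\<dots> = ennreal ((2 * D) powr r) * (\<integral>\<^sup>+x. (SUP n. ennreal (M n x powr r)) \<partial>wm \<nu>)"
      by (rule nn_integral_cmult) measurable
    also have "(\<integral>\<^sup>+x. (SUP n. ennreal (M n x powr r)) \<partial>wm \<nu>) = (SUP n. \<integral>\<^sup>+x. ennreal (M n x powr r) \<partial>wm \<nu>)"
      by (rule nn_integral_monotone_convergence_SUP[OF inc]) measurable
    also have "ennreal ((2 * D) powr r) * \<dots> \<le> ennreal ((2 * D) powr r) * ennreal (K * N powr r)"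
      by (intro mult_left_mono SUP_least Mb) simp
    also have "\<dots> = ennreal ((C * N) powr r)"
    proof -
      have "(C * N) powr r = (2 * D) powr r * (K * N powr r)"
        unfolding C_def powr_mult using K r0 by (simp add: powr_powr)
      then show ?thesis using K by (simp add: ennreal_mult)
    qed
    finally have "epowr (\<integral>\<^sup>+x. ennreal (\<nu> x) * epowr (sharp_maximal \<beta> \<nu> f x) r \<partial>lebesgue) (1 / r) \<le> epowr (ennreal ((C * N) powr r)) (1 / r)"
      by (rule epowr_mono[OF r0(2)])
    also have "\<dots> = ennreal (C * N)" using C N r0 by (simp add: epowr_ennreal powr_powr)
    finally show "weighted_norm r \<nu> (sharp_maximal \<beta> \<nu> f) \<le> ennreal (C * N)"
      unfolding weighted_norm_eq[OF r0(1) nu(2)] .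
  qed
qed

end

section \<open>From admissible constants to the operator norm\<close>

theorem theorem1p41:
  fixes \<beta> \<epsilon> \<delta> :: "real \<times> real"
    and p q r :: real
    and \<mu> lam \<nu> :: "real \<times> real \<Rightarrow> real"
  assumes "monomial_params \<beta> \<epsilon> \<delta>"
    and "1 < q" and "q < p"
    and "1 / q = 1 / r + 1 / p"
    and "\<mu> \<in> Ap_class \<beta> p"
    and "lam \<in> Ap_class \<beta> q"
    and "\<nu> \<in> borel_measurable lebesgue"
    and "AE x in lebesgue. 0 < \<nu> x"
    and "AE x in lebesgue.
           \<nu> x powr (1 / p + 1 / hoelder_conj q) = \<mu> x powr (1 / p) * lam x powr (- 1 / q)"
  shows "\<exists>C::real. C > 0 \<and>
           (\<forall>b :: real \<times> real \<Rightarrow> complex. locally_integrable b \<longrightarrow>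
              weighted_norm r \<nu> (sharp_maximal \<beta> \<nu> b)
                \<le> ennreal C * commutator_norm (monomial_curve \<beta> \<epsilon> \<delta>) b p \<mu> q lam)"
proof -
  have beta: "0 < fst \<beta>" "fst \<beta> < snd \<beta>" using assms(1) by (auto simp: monomial_params_def)
  interpret bloom_commutator \<beta> p q \<mu> lam \<nu> \<epsilon> \<delta> r
    by unfold_locales (use assms beta in auto)
  obtain C where C: "0 < C" and bound: "\<And>f N. locally_integrable f \<Longrightarrow> 0 \<le> N \<Longrightarrow> admissible f N \<Longrightarrow>
    weighted_norm r \<nu> (sharp_maximal \<beta> \<nu> f) \<le> ennreal (C * N)"
    by (rule sharp_maximal_bound, rule that, assumption+)
  have C1: "ennreal (1 / C) * (ennreal C * y) = y" "ennreal C * (ennreal (1 / C) * y) = y" for y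
  proof -
    have "ennreal (1 / C) * ennreal C = ennreal (1 / C * C)" using C by (intro ennreal_mult[symmetric]) auto
    then have "ennreal (1 / C) * ennreal C = 1" using C by simp
    then show "ennreal (1 / C) * (ennreal C * y) = y" "ennreal C * (ennreal (1 / C) * y) = y"
      by (simp_all only: mult.assoc[symmetric] mult.commute[of "ennreal C" "ennreal (1 / C)"] mult_1_left)
  qed
  have "weighted_norm r \<nu> (sharp_maximal \<beta> \<nu> f) \<le> ennreal C * commutator_norm \<gamma> f p \<mu> q lam" if f: "locally_integrable f" for f
  proof -
    let ?W = "weighted_norm r \<nu> (sharp_maximal \<beta> \<nu> f)"
    \<comment> \<open>With the constant on the left the claim is a lower bound for an infimum, which
      also covers the case of an empty set, where the norm is infinite.\<close>
    have "ennreal (1 / C) * ?W \<le> commutator_norm \<gamma> f p \<mu> q lam"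
      unfolding commutator_norm_def
    proof (rule Inf_greatest, drule CollectD)
      fix c
      assume c: "\<forall>F\<in>test_functions. (AE x in lebesgue. hilbert_exists \<gamma> F x \<and> hilbert_exists \<gamma> (\<lambda>y. f y * F y) x) \<and>
            weighted_norm q lam (\<lambda>x. ennreal (cmod (commutator \<gamma> f F x))) \<le> c * weighted_norm p \<mu> (\<lambda>x. ennreal (cmod (F x)))"
      have "?W \<le> ennreal C * c"
      proof (cases c)
        case (real N)
        have "?W \<le> ennreal (C * N)"
          by (rule bound[OF f real(1)]) (use c in \<open>simp add: admissible_def real(2)\<close>)
        also have "\<dots> = ennreal C * c" using real C by (simp add: ennreal_mult)
        finally show ?thesis .
      next
        \<comment> \<open>\<open>admissible\<close> speaks of finite constants only; here the
          right-hand side is infinite because \<open>C\<close> is positive.\<close>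
        case top
        then show ?thesis using C by (simp add: ennreal_mult_top)
      qed
      then have "ennreal (1 / C) * ?W \<le> ennreal (1 / C) * (ennreal C * c)" by (rule mult_left_mono) simp
      then show "ennreal (1 / C) * ?W \<le> c" unfolding C1 .
    qed
    then have "ennreal C * (ennreal (1 / C) * ?W) \<le> ennreal C * commutator_norm \<gamma> f p \<mu> q lam" by (rule mult_left_mono) simp
    then show ?thesis unfolding C1 .
  qed
  with C show ?thesis by blast
qed

end
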